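(* Let $\mu,\sigma>0$, $0\le\gamma<1$, $\nu=\frac{2\mu}{(\gamma-2)\sigma^2}<0$ and $a=\frac1{2-\gamma}\in[\tfrac12,1)$. Consider the CEV Fokker--Planck operator $$\mathcal L_\gamma[p]=-\mu\,(xp)'+\Big(\frac{\sigma^2}{2}x^\gamma p\Big)'',\qquad x\in(0,\infty),$$ in $L^2((0,\infty),w_\gamma)$ with $w_\gamma(x)=x^\gamma e^{\nu x^{2-\gamma}}$. Then $\infty$ is limit point and $0$ is limit circle. The self-adjoint realizations are exactly the operators $\mathcal L_{\gamma,\theta}$, $\theta\in\mathbb R\cup\{\infty\}$, obtained by restricting the maximal operator to those $p$ satisfying, if $\theta\in\mathbb R$, $$\lim_{x\to0^+}\Big\{\frac{\gamma}{2-\gamma}x^{\gamma-1}p(x)+\frac{x^\gamma}{2-\gamma}p'(x)-\frac{\theta|\nu|^{1/(2-\gamma)}}{(2-\gamma)^2}\,x^\gamma\big[xp'(x)+(\gamma-1)p(x)\big]\Big\}=0,$$ and, if $\theta=\infty$, $$\lim_{x\to0^+}x^\gamma\big[xp'(x)+(\gamma-1)p(x)\big]=0 .$$ For $\theta\in\mathbb R$ the spectrum consists of simple eigenvalues and is $$\sigma(\mathcal L_{\gamma,\theta})=\Big\{\mu(2-\gamma)(\Lambda-1):\ m_a(\Lambda)=\theta\Big\},\qquad m_a(\Lambda)=-\frac{\Gamma(\Lambda)\Gamma(-a)}{\Gamma(\Lambda-a)\Gamma(1+a)} .$$ For $\theta=\infty$ the spectrum is $\{-\mu(2-\gamma)(n+1):n\in\mathbb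 N\}$, with eigenfunctions $p_n(x)=x^{1-\gamma}L_n^{\frac1{2-\gamma}}(-\nu x^{2-\gamma})$, $n\in\mathbb N$.
   Context: $\mathbb N$ includes $0$. $\Gamma$ is the Gamma function, with the convention $1/\Gamma=0$ at the non-positive integers (so $m_a$ is meromorphic with poles at $0,-1,-2,\dots$). $L_n^a(y)=\frac{y^{-a}e^y}{n!}\frac{d^n}{dy^n}(e^{-y}y^{n+a})$ is the generalized Laguerre polynomial. In Sturm--Liouville form, $\mathcal L_\gamma[p]=\frac1{w_\gamma}\big[(Q_2p')'+Q_0p\big]$ with $Q_2=\frac{\sigma^2}{2}x^\gamma w_\gamma$ and $Q_0=w_\gamma\big[\frac{\sigma^2}{2}\gamma(\gamma-1)x^{\gamma-2}-\mu\big]$. The maximal operator acts as $\mathcal L_\gamma$ on the set $\mathcal D_{\max}$ of $p\in L^2((0,\infty),w_\gamma)$ such that $p,\,Q_2p'$ are locally absolutely continuous on $(0,\infty)$ and $\mathcal L_\gamma[p]\in L^2((0,\infty),w_\gamma)$. For $f,g\in\mathcal D_{\max}$ let $W_x(f,g)=Q_2(x)[f(x)g'(x)-f'(x)g(x)]$; an endpoint $e\in\{0,\infty\}$ is limit point if $\lim_{x\to e}W_x(f,g)=0$ for all $f,g\in\mathcal D_{\max}$, and limit circle otherwise. *)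

theory Defs
  imports "HOL-Analysis.Analysis"
begin

section \<open>Absolute continuity\<close>

definition abs_continuous_on_interval :: "real \<Rightarrow> real \<Rightarrow> (real \<Rightarrow> 'a::real_normed_vector) \<Rightarrow> bool" where
  "abs_continuous_on_interval a b f \<longleftrightarrow>
     (\<forall>\<epsilon>>0. \<exists>\<delta>>0. \<forall>(n::nat) (u::nat \<Rightarrow> real) (v::nat \<Rightarrow> real).
        (\<forall>i<n. a \<le> u i \<and> u i \<le> v i \<and> v i \<le> b) \<longrightarrow>
        (\<forall>i<n. \<forall>j<n. i \<noteq> j \<longrightarrow> {u i<..<v i} \<inter> {u j<..<v j} = {}) \<longrightarrow>
        (\<Sum>i<n. v i - u i) < \<delta> \<longrightarrow>
        (\<Sum>i<n. norm (f (v i) - f (u i))) < \<epsilon>)"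

definition locally_abs_continuous_pos :: "(real \<Rightarrow> 'a::real_normed_vector) \<Rightarrow> bool" where
  "locally_abs_continuous_pos f \<longleftrightarrow> (\<forall>a b. 0 < a \<longrightarrow> a \<le> b \<longrightarrow> abs_continuous_on_interval a b f)"


section \<open>Unbounded operators in a complex \<open>L\<^sup>2\<close> space\<close>

text \<open>
  Elements of \<open>L\<^sup>2(M)\<close> are represented by functions, equality being equality almost everywhere.
  An operator is its graph, a set of pairs of functions closed under changing either component on
  a null set; such sets correspond bijectively to graphs in the Hilbert space of equivalence classes.
\<close>

definition L2_fun :: "'a measure \<Rightarrow> ('a \<Rightarrow> complex) set" where
  "L2_fun M = {f. f \<in> borel_measurable M \<and> integrable M (\<lambda>x. (cmod (f x))\<^sup>2)}"

definition ae_eq :: "'a measure \<Rightarrow> ('a \<Rightarrow> complex) \<Rightarrow> ('a \<Rightarrow> complex) \<Rightarrow> bool" where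
  "ae_eq M f g \<longleftrightarrow> (AE x in M. f x = g x)"

definition L2_inner :: "'a measure \<Rightarrow> ('a \<Rightarrow> complex) \<Rightarrow> ('a \<Rightarrow> complex) \<Rightarrow> complex" where
  "L2_inner M f g = (\<integral>x. f x * cnj (g x) \<partial>M)"

definition L2_norm :: "'a measure \<Rightarrow> ('a \<Rightarrow> complex) \<Rightarrow> real" where
  "L2_norm M f = sqrt (\<integral>x. (cmod (f x))\<^sup>2 \<partial>M)"

type_synonym 'a op_graph = "(('a \<Rightarrow> complex) \<times> ('a \<Rightarrow> complex)) set"

definition linear_operator :: "'a measure \<Rightarrow> 'a op_graph \<Rightarrow> bool" where
  "linear_operator M A \<longleftrightarrow>
     A \<subseteq> L2_fun M \<times> L2_fun M \<and>
     (\<forall>f g f' g'. (f, g) \<in> A \<longrightarrow> f' \<in> L2_fun M \<longrightarrow> g' \<in> L2_fun M \<longrightarrow>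
        ae_eq M f f' \<longrightarrow> ae_eq M g g' \<longrightarrow> (f', g') \<in> A) \<and>
     ((\<lambda>x. 0), (\<lambda>x. 0)) \<in> A \<and>
     (\<forall>f g f' g'. (f, g) \<in> A \<longrightarrow> (f', g') \<in> A \<longrightarrow>
        ((\<lambda>x. f x + f' x), (\<lambda>x. g x + g' x)) \<in> A) \<and>
     (\<forall>c f g. (f, g) \<in> A \<longrightarrow> ((\<lambda>x. c * f x), (\<lambda>x. c * g x)) \<in> A) \<and>
     (\<forall>f g g'. (f, g) \<in> A \<longrightarrow> (f, g') \<in> A \<longrightarrow> ae_eq M g g')"

definition densely_defined :: "'a measure \<Rightarrow> 'a op_graph \<Rightarrow> bool" where
  "densely_defined M A \<longleftrightarrow>
     (\<forall>h\<in>L2_fun M. \<forall>\<epsilon>>0. \<exists>(f, g)\<in>A. L2_norm M (\<lambda>x. h x - f x) < \<epsilon>)"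

definition adjoint_graph :: "'a measure \<Rightarrow> 'a op_graph \<Rightarrow> 'a op_graph" where
  "adjoint_graph M A =
     {(f, g). f \<in> L2_fun M \<and> g \<in> L2_fun M \<and> (\<forall>(u, v)\<in>A. L2_inner M v f = L2_inner M u g)}"

definition selfadjoint :: "'a measure \<Rightarrow> 'a op_graph \<Rightarrow> bool" where
  "selfadjoint M A \<longleftrightarrow> linear_operator M A \<and> densely_defined M A \<and> adjoint_graph M A = A"

text \<open>
  The norm bound expresses both injectivity of \<open>A - z\<close> and boundedness of its inverse.
\<close>

definition resolvent_set :: "'a measure \<Rightarrow> 'a op_graph \<Rightarrow> complex set" where
  "resolvent_set M A =
     {z. (\<forall>h\<in>L2_fun M. \<exists>(f, g)\<in>A. ae_eq M (\<lambda>x. g x - z * f x) h) \<and>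
         (\<exists>C. \<forall>(f, g)\<in>A. L2_norm M f \<le> C * L2_norm M (\<lambda>x. g x - z * f x))}"

definition op_spectrum :: "'a measure \<Rightarrow> 'a op_graph \<Rightarrow> complex set" where
  "op_spectrum M A = - resolvent_set M A"

definition eigenspace :: "'a measure \<Rightarrow> 'a op_graph \<Rightarrow> complex \<Rightarrow> ('a \<Rightarrow> complex) set" where
  "eigenspace M A z = {f. \<exists>g. (f, g) \<in> A \<and> ae_eq M g (\<lambda>x. z * f x)}"

definition eigenspace_spanned_by ::
    "'a measure \<Rightarrow> 'a op_graph \<Rightarrow> complex \<Rightarrow> ('a \<Rightarrow> complex) \<Rightarrow> bool" where
  "eigenspace_spanned_by M A z f \<longleftrightarrow>
     f \<in> eigenspace M A z \<and> \<not> ae_eq M f (\<lambda>x. 0) \<and>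
     (\<forall>g\<in>eigenspace M A z. \<exists>c. ae_eq M g (\<lambda>x. c * f x))"

definition simple_eigenvalue :: "'a measure \<Rightarrow> 'a op_graph \<Rightarrow> complex \<Rightarrow> bool" where
  "simple_eigenvalue M A z \<longleftrightarrow> (\<exists>f. eigenspace_spanned_by M A z f)"


section \<open>The CEV Fokker--Planck operator\<close>

abbreviation D1 :: "(real \<Rightarrow> complex) \<Rightarrow> real \<Rightarrow> complex" where
  "D1 p x \<equiv> vector_derivative p (at x)"

definition cev_nu :: "real \<Rightarrow> real \<Rightarrow> real \<Rightarrow> real" where
  "cev_nu \<mu> \<sigma> \<gamma> = 2 * \<mu> / ((\<gamma> - 2) * \<sigma>\<^sup>2)"

definition cev_w :: "real \<Rightarrow> real \<Rightarrow> real \<Rightarrow> real \<Rightarrow> real" where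
  "cev_w \<mu> \<sigma> \<gamma> x = x powr \<gamma> * exp (cev_nu \<mu> \<sigma> \<gamma> * x powr (2 - \<gamma>))"

definition cev_measure :: "real \<Rightarrow> real \<Rightarrow> real \<Rightarrow> real measure" where
  "cev_measure \<mu> \<sigma> \<gamma> = density (lebesgue_on {0<..}) (\<lambda>x. ennreal (cev_w \<mu> \<sigma> \<gamma> x))"

definition cev_L :: "real \<Rightarrow> real \<Rightarrow> real \<Rightarrow> (real \<Rightarrow> complex) \<Rightarrow> real \<Rightarrow> complex" where
  "cev_L \<mu> \<sigma> \<gamma> p x =
     - (\<mu> *\<^sub>R D1 (\<lambda>y. y *\<^sub>R p y) x) + D1 (D1 (\<lambda>y. (\<sigma>\<^sup>2 / 2 * y powr \<gamma>) *\<^sub>R p y)) x"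

definition cev_Q2 :: "real \<Rightarrow> real \<Rightarrow> real \<Rightarrow> real \<Rightarrow> real" where
  "cev_Q2 \<mu> \<sigma> \<gamma> x = \<sigma>\<^sup>2 / 2 * x powr \<gamma> * cev_w \<mu> \<sigma> \<gamma> x"

definition cev_Q0 :: "real \<Rightarrow> real \<Rightarrow> real \<Rightarrow> real \<Rightarrow> real" where
  "cev_Q0 \<mu> \<sigma> \<gamma> x = cev_w \<mu> \<sigma> \<gamma> x * (\<sigma>\<^sup>2 / 2 * \<gamma> * (\<gamma> - 1) * x powr (\<gamma> - 2) - \<mu>)"

lemma cev_L_Sturm_Liouville:
  assumes x: "x > 0" and g: "\<gamma> < 2" and s: "\<sigma> > 0"
    and d1: "\<And>y. y > 0 \<Longrightarrow> p differentiable (at y)"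
    and d2: "D1 p differentiable (at x)"
  shows "cev_L \<mu> \<sigma> \<gamma> p x =
    (1 / cev_w \<mu> \<sigma> \<gamma> x) *\<^sub>R
      (D1 (\<lambda>y. cev_Q2 \<mu> \<sigma> \<gamma> y *\<^sub>R D1 p y) x + cev_Q0 \<mu> \<sigma> \<gamma> x *\<^sub>R p x)"
proof -
  define c where "c = (\<lambda>y::real. \<sigma>\<^sup>2 / 2 * y powr \<gamma>)"
  define c1 where "c1 = (\<lambda>y::real. \<sigma>\<^sup>2 / 2 * (\<gamma> * y powr (\<gamma> - 1)))"
  define c2 where "c2 = \<sigma>\<^sup>2 / 2 * (\<gamma> * ((\<gamma> - 1) * x powr (\<gamma> - 2)))"
  define w where "w = cev_w \<mu> \<sigma> \<gamma>"
  define w1 where "w1 = (\<gamma> / x - 2 * \<mu> / \<sigma>\<^sup>2 * x powr (1 - \<gamma>)) * w x"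
  define r where "r = D1 (D1 p) x"
  have p1: "(p has_vector_derivative D1 p y) (at y)" if "y > 0" for y
    using d1[OF that] by (simp add: vector_derivative_works)
  have p2: "(D1 p has_vector_derivative r) (at x)"
    using d2 unfolding r_def by (simp add: vector_derivative_works)
  have dc: "(c has_real_derivative c1 y) (at y)" if "y > 0" for y
    unfolding c_def c1_def using that by (auto intro!: derivative_eq_intros)
  have dc1: "(c1 has_real_derivative c2) (at x)"
    unfolding c1_def c2_def using x
    by (auto intro!: derivative_eq_intros)
  have nu: "cev_nu \<mu> \<sigma> \<gamma> * (2 - \<gamma>) = - (2 * \<mu> / \<sigma>\<^sup>2)"
    using g s by (simp add: cev_nu_def divide_simps) (simp add: algebra_simps)
  have dw: "(w has_real_derivative w1) (at x)"
  proof -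
    have "(w has_real_derivative
        \<gamma> * x powr (\<gamma> - 1) * exp (cev_nu \<mu> \<sigma> \<gamma> * x powr (2 - \<gamma>)) +
        x powr \<gamma> * (exp (cev_nu \<mu> \<sigma> \<gamma> * x powr (2 - \<gamma>)) *
          (cev_nu \<mu> \<sigma> \<gamma> * ((2 - \<gamma>) * x powr (2 - \<gamma> - 1))))) (at x)"
      unfolding w_def cev_w_def[abs_def] using x by (auto intro!: derivative_eq_intros)
    moreover have "x powr (\<gamma> - 1) = x powr \<gamma> / x"
      using x by (simp add: powr_diff)
    moreover have "cev_nu \<mu> \<sigma> \<gamma> * ((2 - \<gamma>) * x powr (2 - \<gamma> - 1)) = - (2 * \<mu> / \<sigma>\<^sup>2) * x powr (1 - \<gamma>)"
      unfolding mult.assoc[symmetric] nu by (simp add: algebra_simps)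
    moreover have "\<gamma> * (x powr \<gamma> / x) * e + x powr \<gamma> * (e * (- (2 * \<mu> / \<sigma>\<^sup>2) * t)) =
        (\<gamma> / x - 2 * \<mu> / \<sigma>\<^sup>2 * t) * (x powr \<gamma> * e)" for e t
      by (simp add: algebra_simps)
    ultimately show ?thesis
      unfolding w1_def w_def cev_w_def by simp
  qed
  have w0: "w x > 0" using x by (simp add: w_def cev_w_def)
  have A: "D1 (\<lambda>y. y *\<^sub>R p y) x = p x + x *\<^sub>R D1 p x"
    by (rule vector_derivative_at)
       (use p1[OF x] in \<open>auto intro!: derivative_eq_intros simp: add.commute\<close>)
  have B1: "D1 (\<lambda>y. c y *\<^sub>R p y) y = c y *\<^sub>R D1 p y + c1 y *\<^sub>R p y" if "y > 0" for y
    by (rule vector_derivative_at, rule has_vector_derivative_scaleR[OF dc[OF that] p1[OF that]])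
  have "((\<lambda>y. c y *\<^sub>R D1 p y + c1 y *\<^sub>R p y) has_vector_derivative
      (c x *\<^sub>R r + c1 x *\<^sub>R D1 p x) + (c1 x *\<^sub>R D1 p x + c2 *\<^sub>R p x)) (at x)"
    by (intro has_vector_derivative_add has_vector_derivative_scaleR dc dc1 p1 p2 x)
  then have "(D1 (\<lambda>y. c y *\<^sub>R p y) has_vector_derivative
      (c x *\<^sub>R r + c1 x *\<^sub>R D1 p x) + (c1 x *\<^sub>R D1 p x + c2 *\<^sub>R p x)) (at x)"
    by (rule has_vector_derivative_transform_within_open[where S = "{0<..}"])
       (use x in \<open>auto simp: B1\<close>)
  then have B: "D1 (D1 (\<lambda>y. c y *\<^sub>R p y)) x =
      (c x *\<^sub>R r + c1 x *\<^sub>R D1 p x) + (c1 x *\<^sub>R D1 p x + c2 *\<^sub>R p x)"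
    by (rule vector_derivative_at)
  have "((\<lambda>y. (c y * w y) *\<^sub>R D1 p y) has_vector_derivative
      (c x * w x) *\<^sub>R r + (c1 x * w x + w1 * c x) *\<^sub>R D1 p x) (at x)"
    by (intro has_vector_derivative_scaleR DERIV_mult dc dw p2 x)
  moreover have "cev_Q2 \<mu> \<sigma> \<gamma> = (\<lambda>y. c y * w y)"
    by (auto simp: cev_Q2_def c_def w_def)
  ultimately have C: "D1 (\<lambda>y. cev_Q2 \<mu> \<sigma> \<gamma> y *\<^sub>R D1 p y) x =
      (c x * w x) *\<^sub>R r + (c1 x * w x + w1 * c x) *\<^sub>R D1 p x"
    by (simp add: vector_derivative_at)
  have E: "w1 * c x = (c1 x - \<mu> * x) * w x"
  proof -
    have "x powr (1 - \<gamma>) * x powr \<gamma> = x"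
      using x by (simp flip: powr_add)
    then have "2 * \<mu> / \<sigma>\<^sup>2 * x powr (1 - \<gamma>) * c x = \<mu> * x"
      using s by (simp add: c_def mult.assoc)
    moreover have "\<gamma> / x * c x = c1 x"
      using x by (simp add: c_def c1_def powr_diff mult_ac)
    moreover have "w1 * c x = (\<gamma> / x * c x - 2 * \<mu> / \<sigma>\<^sup>2 * x powr (1 - \<gamma>) * c x) * w x"
      unfolding w1_def by (simp only: left_diff_distrib right_diff_distrib mult_ac)
    ultimately show ?thesis by simp
  qed
  have F: "cev_Q0 \<mu> \<sigma> \<gamma> x = w x * (c2 - \<mu>)"
    by (simp add: cev_Q0_def w_def c2_def)
  have "cev_L \<mu> \<sigma> \<gamma> p x = c x *\<^sub>R r + (2 * c1 x - \<mu> * x) *\<^sub>R D1 p x + (c2 - \<mu>) *\<^sub>R p x"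
    unfolding cev_L_def using A B by (simp add: c_def algebra_simps scaleR_conv_of_real)
  moreover have "(1 / w x) *\<^sub>R ((c x * w x) *\<^sub>R r + (c1 x * w x + w1 * c x) *\<^sub>R D1 p x
      + (w x * (c2 - \<mu>)) *\<^sub>R p x) =
      c x *\<^sub>R r + (2 * c1 x - \<mu> * x) *\<^sub>R D1 p x + (c2 - \<mu>) *\<^sub>R p x"
  proof -
    have "c1 x * w x + w1 * c x = w x * (2 * c1 x - \<mu> * x)"
      unfolding E by (simp add: algebra_simps)
    then show ?thesis using w0 by (simp add: scaleR_add_right)
  qed
  ultimately show ?thesis
    unfolding C F w_def[symmetric] by simp
qed

text \<open>
  If \<open>Q\<^sub>2 p'\<close> agrees almost everywhere with a locally absolutely continuous function and \<open>p\<close> is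
  locally absolutely continuous, then \<open>p\<close> is continuously differentiable on \<open>(0,\<infinity>)\<close>; requiring
  differentiability everywhere is therefore no restriction.
\<close>

definition cev_Dmax :: "real \<Rightarrow> real \<Rightarrow> real \<Rightarrow> (real \<Rightarrow> complex) set" where
  "cev_Dmax \<mu> \<sigma> \<gamma> =
     {p. p \<in> L2_fun (cev_measure \<mu> \<sigma> \<gamma>) \<and>
         (\<forall>x>0. p differentiable (at x)) \<and>
         locally_abs_continuous_pos p \<and>
         locally_abs_continuous_pos (\<lambda>x. cev_Q2 \<mu> \<sigma> \<gamma> x *\<^sub>R D1 p x) \<and>
         cev_L \<mu> \<sigma> \<gamma> p \<in> L2_fun (cev_measure \<mu> \<sigma> \<gamma>)}"

definition cev_W :: "real \<Rightarrow> real \<Rightarrow> real \<Rightarrow> (real \<Rightarrow> complex) \<Rightarrow> (real \<Rightarrow> complex) \<Rightarrow> real \<Rightarrow> complex" where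
  "cev_W \<mu> \<sigma> \<gamma> f g x = cev_Q2 \<mu> \<sigma> \<gamma> x *\<^sub>R (f x * D1 g x - D1 f x * g x)"

text \<open>
  The endpoint is given by a filter on \<open>(0,\<infinity>)\<close>: \<open>at_right 0\<close> or \<open>at_top\<close>.
\<close>

definition cev_limit_point :: "real \<Rightarrow> real \<Rightarrow> real \<Rightarrow> real filter \<Rightarrow> bool" where
  "cev_limit_point \<mu> \<sigma> \<gamma> E \<longleftrightarrow>
     (\<forall>f\<in>cev_Dmax \<mu> \<sigma> \<gamma>. \<forall>g\<in>cev_Dmax \<mu> \<sigma> \<gamma>. (cev_W \<mu> \<sigma> \<gamma> f g \<longlongrightarrow> 0) E)"

definition cev_limit_circle :: "real \<Rightarrow> real \<Rightarrow> real \<Rightarrow> real filter \<Rightarrow> bool" where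
  "cev_limit_circle \<mu> \<sigma> \<gamma> E \<longleftrightarrow> \<not> cev_limit_point \<mu> \<sigma> \<gamma> E"

definition cev_restriction :: "real \<Rightarrow> real \<Rightarrow> real \<Rightarrow> (real \<Rightarrow> complex) set \<Rightarrow> real op_graph" where
  "cev_restriction \<mu> \<sigma> \<gamma> D =
     {(f, g). f \<in> L2_fun (cev_measure \<mu> \<sigma> \<gamma>) \<and> g \<in> L2_fun (cev_measure \<mu> \<sigma> \<gamma>) \<and>
        (\<exists>p\<in>D. ae_eq (cev_measure \<mu> \<sigma> \<gamma>) f p \<and> ae_eq (cev_measure \<mu> \<sigma> \<gamma>) g (cev_L \<mu> \<sigma> \<gamma> p))}"

definition cev_max :: "real \<Rightarrow> real \<Rightarrow> real \<Rightarrow> real op_graph" where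
  "cev_max \<mu> \<sigma> \<gamma> = cev_restriction \<mu> \<sigma> \<gamma> (cev_Dmax \<mu> \<sigma> \<gamma>)"

definition cev_selfadjoint_realization :: "real \<Rightarrow> real \<Rightarrow> real \<Rightarrow> real op_graph \<Rightarrow> bool" where
  "cev_selfadjoint_realization \<mu> \<sigma> \<gamma> A \<longleftrightarrow>
     selfadjoint (cev_measure \<mu> \<sigma> \<gamma>) A \<and> A \<subseteq> cev_max \<mu> \<sigma> \<gamma>"

definition cev_op :: "real \<Rightarrow> real \<Rightarrow> real \<Rightarrow> real \<Rightarrow> real op_graph" where
  "cev_op \<mu> \<sigma> \<gamma> \<theta> = cev_restriction \<mu> \<sigma> \<gamma>
     {p \<in> cev_Dmax \<mu> \<sigma> \<gamma>.
        ((\<lambda>x. (\<gamma> / (2 - \<gamma>) * x powr (\<gamma> - 1)) *\<^sub>R p x + (x powr \<gamma> / (2 - \<gamma>)) *\<^sub>R D1 p x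
              - (\<theta> * \<bar>cev_nu \<mu> \<sigma> \<gamma>\<bar> powr (1 / (2 - \<gamma>)) / (2 - \<gamma>)\<^sup>2 * x powr \<gamma>) *\<^sub>R
                  (x *\<^sub>R D1 p x + (\<gamma> - 1) *\<^sub>R p x)) \<longlongrightarrow> 0) (at_right 0)}"

definition cev_op_inf :: "real \<Rightarrow> real \<Rightarrow> real \<Rightarrow> real op_graph" where
  "cev_op_inf \<mu> \<sigma> \<gamma> = cev_restriction \<mu> \<sigma> \<gamma>
     {p \<in> cev_Dmax \<mu> \<sigma> \<gamma>.
        ((\<lambda>x. x powr \<gamma> *\<^sub>R (x *\<^sub>R D1 p x + (\<gamma> - 1) *\<^sub>R p x)) \<longlongrightarrow> 0) (at_right 0)}"

text \<open>
  \<open>Gamma\<close> is 0 at the non-positive integers, so division by it there gives 0, which is the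
  convention \<open>1/\<Gamma> = 0\<close>. The value at the poles \<open>\<Lambda> \<in> {0,-1,-2,\<dots>}\<close>, coming from
  \<open>Gamma \<Lambda>\<close>, is meaningless, so they have to be excluded wherever \<open>cev_m\<close> is used.
\<close>

definition cev_m :: "real \<Rightarrow> complex \<Rightarrow> complex" where
  "cev_m a \<Lambda> = - (Gamma \<Lambda> * Gamma (- of_real a)) / (Gamma (\<Lambda> - of_real a) * Gamma (1 + of_real a))"

definition gen_laguerre :: "nat \<Rightarrow> real \<Rightarrow> real \<Rightarrow> real" where
  "gen_laguerre n a y =
     y powr (- a) * exp y / fact n * (deriv ^^ n) (\<lambda>t. exp (- t) * t powr (real n + a)) y"

definition cev_eigenfun :: "real \<Rightarrow> real \<Rightarrow> real \<Rightarrow> nat \<Rightarrow> real \<Rightarrow> complex" where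
  "cev_eigenfun \<mu> \<sigma> \<gamma> n x =
     of_real (x powr (1 - \<gamma>) * gen_laguerre n (1 / (2 - \<gamma>)) (- cev_nu \<mu> \<sigma> \<gamma> * x powr (2 - \<gamma>)))"

end

theory Submission
  imports Defs
begin

text \<open>
  Write \<open>p = x\<^bsup>-\<gamma>\<^esup> u\<close> and let \<open>J = u' - c x\<^bsup>1-\<gamma>\<^esup> u\<close> be the flux, so that \<open>L p = h\<close> becomes the system
  \<open>u' = J + c x\<^bsup>1-\<gamma>\<^esup> u\<close>, \<open>J' = q h\<close>, which is regular at \<open>0\<close>. Every \<open>p\<close> in the maximal domain thus has boundary
  data \<open>(u0, j0)\<close>, the boundary conditions read \<open>j0 + \<theta> \<kappa>\<^sup>a a u0 = 0\<close> and \<open>u0 = 0\<close>, and Green's formula only involves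
  these data, because square integrability kills the Wronskian at infinity.

  For every complex \<open>\<lambda>\<close> the equation \<open>(L - \<lambda>) p = h\<close> is solved by a fixed-point argument in a weighted supremum norm,
  \<open>u\<close> being recovered from \<open>J\<close> by integration from infinity. By Green's formula the kernel of \<open>L - \<lambda>\<close> then has at most one
  dimension. It is spanned by the recessive Kummer function of \<open>\<kappa> x\<^bsup>2-\<gamma>\<^esup>\<close>, a Laplace integral for \<open>Re \<Lambda> \<ge> 1\<close> that is
  continued to the left by a contiguous relation; its boundary data are multiples of \<open>1/\<Gamma>(\<Lambda>)\<close> and \<open>1/\<Gamma>(\<Lambda>-a)\<close>.
  If they satisfy the boundary condition, \<open>\<lambda>\<close> is a simple eigenvalue; if not, adding a multiple of the Kummer function to
  a solution of \<open>(L - \<lambda>) p = h\<close> shows that \<open>\<lambda>\<close> is in the resolvent set.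

  A symmetric realization with a real point in its resolvent set is self-adjoint. Conversely, the boundary data of a
  self-adjoint realization lie on a real line through \<open>0\<close>, so that it is contained in one of the realizations above.
\<close>

section \<open>Absolutely continuous functions\<close>

text \<open>The maximal domain is described by epsilon-delta absolute continuity, the system for
  \<open>u\<close> and \<open>J\<close> by integrals; the bridge between them is the Lebesgue form
  of the fundamental theorem of calculus. The endpoint 0 is regular because 1/w is integrable there,
  as \<gamma> < 1: Cauchy-Schwarz then makes a square integrable h integrable up to 0. The
  fixed-point argument prescribes no boundary condition at 0, so it also works when \<lambda> is an
  eigenvalue of some realization. It normalizes \<open>J\<close> at a distant point and
  \<open>u\<close> at infinity; a weight growing in both directions away from that point makes the
  integral operator a contraction for every \<lambda>. Solvability for all \<lambda> then replaces
  an asymptotic analysis of a second solution: an eigensolution with zero data pairs to zero with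
  every right-hand side, in particular with its own conjugate. Multiplying the Laplace integral by
  1/\<Gamma>(\<Lambda>-a) makes both boundary data entire in \<Lambda>. They have no common zero
  because 0 < a < 1, so one linear equation in the data decides every \<Lambda>, including the poles
  of \<open>cev_m\<close>.\<close>

lemma cball_real_segment: "cball ((x + y) / 2) (\<bar>y - x\<bar> / 2) = {min x y..max x y}" for x :: real
  unfolding cball_eq_atLeastAtMost by (auto simp: min_def max_def abs_if field_simps)

text \<open>Every exceptional point x is the tag of a short interval on which the Riemann term and
  the integral of f differ by more than \<eta> times the length. Vitali's lemma selects disjoint
  intervals of this kind whose fivefold enlargements cover the set; Henstock's lemma bounds the
  total discrepancy of any finite selection, hence its total length.\<close>

lemma negligible_indefinite_integral_quotient:
  fixes f :: "real \<Rightarrow> 'b::euclidean_space"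
  assumes f: "f integrable_on {a..b}" and \<eta>: "\<eta> > 0"
  defines "F \<equiv> \<lambda>u. integral {a..u} f"
  shows "negligible {x\<in>{a<..<b}. \<forall>\<delta>>0. \<exists>y\<in>{a<..<b}. y \<noteq> x \<and> \<bar>y - x\<bar> < \<delta> \<and>
           norm (F y - F x - (y - x) *\<^sub>R f x) > \<eta> * \<bar>y - x\<bar>}" (is "negligible ?E")
proof (rule negligible_outer_le[THEN iffD2], intro allI impI)
  fix e :: real assume e: "e > 0"
  \<comment> \<open>The selected lengths sum to less than e'/\<eta> = e/5, and the enlargement
    multiplies them by 5.\<close>
  define e' where "e' = \<eta> * e / 5"
  have e': "e' > 0" using e \<eta> by (simp add: e'_def)
  have f': "f integrable_on cbox a b" using f by simp
  obtain g where g: "gauge g" and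
    gp: "\<And>p. \<lbrakk>p tagged_partial_division_of (cbox a b); g fine p\<rbrakk> \<Longrightarrow>
             sum (\<lambda>(x,k). norm (measure lborel k *\<^sub>R f x - integral k f)) p < e'"
    using Henstock_lemma[OF f' e'] by blast
  define E where "E = ?E"
  have "\<exists>y. y \<in> {a<..<b} \<and> y \<noteq> x \<and> cball ((x + y) / 2) (\<bar>y - x\<bar> / 2) \<subseteq> g x \<and>
           norm (F y - F x - (y - x) *\<^sub>R f x) > \<eta> * \<bar>y - x\<bar>" if x: "x \<in> E" for x
  proof -
    obtain \<delta> where \<delta>: "\<delta> > 0" "ball x \<delta> \<subseteq> g x"
      using g by (meson gauge_def openE)
    obtain y where y: "y \<in> {a<..<b}" "y \<noteq> x" "\<bar>y - x\<bar> < \<delta>"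
      "norm (F y - F x - (y - x) *\<^sub>R f x) > \<eta> * \<bar>y - x\<bar>"
      using x \<delta>(1) unfolding E_def mem_Collect_eq by (elim conjE allE[of _ \<delta>]) blast
    have "cball ((x + y) / 2) (\<bar>y - x\<bar> / 2) \<subseteq> ball x \<delta>"
      unfolding cball_real_segment using y(3) by (auto simp: dist_real_def abs_if min_def max_def split: if_splits)
    then show ?thesis using y \<delta> by blast
  qed
  then obtain y where y: "\<And>x. x \<in> E \<Longrightarrow> y x \<in> {a<..<b} \<and> y x \<noteq> x \<and>
      cball ((x + y x) / 2) (\<bar>y x - x\<bar> / 2) \<subseteq> g x \<and>
      norm (F (y x) - F x - (y x - x) *\<^sub>R f x) > \<eta> * \<bar>y x - x\<bar>"
    by metis
  have Eab: "x \<in> {a<..<b}" if "x \<in> E" for x using that by (simp add: E_def)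
  note y1 = y[THEN conjunct1] and y2 = y[THEN conjunct2, THEN conjunct1]
    and y3 = y[THEN conjunct2, THEN conjunct2, THEN conjunct1]
    and y4 = y[THEN conjunct2, THEN conjunct2, THEN conjunct2]
  \<comment> \<open>Vitali's lemma speaks of balls, so the segment between x and \<open>y x\<close>
    is written as the ball around its midpoint; x may be either end of it.\<close>
  define c where "c = (\<lambda>x. (x + y x) / 2)"
  define r where "r = (\<lambda>x. \<bar>y x - x\<bar> / 2)"
  have cb: "cball (c x) (r x) = cbox (min x (y x)) (max x (y x))" for x
    by (simp add: c_def r_def cball_real_segment)
  have xin: "x \<in> cball (c x) (r x)" for x
    by (simp add: cb)
  have r: "0 < r i \<and> r i \<le> \<bar>b - a\<bar>" if "i \<in> E" for i
    using y1[OF that] y2[OF that] Eab[OF that] by (auto simp: r_def)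
  have cov: "E \<subseteq> (\<Union>i\<in>E. cball (c i) (r i))" using xin by blast
  obtain C where C: "countable C" "C \<subseteq> E"
     "pairwise (\<lambda>i j. disjnt (cball (c i) (r i)) (cball (c j) (r j))) C"
     "E \<subseteq> (\<Union>i\<in>C. cball (c i) (5 * r i))"
    using Vitali_covering_lemma_cballs[OF cov r] by blast
  have lb: "norm (measure lborel (cball (c i) (r i)) *\<^sub>R f i - integral (cball (c i) (r i)) f) > \<eta> * (2 * r i)"
    if i: "i \<in> E" for i
  proof -
    have ct: "measure lborel (cball (c i) (r i)) = \<bar>y i - i\<bar>" unfolding cb by (auto simp: min_def max_def)
    have "integral (cball (c i) (r i)) f = (if i \<le> y i then F (y i) - F i else F i - F (y i))"
    proof -
      have sp: "integral {u..v} f = F v - F u" if "a < u" "u \<le> v" "v < b" for u v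
      proof -
        have "integral {a..u} f + integral {u..v} f = integral {a..v} f"
          by (rule Henstock_Kurzweil_Integration.integral_combine)
             (use that in \<open>auto intro: integrable_subinterval_real[OF f]\<close>)
        then show ?thesis by (simp add: F_def algebra_simps)
      qed
      have "i \<in> {a<..<b}" "y i \<in> {a<..<b}" using y1[OF i] Eab[OF i] by auto
      then show ?thesis unfolding cb using sp[of i "y i"] sp[of "y i" i]
        by (auto simp: min_def max_def)
    qed
    then have "norm (measure lborel (cball (c i) (r i)) *\<^sub>R f i - integral (cball (c i) (r i)) f) =
        norm (F (y i) - F i - (y i - i) *\<^sub>R f i)"
      unfolding ct by (auto simp: algebra_simps norm_minus_commute abs_if)
    moreover have "2 * r i = \<bar>y i - i\<bar>" by (simp add: r_def)
    ultimately show ?thesis using y4[OF i] by simp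
  qed
  have bound: "(\<Sum>i\<in>I. 10 * r i) \<le> e" if I: "I \<subseteq> C" "finite I" for I
  proof -
    define p where "p = (\<lambda>i. (i, cball (c i) (r i))) ` I"
    have inj: "inj_on (\<lambda>i. (i, cball (c i) (r i))) I" by (auto simp: inj_on_def)
    have IE: "I \<subseteq> E" using I C by blast
    have sub: "cball (c i) (r i) \<subseteq> cbox a b" if "i \<in> I" for i
    proof -
      from that IE have "i \<in> E" by blast
      from y1[OF this] Eab[OF this] show ?thesis unfolding cb by (auto simp: min_def max_def)
    qed
    have "p tagged_partial_division_of (cbox a b)"
      unfolding tagged_partial_division_of_def
    proof (intro conjI allI impI)
      show "finite p" using I by (simp add: p_def)
    next
      fix x K assume "(x, K) \<in> p"
      then have x: "x \<in> I" and K: "K = cball (c x) (r x)" by (auto simp: p_def)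
      show "x \<in> K" "K \<subseteq> cbox a b" "\<exists>a b. K = cbox a b"
        unfolding K using xin sub[OF x] cb by blast+
    next
      fix x1 K1 x2 K2 assume "(x1, K1) \<in> p \<and> (x2, K2) \<in> p \<and> (x1, K1) \<noteq> (x2, K2)"
      then have "x1 \<in> C" "x2 \<in> C" "x1 \<noteq> x2" "K1 = cball (c x1) (r x1)" "K2 = cball (c x2) (r x2)"
        using I unfolding p_def by auto
      then have "disjnt K1 K2" using pairwiseD[OF C(3)] by blast
      then show "interior K1 \<inter> interior K2 = {}"
        by (metis disjnt_def interior_Int interior_empty)
    qed
    moreover have "g fine p"
      using y3 IE unfolding fine_def p_def c_def r_def by blast
    ultimately have "sum (\<lambda>(x,k). norm (measure lborel k *\<^sub>R f x - integral k f)) p < e'" by (rule gp)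
    then have "(\<Sum>i\<in>I. norm (measure lborel (cball (c i) (r i)) *\<^sub>R f i - integral (cball (c i) (r i)) f)) < e'"
      unfolding p_def by (subst (asm) sum.reindex[OF inj]) (simp add: o_def)
    moreover have "(\<Sum>i\<in>I. \<eta> * (2 * r i)) \<le>
        (\<Sum>i\<in>I. norm (measure lborel (cball (c i) (r i)) *\<^sub>R f i - integral (cball (c i) (r i)) f))"
      using lb IE by (intro sum_mono less_imp_le) blast
    ultimately have "\<eta> * (\<Sum>i\<in>I. 2 * r i) < e'" by (simp add: sum_distrib_left)
    then have "(\<Sum>i\<in>I. 2 * r i) < e / 5" using \<eta> by (simp add: e'_def field_simps)
    moreover have "(\<Sum>i\<in>I. 10 * r i) = 5 * (\<Sum>i\<in>I. 2 * r i)" by (simp add: sum_distrib_left)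
    ultimately show ?thesis by simp
  qed
  have mb: "measure lebesgue (\<Union>i\<in>I. cball (c i) (5 * r i)) \<le> e" if I: "I \<subseteq> C" "finite I" for I
  proof -
    have "measure lebesgue (\<Union>i\<in>I. cball (c i) (5 * r i)) \<le> (\<Sum>i\<in>I. measure lebesgue (cball (c i) (5 * r i)))"
      using I by (intro measure_UNION_le) auto
    also have "\<dots> = (\<Sum>i\<in>I. 10 * r i)"
    proof (rule sum.cong)
      fix i assume "i \<in> I"
      then have "r i > 0" using r I C by blast
      moreover have "cball (c i) (5 * r i) = {c i - 5 * r i .. c i + 5 * r i}"
        by (rule cball_eq_atLeastAtMost)
      ultimately show "measure lebesgue (cball (c i) (5 * r i)) = 10 * r i" by simp
    qed simp
    finally show ?thesis using bound[OF I] by simp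
  qed
  show "\<exists>T. ?E \<subseteq> T \<and> T \<in> lmeasurable \<and> measure lebesgue T \<le> e"
    using fmeasurable_UN_bound[OF C(1) _ mb] measure_UN_bound[OF C(1) _ mb] C(4)[unfolded E_def]
    by (intro exI[of _ "\<Union>i\<in>C. cball (c i) (5 * r i)"]) auto
qed

text \<open>If the derivative fails to be f x, the quotient estimate fails for some tolerance
  1/(n+1), so the exceptional set is a countable union of null sets.\<close>

theorem Lebesgue_differentiation:
  fixes f :: "real \<Rightarrow> 'b::euclidean_space"
  assumes f: "f integrable_on {a..b}"
  shows "negligible {x\<in>{a<..<b}. \<not> ((\<lambda>u. integral {a..u} f) has_vector_derivative f x) (at x)}"
proof -
  define F where "F = (\<lambda>u. integral {a..u} f)"
  define E where "E = (\<lambda>n::nat. {x\<in>{a<..<b}. \<forall>\<delta>>0. \<exists>y\<in>{a<..<b}. y \<noteq> x \<and> \<bar>y - x\<bar> < \<delta> \<and>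
           norm (F y - F x - (y - x) *\<^sub>R f x) > inverse (Suc n) * \<bar>y - x\<bar>})"
  have "negligible (E n)" for n
    unfolding E_def F_def by (rule negligible_indefinite_integral_quotient[OF f]) simp
  then have neg: "negligible (\<Union>n. E n)" by (rule negligible_Union_nat)
  have good: "(F has_vector_derivative f x) (at x)" if x: "x \<in> {a<..<b}" "x \<notin> (\<Union>n. E n)" for x
    unfolding has_vector_derivative_def has_derivative_at_alt
  proof (intro conjI allI impI)
    show "bounded_linear (\<lambda>h. h *\<^sub>R f x)" by (rule bounded_linear_scaleR_left)
    fix e :: real assume e: "e > 0"
    obtain n where n: "inverse (Suc n) < e" using reals_Archimedean[OF e] by auto
    from x have "x \<notin> E n" by blast
    then have "\<not> (\<forall>\<delta>>0. \<exists>y\<in>{a<..<b}. y \<noteq> x \<and> \<bar>y - x\<bar> < \<delta> \<and>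
        norm (F y - F x - (y - x) *\<^sub>R f x) > inverse (Suc n) * \<bar>y - x\<bar>)"
      using x(1) unfolding E_def by blast
    then obtain \<delta> where \<delta>1: "\<delta> > 0" and nex: "\<not> (\<exists>y\<in>{a<..<b}. y \<noteq> x \<and> \<bar>y - x\<bar> < \<delta> \<and>
        norm (F y - F x - (y - x) *\<^sub>R f x) > inverse (Suc n) * \<bar>y - x\<bar>)"
      unfolding not_all not_imp by (elim exE conjE)
    have \<delta>2: "norm (F y - F x - (y - x) *\<^sub>R f x) \<le> inverse (Suc n) * \<bar>y - x\<bar>"
      if "y \<in> {a<..<b}" "y \<noteq> x" "\<bar>y - x\<bar> < \<delta>" for y
    proof (rule ccontr)
      assume "\<not> ?thesis"
      then have "y \<noteq> x \<and> \<bar>y - x\<bar> < \<delta> \<and> norm (F y - F x - (y - x) *\<^sub>R f x) > inverse (Suc n) * \<bar>y - x\<bar>"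
        using that by (simp only: not_le simp_thms)
      then have "\<exists>y\<in>{a<..<b}. y \<noteq> x \<and> \<bar>y - x\<bar> < \<delta> \<and>
          norm (F y - F x - (y - x) *\<^sub>R f x) > inverse (Suc n) * \<bar>y - x\<bar>"
        using that(1) by (rule bexI)
      with nex show False by (rule notE)
    qed
    show "\<exists>d>0. \<forall>y. norm (y - x) < d \<longrightarrow> norm (F y - F x - (y - x) *\<^sub>R f x) \<le> e * norm (y - x)"
    proof (intro exI[of _ "min \<delta> (min (x - a) (b - x))"] conjI allI impI)
      fix y assume y: "norm (y - x) < min \<delta> (min (x - a) (b - x))"
      show "norm (F y - F x - (y - x) *\<^sub>R f x) \<le> e * norm (y - x)"
      proof (cases "y = x")
        case False
        have "norm (F y - F x - (y - x) *\<^sub>R f x) \<le> inverse (Suc n) * \<bar>y - x\<bar>"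
          by (rule \<delta>2) (use y False in auto)
        also have "\<dots> \<le> e * \<bar>y - x\<bar>" using n by (intro mult_right_mono) auto
        finally show ?thesis by simp
      qed simp
    qed (use \<delta>1 x in auto)
  qed
  have "{x\<in>{a<..<b}. \<not> (F has_vector_derivative f x) (at x)} \<subseteq> (\<Union>n. E n)"
  proof (rule subsetI, rule ccontr)
    fix x assume x: "x \<in> {x\<in>{a<..<b}. \<not> (F has_vector_derivative f x) (at x)}" "x \<notin> (\<Union>n. E n)"
    have "(F has_vector_derivative f x) (at x)" by (rule good[OF _ x(2)]) (use x(1) in simp)
    then show False using x(1) by simp
  qed
  with neg show ?thesis unfolding F_def by (rule negligible_subset)
qed

section \<open>Families of intervals and the calculus of absolute continuity\<close>

text \<open>The index type is left open, unlike in \<open>abs_continuous_on_interval\<close>: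
  families indexed by pairs occur in the variation argument, and families indexed by the intervals
  themselves in the covering argument.\<close>

definition interval_family :: "real \<Rightarrow> real \<Rightarrow> 'i set \<Rightarrow> ('i \<Rightarrow> real) \<Rightarrow> ('i \<Rightarrow> real) \<Rightarrow> bool" where
  "interval_family a b I u v \<longleftrightarrow> finite I \<and> (\<forall>i\<in>I. a \<le> u i \<and> u i \<le> v i \<and> v i \<le> b) \<and>
     (\<forall>i\<in>I. \<forall>j\<in>I. i \<noteq> j \<longrightarrow> {u i<..<v i} \<inter> {u j<..<v j} = {})"

lemma abs_continuous_on_intervalD:
  fixes f :: "real \<Rightarrow> 'a::real_normed_vector"
  assumes f: "abs_continuous_on_interval a b f" and e: "\<epsilon> > 0"
  shows "\<exists>\<delta>>0. \<forall>(I::'i set) u v. interval_family a b I u v \<longrightarrow> (\<Sum>i\<in>I. v i - u i) < \<delta> \<longrightarrow>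
           (\<Sum>i\<in>I. norm (f (v i) - f (u i))) < \<epsilon>"
proof -
  obtain \<delta> where \<delta>1: "\<delta> > 0" and \<delta>': "\<forall>(n::nat) (u::nat \<Rightarrow> real) (v::nat \<Rightarrow> real).
        (\<forall>i<n. a \<le> u i \<and> u i \<le> v i \<and> v i \<le> b) \<longrightarrow>
        (\<forall>i<n. \<forall>j<n. i \<noteq> j \<longrightarrow> {u i<..<v i} \<inter> {u j<..<v j} = {}) \<longrightarrow>
        (\<Sum>i<n. v i - u i) < \<delta> \<longrightarrow>
        (\<Sum>i<n. norm (f (v i) - f (u i))) < \<epsilon>"
    using f[unfolded abs_continuous_on_interval_def, THEN spec, THEN mp, OF e] by (elim exE conjE)
  note \<delta>2 = \<delta>'[THEN spec, THEN spec, THEN spec, THEN mp, THEN mp, THEN mp]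
  have "(\<Sum>i\<in>I. norm (f (v i) - f (u i))) < \<epsilon>"
    if fam: "interval_family a b I u v" and len: "(\<Sum>i\<in>I. v i - u i) < \<delta>" for I :: "'i set" and u v
  proof -
    have I: "finite I" and famo: "\<And>i. i \<in> I \<Longrightarrow> a \<le> u i \<and> u i \<le> v i \<and> v i \<le> b"
      and famd: "\<And>i j. i \<in> I \<Longrightarrow> j \<in> I \<Longrightarrow> i \<noteq> j \<Longrightarrow> {u i<..<v i} \<inter> {u j<..<v j} = {}"
      using fam unfolding interval_family_def by simp_all
    obtain h where h: "bij_betw h {..<card I} I"
      using ex_bij_betw_nat_finite[OF I] by (auto simp: atLeast0LessThan)
    have hI: "h i \<in> I" if "i < card I" for i using h that by (auto simp: bij_betw_def)
    have hinj: "h i \<noteq> h j" if "i < card I" "j < card I" "i \<noteq> j" for i j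
      using h that by (auto simp: bij_betw_def inj_on_def)
    have "(\<Sum>i<card I. norm (f (v (h i)) - f (u (h i)))) < \<epsilon>"
    proof (rule \<delta>2)
      show "\<forall>i<card I. a \<le> u (h i) \<and> u (h i) \<le> v (h i) \<and> v (h i) \<le> b"
        using hI famo by blast
      show "\<forall>i<card I. \<forall>j<card I. i \<noteq> j \<longrightarrow> {u (h i)<..<v (h i)} \<inter> {u (h j)<..<v (h j)} = {}"
        using hI hinj famd by blast
      show "(\<Sum>i<card I. v (h i) - u (h i)) < \<delta>"
        using len sum.reindex_bij_betw[OF h, of "\<lambda>i. v i - u i"] by simp
    qed
    then show ?thesis using sum.reindex_bij_betw[OF h, of "\<lambda>i. norm (f (v i) - f (u i))"] by simp
  qed
  with \<delta>1 show ?thesis by blast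
qed

lemma abs_continuous_on_intervalI:
  fixes f :: "real \<Rightarrow> 'a::real_normed_vector"
  assumes "\<And>\<epsilon>. \<epsilon> > 0 \<Longrightarrow> \<exists>\<delta>>0. \<forall>(I::nat set) u v. interval_family a b I u v \<longrightarrow> (\<Sum>i\<in>I. v i - u i) < \<delta> \<longrightarrow>
           (\<Sum>i\<in>I. norm (f (v i) - f (u i))) < \<epsilon>"
  shows "abs_continuous_on_interval a b f"
  unfolding abs_continuous_on_interval_def
proof (intro allI impI)
  fix \<epsilon> :: real assume "\<epsilon> > 0"
  then obtain \<delta> where \<delta>: "\<delta> > 0" "\<And>(I::nat set) u v. interval_family a b I u v \<Longrightarrow> (\<Sum>i\<in>I. v i - u i) < \<delta> \<Longrightarrow>
           (\<Sum>i\<in>I. norm (f (v i) - f (u i))) < \<epsilon>" using assms by blast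
  show "\<exists>\<delta>>0. \<forall>(n::nat) (u::nat \<Rightarrow> real) (v::nat \<Rightarrow> real).
        (\<forall>i<n. a \<le> u i \<and> u i \<le> v i \<and> v i \<le> b) \<longrightarrow>
        (\<forall>i<n. \<forall>j<n. i \<noteq> j \<longrightarrow> {u i<..<v i} \<inter> {u j<..<v j} = {}) \<longrightarrow>
        (\<Sum>i<n. v i - u i) < \<delta> \<longrightarrow>
        (\<Sum>i<n. norm (f (v i) - f (u i))) < \<epsilon>"
    using \<delta> by (intro exI[of _ \<delta>] conjI allI impI \<delta>(2)) (auto simp: interval_family_def)
qed

lemma abs_continuous_on_interval_subset:
  assumes "abs_continuous_on_interval a b f" "a \<le> a'" "b' \<le> b"
  shows "abs_continuous_on_interval a' b' f"
proof (rule abs_continuous_on_intervalI)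
  fix \<epsilon> :: real assume "\<epsilon> > 0"
  from abs_continuous_on_intervalD[OF assms(1) this] obtain \<delta> where \<delta>: "\<delta> > 0"
    "\<And>(I::nat set) u v. interval_family a b I u v \<Longrightarrow> (\<Sum>i\<in>I. v i - u i) < \<delta> \<Longrightarrow>
           (\<Sum>i\<in>I. norm (f (v i) - f (u i))) < \<epsilon>" by blast
  have "interval_family a b I u v" if "interval_family a' b' I u v" for I :: "nat set" and u v
    using that assms(2,3) unfolding interval_family_def by (meson order_trans)
  with \<delta> show "\<exists>\<delta>>0. \<forall>(I::nat set) u v. interval_family a' b' I u v \<longrightarrow> (\<Sum>i\<in>I. v i - u i) < \<delta> \<longrightarrow>
           (\<Sum>i\<in>I. norm (f (v i) - f (u i))) < \<epsilon>" by blast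
qed

text \<open>The closure properties reduce to this comparison of increments; two comparison functions
  are what sums and products require.\<close>

lemma abs_continuous_on_interval_dominated:
  fixes f :: "real \<Rightarrow> 'a::real_normed_vector" and g :: "real \<Rightarrow> 'b::real_normed_vector" and h :: "real \<Rightarrow> 'c::real_normed_vector"
  assumes g: "abs_continuous_on_interval a b g" and h: "abs_continuous_on_interval a b h"
    and C: "C \<ge> 0" and D: "D \<ge> 0"
    and le: "\<And>x y. a \<le> x \<Longrightarrow> x \<le> y \<Longrightarrow> y \<le> b \<Longrightarrow> norm (f y - f x) \<le> C * norm (g y - g x) + D * norm (h y - h x)"
  shows "abs_continuous_on_interval a b f"
proof (rule abs_continuous_on_intervalI)
  fix \<epsilon> :: real assume e: "\<epsilon> > 0"
  define \<epsilon>' where "\<epsilon>' = \<epsilon> / (C + D + 1)"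
  have e': "\<epsilon>' > 0" using e C D by (simp add: \<epsilon>'_def)
  from abs_continuous_on_intervalD[OF g this] obtain \<delta>1 where \<delta>1: "\<delta>1 > 0"
    "\<And>(I::nat set) u v. interval_family a b I u v \<Longrightarrow> (\<Sum>i\<in>I. v i - u i) < \<delta>1 \<Longrightarrow>
           (\<Sum>i\<in>I. norm (g (v i) - g (u i))) < \<epsilon>'" by blast
  from abs_continuous_on_intervalD[OF h e'] obtain \<delta>2 where \<delta>2: "\<delta>2 > 0"
    "\<And>(I::nat set) u v. interval_family a b I u v \<Longrightarrow> (\<Sum>i\<in>I. v i - u i) < \<delta>2 \<Longrightarrow>
           (\<Sum>i\<in>I. norm (h (v i) - h (u i))) < \<epsilon>'" by blast
  have "(\<Sum>i\<in>I. norm (f (v i) - f (u i))) < \<epsilon>"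
    if fam: "interval_family a b I u v" and len: "(\<Sum>i\<in>I. v i - u i) < min \<delta>1 \<delta>2" for I :: "nat set" and u v
  proof -
    have "(\<Sum>i\<in>I. norm (f (v i) - f (u i))) \<le> (\<Sum>i\<in>I. C * norm (g (v i) - g (u i)) + D * norm (h (v i) - h (u i)))"
      using fam unfolding interval_family_def by (intro sum_mono le) auto
    also have "\<dots> = C * (\<Sum>i\<in>I. norm (g (v i) - g (u i))) + D * (\<Sum>i\<in>I. norm (h (v i) - h (u i)))"
      by (simp add: sum.distrib sum_distrib_left)
    also have "\<dots> \<le> C * \<epsilon>' + D * \<epsilon>'"
      using \<delta>1(2)[OF fam] \<delta>2(2)[OF fam] len C D by (intro add_mono mult_left_mono) auto
    also have "\<dots> = (C + D) / (C + D + 1) * \<epsilon>" by (simp add: \<epsilon>'_def add_divide_distrib distrib_right)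
    also have "\<dots> < 1 * \<epsilon>" using e C D by (intro mult_strict_right_mono) (auto simp: field_simps)
    finally show ?thesis by simp
  qed
  with \<delta>1 \<delta>2 show "\<exists>\<delta>>0. \<forall>(I::nat set) u v. interval_family a b I u v \<longrightarrow> (\<Sum>i\<in>I. v i - u i) < \<delta> \<longrightarrow>
           (\<Sum>i\<in>I. norm (f (v i) - f (u i))) < \<epsilon>"
    by (intro exI[of _ "min \<delta>1 \<delta>2"]) auto
qed

lemma abs_continuous_on_interval_Lipschitz:
  fixes f :: "real \<Rightarrow> 'a::real_normed_vector"
  assumes "\<And>x y. a \<le> x \<Longrightarrow> x \<le> y \<Longrightarrow> y \<le> b \<Longrightarrow> norm (f y - f x) \<le> C * (y - x)" and "C \<ge> 0"
  shows "abs_continuous_on_interval a b f"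
proof -
  have id: "abs_continuous_on_interval a b (\<lambda>x::real. x)"
    unfolding abs_continuous_on_interval_def
  proof (intro allI impI exI conjI)
    fix \<epsilon> :: real and n :: nat and u v :: "nat \<Rightarrow> real"
    assume "\<epsilon> > 0" then show "\<epsilon> > 0" .
    assume "\<forall>i<n. a \<le> u i \<and> u i \<le> v i \<and> v i \<le> b" "(\<Sum>i<n. v i - u i) < \<epsilon>"
    then show "(\<Sum>i<n. norm (v i - u i)) < \<epsilon>" by (subst sum.cong[OF refl, of _ _ "\<lambda>i. v i - u i"]) auto
  qed
  show ?thesis
    by (rule abs_continuous_on_interval_dominated[OF id id assms(2) order_refl]) (use assms in auto)
qed

lemma abs_continuous_on_interval_imp_continuous_on:
  fixes f :: "real \<Rightarrow> 'a::real_normed_vector"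
  assumes "abs_continuous_on_interval a b f"
  shows "continuous_on {a..b} f"
  unfolding continuous_on_iff
proof (intro ballI allI impI)
  fix x \<epsilon> :: real assume x: "x \<in> {a..b}" and "\<epsilon> > 0"
  from abs_continuous_on_intervalD[OF assms this(2)] obtain \<delta> where \<delta>: "\<delta> > 0"
    "\<And>(I::nat set) u v. interval_family a b I u v \<Longrightarrow> (\<Sum>i\<in>I. v i - u i) < \<delta> \<Longrightarrow>
           (\<Sum>i\<in>I. norm (f (v i) - f (u i))) < \<epsilon>" by blast
  have *: "norm (f t - f s) < \<epsilon>" if "a \<le> s" "s \<le> t" "t \<le> b" "t - s < \<delta>" for s t
    using \<delta>(2)[of "{0}" "\<lambda>_. s" "\<lambda>_. t"] that by (simp add: interval_family_def)
  have "dist (f y) (f x) < \<epsilon>" if "y \<in> {a..b}" "dist y x < \<delta>" for y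
    using *[of x y] *[of y x] x that by (cases "x \<le> y") (auto simp: dist_norm norm_minus_commute)
  with \<delta>(1) show "\<exists>d>0. \<forall>x'\<in>{a..b}. dist x' x < d \<longrightarrow> dist (f x') (f x) < \<epsilon>" by blast
qed

lemma continuous_on_Icc_norm_bound:
  fixes f :: "real \<Rightarrow> 'a::real_normed_vector"
  assumes "continuous_on {a..b} f"
  shows "\<exists>C\<ge>0. \<forall>x\<in>{a..b}. norm (f x) \<le> C"
proof -
  have "bounded (f ` {a..b})"
    using compact_continuous_image[OF assms compact_Icc] by (rule compact_imp_bounded)
  then obtain C where "C > 0" "\<forall>x\<in>{a..b}. norm (f x) \<le> C" unfolding bounded_pos by blast
  then show ?thesis by (meson less_imp_le)
qed

lemma abs_continuous_on_interval_mult: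
  fixes f g :: "real \<Rightarrow> 'a::real_normed_algebra"
  assumes f: "abs_continuous_on_interval a b f" and g: "abs_continuous_on_interval a b g"
  shows "abs_continuous_on_interval a b (\<lambda>x. f x * g x)"
proof -
  obtain C where C: "\<And>x. x \<in> {a..b} \<Longrightarrow> norm (f x) \<le> C" "C \<ge> 0"
    using continuous_on_Icc_norm_bound[OF abs_continuous_on_interval_imp_continuous_on[OF f]] by blast
  obtain D where D: "\<And>x. x \<in> {a..b} \<Longrightarrow> norm (g x) \<le> D" "D \<ge> 0"
    using continuous_on_Icc_norm_bound[OF abs_continuous_on_interval_imp_continuous_on[OF g]] by blast
  show ?thesis
  proof (rule abs_continuous_on_interval_dominated[OF f g D(2) C(2)])
    fix x y assume xy: "a \<le> x" "x \<le> y" "y \<le> b"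
    have "f y * g y - f x * g x = (f y - f x) * g y + f x * (g y - g x)" by (simp add: algebra_simps)
    also have "norm \<dots> \<le> norm (f y - f x) * norm (g y) + norm (f x) * norm (g y - g x)"
      by (intro norm_triangle_le add_mono norm_mult_ineq)
    also have "\<dots> \<le> norm (f y - f x) * D + C * norm (g y - g x)"
      using C D xy by (intro add_mono mult_left_mono mult_right_mono) auto
    finally show "norm (f y * g y - f x * g x) \<le> D * norm (f y - f x) + C * norm (g y - g x)"
      by (simp add: mult.commute)
  qed
qed

lemma abs_continuous_on_interval_add:
  fixes f g :: "real \<Rightarrow> 'a::real_normed_vector"
  assumes f: "abs_continuous_on_interval a b f" and g: "abs_continuous_on_interval a b g"
  shows "abs_continuous_on_interval a b (\<lambda>x. f x + g x)"
proof (rule abs_continuous_on_interval_dominated[OF f g, of 1 1])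
  fix x y
  show "norm (f y + g y - (f x + g x)) \<le> 1 * norm (f y - f x) + 1 * norm (g y - g x)"
    using norm_triangle_ineq[of "f y - f x" "g y - g x"] by (simp add: algebra_simps)
qed auto

lemma abs_continuous_on_interval_C1:
  fixes f :: "real \<Rightarrow> 'a::real_normed_vector"
  assumes f: "\<And>x. x \<in> {a..b} \<Longrightarrow> (f has_vector_derivative f' x) (at x within {a..b})"
    and f': "continuous_on {a..b} f'"
  shows "abs_continuous_on_interval a b f"
proof -
  obtain C where C: "\<And>x. x \<in> {a..b} \<Longrightarrow> norm (f' x) \<le> C" "C \<ge> 0"
    using continuous_on_Icc_norm_bound[OF f'] by blast
  show ?thesis
  proof (rule abs_continuous_on_interval_Lipschitz[OF _ C(2)])
    fix x y assume xy: "a \<le> x" "x \<le> y" "y \<le> b"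
    have "norm (f y - f x) \<le> C * norm (y - x)"
    proof (rule differentiable_bound[of "{a..b}" f "\<lambda>x h. h *\<^sub>R f' x"])
      show "onorm (\<lambda>h. h *\<^sub>R f' z) \<le> C" if "z \<in> {a..b}" for z
        using C(1)[OF that] by (intro onorm_le) (simp add: mult.commute[of C] mult_left_mono)
    qed (use f xy in \<open>auto simp: has_vector_derivative_def\<close>)
    then show "norm (f y - f x) \<le> C * (y - x)" using xy by simp
  qed
qed

lemma interval_family_length:
  assumes fam: "interval_family a b I u v" and ab: "a \<le> b"
  shows "(\<Sum>i\<in>I. v i - u i) \<le> b - a"
proof -
  have I: "finite I" and ord: "\<And>i. i \<in> I \<Longrightarrow> a \<le> u i \<and> u i \<le> v i \<and> v i \<le> b"
    using fam unfolding interval_family_def by auto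
  have dis: "disjoint_family_on (\<lambda>i. {u i<..<v i}) I"
    using fam unfolding interval_family_def disjoint_family_on_def by blast
  have "(\<Sum>i\<in>I. v i - u i) = (\<Sum>i\<in>I. measure lborel {u i<..<v i})"
    using ord by (intro sum.cong) auto
  also have "\<dots> = measure lborel (\<Union>i\<in>I. {u i<..<v i})"
    using ord by (intro measure_finite_Union[symmetric] I dis) (auto simp: emeasure_lborel_Ioo)
  also have "\<dots> \<le> measure lborel {a..b}"
  proof (rule measure_mono_fmeasurable)
    show "(\<Union>i\<in>I. {u i<..<v i}) \<subseteq> {a..b}"
    proof
      fix x assume "x \<in> (\<Union>i\<in>I. {u i<..<v i})"
      then obtain i where "i \<in> I" "u i < x" "x < v i" by auto
      then show "x \<in> {a..b}" using ord[of i] by simp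
    qed
    show "(\<Union>i\<in>I. {u i<..<v i}) \<in> sets lborel" using I by (intro sets.finite_UN) auto
    show "{a..b} \<in> fmeasurable lborel" by (simp add: fmeasurable_def emeasure_lborel_Icc_eq)
  qed
  also have "\<dots> = b - a" using ab by simp
  finally show ?thesis .
qed

section \<open>Total variation and the density of an absolutely continuous function\<close>

text \<open>The supremum of this set is the total variation of \<open>f\<close> on [a, x]. Families
  of disjoint intervals that need not exhaust [a, x] give the same supremum as partitions and are
  the objects for which absolute continuity is formulated.\<close>

definition variation_sums :: "(real \<Rightarrow> real) \<Rightarrow> real \<Rightarrow> real \<Rightarrow> real set" where
  "variation_sums f a x = {(\<Sum>i\<in>I. \<bar>f (v i) - f (u i)\<bar>) | (I::nat set) u v. interval_family a x I u v}"

lemma variation_sumsI: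
  "interval_family a x (I::nat set) u v \<Longrightarrow> (\<Sum>i\<in>I. \<bar>f (v i) - f (u i)\<bar>) \<in> variation_sums f a x"
  unfolding variation_sums_def by (rule CollectI, rule exI[of _ I], rule exI[of _ u], rule exI[of _ v]) simp

text \<open>Clipping all intervals at x by min and max cuts each increment into two; intervals on
  one side of x leave a degenerate piece with increment 0. This is one half of the additivity of the
  variation.\<close>

lemma variation_sums_split:
  assumes "s \<in> variation_sums f a y" and xy: "a \<le> x" "x \<le> y"
  obtains s1 I u v where "s1 \<in> variation_sums f a x" "interval_family x y (I::nat set) u v"
    "s \<le> s1 + (\<Sum>i\<in>I. \<bar>f (v i) - f (u i)\<bar>)"
proof -
  obtain I :: "nat set" and u v where s: "s = (\<Sum>i\<in>I. \<bar>f (v i) - f (u i)\<bar>)" and fam: "interval_family a y I u v"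
    using assms(1) unfolding variation_sums_def by blast
  have ord: "\<And>i. i \<in> I \<Longrightarrow> a \<le> u i \<and> u i \<le> v i \<and> v i \<le> y" and I: "finite I"
    using fam unfolding interval_family_def by auto
  have dis: "{p i<..<q i} \<inter> {p j<..<q j} = {}"
    if "i \<in> I" "j \<in> I" "i \<noteq> j" "\<And>i. {p i<..<q i} \<subseteq> {u i<..<v i}" for i j p q
    using fam that unfolding interval_family_def by blast
  have f1: "interval_family a x I (\<lambda>i. min (u i) x) (\<lambda>i. min (v i) x)"
    unfolding interval_family_def
  proof (intro conjI ballI impI)
    fix i j assume "i \<in> I" "j \<in> I" "i \<noteq> j"
    then show "{min (u i) x<..<min (v i) x} \<inter> {min (u j) x<..<min (v j) x} = {}"
      by (rule dis) auto
  qed (use I xy in \<open>auto dest: ord simp: min_le_iff_disj\<close>)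
  have f2: "interval_family x y I (\<lambda>i. max (u i) x) (\<lambda>i. max (v i) x)"
    unfolding interval_family_def
  proof (intro conjI ballI impI)
    fix i j assume "i \<in> I" "j \<in> I" "i \<noteq> j"
    then show "{max (u i) x<..<max (v i) x} \<inter> {max (u j) x<..<max (v j) x} = {}"
      by (rule dis) auto
  qed (use I xy in \<open>auto dest: ord\<close>)
  have "s \<le> (\<Sum>i\<in>I. \<bar>f (min (v i) x) - f (min (u i) x)\<bar> + \<bar>f (max (v i) x) - f (max (u i) x)\<bar>)"
    unfolding s
  proof (rule sum_mono)
    fix i assume "i \<in> I"
    then show "\<bar>f (v i) - f (u i)\<bar> \<le> \<bar>f (min (v i) x) - f (min (u i) x)\<bar> + \<bar>f (max (v i) x) - f (max (u i) x)\<bar>"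
      using ord[of i] by (auto simp: min_def max_def)
  qed
  also have "\<dots> = (\<Sum>i\<in>I. \<bar>f (min (v i) x) - f (min (u i) x)\<bar>) + (\<Sum>i\<in>I. \<bar>f (max (v i) x) - f (max (u i) x)\<bar>)"
    by (rule sum.distrib)
  finally have "s \<le> \<dots>" .
  moreover have "(\<Sum>i\<in>I. \<bar>f (min (v i) x) - f (min (u i) x)\<bar>) \<in> variation_sums f a x"
    using f1 by (rule variation_sumsI)
  ultimately show thesis using that f2 by blast
qed

text \<open>The other half of additivity in its simplest case: the interval from x to y is attached
  to the family under a fresh index.\<close>

lemma variation_sums_append:
  assumes "s \<in> variation_sums f a x" "a \<le> x" "x \<le> y"
  shows "s + \<bar>f y - f x\<bar> \<in> variation_sums f a y"
proof -
  obtain I :: "nat set" and u v where s: "s = (\<Sum>i\<in>I. \<bar>f (v i) - f (u i)\<bar>)" and fam: "interval_family a x I u v"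
    using assms(1) unfolding variation_sums_def by blast
  have ord: "\<And>i. i \<in> I \<Longrightarrow> a \<le> u i \<and> u i \<le> v i \<and> v i \<le> x" and I: "finite I"
    using fam unfolding interval_family_def by auto
  obtain n where n: "n \<notin> I" using I by (metis ex_new_if_finite infinite_UNIV_nat)
  define u' v' where "u' = u(n := x)" and "v' = v(n := y)"
  have "interval_family a y (insert n I) u' v'"
    unfolding interval_family_def
  proof (intro conjI ballI impI)
    show "finite (insert n I)" using I by simp
    fix i assume i: "i \<in> insert n I"
    then show "a \<le> u' i" "u' i \<le> v' i" "v' i \<le> y"
      using ord assms unfolding u'_def v'_def by (auto intro: order_trans)
    fix j assume j: "j \<in> insert n I" "i \<noteq> j"
    show "{u' i<..<v' i} \<inter> {u' j<..<v' j} = {}"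
    proof (cases "i = n \<or> j = n")
      case True
      have d: "{u k<..<v k} \<inter> {x<..<y} = {}" if "k \<in> I" for k using ord[OF that] by auto
      have e: "u' k = u k" "v' k = v k" if "k \<in> I" for k using that n by (auto simp: u'_def v'_def)
      have en: "u' n = x" "v' n = y" by (auto simp: u'_def v'_def)
      consider "i = n" "j \<in> I" | "j = n" "i \<in> I" using True i j by blast
      then show ?thesis
      proof cases
        case 1 then show ?thesis using d[of j] e[of j] en by (simp add: Int_commute)
      next
        case 2 then show ?thesis using d[of i] e[of i] en by simp
      qed
    next
      case False
      then show ?thesis using i j fam unfolding interval_family_def u'_def v'_def by auto
    qed
  qed
  then have "(\<Sum>i\<in>insert n I. \<bar>f (v' i) - f (u' i)\<bar>) \<in> variation_sums f a y" by (rule variation_sumsI)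
  moreover have "(\<Sum>i\<in>insert n I. \<bar>f (v' i) - f (u' i)\<bar>) = s + \<bar>f y - f x\<bar>"
  proof -
    have "(\<Sum>i\<in>I. \<bar>f (v' i) - f (u' i)\<bar>) = s" unfolding s
      using n by (intro sum.cong) (auto simp: u'_def v'_def)
    then show ?thesis using I n by (simp add: u'_def v'_def)
  qed
  ultimately show ?thesis by simp
qed

text \<open>The variation function \<open>V\<close> majorizes the increments of \<open>f\<close> and is itself absolutely
  continuous, which reduces everything to monotone functions.\<close>

lemma abs_continuous_majorant:
  fixes f :: "real \<Rightarrow> real"
  assumes f: "abs_continuous_on_interval a b f" and ab: "a \<le> b"
    and bdd: "\<And>I u v. interval_family a b (I::nat set) u v \<Longrightarrow> (\<Sum>i\<in>I. \<bar>f (v i) - f (u i)\<bar>) \<le> B"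
  obtains V where "abs_continuous_on_interval a b V"
    "\<And>x y. a \<le> x \<Longrightarrow> x \<le> y \<Longrightarrow> y \<le> b \<Longrightarrow> \<bar>f y - f x\<bar> \<le> V y - V x"
proof -
  define V where "V = (\<lambda>x. Sup (variation_sums f a x))"
  have ne: "variation_sums f a x \<noteq> {}" for x
  proof -
    have "interval_family a x ({}::nat set) u v" for u v by (simp add: interval_family_def)
    then show ?thesis unfolding variation_sums_def by blast
  qed
  have bd: "bdd_above (variation_sums f a x)" if x: "x \<le> b" for x
  proof (rule bdd_aboveI)
    fix s assume "s \<in> variation_sums f a x"
    then obtain I :: "nat set" and u v where s: "s = (\<Sum>i\<in>I. \<bar>f (v i) - f (u i)\<bar>)" and fam: "interval_family a x I u v"
      unfolding variation_sums_def by blast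
    have "interval_family a b I u v" using fam x unfolding interval_family_def by (meson order_trans)
    then show "s \<le> B" unfolding s by (rule bdd)
  qed
  have V1: "\<bar>f y - f x\<bar> \<le> V y - V x" if xy: "a \<le> x" "x \<le> y" "y \<le> b" for x y
  proof -
    have "V x \<le> V y - \<bar>f y - f x\<bar>" unfolding V_def
    proof (rule cSup_least[OF ne])
      fix s assume "s \<in> variation_sums f a x"
      then have "s + \<bar>f y - f x\<bar> \<in> variation_sums f a y" using xy by (intro variation_sums_append)
      then show "s \<le> Sup (variation_sums f a y) - \<bar>f y - f x\<bar>"
        using cSup_upper[OF _ bd[OF xy(3)]] by force
    qed
    then show ?thesis by simp
  qed
  have V2: "\<exists>I u v. interval_family x y (I::nat set) u v \<and> V y - V x \<le> (\<Sum>i\<in>I. \<bar>f (v i) - f (u i)\<bar>) + \<eta>"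
    if xy: "a \<le> x" "x \<le> y" "y \<le> b" and \<eta>: "\<eta> > 0" for x y \<eta>
  proof -
    have "V y - \<eta> < Sup (variation_sums f a y)" using \<eta> by (simp add: V_def)
    then obtain s where s: "s \<in> variation_sums f a y" "V y - \<eta> < s"
      using less_cSup_iff[OF ne bd[OF xy(3)]] by blast
    obtain s1 I u v where s1: "s1 \<in> variation_sums f a x" "interval_family x y (I::nat set) u v"
      "s \<le> s1 + (\<Sum>i\<in>I. \<bar>f (v i) - f (u i)\<bar>)"
      using variation_sums_split[OF s(1) xy(1,2)] by blast
    have "s1 \<le> V x" unfolding V_def using s1 bd[of x] xy by (intro cSup_upper) auto
    then show ?thesis using s s1 by (rule_tac exI[of _ I], rule_tac exI[of _ u], rule_tac exI[of _ v]) auto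
  qed
  \<comment> \<open>Each increment of \<open>V\<close> is approximated by a variation sum over a
    subfamily inside that interval. The subfamilies unite to one family indexed by pairs, of no
    larger total length, to which the absolute continuity of \<open>f\<close> applies.\<close>
  have "abs_continuous_on_interval a b V"
  proof (rule abs_continuous_on_intervalI)
    fix \<epsilon> :: real assume "\<epsilon> > 0"
    then have e2: "\<epsilon> / 2 > 0" by simp
    from abs_continuous_on_intervalD[OF f this] obtain \<delta> where \<delta>: "\<delta> > 0"
      "\<And>(I::(nat \<times> nat) set) u v. interval_family a b I u v \<Longrightarrow> (\<Sum>i\<in>I. v i - u i) < \<delta> \<Longrightarrow>
           (\<Sum>i\<in>I. norm (f (v i) - f (u i))) < \<epsilon> / 2" by blast
    have "(\<Sum>i\<in>I. norm (V (v i) - V (u i))) < \<epsilon>"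
      if fam: "interval_family a b I u v" and len: "(\<Sum>i\<in>I. v i - u i) < \<delta>" for I :: "nat set" and u v
    proof -
      have ord: "\<And>i. i \<in> I \<Longrightarrow> a \<le> u i \<and> u i \<le> v i \<and> v i \<le> b" and I: "finite I"
        using fam unfolding interval_family_def by auto
      \<comment> \<open>The \<open>card I\<close> approximation errors add up to at most
        \<epsilon>/2; the summand 1 covers the empty family.\<close>
      define \<eta> where "\<eta> = \<epsilon> / (2 * (real (card I) + 1))"
      have \<eta>: "\<eta> > 0" using \<open>\<epsilon> > 0\<close> by (simp add: \<eta>_def)
      have "\<forall>i\<in>I. \<exists>K p q. interval_family (u i) (v i) (K::nat set) p q \<and>
          V (v i) - V (u i) \<le> (\<Sum>k\<in>K. \<bar>f (q k) - f (p k)\<bar>) + \<eta>"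
        using ord by (intro ballI V2 \<eta>) auto
      then obtain K p q where K: "\<And>i. i \<in> I \<Longrightarrow> interval_family (u i) (v i) (K i :: nat set) (p i) (q i) \<and>
          V (v i) - V (u i) \<le> (\<Sum>k\<in>K i. \<bar>f (q i k) - f (p i k)\<bar>) + \<eta>" by metis
      have Kf: "\<And>i. i \<in> I \<Longrightarrow> finite (K i)" and
        Ko: "\<And>i k. i \<in> I \<Longrightarrow> k \<in> K i \<Longrightarrow> u i \<le> p i k \<and> p i k \<le> q i k \<and> q i k \<le> v i"
        using K unfolding interval_family_def by auto
      define S where "S = Sigma I K"
      define P Q where "P = (\<lambda>(i,k). p i k)" and "Q = (\<lambda>(i,k). q i k)"
      have famS: "interval_family a b S P Q"
        unfolding interval_family_def
      proof (intro conjI ballI impI)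
        show "finite S" using I Kf by (simp add: S_def)
        fix x assume x: "x \<in> S"
        then obtain i k where ik: "x = (i,k)" "i \<in> I" "k \<in> K i" by (auto simp: S_def)
        show "a \<le> P x" "P x \<le> Q x" "Q x \<le> b"
          using Ko[OF ik(2,3)] ord[OF ik(2)] by (auto simp: P_def Q_def ik(1))
        fix y assume y: "y \<in> S" "x \<noteq> y"
        then obtain j l where jl: "y = (j,l)" "j \<in> I" "l \<in> K j" by (auto simp: S_def)
        show "{P x<..<Q x} \<inter> {P y<..<Q y} = {}"
        proof (cases "i = j")
          case True
          then show ?thesis using K[OF ik(2)] ik jl y unfolding interval_family_def P_def Q_def by auto
        next
          case False
          then have "{u i<..<v i} \<inter> {u j<..<v j} = {}" using fam ik jl unfolding interval_family_def by blast
          moreover have "{P x<..<Q x} \<subseteq> {u i<..<v i}" "{P y<..<Q y} \<subseteq> {u j<..<v j}"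
            using Ko[OF ik(2,3)] Ko[OF jl(2,3)] by (auto simp: P_def Q_def ik(1) jl(1))
          ultimately show ?thesis by blast
        qed
      qed
      have "(\<Sum>x\<in>S. Q x - P x) = (\<Sum>i\<in>I. \<Sum>k\<in>K i. q i k - p i k)"
        unfolding S_def P_def Q_def using I Kf by (subst sum.Sigma) (auto simp: case_prod_unfold)
      also have "\<dots> \<le> (\<Sum>i\<in>I. v i - u i)"
        using K ord by (intro sum_mono interval_family_length) auto
      finally have "(\<Sum>x\<in>S. Q x - P x) < \<delta>" using len by simp
      from \<delta>(2)[OF famS this] have "(\<Sum>x\<in>S. \<bar>f (Q x) - f (P x)\<bar>) < \<epsilon> / 2" by simp
      moreover have "(\<Sum>x\<in>S. \<bar>f (Q x) - f (P x)\<bar>) = (\<Sum>i\<in>I. \<Sum>k\<in>K i. \<bar>f (q i k) - f (p i k)\<bar>)"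
        unfolding S_def P_def Q_def using I Kf by (subst sum.Sigma) (auto simp: case_prod_unfold)
      moreover have "(\<Sum>i\<in>I. norm (V (v i) - V (u i))) \<le> (\<Sum>i\<in>I. (\<Sum>k\<in>K i. \<bar>f (q i k) - f (p i k)\<bar>) + \<eta>)"
      proof (rule sum_mono)
        fix i assume i: "i \<in> I"
        have "0 \<le> V (v i) - V (u i)" using V1[of "u i" "v i"] ord[OF i] by (meson abs_ge_zero order_trans)
        then show "norm (V (v i) - V (u i)) \<le> (\<Sum>k\<in>K i. \<bar>f (q i k) - f (p i k)\<bar>) + \<eta>"
          using K[OF i] by simp
      qed
      moreover have "(\<Sum>i\<in>I. (\<Sum>k\<in>K i. \<bar>f (q i k) - f (p i k)\<bar>) + \<eta>) =
          (\<Sum>i\<in>I. \<Sum>k\<in>K i. \<bar>f (q i k) - f (p i k)\<bar>) + card I * \<eta>" by (simp add: sum.distrib)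
      moreover have "card I * \<eta> \<le> \<epsilon> / 2" using \<open>\<epsilon> > 0\<close> by (simp add: \<eta>_def field_simps)
      ultimately show ?thesis by linarith
    qed
    with \<delta>(1) show "\<exists>\<delta>>0. \<forall>(I::nat set) u v. interval_family a b I u v \<longrightarrow> (\<Sum>i\<in>I. v i - u i) < \<delta> \<longrightarrow>
           (\<Sum>i\<in>I. norm (V (v i) - V (u i))) < \<epsilon>" by blast
  qed
  with V1 show thesis using that by blast
qed

text \<open>A null set is covered by nonoverlapping closed intervals of small total length; their
  Stieltjes measure is a sum of increments of \<open>G\<close> over an
  \<open>interval_family\<close>, hence small. \<open>H\<close> continues \<open>G\<close> by
  constants, because a Stieltjes measure belongs to a function on the whole line.\<close>

lemma mono_abs_continuous_null:
  fixes G :: "real \<Rightarrow> real"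
  assumes G: "abs_continuous_on_interval a b G" and ab: "a \<le> b"
    and mono: "\<And>x y. a \<le> x \<Longrightarrow> x \<le> y \<Longrightarrow> y \<le> b \<Longrightarrow> G x \<le> G y"
  defines "H \<equiv> \<lambda>x. G (max a (min b x))"
  shows "absolutely_continuous lborel (interval_measure H)"
    and "\<And>x y. x \<le> y \<Longrightarrow> H x \<le> H y" and "continuous_on UNIV H"
proof -
  let ?k = "\<lambda>x. max a (min b x)"
  have k: "a \<le> ?k x" "?k x \<le> b" "x \<le> y \<Longrightarrow> ?k x \<le> ?k y" for x y :: real
    using ab by auto
  show Hm: "\<And>x y. x \<le> y \<Longrightarrow> H x \<le> H y" unfolding H_def by (rule mono) (use k in auto)
  show Hc: "continuous_on UNIV H" unfolding H_def
    by (rule continuous_on_compose2[OF abs_continuous_on_interval_imp_continuous_on[OF G]])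
       (use k in \<open>auto intro!: continuous_intros\<close>)
  have Hr: "continuous (at_right x) H" for x
    using Hc by (simp add: continuous_on_eq_continuous_at continuous_at_imp_continuous_within)
  have mIcc: "emeasure (interval_measure H) {x..y} = H y - H x" if "x \<le> y" for x y
    by (rule emeasure_interval_measure_Icc) (use that Hm Hc in auto)
  show "absolutely_continuous lborel (interval_measure H)"
    unfolding absolutely_continuous_def
  proof
    fix N :: "real set" assume N: "N \<in> null_sets lborel"
    then have Nb: "N \<in> sets borel" by (simp add: null_sets_def)
    \<comment> \<open>The window keeps both measures finite and lets the set be enclosed in
      intervals inside a bounded box.\<close>
    have part: "N \<inter> {-real m..real m} \<in> null_sets (interval_measure H)" for m :: nat
    proof -
      let ?N = "N \<inter> {-real m..real m}"
      have lm: "?N \<in> lmeasurable" "measure lebesgue ?N = 0"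
      proof -
        have "?N \<in> null_sets lborel" using N by (intro null_set_Int2) auto
        then have "?N \<in> null_sets lebesgue" by (rule null_sets_completionI)
        then have "negligible ?N" by (simp add: negligible_iff_null_sets)
        then show "?N \<in> lmeasurable" "measure lebesgue ?N = 0"
          by (auto simp: negligible_imp_measurable negligible_imp_measure0)
      qed
      have "measure (interval_measure H) ?N \<le> \<epsilon>" if "\<epsilon> > 0" for \<epsilon>
      proof -
        from abs_continuous_on_intervalD[OF G that] obtain \<delta> where \<delta>: "\<delta> > 0"
          "\<And>(I::real set set) u v. interval_family a b I u v \<Longrightarrow> (\<Sum>i\<in>I. v i - u i) < \<delta> \<Longrightarrow>
              (\<Sum>i\<in>I. norm (G (v i) - G (u i))) < \<epsilon>" by blast
        have sub: "?N \<subseteq> cbox (-real m) (real m)" by auto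
        obtain \<D> where \<D>: "countable \<D>"
          "\<And>K. K \<in> \<D> \<Longrightarrow> K \<subseteq> cbox (-real m) (real m) \<and> K \<noteq> {} \<and> (\<exists>c d. K = cbox c d)"
          "pairwise (\<lambda>A B. interior A \<inter> interior B = {}) \<D>"
          "?N \<subseteq> \<Union>\<D>" "\<Union>\<D> \<in> lmeasurable" "measure lebesgue (\<Union>\<D>) \<le> measure lebesgue ?N + \<delta> / 2"
          using measurable_outer_intervals_bounded[OF lm(1) sub, of "\<delta> / 2"] \<delta>(1) by (metis half_gt_zero)
        define l r :: "real set \<Rightarrow> real" where "l = Inf" and "r = Sup"
        have lr: "K = {l K..r K} \<and> l K \<le> r K" if K: "K \<in> \<D>" for K
        proof -
          obtain c d where "K = {c..d}" "K \<noteq> {}" using \<D>(2)[OF K] by auto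
          then show ?thesis by (simp add: l_def r_def)
        qed
        \<comment> \<open>Absolute continuity controls finite subfamilies only; the uniform bound
          carries over to the countable union.\<close>
        have "measure (interval_measure H) (\<Union>\<F>) \<le> \<epsilon>" if F: "\<F> \<subseteq> \<D>" "finite \<F>" for \<F>
        proof -
          have dis: "{l K<..<r K} \<inter> {l K'<..<r K'} = {}" if "K \<in> \<F>" "K' \<in> \<F>" "K \<noteq> K'" for K K'
          proof -
            have "interior K \<inter> interior K' = {}" using \<D>(3) that F unfolding pairwise_def by blast
            moreover have "interior K = {l K<..<r K}" "interior K' = {l K'<..<r K'}"
              using lr[of K] lr[of K'] that F by (metis interior_atLeastAtMost_real subsetD)+
            ultimately show ?thesis by simp
          qed
          have fam: "interval_family a b \<F> (\<lambda>K. ?k (l K)) (\<lambda>K. ?k (r K))"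
            unfolding interval_family_def
          proof (intro conjI ballI impI)
            fix K assume "K \<in> \<F>" then show "?k (l K) \<le> ?k (r K)" using lr[of K] F by (intro k) auto
          next
            fix K K' assume KK: "K \<in> \<F>" "K' \<in> \<F>" "K \<noteq> K'"
            have "{?k (l K)<..<?k (r K)} \<subseteq> {l K<..<r K}" for K
              by (auto simp: max_def min_def split: if_splits)
            then show "{?k (l K)<..<?k (r K)} \<inter> {?k (l K')<..<?k (r K')} = {}"
              using dis[OF KK] by blast
          qed (use F k in auto)
          have "(\<Sum>K\<in>\<F>. ?k (r K) - ?k (l K)) \<le> (\<Sum>K\<in>\<F>. r K - l K)"
          proof (rule sum_mono)
            fix K assume "K \<in> \<F>"
            then have "l K \<le> r K" using lr[of K] F by auto
            then show "?k (r K) - ?k (l K) \<le> r K - l K" by (auto simp: max_def min_def)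
          qed
          also have "\<dots> = (\<Sum>K\<in>\<F>. measure lebesgue {l K<..<r K})"
            using lr F by (intro sum.cong) auto
          also have "\<dots> = measure lebesgue (\<Union>K\<in>\<F>. {l K<..<r K})"
            by (rule measure_finite_Union[symmetric])
               (use F dis lr in \<open>auto simp: disjoint_family_on_def\<close>)
          also have "\<dots> \<le> measure lebesgue (\<Union>\<D>)"
          proof (rule measure_mono_fmeasurable)
            show "(\<Union>K\<in>\<F>. {l K<..<r K}) \<subseteq> \<Union>\<D>"
            proof
              fix x assume "x \<in> (\<Union>K\<in>\<F>. {l K<..<r K})"
              then obtain K where K: "K \<in> \<D>" "x \<in> {l K..r K}" using F by force
              then show "x \<in> \<Union>\<D>" using lr[OF K(1)] by blast
            qed
            show "(\<Union>K\<in>\<F>. {l K<..<r K}) \<in> sets lebesgue" using F by (intro sets.finite_UN) auto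
          qed (rule \<D>)
          also have "\<dots> < \<delta>" using \<D>(6) lm(2) \<delta>(1) by simp
          finally have "(\<Sum>K\<in>\<F>. norm (G (?k (r K)) - G (?k (l K)))) < \<epsilon>" by (rule \<delta>(2)[OF fam])
          then have small: "(\<Sum>K\<in>\<F>. norm (H (r K) - H (l K))) < \<epsilon>" by (simp add: H_def)
          have "measure (interval_measure H) (\<Union>K\<in>\<F>. K) \<le> (\<Sum>K\<in>\<F>. measure (interval_measure H) K)"
          proof (rule measure_UNION_le)
            show "K \<in> sets (interval_measure H)" if "K \<in> \<F>" for K using that lr[of K] F by (metis atLeastAtMost_borel sets_interval_measure subsetD)
          qed (rule F)
          also have "\<dots> = (\<Sum>K\<in>\<F>. norm (H (r K) - H (l K)))"
          proof (rule sum.cong)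
            fix K assume "K \<in> \<F>"
            then have K: "K = {l K..r K}" "l K \<le> r K" using lr[of K] F by auto
            have "measure (interval_measure H) {l K..r K} = H (r K) - H (l K)"
              using mIcc[OF K(2)] Hm[OF K(2)] by (simp add: measure_def)
            with K Hm[OF K(2)] show "measure (interval_measure H) K = norm (H (r K) - H (l K))" by simp
          qed simp
          finally show ?thesis using small by simp
        qed
        moreover have "K \<in> fmeasurable (interval_measure H)" if "K \<in> \<D>" for K
        proof -
          have "{l K..r K} \<in> sets (interval_measure H)" by simp
          moreover have "emeasure (interval_measure H) {l K..r K} < \<infinity>"
            using mIcc[of "l K" "r K"] lr[OF that] by (metis ennreal_less_top infinity_ennreal_def)
          ultimately have "{l K..r K} \<in> fmeasurable (interval_measure H)" by (rule fmeasurableI)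
          then show ?thesis using lr[OF that] by metis
        qed
        ultimately have "\<Union>\<D> \<in> fmeasurable (interval_measure H)" "measure (interval_measure H) (\<Union>\<D>) \<le> \<epsilon>"
          using fmeasurable_Union_bound[OF \<D>(1)] measure_Union_bound[OF \<D>(1)] by blast+
        moreover have "measure (interval_measure H) ?N \<le> measure (interval_measure H) (\<Union>\<D>)"
          using \<D>(4) Nb calculation(1) by (intro measure_mono_fmeasurable) auto
        ultimately show ?thesis by linarith
      qed
      then have m0: "measure (interval_measure H) ?N \<le> 0" by (rule field_le_epsilon) simp
      have "emeasure (interval_measure H) ?N \<le> emeasure (interval_measure H) {-real m..real m}"
        by (intro emeasure_mono) auto
      then have "emeasure (interval_measure H) ?N < top"
        using mIcc[of "-real m" "real m"] by (simp add: ennreal_less_top le_less_trans)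
      then have "emeasure (interval_measure H) ?N = 0"
        using m0 by (metis emeasure_eq_ennreal_measure ennreal_0 less_irrefl measure_le_0_iff)
      then show ?thesis using Nb by (auto intro: null_setsI)
    qed
    have "(\<Union>m::nat. N \<inter> {-real m..real m}) \<in> null_sets (interval_measure H)"
      using part by (intro null_sets_UN) auto
    moreover have "(\<Union>m::nat. N \<inter> {-real m..real m}) = N"
    proof -
      have "\<exists>m::nat. x \<in> {-real m..real m}" for x
      proof -
        obtain m :: nat where "\<bar>x\<bar> \<le> real m" using real_arch_simple by blast
        then have "x \<in> {-real m..real m}" by auto
        then show ?thesis by blast
      qed
      then show ?thesis by blast
    qed
    ultimately show "N \<in> null_sets (interval_measure H)" by simp
  qed
qed

text \<open>The density is the Radon-Nikodym derivative of the Stieltjes measure of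
  \<open>G\<close>. It is finite almost everywhere because that measure is sigma-finite, so it may
  be read as a real function.\<close>

lemma mono_abs_continuous_density:
  fixes G :: "real \<Rightarrow> real"
  assumes G: "abs_continuous_on_interval a b G" and ab: "a \<le> b"
    and mono: "\<And>x y. a \<le> x \<Longrightarrow> x \<le> y \<Longrightarrow> y \<le> b \<Longrightarrow> G x \<le> G y"
  obtains g where "g absolutely_integrable_on {a..b}"
    "\<And>x. x \<in> {a..b} \<Longrightarrow> (g has_integral (G x - G a)) {a..x}"
proof -
  define H where "H = (\<lambda>x. G (max a (min b x)))"
  have ac: "absolutely_continuous lborel (interval_measure H)"
    and Hm: "\<And>x y. x \<le> y \<Longrightarrow> H x \<le> H y" and Hc: "continuous_on UNIV H"
    unfolding H_def by (rule mono_abs_continuous_null[OF G ab mono]; assumption)+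
  have Hr: "continuous (at_right x) H" for x
    using Hc by (simp add: continuous_on_eq_continuous_at continuous_at_imp_continuous_within)
  let ?R = "RN_deriv lborel (interval_measure H)"
  have sf: "sigma_finite_measure (interval_measure H)"
    by (rule sigma_finite_interval_measure) (use Hm Hr in auto)
  have dens: "density lborel ?R = interval_measure H"
    by (rule sigma_finite_measure.density_RN_deriv[OF sigma_finite_lborel ac]) simp
  have fin: "AE x in lborel. ?R x \<noteq> \<infinity>"
    by (rule sigma_finite_measure.RN_deriv_finite[OF sigma_finite_lborel sf ac]) simp
  define g where "g = (\<lambda>x. enn2real (?R x))"
  have gm: "g \<in> borel_measurable lborel" unfolding g_def by measurable
  have int: "(g has_integral (G x - G a)) {a..x}" if x: "x \<in> {a..b}" for x
  proof -
    have "emeasure (interval_measure H) {a..x} = H x - H a"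
      by (rule emeasure_interval_measure_Icc) (use x Hm Hc in auto)
    also have "H x - H a = G x - G a" using x by (simp add: H_def)
    finally have "(\<integral>\<^sup>+t. ?R t * indicator {a..x} t \<partial>lborel) = ennreal (G x - G a)"
      by (subst (asm) dens[symmetric]) (simp add: emeasure_density)
    moreover have "(\<integral>\<^sup>+t. ?R t * indicator {a..x} t \<partial>lborel) = (\<integral>\<^sup>+t. ennreal (g t * indicator {a..x} t) \<partial>lborel)"
      using fin by (intro nn_integral_cong_AE)
        (auto elim!: eventually_mono simp: g_def indicator_def less_top)
    ultimately have "((\<lambda>t. g t * indicator {a..x} t) has_integral (G x - G a)) UNIV"
      using gm x mono[of a x] by (intro nn_integral_has_integral) (auto simp: g_def)
    moreover have "(\<lambda>t. g t * indicator {a..x} t) = (\<lambda>t. if t \<in> {a..x} then g t else 0)"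
      by (auto simp: indicator_def)
    ultimately have "((\<lambda>t. if t \<in> {a..x} then g t else 0) has_integral (G x - G a)) UNIV" by (simp only:)
    then show ?thesis by (rule has_integral_restrict_UNIV[THEN iffD1])
  qed
  have "g absolutely_integrable_on {a..b}"
    using int[of b] ab by (intro nonnegative_absolutely_integrable_1) (auto simp: g_def has_integral_integrable)
  with int show thesis using that by blast
qed

text \<open>Jordan decomposition: \<open>V\<close> and \<open>V - f\<close> are both monotone and
  absolutely continuous for the majorant \<open>V\<close>. The bound on the variation sums is
  assumed here since it is immediate only on short intervals.\<close>

lemma abs_continuous_density_short:
  fixes f :: "real \<Rightarrow> real"
  assumes f: "abs_continuous_on_interval a b f" and ab: "a \<le> b"
    and bdd: "\<And>I u v. interval_family a b (I::nat set) u v \<Longrightarrow> (\<Sum>i\<in>I. \<bar>f (v i) - f (u i)\<bar>) \<le> B"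
  obtains g where "g absolutely_integrable_on {a..b}"
    "\<And>x. x \<in> {a..b} \<Longrightarrow> (g has_integral (f x - f a)) {a..x}"
proof -
  obtain V where V: "abs_continuous_on_interval a b V"
    "\<And>x y. a \<le> x \<Longrightarrow> x \<le> y \<Longrightarrow> y \<le> b \<Longrightarrow> \<bar>f y - f x\<bar> \<le> V y - V x"
    using abs_continuous_majorant[OF f ab bdd] by blast
  have W: "abs_continuous_on_interval a b (\<lambda>x. V x - f x)"
  proof (rule abs_continuous_on_interval_dominated[OF V(1) f, of 1 1])
    fix x y show "norm (V y - f y - (V x - f x)) \<le> 1 * norm (V y - V x) + 1 * norm (f y - f x)" by simp
  qed auto
  obtain g1 where g1: "g1 absolutely_integrable_on {a..b}"
    "\<And>x. x \<in> {a..b} \<Longrightarrow> (g1 has_integral (V x - V a)) {a..x}"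
  proof (rule mono_abs_continuous_density[OF V(1) ab])
    fix x y assume "a \<le> x" "x \<le> y" "y \<le> b"
    then show "V x \<le> V y" using V(2)[of x y] by linarith
  qed blast
  obtain g2 where g2: "g2 absolutely_integrable_on {a..b}"
    "\<And>x. x \<in> {a..b} \<Longrightarrow> (g2 has_integral (V x - f x - (V a - f a))) {a..x}"
  proof (rule mono_abs_continuous_density[OF W ab])
    fix x y assume "a \<le> x" "x \<le> y" "y \<le> b"
    then show "V x - f x \<le> V y - f y" using V(2)[of x y] by linarith
  qed blast
  show thesis
  proof
    show "(\<lambda>t. g1 t - g2 t) absolutely_integrable_on {a..b}" using g1 g2 by (intro set_integral_diff)
    show "((\<lambda>t. g1 t - g2 t) has_integral (f x - f a)) {a..x}" if "x \<in> {a..b}" for x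
      using has_integral_diff[OF g1(2)[OF that] g2(2)[OF that]] by simp
  qed
qed

text \<open>An interval shorter than the \<delta> belonging to tolerance 1 has variation sums at
  most 1. The whole interval is exhausted in steps of length h = \<delta>/2, and the densities are
  glued at the cut points.\<close>

lemma abs_continuous_density_real:
  fixes f :: "real \<Rightarrow> real"
  assumes f: "abs_continuous_on_interval a b f" and ab: "a \<le> b"
  obtains g where "g absolutely_integrable_on {a..b}"
    "\<And>x. x \<in> {a..b} \<Longrightarrow> (g has_integral (f x - f a)) {a..x}"
proof -
  obtain \<delta> where \<delta>: "\<delta> > 0"
    "\<And>(I::nat set) u v. interval_family a b I u v \<Longrightarrow> (\<Sum>i\<in>I. v i - u i) < \<delta> \<Longrightarrow>
           (\<Sum>i\<in>I. norm (f (v i) - f (u i))) < 1"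
    using abs_continuous_on_intervalD[OF f zero_less_one] by blast
  define h where "h = \<delta> / 2"
  have h: "h > 0" "h < \<delta>" using \<delta>(1) by (auto simp: h_def)
  have "\<exists>g. g absolutely_integrable_on {a..c} \<and> (\<forall>x\<in>{a..c}. (g has_integral (f x - f a)) {a..x})"
    if "c \<in> {a..b}" "c - a \<le> real n * h" for n c
    using that
  proof (induction n arbitrary: c)
    case 0
    then have "c = a" by simp
    then show ?case by (auto intro!: exI[of _ "\<lambda>_. 0"] simp: has_integral_refl)
  next
    case (Suc n)
    define d where "d = max a (c - h)"
    have d: "d \<in> {a..b}" "d \<le> c" "c - d \<le> h" "d - a \<le> real n * h"
      using Suc.prems h by (auto simp: d_def max_def algebra_simps)
    obtain g1 where g1: "g1 absolutely_integrable_on {a..d}" "\<And>x. x \<in> {a..d} \<Longrightarrow> (g1 has_integral (f x - f a)) {a..x}"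
      using Suc.IH[OF d(1,4)] by blast
    have fd: "abs_continuous_on_interval d c f"
      by (rule abs_continuous_on_interval_subset[OF f]) (use d Suc.prems in auto)
    have bd: "(\<Sum>i\<in>I. \<bar>f (v i) - f (u i)\<bar>) \<le> 1" if fam: "interval_family d c (I::nat set) u v" for I u v
    proof -
      have "interval_family a b I u v"
        using fam d(1) Suc.prems(1) unfolding interval_family_def by (meson atLeastAtMost_iff order_trans)
      moreover have "(\<Sum>i\<in>I. v i - u i) < \<delta>"
        using interval_family_length[OF fam d(2)] d(3) h by linarith
      ultimately show ?thesis using \<delta>(2) by fastforce
    qed
    obtain g2 where g2: "g2 absolutely_integrable_on {d..c}" "\<And>x. x \<in> {d..c} \<Longrightarrow> (g2 has_integral (f x - f d)) {d..x}"
      using abs_continuous_density_short[OF fd d(2) bd] by blast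
    define g where "g = (\<lambda>t. if t < d then g1 t else g2 t)"
    have gL: "(g has_integral (f x - f a)) {a..x}" if "x \<in> {a..d}" for x
      by (rule has_integral_spike_finite[OF _ _ g1(2)[OF that], of "{d}"]) (use that in \<open>auto simp: g_def\<close>)
    have gR: "(g has_integral (f x - f d)) {d..x}" if "x \<in> {d..c}" for x
      by (rule has_integral_spike_finite[OF _ _ g2(2)[OF that], of "{d}"]) (use that in \<open>auto simp: g_def\<close>)
    have "g absolutely_integrable_on {a..c}"
    proof (rule absolutely_integrable_on_combine[where c = d])
      show "g absolutely_integrable_on {a..d}"
        by (rule absolutely_integrable_spike[OF g1(1), of "{d}"]) (auto simp: g_def)
      show "g absolutely_integrable_on {d..c}"
        by (rule absolutely_integrable_spike[OF g2(1), of "{d}"]) (auto simp: g_def)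
    qed (use d in auto)
    moreover have "(g has_integral (f x - f a)) {a..x}" if "x \<in> {a..c}" for x
    proof (cases "x \<le> d")
      case False
      then show ?thesis
        using has_integral_combine[of a d x g "f d - f a" "f x - f d"] gL[of d] gR[of x] d that by simp
    qed (use that gL in simp)
    ultimately show ?case by blast
  qed
  moreover obtain n :: nat where "(b - a) / h \<le> real n" using real_arch_simple by blast
  then have "b - a \<le> real n * h" using h by (simp add: field_simps)
  ultimately show thesis using that ab by (metis atLeastAtMost_iff order_refl)
qed

text \<open>Real and imaginary part are treated separately for the density; differentiating its
  indefinite integral by Lebesgue's theorem then shows that the density is the pointwise derivative
  almost everywhere.\<close>

theorem abs_continuous_FTC:
  fixes f :: "real \<Rightarrow> complex"
  assumes f: "abs_continuous_on_interval a b f" and ab: "a \<le> b"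
  obtains g where "g absolutely_integrable_on {a..b}"
    "\<And>x. x \<in> {a..b} \<Longrightarrow> (g has_integral (f x - f a)) {a..x}"
    "negligible {x\<in>{a<..<b}. \<not> (f has_vector_derivative g x) (at x)}"
proof -
  have Re: "abs_continuous_on_interval a b (\<lambda>x. Re (f x))" and Im: "abs_continuous_on_interval a b (\<lambda>x. Im (f x))"
    using abs_Re_le_cmod[of "f y - f x" for x y] abs_Im_le_cmod[of "f y - f x" for x y]
    by (auto intro!: abs_continuous_on_interval_dominated[OF f f, of 1 0])
  obtain g1 where g1: "g1 absolutely_integrable_on {a..b}"
    "\<And>x. x \<in> {a..b} \<Longrightarrow> (g1 has_integral (Re (f x) - Re (f a))) {a..x}"
    using abs_continuous_density_real[OF Re ab] by blast
  obtain g2 where g2: "g2 absolutely_integrable_on {a..b}"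
    "\<And>x. x \<in> {a..b} \<Longrightarrow> (g2 has_integral (Im (f x) - Im (f a))) {a..x}"
    using abs_continuous_density_real[OF Im ab] by blast
  define g where "g = (\<lambda>t. Complex (g1 t) (g2 t))"
  have gs: "g = (\<lambda>t. g1 t *\<^sub>R 1 + g2 t *\<^sub>R \<i>)" by (auto simp: g_def complex_eq_iff)
  have ga: "g absolutely_integrable_on {a..b}" unfolding gs
    using g1 g2 by (intro set_integral_add absolutely_integrable_linear[OF _ bounded_linear_scaleR_left, unfolded o_def])
  have gi: "(g has_integral (f x - f a)) {a..x}" if "x \<in> {a..b}" for x
  proof -
    have "(g has_integral ((Re (f x) - Re (f a)) *\<^sub>R 1 + (Im (f x) - Im (f a)) *\<^sub>R \<i>)) {a..x}"
      unfolding gs using g1(2)[OF that] g2(2)[OF that]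
      by (intro has_integral_add has_integral_linear[OF _ bounded_linear_scaleR_left, unfolded o_def])
    moreover have "(Re (f x) - Re (f a)) *\<^sub>R 1 + (Im (f x) - Im (f a)) *\<^sub>R \<i> = f x - f a"
      by (simp add: complex_eq_iff)
    ultimately show ?thesis by simp
  qed
  have "g integrable_on {a..b}" using gi[of b] ab by (auto simp: has_integral_integrable)
  from Lebesgue_differentiation[OF this]
  have "negligible {x\<in>{a<..<b}. \<not> (f has_vector_derivative g x) (at x)}"
  proof (rule negligible_subset, intro subsetI)
    fix x assume x: "x \<in> {x\<in>{a<..<b}. \<not> (f has_vector_derivative g x) (at x)}"
    have "(f has_vector_derivative g x) (at x)" if F: "((\<lambda>u. integral {a..u} g) has_vector_derivative g x) (at x)"
    proof -
      have "((\<lambda>u. integral {a..u} g + f a) has_vector_derivative g x) (at x)"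
        using has_vector_derivative_add[OF F has_vector_derivative_const[of "f a"]] by simp
      then show ?thesis
        by (rule has_vector_derivative_transform_within_open[where S = "{a<..<b}"])
           (use x integral_unique[OF gi] in auto)
    qed
    then show "x \<in> {x\<in>{a<..<b}. \<not> ((\<lambda>u. integral {a..u} g) has_vector_derivative g x) (at x)}" using x by blast
  qed
  with ga gi show thesis using that by blast
qed

section \<open>Absolute continuity of indefinite integrals\<close>

lemma interval_family_sum_integral_le:
  fixes \<psi> :: "real \<Rightarrow> real"
  assumes fam: "interval_family a b I u v" and \<psi>: "\<psi> integrable_on {a..b}"
    and nn: "\<And>x. x \<in> {a..b} \<Longrightarrow> 0 \<le> \<psi> x"
  shows "(\<Sum>i\<in>I. integral {u i..v i} \<psi>) \<le> integral {a..b} \<psi>"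
proof -
  have I: "finite I" and ord: "\<And>i. i \<in> I \<Longrightarrow> a \<le> u i \<and> u i \<le> v i \<and> v i \<le> b"
    and dis: "\<And>i j. i \<in> I \<Longrightarrow> j \<in> I \<Longrightarrow> i \<noteq> j \<Longrightarrow> {u i<..<v i} \<inter> {u j<..<v j} = {}"
    using fam unfolding interval_family_def by simp_all
  have 1: "((\<lambda>x. if x \<in> {u i<..<v i} then \<psi> x else 0) has_integral integral {u i..v i} \<psi>) {a..b}"
    if i: "i \<in> I" for i
  proof -
    have "\<psi> integrable_on {u i..v i}" by (rule integrable_subinterval_real[OF \<psi>]) (use ord[OF i] in auto)
    then have "(\<psi> has_integral integral {u i..v i} \<psi>) {u i<..<v i}"
      by (metis has_integral_Icc_iff_Ioo integrable_integral)
    moreover have "{u i<..<v i} \<subseteq> {a..b}" using ord[OF i] by auto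
    ultimately show ?thesis by (rule has_integral_restrict[THEN iffD2, rotated])
  qed
  have "((\<lambda>x. \<Sum>i\<in>I. if x \<in> {u i<..<v i} then \<psi> x else 0) has_integral (\<Sum>i\<in>I. integral {u i..v i} \<psi>)) {a..b}"
    using I 1 by (rule has_integral_sum)
  moreover have "(\<Sum>i\<in>I. if x \<in> {u i<..<v i} then \<psi> x else 0) \<le> \<psi> x" if x: "x \<in> {a..b}" for x
  proof (cases "\<exists>i\<in>I. x \<in> {u i<..<v i}")
    case True
    then obtain i where i: "i \<in> I" "x \<in> {u i<..<v i}" by blast
    have "x \<notin> {u j<..<v j}" if "j \<in> I - {i}" for j using dis[of i j] i that by blast
    then have "(\<Sum>j\<in>I - {i}. if x \<in> {u j<..<v j} then \<psi> x else 0) = 0"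
      by (intro sum.neutral ballI) (simp only: if_False)
    then have "(\<Sum>j\<in>I. if x \<in> {u j<..<v j} then \<psi> x else 0) = \<psi> x"
      using i(2) by (simp add: sum.remove[OF I i(1)])
    then show ?thesis by simp
  next
    case False
    then show ?thesis using nn[OF x] by (subst sum.neutral) auto
  qed
  ultimately show ?thesis by (rule has_integral_le[OF _ integrable_integral[OF \<psi>]])
qed

text \<open>The norm of g is at most k plus its excess over k. The excess has a small integral for
  large k by dominated convergence, and the bounded part contributes at most k times the total
  length.\<close>

lemma abs_continuous_indefinite_integral:
  fixes g :: "real \<Rightarrow> 'b::euclidean_space"
  assumes g: "g absolutely_integrable_on {a..b}"
    and F: "\<And>x. x \<in> {a..b} \<Longrightarrow> F x = C + integral {a..x} g"
  shows "abs_continuous_on_interval a b F"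
proof (rule abs_continuous_on_intervalI)
  fix \<epsilon> :: real assume e: "\<epsilon> > 0"
  define \<psi> where "\<psi> = (\<lambda>k::nat. \<lambda>x. max (norm (g x) - real k) 0)"
  have ng: "(\<lambda>x. norm (g x)) absolutely_integrable_on {a..b}"
    using g by (rule absolutely_integrable_norm[unfolded o_def])
  have \<psi>a: "\<psi> k absolutely_integrable_on {a..b}" for k
    unfolding \<psi>_def using absolutely_integrable_max_1[OF set_integral_diff(1)[OF ng absolutely_integrable_on_const] absolutely_integrable_zero]
    by (simp add: lmeasurable_interval)
  then have \<psi>i: "\<psi> k integrable_on {a..b}" for k by (simp add: absolutely_integrable_on_def)
  have "(\<lambda>k. integral {a..b} (\<psi> k)) \<longlonglongrightarrow> integral {a..b} (\<lambda>x. 0)"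
  proof (rule dominated_convergence(2)[where h = "\<lambda>x. norm (g x)"])
    show "(\<lambda>x. norm (g x)) integrable_on {a..b}" using ng by (simp add: absolutely_integrable_on_def)
    show "(\<lambda>k. \<psi> k x) \<longlonglongrightarrow> 0" for x
    proof (rule tendsto_eventually)
      obtain n :: nat where "norm (g x) \<le> real n" using real_arch_simple by blast
      then show "\<forall>\<^sub>F k in sequentially. \<psi> k x = 0"
        unfolding eventually_sequentially \<psi>_def by (intro exI[of _ n]) auto
    qed
  qed (use \<psi>i in \<open>auto simp: \<psi>_def\<close>)
  then have "\<forall>\<^sub>F k in sequentially. integral {a..b} (\<psi> k) < \<epsilon> / 2"
    using e by (intro order_tendstoD(2)) auto
  then obtain k where k: "integral {a..b} (\<psi> k) < \<epsilon> / 2" by (auto simp: eventually_sequentially)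
  define \<delta> where "\<delta> = \<epsilon> / (2 * (real k + 1))"
  have "(\<Sum>i\<in>I. norm (F (v i) - F (u i))) < \<epsilon>"
    if fam: "interval_family a b (I::nat set) u v" and len: "(\<Sum>i\<in>I. v i - u i) < \<delta>" for I u v
  proof -
    have ord: "\<And>i. i \<in> I \<Longrightarrow> a \<le> u i \<and> u i \<le> v i \<and> v i \<le> b"
      using fam unfolding interval_family_def by simp_all
    have "(\<Sum>i\<in>I. norm (F (v i) - F (u i))) \<le> (\<Sum>i\<in>I. real k * (v i - u i) + integral {u i..v i} (\<psi> k))"
    proof (rule sum_mono)
      fix i assume "i \<in> I"
      note o = ord[OF this]
      have gi: "g integrable_on {a..v i}" "g integrable_on {u i..v i}" and pi: "\<psi> k integrable_on {u i..v i}"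
        using o g \<psi>i[of k] integrable_subinterval_real[of g a b] integrable_subinterval_real[of "\<psi> k" a b]
        by (simp_all add: absolutely_integrable_on_def)
      have "integral {a..u i} g + integral {u i..v i} g = integral {a..v i} g"
        by (rule Henstock_Kurzweil_Integration.integral_combine) (use o gi in auto)
      then have "F (v i) - F (u i) = integral {u i..v i} g" using F o by (simp add: algebra_simps)
      also have "norm \<dots> \<le> integral {u i..v i} (\<lambda>x. real k + \<psi> k x)"
        by (rule integral_norm_bound_integral) (use gi pi in \<open>auto intro!: integrable_add simp: \<psi>_def\<close>)
      also have "\<dots> = real k * (v i - u i) + integral {u i..v i} (\<psi> k)"
        using pi o by (subst integral_add) auto
      finally show "norm (F (v i) - F (u i)) \<le> real k * (v i - u i) + integral {u i..v i} (\<psi> k)" .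
    qed
    also have "\<dots> = real k * (\<Sum>i\<in>I. v i - u i) + (\<Sum>i\<in>I. integral {u i..v i} (\<psi> k))"
      by (simp add: sum.distrib sum_distrib_left)
    also have "(\<Sum>i\<in>I. integral {u i..v i} (\<psi> k)) \<le> integral {a..b} (\<psi> k)"
      by (rule interval_family_sum_integral_le[OF fam \<psi>i]) (simp add: \<psi>_def)
    also have "real k * (\<Sum>i\<in>I. v i - u i) \<le> real k * \<delta>" using len by (intro mult_left_mono) auto
    also have "real k * \<delta> \<le> \<epsilon> / 2" using e by (simp add: \<delta>_def field_simps)
    finally show ?thesis using k by linarith
  qed
  moreover have "\<delta> > 0" using e by (simp add: \<delta>_def)
  ultimately show "\<exists>\<delta>>0. \<forall>(I::nat set) u v. interval_family a b I u v \<longrightarrow> (\<Sum>i\<in>I. v i - u i) < \<delta> \<longrightarrow>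
           (\<Sum>i\<in>I. norm (F (v i) - F (u i))) < \<epsilon>" by blast
qed

section \<open>The Hilbert space and the maximal operator\<close>

text \<open>Completeness of Lebesgue measure; it makes membership in \<open>L2\<close> invariant
  under changes on null sets.\<close>

lemma borel_measurable_lebesgue_on_AE:
  fixes f :: "'a::euclidean_space \<Rightarrow> 'b::euclidean_space"
  assumes f: "f \<in> borel_measurable (lebesgue_on S)" and S: "S \<in> sets lebesgue"
    and ae: "AE x in lebesgue_on S. f x = g x"
  shows "g \<in> borel_measurable (lebesgue_on S)"
proof -
  have "AE x in lebesgue. x \<in> S \<longrightarrow> f x = g x"
    using ae by (rule AE_restrict_space_iff[THEN iffD1, rotated]) (simp add: S)
  then have "AE x in lebesgue. (if x \<in> S then f x else 0) = (if x \<in> S then g x else 0)"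
    by eventually_elim auto
  then have "(\<lambda>x. if x \<in> S then g x else 0) \<in> borel_measurable lebesgue"
    by (rule borel_measurable_AE[OF borel_measurable_if_I[OF f S]])
  then show ?thesis by (rule borel_measurable_if_D)
qed

lemma AE_lebesgue_on_iff_negligible:
  assumes "S \<in> sets lebesgue"
  shows "(AE x in lebesgue_on S. P x) \<longleftrightarrow> negligible {x\<in>S. \<not> P x}"
proof -
  have "(AE x in lebesgue_on S. P x) \<longleftrightarrow> (AE x in lebesgue. x \<in> S \<longrightarrow> P x)"
    using assms by (subst AE_restrict_space_iff) auto
  also have "\<dots> \<longleftrightarrow> {x. \<not> (x \<in> S \<longrightarrow> P x)} \<in> null_sets lebesgue"
    by (simp add: completion.AE_iff_null_sets)
  finally show ?thesis by (simp add: negligible_iff_null_sets)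
qed

lemma powr_tendsto_0: "p > 0 \<Longrightarrow> ((\<lambda>x::real. x powr p) \<longlongrightarrow> 0) (at_right 0)"
proof -
  assume p: "p > 0"
  have "((\<lambda>x::real. x powr p) \<longlongrightarrow> 0 powr p) (at_right 0)"
    using p by (intro tendsto_powr' tendsto_intros) (auto intro: eventually_mono[OF eventually_at_right_less])
  then show ?thesis by simp
qed

lemma continuous_on_extend_0:
  fixes f :: "real \<Rightarrow> complex"
  assumes f: "\<And>t. t > 0 \<Longrightarrow> isCont f t" and l: "(f \<longlongrightarrow> l) (at_right 0)" and x: "x > 0"
  shows "continuous_on {0..x} (\<lambda>t. if t \<le> 0 then l else f t)" (is "continuous_on _ ?F")
  unfolding continuous_on_def
proof
  fix t assume t: "t \<in> {0..x}"
  show "(?F \<longlongrightarrow> ?F t) (at t within {0..x})"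
  proof (cases "t = 0")
    case True
    have "(?F \<longlongrightarrow> l) (at_right 0)"
      by (rule Lim_transform_eventually[OF l]) (auto intro!: eventually_mono[OF eventually_at_right_less])
    then show ?thesis using True x by (simp add: at_within_Icc_at_right)
  next
    case False
    with t have t0: "t > 0" by simp
    have "(?F \<longlongrightarrow> f t) (at t)"
      by (rule Lim_transform_within_open[where s = "{0<..}", OF f[OF t0, unfolded isCont_def]]) (use t0 in auto)
    then show ?thesis using t0 by (auto intro: tendsto_within_subset)
  qed
qed

lemma continuous_on_Icc_tendsto_right:
  fixes g :: "real \<Rightarrow> 'a::topological_space"
  assumes "continuous_on {s..t} g" "s < t"
  shows "(g \<longlongrightarrow> g s) (at_right s)"
proof -
  have "(g \<longlongrightarrow> g s) (at s within {s..t})" using assms by (simp add: continuous_on_def)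
  then show ?thesis using assms(2) by (simp add: at_within_Icc_at_right)
qed

locale cev_parameters =
  fixes \<mu> \<sigma> \<gamma> :: real
  assumes mu: "\<mu> > 0" and sigma: "\<sigma> > 0" and gamma0: "0 \<le> \<gamma>" and gamma1: "\<gamma> < 1"
begin

text \<open>\<open>\<kappa>\<close> is -\<nu> and \<open>y\<close> is the variable in which the
  eigenvalue equation becomes Kummer's. \<open>c\<close> is normalized by y' = c x^{1-\<gamma>},
  which makes \<open>E\<close> the integrating factor of the equation for u; \<open>q\<close> turns
  the operator into the derivative of the flux, J' = q L p.\<close>

definition "\<kappa> = 2 * \<mu> / ((2 - \<gamma>) * \<sigma>\<^sup>2)"
definition "c = 2 * \<mu> / \<sigma>\<^sup>2"
definition "q = 2 / \<sigma>\<^sup>2"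
definition "a = 1 / (2 - \<gamma>)"
definition y :: "real \<Rightarrow> real" where "y x = \<kappa> * x powr (2 - \<gamma>)"
definition E :: "real \<Rightarrow> real" where "E x = exp (- y x)"

abbreviation "w \<equiv> cev_w \<mu> \<sigma> \<gamma>"
abbreviation "M \<equiv> cev_measure \<mu> \<sigma> \<gamma>"
abbreviation "L2 \<equiv> L2_fun M"

lemma kappa: "\<kappa> > 0" and c_pos: "c > 0" and q_pos: "q > 0" and c_kappa: "c = \<kappa> * (2 - \<gamma>)"
  and nu_kappa: "cev_nu \<mu> \<sigma> \<gamma> = - \<kappa>" and c_mu: "\<mu> * q = c"
  using mu sigma gamma1 by (auto simp: \<kappa>_def c_def q_def cev_nu_def field_simps)

lemma sigma_q: "\<sigma>\<^sup>2 / 2 * q = 1" "\<sigma>\<^sup>2 / 2 = 1 / q" "\<sigma>\<^sup>2 / 2 * c = \<mu>"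
  using sigma by (auto simp: q_def c_def)

lemma a_bounds: "1/2 \<le> a" "a < 1" "(2 - \<gamma>) * a = 1"
  using gamma0 gamma1 by (auto simp: a_def field_simps)

lemma E_pos: "E x > 0" and y_nonneg: "0 \<le> y x" and E_le1: "E x \<le> 1"
  using kappa by (auto simp: E_def y_def)

lemma w_eq: "w x = x powr \<gamma> * E x"
  by (simp add: cev_w_def nu_kappa E_def y_def)

lemma w_pos: "x > 0 \<Longrightarrow> w x > 0"
  by (simp add: w_eq E_pos)

lemma w_nonneg: "w x \<ge> 0"
  using E_pos[of x] by (simp add: w_eq)

lemma y_deriv: "x > 0 \<Longrightarrow> (y has_real_derivative c * x powr (1 - \<gamma>)) (at x)"
  unfolding y_def[abs_def] c_kappa using gamma1 by (auto intro!: derivative_eq_intros simp: field_simps)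

lemma E_deriv: "x > 0 \<Longrightarrow> (E has_real_derivative - (c * x powr (1 - \<gamma>)) * E x) (at x)"
  unfolding E_def[abs_def] by (auto intro!: derivative_eq_intros y_deriv)

lemma y_cont: "continuous_on {0..} y"
  unfolding y_def[abs_def] using gamma1 by (auto intro!: continuous_intros continuous_on_powr')

lemma y_mono: "0 \<le> s \<Longrightarrow> s \<le> t \<Longrightarrow> y s \<le> y t"
  unfolding y_def using kappa gamma1 by (intro mult_left_mono powr_mono2) auto

lemma E_cont: "continuous_on {0..} E"
  unfolding E_def[abs_def] by (intro continuous_intros y_cont)

lemma w_cont: "continuous_on {0<..} w"
  unfolding cev_w_def[abs_def] by (auto intro!: continuous_intros)

section \<open>The weighted space of square integrable functions\<close>

lemma space_M: "space M = {0<..}" and sets_M: "sets M = sets (lebesgue_on {0<..})"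
  by (simp_all add: cev_measure_def)

lemma measurable_M: "borel_measurable M = borel_measurable (lebesgue_on {0<..})"
  by (rule measurable_cong_sets) (simp_all add: sets_M)

lemma w_measurable: "w \<in> borel_measurable (lebesgue_on {0<..})"
  using w_cont by (rule continuous_imp_measurable_on_sets_lebesgue) simp

lemma AE_M: "(AE x in M. P x) \<longleftrightarrow> (AE x in lebesgue_on {0<..}. P x)"
proof -
  have "(AE x in M. P x) \<longleftrightarrow> (AE x in lebesgue_on {0<..}. 0 < ennreal (w x) \<longrightarrow> P x)"
    unfolding cev_measure_def using w_measurable by (intro AE_density) simp
  also have "\<dots> \<longleftrightarrow> (AE x in lebesgue_on {0<..}. P x)"
    by (intro AE_cong) (auto simp: w_pos)
  finally show ?thesis .
qed

lemma AE_M_negligible: "(AE x in M. P x) \<longleftrightarrow> negligible {x. x > 0 \<and> \<not> P x}"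
  unfolding AE_M by (subst AE_lebesgue_on_iff_negligible) auto

lemma AE_M_pos: "(\<And>x. x > 0 \<Longrightarrow> P x) \<Longrightarrow> AE x in M. P x"
  by (rule AE_I2) (simp add: space_M)

lemma integrable_M:
  fixes f :: "real \<Rightarrow> 'b::euclidean_space"
  assumes "f \<in> borel_measurable M"
  shows "integrable M f \<longleftrightarrow> (\<lambda>x. w x *\<^sub>R f x) absolutely_integrable_on {0<..}"
  unfolding cev_measure_def using assms w_measurable w_nonneg
  by (subst integrable_density) (simp_all add: measurable_M integrable_restrict_space set_integrable_def)

lemma integral_M:
  fixes f :: "real \<Rightarrow> 'b::euclidean_space"
  assumes "integrable M f"
  shows "integral\<^sup>L M f = integral {0<..} (\<lambda>x. w x *\<^sub>R f x)"
proof -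
  have m: "f \<in> borel_measurable M" using assms by simp
  have ai: "(\<lambda>x. w x *\<^sub>R f x) absolutely_integrable_on {0<..}" using integrable_M[OF m] assms by simp
  have "integral\<^sup>L M f = integral\<^sup>L (lebesgue_on {0<..}) (\<lambda>x. w x *\<^sub>R f x)"
    unfolding cev_measure_def using m w_measurable w_nonneg by (subst integral_density) (simp_all add: measurable_M)
  also have "\<dots> = integral {0<..} (\<lambda>x. w x *\<^sub>R f x)"
    using ai by (intro lebesgue_integral_eq_integral) (simp_all add: absolutely_integrable_imp_integrable)
  finally show ?thesis .
qed

lemma L2_measurable: "f \<in> L2 \<Longrightarrow> f \<in> borel_measurable (lebesgue_on {0<..})"
  by (simp add: L2_fun_def measurable_M)

lemma L2_iff: "f \<in> L2 \<longleftrightarrow> f \<in> borel_measurable (lebesgue_on {0<..}) \<and> (\<lambda>x. w x * (cmod (f x))\<^sup>2) integrable_on {0<..}"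
proof (cases "f \<in> borel_measurable (lebesgue_on {0<..})")
  case True
  then have "(\<lambda>x. (cmod (f x))\<^sup>2) \<in> borel_measurable M" unfolding measurable_M by measurable
  from integrable_M[OF this] True show ?thesis
    by (simp add: L2_fun_def measurable_M absolutely_integrable_on_iff_nonneg w_nonneg)
qed (simp add: L2_fun_def measurable_M)

lemma L2_norm_sq: "f \<in> L2 \<Longrightarrow> (L2_norm M f)\<^sup>2 = integral {0<..} (\<lambda>x. w x * (cmod (f x))\<^sup>2)"
proof -
  assume f: "f \<in> L2"
  have "(L2_norm M f)\<^sup>2 = (\<integral>x. (cmod (f x))\<^sup>2 \<partial>M)"
    unfolding L2_norm_def by (rule real_sqrt_pow2) simp
  with f show ?thesis by (simp add: integral_M L2_fun_def)
qed

lemma L2_norm_nonneg: "L2_norm M f \<ge> 0"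
  by (simp add: L2_norm_def)

lemma L2_bound:
  assumes "f \<in> borel_measurable (lebesgue_on {0<..})" "g integrable_on {0<..}"
    "\<And>x. x > 0 \<Longrightarrow> w x * (cmod (f x))\<^sup>2 \<le> g x"
  shows "f \<in> L2" "(L2_norm M f)\<^sup>2 \<le> integral {0<..} g"
proof -
  have [measurable]: "f \<in> borel_measurable (lebesgue_on {0<..})" "w \<in> borel_measurable (lebesgue_on {0<..})"
    using assms w_measurable by auto
  have "(\<lambda>x. w x * (cmod (f x))\<^sup>2) \<in> borel_measurable (lebesgue_on {0<..})" by measurable
  then have i: "(\<lambda>x. w x * (cmod (f x))\<^sup>2) integrable_on {0<..}"
    by (rule measurable_bounded_by_integrable_imp_integrable[OF _ assms(2)])
       (use assms(3) w_nonneg in \<open>auto simp: abs_mult\<close>)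
  then show f: "f \<in> L2" using assms(1) by (simp add: L2_iff)
  show "(L2_norm M f)\<^sup>2 \<le> integral {0<..} g"
    unfolding L2_norm_sq[OF f] using i assms(2,3) by (intro integral_le) auto
qed

lemma L2_zero: "(\<lambda>x. 0) \<in> L2"
  by (simp add: L2_fun_def)

lemma L2_scale: "f \<in> L2 \<Longrightarrow> (\<lambda>x. k * f x) \<in> L2"
  and L2_norm_scale: "f \<in> L2 \<Longrightarrow> L2_norm M (\<lambda>x. k * f x) = cmod k * L2_norm M f"
proof -
  assume f: "f \<in> L2"
  have [measurable]: "f \<in> borel_measurable M" and i: "integrable M (\<lambda>x. (cmod (f x))\<^sup>2)"
    using f by (auto simp: L2_fun_def)
  show "(\<lambda>x. k * f x) \<in> L2"
    using i by (simp add: L2_fun_def norm_mult power_mult_distrib)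
  show "L2_norm M (\<lambda>x. k * f x) = cmod k * L2_norm M f"
    by (simp add: L2_norm_def norm_mult power_mult_distrib real_sqrt_mult)
qed

lemma sq_sum_le: "(cmod (u + v))\<^sup>2 \<le> 2 * (cmod u)\<^sup>2 + 2 * (cmod v)\<^sup>2"
proof -
  have "(cmod (u + v))\<^sup>2 \<le> (cmod u + cmod v)\<^sup>2" by (intro power_mono norm_triangle_ineq) auto
  also have "\<dots> \<le> 2 * (cmod u)\<^sup>2 + 2 * (cmod v)\<^sup>2"
    using zero_le_power2[of "cmod u - cmod v"] by (simp add: power2_eq_square algebra_simps)
  finally show ?thesis .
qed

lemma L2_add: "f \<in> L2 \<Longrightarrow> g \<in> L2 \<Longrightarrow> (\<lambda>x. f x + g x) \<in> L2"
  and L2_norm_add: "f \<in> L2 \<Longrightarrow> g \<in> L2 \<Longrightarrow> (L2_norm M (\<lambda>x. f x + g x))\<^sup>2 \<le> 2 * (L2_norm M f)\<^sup>2 + 2 * (L2_norm M g)\<^sup>2"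
proof -
  assume f: "f \<in> L2" and g: "g \<in> L2"
  have m: "(\<lambda>x. f x + g x) \<in> borel_measurable (lebesgue_on {0<..})"
    using L2_measurable[OF f] L2_measurable[OF g] by measurable
  have i: "(\<lambda>x. 2 * (w x * (cmod (f x))\<^sup>2) + 2 * (w x * (cmod (g x))\<^sup>2)) integrable_on {0<..}"
    using f g by (intro integrable_add integrable_on_mult_right) (auto simp: L2_iff)
  have le: "w x * (cmod (f x + g x))\<^sup>2 \<le> 2 * (w x * (cmod (f x))\<^sup>2) + 2 * (w x * (cmod (g x))\<^sup>2)" for x
  proof -
    have "w x * (cmod (f x + g x))\<^sup>2 \<le> w x * (2 * (cmod (f x))\<^sup>2 + 2 * (cmod (g x))\<^sup>2)"
      by (intro mult_left_mono sq_sum_le w_nonneg)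
    then show ?thesis by (simp add: algebra_simps)
  qed
  show "(\<lambda>x. f x + g x) \<in> L2" by (rule L2_bound(1)[OF m i le])
  have "integral {0<..} (\<lambda>x. 2 * (w x * (cmod (f x))\<^sup>2) + 2 * (w x * (cmod (g x))\<^sup>2)) =
      2 * (L2_norm M f)\<^sup>2 + 2 * (L2_norm M g)\<^sup>2"
    unfolding L2_norm_sq[OF f] L2_norm_sq[OF g]
    using f g by (subst integral_add) (auto simp: L2_iff intro!: integrable_on_mult_right)
  then show "(L2_norm M (\<lambda>x. f x + g x))\<^sup>2 \<le> 2 * (L2_norm M f)\<^sup>2 + 2 * (L2_norm M g)\<^sup>2"
    using L2_bound(2)[OF m i le] by simp
qed

lemma L2_diff: "f \<in> L2 \<Longrightarrow> g \<in> L2 \<Longrightarrow> (\<lambda>x. f x - g x) \<in> L2"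
  using L2_scale[of g "-1"] L2_add[of f "\<lambda>x. - g x"] by simp

lemma L2_cnj: "f \<in> L2 \<Longrightarrow> (\<lambda>x. cnj (f x)) \<in> L2"
  using borel_measurable_continuous_on[OF continuous_on_cnj[OF continuous_on_id], of f M]
  by (auto simp: L2_fun_def)

lemma L2_ae: "f \<in> L2 \<Longrightarrow> ae_eq M f g \<Longrightarrow> g \<in> L2"
proof -
  assume f: "f \<in> L2" and ae: "ae_eq M f g"
  have m: "g \<in> borel_measurable M"
    unfolding measurable_M
    by (rule borel_measurable_lebesgue_on_AE[OF L2_measurable[OF f]]) (use ae in \<open>simp_all add: ae_eq_def AE_M\<close>)
  have fm: "f \<in> borel_measurable M" using f by (simp add: L2_fun_def)
  have "integrable M (\<lambda>x. (cmod (f x))\<^sup>2) \<longleftrightarrow> integrable M (\<lambda>x. (cmod (g x))\<^sup>2)"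
  proof (rule integrable_cong_AE)
    show "(\<lambda>x. (cmod (f x))\<^sup>2) \<in> borel_measurable M" using fm by measurable
    show "(\<lambda>x. (cmod (g x))\<^sup>2) \<in> borel_measurable M" using m by measurable
    show "AE x in M. (cmod (f x))\<^sup>2 = (cmod (g x))\<^sup>2" using ae unfolding ae_eq_def by (rule AE_mp) simp
  qed
  with f m show "g \<in> L2" by (simp add: L2_fun_def)
qed

lemma L2_norm_ae:
  assumes "f \<in> L2" "g \<in> L2" "ae_eq M f g"
  shows "L2_norm M f = L2_norm M g"
proof -
  have [measurable]: "f \<in> borel_measurable M" "g \<in> borel_measurable M" using assms by (auto simp: L2_fun_def)
  have "(\<integral>x. (cmod (f x))\<^sup>2 \<partial>M) = (\<integral>x. (cmod (g x))\<^sup>2 \<partial>M)"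
    using assms(3) unfolding ae_eq_def by (intro integral_cong_AE) (auto elim: AE_mp)
  then show ?thesis by (simp add: L2_norm_def)
qed

lemma ae_eq_refl: "ae_eq M f f" and ae_eq_sym: "ae_eq M f g \<Longrightarrow> ae_eq M g f"
  and ae_eq_trans: "ae_eq M f g \<Longrightarrow> ae_eq M g h \<Longrightarrow> ae_eq M f h"
  by (auto simp: ae_eq_def elim: AE_mp eventually_mono)

lemma L2_mult_integrable:
  assumes f: "f \<in> L2" and g: "g \<in> L2"
  shows "integrable M (\<lambda>x. f x * g x)"
proof -
  have [measurable]: "f \<in> borel_measurable M" "g \<in> borel_measurable M" using assms by (auto simp: L2_fun_def)
  have "integrable M (\<lambda>x. (cmod (f x))\<^sup>2 + (cmod (g x))\<^sup>2)" using f g by (simp add: L2_fun_def)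
  then show ?thesis
  proof (rule Bochner_Integration.integrable_bound)
    show "AE x in M. cmod (f x * g x) \<le> norm ((cmod (f x))\<^sup>2 + (cmod (g x))\<^sup>2)"
    proof (rule AE_I2)
      fix x
      have "2 * (cmod (f x) * cmod (g x)) \<le> (cmod (f x))\<^sup>2 + (cmod (g x))\<^sup>2"
        using sum_squares_bound[of "cmod (f x)" "cmod (g x)"] by simp
      moreover have "0 \<le> cmod (f x) * cmod (g x)" by simp
      ultimately show "cmod (f x * g x) \<le> norm ((cmod (f x))\<^sup>2 + (cmod (g x))\<^sup>2)" by (simp only: norm_mult real_norm_def)
    qed
  qed measurable
qed

lemma L2_mult_absolutely_integrable:
  assumes "f \<in> L2" "g \<in> L2"
  shows "(\<lambda>x. w x *\<^sub>R (f x * g x)) absolutely_integrable_on {0<..}"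
  using L2_mult_integrable[OF assms] by (subst integrable_M[symmetric]) auto

lemma L2_inner_eq:
  assumes "f \<in> L2" "g \<in> L2"
  shows "L2_inner M f g = integral {0<..} (\<lambda>x. w x *\<^sub>R (f x * cnj (g x)))"
  unfolding L2_inner_def using L2_mult_integrable[OF assms(1) L2_cnj[OF assms(2)]] by (rule integral_M)

lemma L2_zero_ae:
  assumes "f \<in> L2" "L2_norm M f = 0"
  shows "ae_eq M f (\<lambda>x. 0)"
proof -
  have "(\<integral>x. (cmod (f x))\<^sup>2 \<partial>M) = 0" using assms(2) by (simp add: L2_norm_def)
  then have "AE x in M. (cmod (f x))\<^sup>2 = 0"
    using assms(1) by (subst (asm) integral_nonneg_eq_0_iff_AE) (auto simp: L2_fun_def)
  then show ?thesis by (simp add: ae_eq_def)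
qed

text \<open>Cauchy--Schwarz against \<open>1/w\<close>, in AM--GM form with a free parameter.\<close>

lemma L2_imp_integrable_Icc:
  assumes h: "h \<in> L2" and st: "0 \<le> s" "s \<le> t" and iw: "(\<lambda>x. 1 / w x) integrable_on {s..t}"
  shows "h absolutely_integrable_on {s..t}"
    and "integral {s..t} (\<lambda>x. cmod (h x)) \<le> L2_norm M h * sqrt (integral {s..t} (\<lambda>x. 1 / w x))"
proof -
  let ?S = "{s<..<t}"
  have sub: "?S \<subseteq> {0<..}" using st by auto
  have iw': "(\<lambda>x. 1 / w x) integrable_on ?S" using iw by (simp add: integrable_on_Icc_iff_Ioo)
  have hw: "(\<lambda>x. w x * (cmod (h x))\<^sup>2) integrable_on {0<..}" using h by (simp add: L2_iff)
  have hwa: "(\<lambda>x. w x * (cmod (h x))\<^sup>2) absolutely_integrable_on {0<..}"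
    using hw by (simp add: absolutely_integrable_on_iff_nonneg w_nonneg)
  have hwS: "(\<lambda>x. w x * (cmod (h x))\<^sup>2) integrable_on ?S"
    using set_integrable_subset[OF hwa _ sub] by (simp add: absolutely_integrable_on_def)
  have hm: "h \<in> borel_measurable (lebesgue_on ?S)"
    using L2_measurable[OF h] sub by (rule measurable_restrict_mono)
  define A where "A = L2_norm M h"
  define B where "B = integral {s..t} (\<lambda>x. 1 / w x)"
  have Bo: "integral ?S (\<lambda>x. 1 / w x) = B" unfolding B_def by (rule integral_open_interval_real[symmetric])
  have wA: "integral ?S (\<lambda>x. w x * (cmod (h x))\<^sup>2) \<le> A\<^sup>2"
    unfolding A_def L2_norm_sq[OF h] by (rule integral_subset_le[OF sub hwS hw]) (simp add: w_nonneg)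
  have A0: "A \<ge> 0" unfolding A_def by (rule L2_norm_nonneg)
  have B0: "B \<ge> 0" unfolding B_def by (rule integral_nonneg[OF iw]) (simp add: w_nonneg)
  have pt: "cmod (h x) \<le> e / 2 * (w x * (cmod (h x))\<^sup>2) + 1 / (2 * e) * (1 / w x)" if e: "e > 0" and x: "x \<in> ?S" for e x
  proof -
    have wp: "w x > 0" using x st by (intro w_pos) auto
    have "0 \<le> (e * w x * cmod (h x) - 1)\<^sup>2 / (2 * e * w x)" using e wp by (intro divide_nonneg_pos) auto
    also have "\<dots> = e / 2 * (w x * (cmod (h x))\<^sup>2) + 1 / (2 * e) * (1 / w x) - cmod (h x)"
      using e wp by (simp add: power2_eq_square field_simps)
    finally show ?thesis by simp
  qed
  have gi: "(\<lambda>x. e / 2 * (w x * (cmod (h x))\<^sup>2) + 1 / (2 * e) * (1 / w x)) integrable_on ?S" for e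
    using hwS iw' by (intro integrable_add integrable_on_mult_right)
  have ha: "h absolutely_integrable_on ?S"
    by (rule measurable_bounded_by_integrable_imp_absolutely_integrable[OF hm _ gi[of 1]]) (use pt[of 1] in auto)
  then show ha': "h absolutely_integrable_on {s..t}" by (simp add: absolutely_integrable_on_Icc_iff_Ioo)
  have nh: "(\<lambda>x. cmod (h x)) integrable_on ?S" using ha by (simp add: absolutely_integrable_on_def)
  define X where "X = integral {s..t} (\<lambda>x. cmod (h x))"
  have Xo: "X = integral ?S (\<lambda>x. cmod (h x))" unfolding X_def by (rule integral_open_interval_real)
  have X: "X \<le> e / 2 * A\<^sup>2 + 1 / (2 * e) * B" if e: "e > 0" for e
  proof -
    have "X \<le> integral ?S (\<lambda>x. e / 2 * (w x * (cmod (h x))\<^sup>2) + 1 / (2 * e) * (1 / w x))"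
      unfolding Xo by (rule integral_le[OF nh gi]) (use pt[OF e] in auto)
    also have "\<dots> = e / 2 * integral ?S (\<lambda>x. w x * (cmod (h x))\<^sup>2) + 1 / (2 * e) * B"
      using hwS iw' by (subst integral_add) (auto simp: Bo[symmetric] intro!: integrable_on_mult_right simp del: times_divide_eq_right times_divide_eq_left)
    also have "\<dots> \<le> e / 2 * A\<^sup>2 + 1 / (2 * e) * B" using wA e by simp
    finally show ?thesis .
  qed
  \<comment> \<open>The optimal e is sqrt B / A. Adding d to both avoids a vanishing numerator or
    denominator and is undone by letting d tend to 0.\<close>
  have Xe: "X \<le> (A + d) * (sqrt B + d)" if d: "d > 0" for d
  proof -
    define e where "e = (sqrt B + d) / (A + d)"
    have p: "sqrt B + d > 0" "A + d > 0" using d A0 B0 by (auto intro: add_nonneg_pos)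
    have e: "e > 0" using p by (simp add: e_def)
    have "A\<^sup>2 \<le> (A + d)\<^sup>2" using A0 d by (intro power_mono) auto
    moreover have "B \<le> (sqrt B + d)\<^sup>2"
      using power_mono[of "sqrt B" "sqrt B + d" 2] d B0 by simp
    ultimately have "X \<le> e / 2 * (A + d)\<^sup>2 + 1 / (2 * e) * (sqrt B + d)\<^sup>2"
      using X[OF e] e by (smt (verit) mult_left_mono divide_nonneg_pos)
    also have "\<dots> = (A + d) * (sqrt B + d)"
    proof -
      have "v / u / 2 * u\<^sup>2 + 1 / (2 * (v / u)) * v\<^sup>2 = u * v" if "u > 0" "v > 0" for u v :: real
        using that by (simp add: power2_eq_square)
      then show ?thesis using p unfolding e_def by blast
    qed
    finally show ?thesis .
  qed
  have "((\<lambda>d. (A + d) * (sqrt B + d)) \<longlongrightarrow> (A + 0) * (sqrt B + 0)) (at_right 0)"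
    by (intro tendsto_intros)
  then have "X \<le> (A + 0) * (sqrt B + 0)"
    by (rule tendsto_lowerbound) (auto simp: eventually_at_right_less Xe intro: eventually_mono[OF eventually_at_right_less])
  then show "integral {s..t} (\<lambda>x. cmod (h x)) \<le> L2_norm M h * sqrt (integral {s..t} (\<lambda>x. 1 / w x))"
    by (simp add: X_def A_def B_def)
qed

text \<open>Here \<gamma> < 1 makes 0 a regular endpoint: 1/w behaves like x^{-\<gamma>} near 0, and
  its other factor e^y is bounded on compact intervals.\<close>

lemma inv_w_integrable:
  assumes "0 \<le> t" shows "(\<lambda>x. 1 / w x) integrable_on {0..t}"
proof -
  have "(\<lambda>x. x powr (-\<gamma>)) absolutely_integrable_on {0..t}"
    using integrable_on_powr_from_0[of "-\<gamma>" t] assms gamma1 by (intro nonnegative_absolutely_integrable_1) auto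
  moreover have "continuous_on {0..t} (\<lambda>x. exp (y x))"
    by (intro continuous_intros continuous_on_subset[OF y_cont]) auto
  ultimately have "(\<lambda>x. exp (y x) * x powr (-\<gamma>)) absolutely_integrable_on {0..t}"
    by (intro absolutely_integrable_bounded_measurable_product_real)
       (auto intro: continuous_imp_measurable_on_sets_lebesgue compact_imp_bounded compact_continuous_image)
  then have "(\<lambda>x. exp (y x) * x powr (-\<gamma>)) integrable_on {0..t}" by (simp add: absolutely_integrable_on_def)
  then show ?thesis
    by (rule integrable_eq) (simp add: w_eq E_def powr_minus exp_minus field_simps)
qed

lemma L2_integrable_0:
  assumes "h \<in> L2" "0 \<le> t"
  shows "h absolutely_integrable_on {0..t}" "h integrable_on {0..t}"
  using L2_imp_integrable_Icc(1)[OF assms(1) order_refl assms(2) inv_w_integrable[OF assms(2)]]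
  by (simp_all add: absolutely_integrable_on_def)

section \<open>Solutions with boundary data at the regular endpoint\<close>

text \<open>Inverse of the substitution u = x^\<gamma> p. Up to the constant \<sigma>^2/2, u is the
  function under the second derivative in the operator, and unlike p it has a limit at 0 for every p
  in the maximal domain.\<close>

abbreviation "dens u \<equiv> (\<lambda>x. x powr (-\<gamma>) *\<^sub>R u x)"

text \<open>For \<open>u = x\<^sup>\<gamma> p\<close> the equation \<open>L p = h\<close> is the system \<open>u' = J + c x\<^bsup>1-\<gamma>\<^esup> u\<close>, \<open>J' = q h\<close>, which is
  regular at \<open>0\<close>; \<open>u0\<close> and \<open>j0\<close> are the initial values of \<open>u\<close> and of the flux \<open>J\<close>.\<close>

definition sol :: "complex \<Rightarrow> complex \<Rightarrow> (real \<Rightarrow> complex) \<Rightarrow> (real \<Rightarrow> complex) \<Rightarrow> (real \<Rightarrow> complex) \<Rightarrow> bool" where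
  "sol u0 j0 u J h \<longleftrightarrow> h \<in> L2 \<and> dens u \<in> L2 \<and>
     (\<forall>x>0. (u has_vector_derivative (J x + (c * x powr (1 - \<gamma>)) *\<^sub>R u x)) (at x)) \<and>
     (\<forall>x>0. J x = j0 + q *\<^sub>R integral {0..x} h) \<and> (u \<longlongrightarrow> u0) (at_right 0)"

lemma sol_L2: "sol u0 j0 u J h \<Longrightarrow> h \<in> L2" "sol u0 j0 u J h \<Longrightarrow> dens u \<in> L2"
  and sol_deriv: "sol u0 j0 u J h \<Longrightarrow> x > 0 \<Longrightarrow> (u has_vector_derivative (J x + (c * x powr (1 - \<gamma>)) *\<^sub>R u x)) (at x)"
  and sol_J: "sol u0 j0 u J h \<Longrightarrow> x > 0 \<Longrightarrow> J x = j0 + q *\<^sub>R integral {0..x} h"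
  and sol_u0: "sol u0 j0 u J h \<Longrightarrow> (u \<longlongrightarrow> u0) (at_right 0)"
  by (auto simp: sol_def)

lemma integral_cong_AE_M:
  fixes h :: "real \<Rightarrow> complex"
  assumes "ae_eq M h h'" "0 \<le> s"
  shows "integral {s..t} h = integral {s..t} h'"
proof (rule integral_spike)
  show "negligible ({x. x > 0 \<and> h x \<noteq> h' x} \<union> {0})"
    using assms(1) by (simp add: ae_eq_def AE_M_negligible)
qed (use assms(2) in auto)

lemma sol_cong:
  assumes s: "sol u0 j0 u J h" and u: "\<And>x. x > 0 \<Longrightarrow> u' x = u x" and h: "ae_eq M h h'"
  shows "sol u0 j0 u' J h'"
  unfolding sol_def
proof (intro conjI allI impI)
  show "h' \<in> L2" using sol_L2(1)[OF s] h by (rule L2_ae)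
  show "dens u' \<in> L2"
    by (rule L2_ae[OF sol_L2(2)[OF s]]) (auto simp: ae_eq_def u intro: AE_M_pos)
  show "(u' \<longlongrightarrow> u0) (at_right 0)"
    by (rule Lim_transform_eventually[OF sol_u0[OF s]])
       (auto simp: u intro: eventually_mono[OF eventually_at_right_less])
next
  fix x :: real assume x: "x > 0"
  show "J x = j0 + q *\<^sub>R integral {0..x} h'"
    using sol_J[OF s x] integral_cong_AE_M[OF h order_refl] by simp
  have "(u' has_vector_derivative (J x + (c * x powr (1 - \<gamma>)) *\<^sub>R u x)) (at x)"
    by (rule has_vector_derivative_transform_within_open[OF sol_deriv[OF s x], of "{0<..}"]) (use x u in auto)
  then show "(u' has_vector_derivative (J x + (c * x powr (1 - \<gamma>)) *\<^sub>R u' x)) (at x)" using u x by simp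
qed

lemma sol_add:
  assumes s: "sol u0 j0 u J h" and s': "sol u0' j0' u' J' h'"
  shows "sol (u0 + u0') (j0 + j0') (\<lambda>x. u x + u' x) (\<lambda>x. J x + J' x) (\<lambda>x. h x + h' x)"
  unfolding sol_def
proof (intro conjI allI impI)
  show "(\<lambda>x. h x + h' x) \<in> L2" using s s' by (intro L2_add sol_L2)
  show "(\<lambda>x. x powr (-\<gamma>) *\<^sub>R (u x + u' x)) \<in> L2"
    using L2_add[OF sol_L2(2)[OF s] sol_L2(2)[OF s']] by (simp add: scaleR_add_right)
  show "((\<lambda>x. u x + u' x) \<longlongrightarrow> u0 + u0') (at_right 0)" using s s' by (intro tendsto_add sol_u0)
  fix x :: real assume x: "x > 0"
  show "J x + J' x = j0 + j0' + q *\<^sub>R integral {0..x} (\<lambda>x. h x + h' x)"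
    using sol_J[OF s x] sol_J[OF s' x] L2_integrable_0(2)[OF sol_L2(1)[OF s], of x] L2_integrable_0(2)[OF sol_L2(1)[OF s'], of x] x
    by (simp add: integral_add scaleR_add_right)
  show "((\<lambda>x. u x + u' x) has_vector_derivative J x + J' x + (c * x powr (1 - \<gamma>)) *\<^sub>R (u x + u' x)) (at x)"
    using has_vector_derivative_add[OF sol_deriv[OF s x] sol_deriv[OF s' x]] by (simp add: algebra_simps)
qed

lemma sol_scale:
  assumes s: "sol u0 j0 u J h"
  shows "sol (k * u0) (k * j0) (\<lambda>x. k * u x) (\<lambda>x. k * J x) (\<lambda>x. k * h x)"
  unfolding sol_def
proof (intro conjI allI impI)
  show "(\<lambda>x. k * h x) \<in> L2" using s by (intro L2_scale sol_L2)
  show "(\<lambda>x. x powr (-\<gamma>) *\<^sub>R (k * u x)) \<in> L2"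
    using L2_scale[OF sol_L2(2)[OF s], of k] by simp
  show "((\<lambda>x. k * u x) \<longlongrightarrow> k * u0) (at_right 0)" using s by (intro tendsto_mult_left sol_u0)
  fix x :: real assume x: "x > 0"
  show "k * J x = k * j0 + q *\<^sub>R integral {0..x} (\<lambda>x. k * h x)"
    using sol_J[OF s x] by (simp add: distrib_left)
  show "((\<lambda>x. k * u x) has_vector_derivative k * J x + (c * x powr (1 - \<gamma>)) *\<^sub>R (k * u x)) (at x)"
    using has_vector_derivative_mult_right[OF sol_deriv[OF s x], of k] by (simp add: algebra_simps)
qed

text \<open>The coefficients of the system are real. This allows Green's formula to be proved for
  the bilinear pairing and transferred to the inner product.\<close>

lemma sol_cnj:
  assumes s: "sol u0 j0 u J h"
  shows "sol (cnj u0) (cnj j0) (\<lambda>x. cnj (u x)) (\<lambda>x. cnj (J x)) (\<lambda>x. cnj (h x))"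
  unfolding sol_def
proof (intro conjI allI impI)
  show "(\<lambda>x. cnj (h x)) \<in> L2" using s by (intro L2_cnj sol_L2)
  show "(\<lambda>x. x powr (-\<gamma>) *\<^sub>R cnj (u x)) \<in> L2"
    using L2_cnj[OF sol_L2(2)[OF s]] by (simp add: complex_cnj_scaleR)
  show "((\<lambda>x. cnj (u x)) \<longlongrightarrow> cnj u0) (at_right 0)" using s by (intro tendsto_cnj sol_u0)
  fix x :: real assume x: "x > 0"
  have "integral {0..x} (\<lambda>x. cnj (h x)) = cnj (integral {0..x} h)"
    by (rule integral_cnj[symmetric])
  then show "cnj (J x) = cnj j0 + q *\<^sub>R integral {0..x} (\<lambda>x. cnj (h x))"
    using sol_J[OF s x] by (simp add: complex_cnj_scaleR)
  show "((\<lambda>x. cnj (u x)) has_vector_derivative cnj (J x) + (c * x powr (1 - \<gamma>)) *\<^sub>R cnj (u x)) (at x)"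
    using bounded_linear.has_vector_derivative[OF bounded_linear_cnj sol_deriv[OF s x]] by (simp add: complex_cnj_scaleR)
qed

lemma sol_J_cont:
  assumes s: "sol u0 j0 u J h"
  shows "continuous_on {0<..} J" "(J \<longlongrightarrow> j0) (at_right 0)"
proof -
  let ?I = "\<lambda>x. j0 + q *\<^sub>R integral {0..x} h"
  have I: "continuous_on {0..t} ?I" if "t > 0" for t
    using L2_integrable_0(2)[OF sol_L2(1)[OF s], of t] that
    by (intro continuous_intros indefinite_integral_continuous_1) auto
  have "isCont J x" if x: "x > 0" for x
  proof -
    have "isCont ?I x" by (rule continuous_on_interior[OF I[of "x + 1"]]) (use x in auto)
    then show ?thesis
      by (rule isCont_cong[THEN iffD1, rotated])
         (auto simp: sol_J[OF s] intro!: eventually_mono[OF eventually_nhds_in_open[of "{0<..}"]] x)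
  qed
  then show "continuous_on {0<..} J" by (simp add: continuous_on_eq_continuous_at)
  have "(?I \<longlongrightarrow> ?I 0) (at_right 0)" by (rule continuous_on_Icc_tendsto_right[OF I[of 1]]) simp_all
  then have "(?I \<longlongrightarrow> j0) (at_right 0)" by simp
  then show "(J \<longlongrightarrow> j0) (at_right 0)"
    by (rule Lim_transform_eventually) (auto simp: sol_J[OF s] intro: eventually_mono[OF eventually_at_right_less])
qed

lemma sol_u_cont:
  assumes s: "sol u0 j0 u J h"
  shows "continuous_on {0<..} u"
  using sol_deriv[OF s]
  by (auto simp: continuous_on_eq_continuous_at intro!: has_vector_derivative_continuous)

lemma sol_deriv_limit:
  assumes s: "sol u0 j0 u J h"
  shows "((\<lambda>x. J x + (c * x powr (1 - \<gamma>)) *\<^sub>R u x) \<longlongrightarrow> j0) (at_right 0)"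
proof -
  have "((\<lambda>x. J x + (c * x powr (1 - \<gamma>)) *\<^sub>R u x) \<longlongrightarrow> j0 + (c * 0) *\<^sub>R u0) (at_right 0)"
    using gamma1 by (intro tendsto_intros sol_J_cont(2)[OF s] sol_u0[OF s] powr_tendsto_0) auto
  then show ?thesis by simp
qed

section \<open>Identification of the maximal operator\<close>

text \<open>The operator is a divergence: (\<sigma>^2/2 x^\<gamma> p)' = J/q + \<mu> x p, and the
  drift cancels the last term after another differentiation. Differentiability of \<open>J\<close>
  at the single point x is enough, which fits an almost everywhere statement.\<close>

lemma cev_L_flux:
  fixes p p' J :: "real \<Rightarrow> complex"
  assumes p: "\<And>t. t > 0 \<Longrightarrow> (p has_vector_derivative p' t) (at t)"
    and J: "\<And>t. t > 0 \<Longrightarrow> J t = t powr \<gamma> *\<^sub>R p' t + (\<gamma> * t powr (\<gamma> - 1) - c * t) *\<^sub>R p t"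
    and x: "x > 0" and d: "(J has_vector_derivative q *\<^sub>R d) (at x)"
  shows "cev_L \<mu> \<sigma> \<gamma> p x = d"
proof -
  have A: "((\<lambda>t. t *\<^sub>R p t) has_vector_derivative x *\<^sub>R p' x + p x) (at x)"
    using p[OF x] by (auto intro!: derivative_eq_intros)
  have B: "D1 (\<lambda>t. (\<sigma>\<^sup>2 / 2 * t powr \<gamma>) *\<^sub>R p t) t = (1 / q) *\<^sub>R J t + \<mu> *\<^sub>R (t *\<^sub>R p t)" if t: "t > 0" for t
  proof -
    have "((\<lambda>t. \<sigma>\<^sup>2 / 2 * t powr \<gamma>) has_real_derivative \<sigma>\<^sup>2 / 2 * (\<gamma> * t powr (\<gamma> - 1))) (at t)"
      using t by (auto intro!: derivative_eq_intros)
    from has_vector_derivative_scaleR[OF this p[OF t]]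
    have "D1 (\<lambda>t. (\<sigma>\<^sup>2 / 2 * t powr \<gamma>) *\<^sub>R p t) t =
        (\<sigma>\<^sup>2 / 2 * t powr \<gamma>) *\<^sub>R p' t + (\<sigma>\<^sup>2 / 2 * (\<gamma> * t powr (\<gamma> - 1))) *\<^sub>R p t"
      by (rule vector_derivative_at)
    also have "\<dots> = (\<sigma>\<^sup>2 / 2) *\<^sub>R J t + (\<sigma>\<^sup>2 / 2 * c * t) *\<^sub>R p t"
      unfolding J[OF t] by (simp add: algebra_simps)
    finally show ?thesis unfolding sigma_q(3) unfolding sigma_q(2) by simp
  qed
  have "((\<lambda>t. (1 / q) *\<^sub>R J t + \<mu> *\<^sub>R (t *\<^sub>R p t)) has_vector_derivative
      (1 / q) *\<^sub>R (q *\<^sub>R d) + \<mu> *\<^sub>R (x *\<^sub>R p' x + p x)) (at x)"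
    by (intro has_vector_derivative_add bounded_linear.has_vector_derivative[OF bounded_linear_scaleR_right] d A)
  then have "(D1 (\<lambda>t. (\<sigma>\<^sup>2 / 2 * t powr \<gamma>) *\<^sub>R p t) has_vector_derivative
      (1 / q) *\<^sub>R (q *\<^sub>R d) + \<mu> *\<^sub>R (x *\<^sub>R p' x + p x)) (at x)"
    by (rule has_vector_derivative_transform_within_open[where S = "{0<..}"]) (use x B in auto)
  from vector_derivative_at[OF this] vector_derivative_at[OF A] show ?thesis
    using q_pos unfolding cev_L_def by simp
qed

lemma abs_continuous_of_real_C1:
  fixes f f' :: "real \<Rightarrow> real"
  assumes "s > 0" "\<And>x. x > 0 \<Longrightarrow> (f has_real_derivative f' x) (at x)" "continuous_on {0<..} f'"
  shows "abs_continuous_on_interval s t (\<lambda>x. complex_of_real (f x))"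
proof (rule abs_continuous_on_interval_C1)
  show "((\<lambda>x. complex_of_real (f x)) has_vector_derivative of_real (f' x)) (at x within {s..t})" if "x \<in> {s..t}" for x
    using assms(2)[of x] assms(1) that
    by (intro has_vector_derivative_at_within[OF has_vector_derivative_of_real])
       (auto simp: has_real_derivative_iff_has_vector_derivative)
  show "continuous_on {s..t} (\<lambda>x. complex_of_real (f' x))"
    using assms by (intro continuous_intros continuous_on_subset[OF assms(3)]) auto
qed

text \<open>\<open>J\<close> and Q2 p' differ by smooth factors and a smooth multiple of p, so local
  absolute continuity passes from either one to the other.\<close>

lemma Q2_flux:
  fixes p p' J :: complex
  assumes t: "t > 0" and J: "J = t powr \<gamma> *\<^sub>R p' + (\<gamma> * t powr (\<gamma> - 1) - c * t) *\<^sub>R p"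
  shows "cev_Q2 \<mu> \<sigma> \<gamma> t *\<^sub>R p' = of_real (t powr \<gamma> * E t / q) * J + of_real (t powr \<gamma> * E t / q * (c * t - \<gamma> * t powr (\<gamma> - 1))) * p"
    and "J = of_real (t powr (-\<gamma>) * exp (y t) * q) * (cev_Q2 \<mu> \<sigma> \<gamma> t *\<^sub>R p') + of_real (\<gamma> * t powr (\<gamma> - 1) - c * t) * p"
proof -
  have Q: "cev_Q2 \<mu> \<sigma> \<gamma> t = 1 / q * (t powr \<gamma> * E t) * t powr \<gamma>"
    by (simp add: cev_Q2_def sigma_q(2) w_eq)
  have tp: "t powr \<gamma> *\<^sub>R p' = J - (\<gamma> * t powr (\<gamma> - 1) - c * t) *\<^sub>R p" using J by simp
  show "cev_Q2 \<mu> \<sigma> \<gamma> t *\<^sub>R p' = of_real (t powr \<gamma> * E t / q) * J + of_real (t powr \<gamma> * E t / q * (c * t - \<gamma> * t powr (\<gamma> - 1))) * p"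
    unfolding Q scaleR_scaleR[symmetric] tp by (simp add: scaleR_conv_of_real algebra_simps)
  have e: "t powr (-\<gamma>) * exp (y t) * q * cev_Q2 \<mu> \<sigma> \<gamma> t = t powr \<gamma>"
    unfolding Q E_def using t q_pos by (simp add: powr_minus exp_minus field_simps)
  have e2: "of_real (t powr (-\<gamma>) * exp (y t) * q) * (cev_Q2 \<mu> \<sigma> \<gamma> t *\<^sub>R p') = t powr \<gamma> *\<^sub>R p'"
  proof -
    have "of_real (t powr (-\<gamma>) * exp (y t) * q) * (cev_Q2 \<mu> \<sigma> \<gamma> t *\<^sub>R p') =
        (t powr (-\<gamma>) * exp (y t) * q * cev_Q2 \<mu> \<sigma> \<gamma> t) *\<^sub>R p'"
      by (simp add: scaleR_conv_of_real mult_ac)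
    then show ?thesis by (simp only: e)
  qed
  show "J = of_real (t powr (-\<gamma>) * exp (y t) * q) * (cev_Q2 \<mu> \<sigma> \<gamma> t *\<^sub>R p') + of_real (\<gamma> * t powr (\<gamma> - 1) - c * t) * p"
    unfolding e2 by (simp only: J scaleR_conv_of_real)
qed

text \<open>\<open>J\<close> is absolutely continuous on [s, t], hence the integral of its almost
  everywhere derivative, and \<open>cev_L_flux\<close> identifies that derivative with q L p
  wherever it exists.\<close>

lemma Dmax_flux_integral:
  assumes p: "p \<in> cev_Dmax \<mu> \<sigma> \<gamma>" and st: "0 < s" "s \<le> t"
  defines "J \<equiv> \<lambda>t. t powr \<gamma> *\<^sub>R D1 p t + (\<gamma> * t powr (\<gamma> - 1) - c * t) *\<^sub>R p t"
  shows "J t = J s + q *\<^sub>R integral {s..t} (cev_L \<mu> \<sigma> \<gamma> p)"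
proof -
  have dp: "\<And>x. x > 0 \<Longrightarrow> (p has_vector_derivative D1 p x) (at x)"
    and acp: "abs_continuous_on_interval s t p"
    and acQ: "abs_continuous_on_interval s t (\<lambda>x. cev_Q2 \<mu> \<sigma> \<gamma> x *\<^sub>R D1 p x)"
    using p st by (auto simp: cev_Dmax_def vector_derivative_works locally_abs_continuous_pos_def)
  have a: "abs_continuous_on_interval s t (\<lambda>x. of_real (x powr (-\<gamma>) * exp (y x) * q) * (cev_Q2 \<mu> \<sigma> \<gamma> x *\<^sub>R D1 p x) +
      of_real (\<gamma> * x powr (\<gamma> - 1) - c * x) * p x)"
  proof (intro abs_continuous_on_interval_add abs_continuous_on_interval_mult acp acQ)
    show "abs_continuous_on_interval s t (\<lambda>x. complex_of_real (x powr (-\<gamma>) * exp (y x) * q))"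
      by (rule abs_continuous_of_real_C1[OF st(1), where f' =
            "\<lambda>x. (-\<gamma> * x powr (-\<gamma> - 1) * exp (y x) + x powr (-\<gamma>) * (exp (y x) * (c * x powr (1 - \<gamma>)))) * q"])
         (auto intro!: derivative_eq_intros y_deriv continuous_intros continuous_on_subset[OF y_cont])
    show "abs_continuous_on_interval s t (\<lambda>x. complex_of_real (\<gamma> * x powr (\<gamma> - 1) - c * x))"
      by (rule abs_continuous_of_real_C1[OF st(1), where f' = "\<lambda>x. \<gamma> * ((\<gamma> - 1) * x powr (\<gamma> - 1 - 1)) - c"])
         (auto intro!: derivative_eq_intros continuous_intros)
  qed
  have Jx: "J x = of_real (x powr (-\<gamma>) * exp (y x) * q) * (cev_Q2 \<mu> \<sigma> \<gamma> x *\<^sub>R D1 p x) +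
      of_real (\<gamma> * x powr (\<gamma> - 1) - c * x) * p x" if "x > 0" for x
    by (rule Q2_flux(2)[OF that]) (simp add: J_def)
  have "abs_continuous_on_interval s t J"
  proof (rule abs_continuous_on_interval_dominated[OF a a, of 1 0])
    fix x z assume "s \<le> x" "x \<le> z" "z \<le> t"
    then have "x > 0" "z > 0" using st by auto
    then show "norm (J z - J x) \<le> 1 * norm (of_real (z powr (-\<gamma>) * exp (y z) * q) * (cev_Q2 \<mu> \<sigma> \<gamma> z *\<^sub>R D1 p z) +
      of_real (\<gamma> * z powr (\<gamma> - 1) - c * z) * p z - (of_real (x powr (-\<gamma>) * exp (y x) * q) * (cev_Q2 \<mu> \<sigma> \<gamma> x *\<^sub>R D1 p x) +
      of_real (\<gamma> * x powr (\<gamma> - 1) - c * x) * p x)) + 0 * norm (of_real (z powr (-\<gamma>) * exp (y z) * q) * (cev_Q2 \<mu> \<sigma> \<gamma> z *\<^sub>R D1 p z) +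
      of_real (\<gamma> * z powr (\<gamma> - 1) - c * z) * p z - (of_real (x powr (-\<gamma>) * exp (y x) * q) * (cev_Q2 \<mu> \<sigma> \<gamma> x *\<^sub>R D1 p x) +
      of_real (\<gamma> * x powr (\<gamma> - 1) - c * x) * p x))"
      by (simp only: Jx mult_1 mult_zero_left add_0_right order_refl)
  qed simp_all
  then obtain g where g: "g absolutely_integrable_on {s..t}"
    "\<And>x. x \<in> {s..t} \<Longrightarrow> (g has_integral (J x - J s)) {s..x}"
    "negligible {x\<in>{s<..<t}. \<not> (J has_vector_derivative g x) (at x)}"
    using st by (elim abs_continuous_FTC) auto
  let ?N = "{x\<in>{s<..<t}. \<not> (J has_vector_derivative g x) (at x)} \<union> {s, t}"
  have "cev_L \<mu> \<sigma> \<gamma> p x = (1 / q) *\<^sub>R g x" if "x \<in> {s..t} - ?N" for x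
    by (rule cev_L_flux[OF dp, where J = J]) (use that st q_pos in \<open>auto simp: J_def\<close>)
  note eq = this
  have "negligible ?N" using g(3) by simp
  then have "integral {s..t} (cev_L \<mu> \<sigma> \<gamma> p) = integral {s..t} (\<lambda>x. (1 / q) *\<^sub>R g x)"
    by (rule integral_spike) (rule eq[symmetric])
  also have "\<dots> = (1 / q) *\<^sub>R (J t - J s)"
    using g(2)[of t] st by (simp add: integral_unique)
  finally show ?thesis using q_pos by simp
qed

lemma Dmax_sol:
  assumes p: "p \<in> cev_Dmax \<mu> \<sigma> \<gamma>"
  obtains u0 j0 J where "sol u0 j0 (\<lambda>x. x powr \<gamma> *\<^sub>R p x) J (cev_L \<mu> \<sigma> \<gamma> p)"
proof -
  define J where "J = (\<lambda>t. t powr \<gamma> *\<^sub>R D1 p t + (\<gamma> * t powr (\<gamma> - 1) - c * t) *\<^sub>R p t)"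
  define h where "h = cev_L \<mu> \<sigma> \<gamma> p"
  define u where "u = (\<lambda>x. x powr \<gamma> *\<^sub>R p x)"
  have h: "h \<in> L2" and pL: "p \<in> L2" using p by (auto simp: cev_Dmax_def h_def)
  have dp: "\<And>x. x > 0 \<Longrightarrow> (p has_vector_derivative D1 p x) (at x)"
    using p by (auto simp: cev_Dmax_def vector_derivative_works)
  \<comment> \<open>The initial flux is computed backwards from the value at 1, since the integral
    of h down to 0 converges.\<close>
  define j0 where "j0 = J 1 - q *\<^sub>R integral {0..1} h"
  have Jeq: "J x = j0 + q *\<^sub>R integral {0..x} h" if x: "x > 0" for x
  proof -
    have split: "integral {0..t} h = integral {0..s} h + integral {s..t} h" if "0 < s" "s \<le> t" for s t
      using Henstock_Kurzweil_Integration.integral_combine[of 0 s t h] L2_integrable_0(2)[OF h] that by simp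
    show ?thesis
    proof (cases "x \<le> 1")
      case True
      then show ?thesis using Dmax_flux_integral[OF p x True] split[OF x True]
        by (simp add: j0_def J_def h_def scaleR_add_right)
    next
      case False
      then show ?thesis using Dmax_flux_integral[OF p, of 1 x] split[of 1 x]
        by (simp add: j0_def J_def h_def scaleR_add_right)
    qed
  qed
  have du: "(u has_vector_derivative J x + (c * x powr (1 - \<gamma>)) *\<^sub>R u x) (at x)" if x: "x > 0" for x
  proof -
    have "((\<lambda>x. x powr \<gamma>) has_real_derivative \<gamma> * x powr (\<gamma> - 1)) (at x)"
      using x by (auto intro!: derivative_eq_intros)
    from has_vector_derivative_scaleR[OF this dp[OF x]]
    have "(u has_vector_derivative x powr \<gamma> *\<^sub>R D1 p x + (\<gamma> * x powr (\<gamma> - 1)) *\<^sub>R p x) (at x)" by (simp add: u_def)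
    moreover have k: "c * x powr (1 - \<gamma>) * x powr \<gamma> = c * x" using x by (simp add: powr_diff)
    have "(c * x powr (1 - \<gamma>)) *\<^sub>R u x = (c * x) *\<^sub>R p x" unfolding u_def scaleR_scaleR k ..
    then have "J x + (c * x powr (1 - \<gamma>)) *\<^sub>R u x = x powr \<gamma> *\<^sub>R D1 p x + (\<gamma> * x powr (\<gamma> - 1)) *\<^sub>R p x"
      by (simp add: J_def scaleR_diff_left)
    ultimately show ?thesis by simp
  qed
  define I where "I = (\<lambda>x. j0 + q *\<^sub>R integral {0..x} h)"
  have Ic: "continuous_on {0..1} I"
    unfolding I_def using L2_integrable_0(2)[OF h, of 1] by (intro continuous_intros indefinite_integral_continuous_1) auto
  \<comment> \<open>With the integrating factor \<open>E\<close> the equation for u becomes (E u)' =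
    E J, whose right-hand side is continuous up to 0; this gives the limit of u.\<close>
  define F where "F = (\<lambda>x. E x *\<^sub>R u x)"
  have dF: "(F has_vector_derivative E x *\<^sub>R J x) (at x)" if x: "x > 0" for x
    using has_vector_derivative_scaleR[OF E_deriv[OF x] du[OF x]] by (simp add: F_def algebra_simps)
  have EI: "continuous_on {0..1} (\<lambda>x. E x *\<^sub>R I x)"
    by (intro continuous_intros Ic continuous_on_subset[OF E_cont]) auto
  have FE: "F x = F 1 - integral {x..1} (\<lambda>x. E x *\<^sub>R I x)" if x: "0 < x" "x \<le> 1" for x
  proof -
    have "((\<lambda>x. E x *\<^sub>R I x) has_integral (F 1 - F x)) {x..1}"
    proof (rule fundamental_theorem_of_calculus[OF x(2)])
      fix t assume "t \<in> {x..1}"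
      then have "t > 0" using x by simp
      then show "(F has_vector_derivative E t *\<^sub>R I t) (at t within {x..1})"
        using has_vector_derivative_at_within[OF dF[OF \<open>t > 0\<close>], of "{x..1}"]
        unfolding I_def Jeq[OF \<open>t > 0\<close>] by simp
    qed
    then show ?thesis by (simp add: integral_unique)
  qed
  define u0 where "u0 = F 1 - integral {0..1} (\<lambda>x. E x *\<^sub>R I x)"
  have "continuous_on {0..1} (\<lambda>x. F 1 - integral {x..1} (\<lambda>x. E x *\<^sub>R I x))"
    by (intro continuous_on_diff continuous_on_const indefinite_integral_continuous_1' integrable_continuous_real[OF EI])
  then have "((\<lambda>x. F 1 - integral {x..1} (\<lambda>x. E x *\<^sub>R I x)) \<longlongrightarrow> u0) (at_right 0)"
    unfolding u0_def by (rule continuous_on_Icc_tendsto_right) simp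
  moreover have "\<forall>\<^sub>F x in at_right 0. F 1 - integral {x..1} (\<lambda>x. E x *\<^sub>R I x) = F x"
  proof (rule eventually_mono[OF eventually_at_right_real[OF zero_less_one]])
    fix x :: real assume "x \<in> {0<..<1}"
    then show "F 1 - integral {x..1} (\<lambda>x. E x *\<^sub>R I x) = F x" by (intro FE[symmetric]) auto
  qed
  ultimately have Fl: "(F \<longlongrightarrow> u0) (at_right 0)" by (rule Lim_transform_eventually)
  have El: "(E \<longlongrightarrow> E 0) (at_right 0)"
    by (rule continuous_on_Icc_tendsto_right[of 0 1, OF continuous_on_subset[OF E_cont]]) auto
  have "((\<lambda>x. (1 / E x) *\<^sub>R F x) \<longlongrightarrow> (1 / E 0) *\<^sub>R u0) (at_right 0)"
    using E_pos[of 0] by (intro tendsto_intros Fl El) auto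
  moreover have "(\<lambda>x. (1 / E x) *\<^sub>R F x) = u"
    using E_pos by (auto simp: F_def less_imp_neq[symmetric])
  moreover have "E 0 = 1" using gamma1 by (simp add: E_def y_def)
  ultimately have "(u \<longlongrightarrow> u0) (at_right 0)" by simp
  moreover have "dens u \<in> L2"
    by (rule L2_ae[OF pL]) (auto simp: ae_eq_def u_def powr_minus intro!: AE_M_pos)
  ultimately have "sol u0 j0 u J h" using h du Jeq by (simp add: sol_def)
  then show thesis using that by (simp add: u_def h_def)
qed

lemma sol_J_abs_continuous:
  assumes s: "sol u0 j0 u J h" and st: "s > 0" "s \<le> t"
  shows "abs_continuous_on_interval s t J"
proof -
  have "abs_continuous_on_interval 0 t (\<lambda>x. j0 + integral {0..x} (\<lambda>x. q *\<^sub>R h x))"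
    by (rule abs_continuous_indefinite_integral[where g = "\<lambda>x. q *\<^sub>R h x"])
       (use L2_integrable_0(1)[OF sol_L2(1)[OF s], of t] st in auto)
  from abs_continuous_on_interval_subset[OF this, of s t]
  have a: "abs_continuous_on_interval s t (\<lambda>x. j0 + integral {0..x} (\<lambda>x. q *\<^sub>R h x))" using st by simp
  show ?thesis
    by (rule abs_continuous_on_interval_dominated[OF a a, of 1 0]) (use st sol_J[OF s] in auto)
qed

lemma sol_J_derivative_AE:
  assumes s: "sol u0 j0 u J h"
  shows "negligible {x. x > 0 \<and> \<not> (J has_vector_derivative q *\<^sub>R h x) (at x)}"
proof (rule negligible_subset)
  let ?N = "\<lambda>n::nat. {x\<in>{0<..<real n}. \<not> ((\<lambda>u. integral {0..u} h) has_vector_derivative h x) (at x)}"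
  show "negligible (\<Union>n. ?N n)"
    by (intro negligible_Union_nat Lebesgue_differentiation L2_integrable_0(2)[OF sol_L2(1)[OF s]]) simp
  show "{x. x > 0 \<and> \<not> (J has_vector_derivative q *\<^sub>R h x) (at x)} \<subseteq> (\<Union>n. ?N n)"
  proof (rule subsetI, rule ccontr)
    fix x assume x: "x \<in> {x. x > 0 \<and> \<not> (J has_vector_derivative q *\<^sub>R h x) (at x)}" and nx: "x \<notin> (\<Union>n. ?N n)"
    obtain n :: nat where "x < real n" using reals_Archimedean2 by blast
    with x nx have "((\<lambda>u. integral {0..u} h) has_vector_derivative h x) (at x)" by auto
    then have "((\<lambda>u. j0 + q *\<^sub>R integral {0..u} h) has_vector_derivative q *\<^sub>R h x) (at x)"
      by (auto intro!: derivative_eq_intros bounded_linear.has_vector_derivative[OF bounded_linear_scaleR_right])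
    then have "(J has_vector_derivative q *\<^sub>R h x) (at x)"
      by (rule has_vector_derivative_transform_within_open[where S = "{0<..}"]) (use x sol_J[OF s] in auto)
    then show False using x by simp
  qed
qed

text \<open>Converse of \<open>Dmax_sol\<close>. The formula for p' is continuous, so p is
  continuously differentiable, and the a.e. derivative of \<open>J\<close> returns h. The two lemmas
  identify the maximal operator with the solutions of the system.\<close>

lemma sol_Dmax:
  assumes s: "sol u0 j0 u J h"
  defines "p \<equiv> \<lambda>x. x powr (-\<gamma>) *\<^sub>R u x"
  shows "p \<in> cev_Dmax \<mu> \<sigma> \<gamma>" "ae_eq M (cev_L \<mu> \<sigma> \<gamma> p) h"
    "\<And>x. x > 0 \<Longrightarrow> (p has_vector_derivative x powr (-\<gamma>) *\<^sub>R (J x + (c * x powr (1 - \<gamma>)) *\<^sub>R u x) + (-\<gamma> * x powr (-\<gamma> - 1)) *\<^sub>R u x) (at x)"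
proof -
  define p' where "p' = (\<lambda>x. x powr (-\<gamma>) *\<^sub>R (J x + (c * x powr (1 - \<gamma>)) *\<^sub>R u x) + (-\<gamma> * x powr (-\<gamma> - 1)) *\<^sub>R u x)"
  have dp: "(p has_vector_derivative p' x) (at x)" if x: "x > 0" for x
  proof -
    have "((\<lambda>x. x powr (-\<gamma>)) has_real_derivative -\<gamma> * x powr (-\<gamma> - 1)) (at x)"
      using x by (auto intro!: derivative_eq_intros)
    from has_vector_derivative_scaleR[OF this sol_deriv[OF s x]] show ?thesis by (simp add: p_def p'_def)
  qed
  then show "\<And>x. x > 0 \<Longrightarrow> (p has_vector_derivative x powr (-\<gamma>) *\<^sub>R (J x + (c * x powr (1 - \<gamma>)) *\<^sub>R u x) + (-\<gamma> * x powr (-\<gamma> - 1)) *\<^sub>R u x) (at x)"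
    by (simp add: p'_def)
  have D1p: "D1 p x = p' x" if "x > 0" for x using dp[OF that] by (rule vector_derivative_at)
  have Jp: "J x = x powr \<gamma> *\<^sub>R p' x + (\<gamma> * x powr (\<gamma> - 1) - c * x) *\<^sub>R p x" if x: "x > 0" for x
  proof -
    have e: "x powr \<gamma> * x powr (-\<gamma>) = 1" "x powr \<gamma> * (-\<gamma> * x powr (-\<gamma> - 1)) = - (\<gamma> / x)"
      using x by (simp_all add: powr_minus powr_diff field_simps)
    have e3: "(\<gamma> * x powr (\<gamma> - 1) - c * x) * x powr (-\<gamma>) = \<gamma> / x - c * x powr (1 - \<gamma>)"
      using x by (simp add: powr_minus powr_diff field_simps)
    have "x powr \<gamma> *\<^sub>R p' x = J x + (c * x powr (1 - \<gamma>)) *\<^sub>R u x + (- (\<gamma> / x)) *\<^sub>R u x"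
    proof -
      have "x powr \<gamma> *\<^sub>R p' x = (x powr \<gamma> * x powr (-\<gamma>)) *\<^sub>R (J x + (c * x powr (1 - \<gamma>)) *\<^sub>R u x)
          + (x powr \<gamma> * (-\<gamma> * x powr (-\<gamma> - 1))) *\<^sub>R u x"
        unfolding p'_def by (simp only: scaleR_add_right[of "x powr \<gamma>"] scaleR_scaleR)
      then show ?thesis by (simp only: e scaleR_one)
    qed
    moreover have "(\<gamma> * x powr (\<gamma> - 1) - c * x) *\<^sub>R p x = (\<gamma> / x - c * x powr (1 - \<gamma>)) *\<^sub>R u x"
      unfolding p_def scaleR_scaleR e3 ..
    ultimately show ?thesis by (simp add: scaleR_diff_left)
  qed
  have p'c: "continuous_on {0<..} p'"
    unfolding p'_def by (intro continuous_intros sol_J_cont[OF s] sol_u_cont[OF s]) auto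
  have acp: "abs_continuous_on_interval s t p" if "s > 0" for s t
    by (rule abs_continuous_on_interval_C1[of _ _ _ p'])
       (use that in \<open>auto intro: has_vector_derivative_at_within[OF dp] continuous_on_subset[OF p'c]\<close>)
  have ae: "ae_eq M (cev_L \<mu> \<sigma> \<gamma> p) h"
    unfolding ae_eq_def AE_M_negligible
  proof (rule negligible_subset[OF sol_J_derivative_AE[OF s]], rule subsetI, rule ccontr)
    fix x assume x: "x \<in> {x. x > 0 \<and> cev_L \<mu> \<sigma> \<gamma> p x \<noteq> h x}"
      and "x \<notin> {x. x > 0 \<and> \<not> (J has_vector_derivative q *\<^sub>R h x) (at x)}"
    then have "(J has_vector_derivative q *\<^sub>R h x) (at x)" by simp
    from cev_L_flux[OF dp Jp _ this] x show False by auto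
  qed
  then show "ae_eq M (cev_L \<mu> \<sigma> \<gamma> p) h" .
  have acQ: "abs_continuous_on_interval s t (\<lambda>x. cev_Q2 \<mu> \<sigma> \<gamma> x *\<^sub>R D1 p x)" if st: "s > 0" "s \<le> t" for s t
  proof -
    have a: "abs_continuous_on_interval s t (\<lambda>x. of_real (x powr \<gamma> * E x / q) * J x +
        of_real (x powr \<gamma> * E x / q * (c * x - \<gamma> * x powr (\<gamma> - 1))) * p x)"
    proof (intro abs_continuous_on_interval_add abs_continuous_on_interval_mult acp sol_J_abs_continuous[OF s] st)
      show 1: "abs_continuous_on_interval s t (\<lambda>x. complex_of_real (x powr \<gamma> * E x / q))"
        by (rule abs_continuous_of_real_C1[OF st(1), where f' =
            "\<lambda>x. (\<gamma> * x powr (\<gamma> - 1) * E x + x powr \<gamma> * (- (c * x powr (1 - \<gamma>)) * E x)) / q"])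
           (auto intro!: derivative_eq_intros E_deriv continuous_intros continuous_on_subset[OF E_cont] simp: q_pos[THEN less_imp_neq, symmetric])
      have 2: "abs_continuous_on_interval s t (\<lambda>x. complex_of_real (c * x - \<gamma> * x powr (\<gamma> - 1)))"
        by (rule abs_continuous_of_real_C1[OF st(1), where f' = "\<lambda>x. c - \<gamma> * ((\<gamma> - 1) * x powr (\<gamma> - 1 - 1))"])
           (auto intro!: derivative_eq_intros continuous_intros)
      show "abs_continuous_on_interval s t (\<lambda>x. complex_of_real (x powr \<gamma> * E x / q * (c * x - \<gamma> * x powr (\<gamma> - 1))))"
        using abs_continuous_on_interval_mult[OF 1 2] by (simp only: of_real_mult)
    qed
    show ?thesis
      by (rule abs_continuous_on_interval_dominated[OF a a, of 1 0])
         (use st Q2_flux(1)[OF _ Jp] D1p in auto)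
  qed
  show "p \<in> cev_Dmax \<mu> \<sigma> \<gamma>"
    unfolding cev_Dmax_def locally_abs_continuous_pos_def
    using sol_L2(2)[OF s] L2_ae[OF sol_L2(1)[OF s] ae_eq_sym[OF ae]] dp acp acQ
    by (auto simp: p_def[symmetric] intro: differentiableI_vector)
qed

text \<open>Any boundary condition that depends on the data (u0, j0) alone is translated to
  \<open>sol\<close>; spectrum and self-adjointness are studied in that form.\<close>

lemma restriction_iff:
  assumes B: "\<And>p u0 j0 J. p \<in> cev_Dmax \<mu> \<sigma> \<gamma> \<Longrightarrow> sol u0 j0 (\<lambda>x. x powr \<gamma> *\<^sub>R p x) J (cev_L \<mu> \<sigma> \<gamma> p) \<Longrightarrow> P p \<longleftrightarrow> B u0 j0"
  shows "(f, g) \<in> cev_restriction \<mu> \<sigma> \<gamma> {p \<in> cev_Dmax \<mu> \<sigma> \<gamma>. P p} \<longleftrightarrow>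
     (\<exists>u0 j0 u J. sol u0 j0 u J g \<and> f \<in> L2 \<and> ae_eq M f (dens u) \<and> B u0 j0)" (is "?L \<longleftrightarrow> ?R")
proof
  assume ?L
  then obtain p where f: "f \<in> L2" "g \<in> L2" and p: "p \<in> cev_Dmax \<mu> \<sigma> \<gamma>" "P p"
    "ae_eq M f p" "ae_eq M g (cev_L \<mu> \<sigma> \<gamma> p)" by (auto simp: cev_restriction_def)
  obtain u0 j0 J where s: "sol u0 j0 (\<lambda>x. x powr \<gamma> *\<^sub>R p x) J (cev_L \<mu> \<sigma> \<gamma> p)"
    using Dmax_sol[OF p(1)] .
  have "sol u0 j0 (\<lambda>x. x powr \<gamma> *\<^sub>R p x) J g" by (rule sol_cong[OF s _ ae_eq_sym[OF p(4)]]) simp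
  moreover have "ae_eq M p (\<lambda>x. x powr (-\<gamma>) *\<^sub>R (x powr \<gamma> *\<^sub>R p x))"
    by (auto simp: ae_eq_def powr_minus intro!: AE_M_pos)
  ultimately show ?R using B[OF p(1) s] p f ae_eq_trans by blast
next
  assume ?R
  then obtain u0 j0 u J where s: "sol u0 j0 u J g" and f: "f \<in> L2" "ae_eq M f (dens u)"
    and b: "B u0 j0" by blast
  define p where "p = dens u"
  note D = sol_Dmax[OF s, folded p_def]
  have "sol u0 j0 (\<lambda>x. x powr \<gamma> *\<^sub>R p x) J (cev_L \<mu> \<sigma> \<gamma> p)"
    by (rule sol_cong[OF s _ ae_eq_sym[OF D(2)]]) (simp add: p_def powr_minus)
  with B[OF D(1)] b have "P p" by blast
  then show ?L using D f sol_L2(1)[OF s] ae_eq_sym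
    unfolding cev_restriction_def p_def by blast
qed

lemma cev_max_iff:
  "(f, g) \<in> cev_max \<mu> \<sigma> \<gamma> \<longleftrightarrow>
     (\<exists>u0 j0 u J. sol u0 j0 u J g \<and> f \<in> L2 \<and> ae_eq M f (dens u))"
  using restriction_iff[of "\<lambda>_. True" "\<lambda>_ _. True" f g] by (simp add: cev_max_def)

lemma Dmax_flux:
  assumes p: "p \<in> cev_Dmax \<mu> \<sigma> \<gamma>" and s: "sol u0 j0 (\<lambda>x. x powr \<gamma> *\<^sub>R p x) J h" and x: "x > 0"
  shows "J x + (c * x powr (1 - \<gamma>)) *\<^sub>R (x powr \<gamma> *\<^sub>R p x) = (\<gamma> * x powr (\<gamma> - 1)) *\<^sub>R p x + x powr \<gamma> *\<^sub>R D1 p x"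
proof -
  have dp: "(p has_vector_derivative D1 p x) (at x)"
    using p x by (auto simp: cev_Dmax_def vector_derivative_works)
  have "((\<lambda>x. x powr \<gamma>) has_real_derivative \<gamma> * x powr (\<gamma> - 1)) (at x)"
    using x by (auto intro!: derivative_eq_intros)
  from has_vector_derivative_scaleR[OF this dp]
  have "((\<lambda>x. x powr \<gamma> *\<^sub>R p x) has_vector_derivative (\<gamma> * x powr (\<gamma> - 1)) *\<^sub>R p x + x powr \<gamma> *\<^sub>R D1 p x) (at x)"
    by (simp add: add.commute)
  then show ?thesis using sol_deriv[OF s x] vector_derivative_unique_at by blast
qed

text \<open>The first expression is u' and the second is x u' - u, both written in terms of p; these
  are the two building blocks of the boundary conditions.\<close>

lemma boundary_limits:
  assumes p: "p \<in> cev_Dmax \<mu> \<sigma> \<gamma>" and s: "sol u0 j0 (\<lambda>x. x powr \<gamma> *\<^sub>R p x) J (cev_L \<mu> \<sigma> \<gamma> p)"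
  shows "((\<lambda>x. (\<gamma> * x powr (\<gamma> - 1)) *\<^sub>R p x + x powr \<gamma> *\<^sub>R D1 p x) \<longlongrightarrow> j0) (at_right 0)"
    and "((\<lambda>x. x powr \<gamma> *\<^sub>R (x *\<^sub>R D1 p x + (\<gamma> - 1) *\<^sub>R p x)) \<longlongrightarrow> - u0) (at_right 0)"
proof -
  let ?u = "\<lambda>x. x powr \<gamma> *\<^sub>R p x"
  let ?v = "\<lambda>x. (\<gamma> * x powr (\<gamma> - 1)) *\<^sub>R p x + x powr \<gamma> *\<^sub>R D1 p x"
  note v = Dmax_flux[OF p s]
  show lim: "(?v \<longlongrightarrow> j0) (at_right 0)"
    by (rule Lim_transform_eventually[OF sol_deriv_limit[OF s]], rule eventually_mono[OF eventually_at_right_less], rule v)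
  have "((\<lambda>x. x *\<^sub>R ?v x - ?u x) \<longlongrightarrow> 0 *\<^sub>R j0 - u0) (at_right 0)"
    by (intro tendsto_intros lim sol_u0[OF s])
  then have l2: "((\<lambda>x. x *\<^sub>R ?v x - ?u x) \<longlongrightarrow> - u0) (at_right 0)" by simp
  have e2: "x *\<^sub>R ?v x - ?u x = x powr \<gamma> *\<^sub>R (x *\<^sub>R D1 p x + (\<gamma> - 1) *\<^sub>R p x)" if "x > 0" for x
  proof -
    have "x * (\<gamma> * x powr (\<gamma> - 1)) = \<gamma> * x powr \<gamma>" using that by (simp add: powr_diff)
    then have "x *\<^sub>R ((\<gamma> * x powr (\<gamma> - 1)) *\<^sub>R p x) = (\<gamma> * x powr \<gamma>) *\<^sub>R p x" by (simp only: scaleR_scaleR)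
    then show ?thesis by (simp only: scaleR_add_right) (simp add: algebra_simps)
  qed
  show "((\<lambda>x. x powr \<gamma> *\<^sub>R (x *\<^sub>R D1 p x + (\<gamma> - 1) *\<^sub>R p x)) \<longlongrightarrow> - u0) (at_right 0)"
    by (rule Lim_transform_eventually[OF l2], rule eventually_mono[OF eventually_at_right_less], rule e2)
qed

lemma tendsto_0_iff_limit:
  fixes f :: "real \<Rightarrow> complex"
  assumes "(f \<longlongrightarrow> l) (at_right 0)"
  shows "(f \<longlongrightarrow> 0) (at_right 0) \<longleftrightarrow> l = 0"
proof
  assume "(f \<longlongrightarrow> 0) (at_right 0)"
  from tendsto_unique[OF trivial_limit_at_right_real assms this] show "l = 0" .
qed (use assms in simp)

lemma cev_op_inf_iff:
  "(f, g) \<in> cev_op_inf \<mu> \<sigma> \<gamma> \<longleftrightarrow>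
     (\<exists>u0 j0 u J. sol u0 j0 u J g \<and> f \<in> L2 \<and> ae_eq M f (dens u) \<and> u0 = 0)"
  unfolding cev_op_inf_def
  by (rule restriction_iff) (use tendsto_0_iff_limit[OF boundary_limits(2)] in auto)

lemma cev_op_iff:
  "(f, g) \<in> cev_op \<mu> \<sigma> \<gamma> \<theta> \<longleftrightarrow>
     (\<exists>u0 j0 u J. sol u0 j0 u J g \<and> f \<in> L2 \<and> ae_eq M f (dens u) \<and>
        j0 + of_real (\<theta> * \<kappa> powr a * a) * u0 = 0)"
  unfolding cev_op_def
proof (rule restriction_iff)
  fix p u0 j0 J assume p: "p \<in> cev_Dmax \<mu> \<sigma> \<gamma>" and s: "sol u0 j0 (\<lambda>x. x powr \<gamma> *\<^sub>R p x) J (cev_L \<mu> \<sigma> \<gamma> p)"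
  let ?b = "\<theta> * \<bar>cev_nu \<mu> \<sigma> \<gamma>\<bar> powr (1 / (2 - \<gamma>)) / (2 - \<gamma>)\<^sup>2"
  let ?F = "\<lambda>x. (\<gamma> / (2 - \<gamma>) * x powr (\<gamma> - 1)) *\<^sub>R p x + (x powr \<gamma> / (2 - \<gamma>)) *\<^sub>R D1 p x
              - (?b * x powr \<gamma>) *\<^sub>R (x *\<^sub>R D1 p x + (\<gamma> - 1) *\<^sub>R p x)"
  have "((\<lambda>x. a *\<^sub>R ((\<gamma> * x powr (\<gamma> - 1)) *\<^sub>R p x + x powr \<gamma> *\<^sub>R D1 p x) -
      ?b *\<^sub>R (x powr \<gamma> *\<^sub>R (x *\<^sub>R D1 p x + (\<gamma> - 1) *\<^sub>R p x))) \<longlongrightarrow> a *\<^sub>R j0 - ?b *\<^sub>R (- u0)) (at_right 0)"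
    by (intro tendsto_intros boundary_limits[OF p s])
  moreover have "(\<lambda>x. a *\<^sub>R ((\<gamma> * x powr (\<gamma> - 1)) *\<^sub>R p x + x powr \<gamma> *\<^sub>R D1 p x) -
      ?b *\<^sub>R (x powr \<gamma> *\<^sub>R (x *\<^sub>R D1 p x + (\<gamma> - 1) *\<^sub>R p x))) = ?F"
    by (rule ext) (simp only: scaleR_add_right[of a] scaleR_scaleR, simp add: a_def)
  ultimately have "(?F \<longlongrightarrow> a *\<^sub>R j0 - ?b *\<^sub>R (- u0)) (at_right 0)" by simp
  \<comment> \<open>|\<nu>|^{1/(2-\<gamma>)} is \<kappa>^a and 1/(2-\<gamma>)^2 is a^2, so one
    factor a can be taken out of the whole condition.\<close>
  moreover have "a *\<^sub>R j0 - ?b *\<^sub>R (- u0) = a *\<^sub>R (j0 + of_real (\<theta> * \<kappa> powr a * a) * u0)"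
  proof -
    have "?b = a * (\<theta> * \<kappa> powr a * a)" using kappa by (simp add: nu_kappa a_def power2_eq_square)
    then show ?thesis by (simp add: scaleR_conv_of_real algebra_simps)
  qed
  ultimately show "(?F \<longlongrightarrow> 0) (at_right 0) \<longleftrightarrow> j0 + of_real (\<theta> * \<kappa> powr a * a) * u0 = 0"
    using tendsto_0_iff_limit[of ?F] a_bounds by simp
qed

end

section \<open>Behaviour at infinity and Green's formula\<close>

lemma nonneg_has_integral_Ici:
  fixes f F :: "real \<Rightarrow> real"
  assumes f: "\<And>t. t \<ge> s \<Longrightarrow> (f has_integral (F t - F s)) {s..t}" and nn: "\<And>x. x \<ge> s \<Longrightarrow> 0 \<le> f x"
    and F: "(F \<longlongrightarrow> l) at_top"
  shows "(f has_integral (l - F s)) {s..}"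
proof -
  let ?f = "\<lambda>k::nat. \<lambda>x. if x \<in> {s..s + real k} then f x else 0"
  have 1: "(?f k has_integral (F (s + real k) - F s)) {s..}" for k
    using f[of "s + real k"] by (subst has_integral_restrict) auto
  have "(\<lambda>k. F (s + real k) - F s) \<longlonglongrightarrow> l - F s"
    by (intro tendsto_intros filterlim_compose[OF F] filterlim_tendsto_add_at_top[OF tendsto_const filterlim_real_sequentially])
  then have lim: "(\<lambda>k. integral {s..} (?f k)) \<longlonglongrightarrow> l - F s" using integral_unique[OF 1] by simp
  have "f integrable_on {s..} \<and> (\<lambda>k. integral {s..} (?f k)) \<longlonglongrightarrow> integral {s..} f"
  proof (rule monotone_convergence_increasing)
    show "?f k integrable_on {s..}" for k using 1 by blast
    show "?f k x \<le> ?f (Suc k) x" if "x \<in> {s..}" for k x using nn[of x] that by auto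
    show "(\<lambda>k. ?f k x) \<longlonglongrightarrow> f x" if "x \<in> {s..}" for x
    proof (rule tendsto_eventually)
      obtain n :: nat where "x - s \<le> real n" using real_arch_simple by blast
      then show "\<forall>\<^sub>F k in sequentially. ?f k x = f x"
        unfolding eventually_sequentially using that by (intro exI[of _ n]) auto
    qed
    show "bounded (range (\<lambda>k. integral {s..} (?f k)))"
      using lim by (rule convergent_imp_bounded)
  qed
  then have "f integrable_on {s..}" "integral {s..} f = l - F s" using LIMSEQ_unique[OF lim] by auto
  then show ?thesis by (simp add: has_integral_iff)
qed

lemma integral_Ici_tendsto:
  fixes f :: "real \<Rightarrow> 'b::euclidean_space"
  assumes f: "f absolutely_integrable_on {s..}"
  shows "((\<lambda>t. integral {s..t} f) \<longlongrightarrow> integral {s..} f) at_top"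
proof -
  have "set_integrable lebesgue {s..t} f" for t by (rule set_integrable_subset[OF f]) auto
  then have "set_lebesgue_integral lebesgue {s..t} f = integral {s..t} f" for t
    by (rule set_lebesgue_integral_eq_integral(2))
  moreover have "set_lebesgue_integral lebesgue {s..} f = integral {s..} f"
    using f by (rule set_lebesgue_integral_eq_integral(2))
  moreover have "((\<lambda>t. set_lebesgue_integral lebesgue {s..t} f) \<longlongrightarrow> set_lebesgue_integral lebesgue {s..} f) at_top"
    by (rule tendsto_set_lebesgue_integral_at_top[OF _ f]) simp
  ultimately show ?thesis by simp
qed

lemma integral_Ioi_tendsto:
  fixes f :: "real \<Rightarrow> 'b::euclidean_space"
  assumes f: "f absolutely_integrable_on {0<..}"
  shows "((\<lambda>s. integral {s..} f) \<longlongrightarrow> integral {0<..} f) (at_right 0)"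
proof -
  have fs: "f absolutely_integrable_on S" if "S \<subseteq> {0<..}" "S \<in> sets lebesgue" for S
    by (rule set_integrable_subset[OF f]) (use that in auto)
  have "((\<lambda>s. set_lebesgue_integral lebesgue {s..1} f) \<longlongrightarrow> set_lebesgue_integral lebesgue {0<..1} f) (at_right 0)"
    by (rule tendsto_set_lebesgue_integral_at_right) (auto intro: fs)
  then have l: "((\<lambda>s. set_lebesgue_integral lebesgue {s..1} f + integral {1..} f) \<longlongrightarrow>
      set_lebesgue_integral lebesgue {0<..1} f + integral {1..} f) (at_right 0)"
    by (intro tendsto_intros)
  have un: "integral (A \<union> {1..}) f = set_lebesgue_integral lebesgue A f + integral {1..} f"
    if "A \<subseteq> {0<..}" "A \<in> sets lebesgue" "A \<inter> {1..} = {1}" for A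
  proof -
    have "set_lebesgue_integral lebesgue A f = integral A f"
      using fs[OF that(1,2)] by (rule set_lebesgue_integral_eq_integral(2))
    moreover have "integral (A \<union> {1..}) f = integral A f + integral {1..} f"
    proof (rule integral_Un)
      have "{1..} \<subseteq> {0::real<..}" by auto
      then show "f integrable_on {1..}" using fs[of "{1..}"] by (simp add: absolutely_integrable_on_def)
      show "f integrable_on A" using fs[OF that(1,2)] by (simp add: absolutely_integrable_on_def)
    qed (use that in simp)
    ultimately show ?thesis by simp
  qed
  have "set_lebesgue_integral lebesgue {0<..1} f + integral {1..} f = integral {0<..} f"
  proof -
    have "{0<..1} \<union> {1..} = {0::real<..}" "{0<..1} \<inter> {1..} = {1::real}" by auto
    moreover have "{0<..1} \<subseteq> {0::real<..}" by auto
    ultimately show ?thesis using un[of "{0<..1}"] by simp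
  qed
  moreover have "\<forall>\<^sub>F s in at_right 0. set_lebesgue_integral lebesgue {s..1} f + integral {1..} f = integral {s..} f"
  proof (rule eventually_mono[OF eventually_at_right_real[OF zero_less_one]])
    fix s :: real assume s: "s \<in> {0<..<1}"
    then have "{s..1} \<union> {1..} = {s..}" "{s..1} \<inter> {1..} = {1}" "{s..1} \<subseteq> {0<..}" by auto
    then show "set_lebesgue_integral lebesgue {s..1} f + integral {1..} f = integral {s..} f"
      using un[of "{s..1}"] by simp
  qed
  ultimately show ?thesis using Lim_transform_eventually[OF l] by simp
qed

context cev_parameters
begin

section \<open>Growth of square integrable solutions\<close>

text \<open>The square root of \<open>E\<close>. Square integrable right-hand sides produce fluxes
  of order e^{y/2}, so \<open>E\<close> times a flux is of order \<open>e2\<close>.\<close>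

definition e2 :: "real \<Rightarrow> real" where "e2 x = exp (- y x / 2)"

lemma e2_pos: "e2 x > 0" and e2_le1: "e2 x \<le> 1"
  and E_exp_half: "E x * exp (y x / 2) = e2 x" and exp_e2: "exp (y x) * e2 x = exp (y x / 2)"
  using y_nonneg[of x] by (auto simp: e2_def E_def simp flip: exp_add)

lemma e2_cont: "continuous_on {0..} e2"
  unfolding e2_def[abs_def] by (intro continuous_intros y_cont) auto

lemma x_le_y: "x > 0 \<Longrightarrow> x \<le> 1 + y x / \<kappa>"
proof (cases "x \<le> 1")
  case False
  then have "x powr 1 \<le> x powr (2 - \<gamma>)" using gamma1 by (intro powr_mono) auto
  then show ?thesis using False kappa by (simp add: y_def)
next
  case True
  have "0 \<le> y x / \<kappa>" using y_nonneg kappa by simp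
  then show ?thesis using True by linarith
qed

lemma y_at_top: "filterlim y at_top at_top"
proof (rule filterlim_at_top_mono)
  show "filterlim (\<lambda>x. \<kappa> * (-1 + x)) at_top at_top"
    by (intro filterlim_tendsto_pos_mult_at_top[OF tendsto_const kappa]
        filterlim_tendsto_add_at_top[OF tendsto_const filterlim_ident])
  show "\<forall>\<^sub>F x in at_top. \<kappa> * (-1 + x) \<le> y x"
  proof (rule eventually_mono[OF eventually_gt_at_top[of 0]])
    fix x :: real assume "x > 0"
    from x_le_y[OF this] have "-1 + x \<le> y x / \<kappa>" by simp
    then show "\<kappa> * (-1 + x) \<le> y x" using kappa by (simp add: field_simps)
  qed
qed

lemma powr_exp_half_has_integral:
  assumes "0 < s" "s \<le> t" and k: "k \<noteq> 0"
  shows "((\<lambda>x. x powr (1 - \<gamma>) * exp (k * y x)) has_integral (exp (k * y t) / (c * k) - exp (k * y s) / (c * k))) {s..t}"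
proof (rule fundamental_theorem_of_calculus[OF assms(2)])
  fix x assume "x \<in> {s..t}"
  then have "x > 0" using assms by simp
  then have "((\<lambda>x. exp (k * y x) / (c * k)) has_real_derivative x powr (1 - \<gamma>) * exp (k * y x)) (at x)"
    using k c_pos by (auto intro!: derivative_eq_intros y_deriv)
  then show "((\<lambda>x. exp (k * y x) / (c * k)) has_vector_derivative x powr (1 - \<gamma>) * exp (k * y x)) (at x within {s..t})"
    unfolding has_real_derivative_iff_has_vector_derivative by (rule has_vector_derivative_at_within)
qed

text \<open>x^{1-\<gamma>} \<open>e2\<close> is an exact derivative up to a constant; inserting
  x^{1-\<gamma>} costs s^{\<gamma>-1}. This factor is the gain that later makes Wronskians vanish at
  infinity.\<close>

lemma e2_integrable:
  assumes s: "s > 0"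
  shows "e2 integrable_on {s..}" "integral {s..} e2 \<le> 2 / c * s powr (\<gamma> - 1) * e2 s"
proof -
  have "((\<lambda>x. x powr (1 - \<gamma>) * exp (- (1/2) * y x)) has_integral (0 - exp (- (1/2) * y s) / (c * - (1/2)))) {s..}"
  proof (rule nonneg_has_integral_Ici)
    show "((\<lambda>x. x powr (1 - \<gamma>) * exp (- (1/2) * y x)) has_integral (exp (- (1/2) * y t) / (c * - (1/2)) - exp (- (1/2) * y s) / (c * - (1/2)))) {s..t}"
      if "s \<le> t" for t using powr_exp_half_has_integral[OF s that, of "- (1/2)"] by simp
    have "((\<lambda>t. exp (- (1/2) * y t) / (c * - (1/2))) \<longlongrightarrow> 0 / (c * - (1/2))) at_top"
      using c_pos by (intro tendsto_divide tendsto_const filterlim_compose[OF exp_at_bot]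
          filterlim_tendsto_neg_mult_at_bot[OF tendsto_const _ y_at_top]) auto
    then show "((\<lambda>t. exp (- (1/2) * y t) / (c * - (1/2))) \<longlongrightarrow> 0) at_top" by simp
  qed simp
  then have I: "((\<lambda>x. x powr (1 - \<gamma>) * e2 x) has_integral 2 / c * e2 s) {s..}"
    using c_pos by (simp add: e2_def field_simps)
  then have I2: "((\<lambda>x. s powr (\<gamma> - 1) * (x powr (1 - \<gamma>) * e2 x)) has_integral s powr (\<gamma> - 1) * (2 / c * e2 s)) {s..}"
    by (rule has_integral_mult_right)
  have le: "e2 x \<le> s powr (\<gamma> - 1) * (x powr (1 - \<gamma>) * e2 x)" if "x \<in> {s..}" for x
  proof -
    have "s powr (\<gamma> - 1) * s powr (1 - \<gamma>) \<le> s powr (\<gamma> - 1) * x powr (1 - \<gamma>)"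
      using that s gamma1 by (intro mult_left_mono powr_mono2) auto
    moreover have "s powr (\<gamma> - 1) * s powr (1 - \<gamma>) = 1" using s by (simp flip: powr_add)
    ultimately show ?thesis using e2_pos[of x] by (simp add: mult.assoc[symmetric])
  qed
  have "e2 \<in> borel_measurable (lebesgue_on {s..})"
    using s by (intro continuous_imp_measurable_on_sets_lebesgue continuous_on_subset[OF e2_cont]) auto
  then show i: "e2 integrable_on {s..}"
    by (rule measurable_bounded_by_integrable_imp_integrable[OF _ has_integral_integrable[OF I2]])
       (use le e2_pos in \<open>auto simp: less_imp_le\<close>)
  show "integral {s..} e2 \<le> 2 / c * s powr (\<gamma> - 1) * e2 s"
    using has_integral_le[OF integrable_integral[OF i] I2 le] by (simp add: mult_ac)
qed

lemma weight_e2_integrable: "(\<lambda>x. x powr (-\<gamma>) * e2 x) integrable_on {0<..}"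
proof -
  let ?f = "\<lambda>x. x powr (-\<gamma>) * e2 x"
  have m: "?f \<in> borel_measurable (lebesgue_on S)" if "S \<subseteq> {0<..}" "S \<in> sets lebesgue" for S
    using that by (intro continuous_imp_measurable_on_sets_lebesgue continuous_intros continuous_on_subset[OF e2_cont]) auto
  have "(\<lambda>x. x powr (-\<gamma>)) absolutely_integrable_on {0..1}"
    using integrable_on_powr_from_0[of "-\<gamma>" 1] gamma1 by (intro nonnegative_absolutely_integrable_1) auto
  then have "(\<lambda>x. x powr (-\<gamma>)) absolutely_integrable_on {0<..1}" by (rule set_integrable_subset) auto
  then have pi: "(\<lambda>x. x powr (-\<gamma>)) integrable_on {0<..1}" by (simp add: absolutely_integrable_on_def)
  have 1: "?f integrable_on {0<..1}"
    by (rule measurable_bounded_by_integrable_imp_integrable[OF m[OF _ _] pi])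
       (auto simp: e2_pos less_imp_le intro!: mult_left_le e2_le1)
  have 2: "?f integrable_on {1..}"
  proof (rule measurable_bounded_by_integrable_imp_integrable[OF m[OF _ _] e2_integrable(1)[OF zero_less_one]])
    fix x :: real assume "x \<in> {1..}"
    then have "x powr (-\<gamma>) \<le> 1 powr (-\<gamma>)" using gamma0 by (intro powr_mono2') auto
    then show "norm (x powr (-\<gamma>) * e2 x) \<le> e2 x"
      using e2_pos[of x] by (simp add: mult_left_le_one_le)
  qed auto
  have "{0<..1} \<inter> {1..} = {1::real}" by auto
  then have "negligible ({0<..1} \<inter> {1::real..})" by simp
  from integrable_Un[OF this 1 2] have "?f integrable_on {0<..1} \<union> {1..}" .
  moreover have "{0<..1} \<union> {1..} = {0::real<..}" by auto
  ultimately show ?thesis by simp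
qed

lemma w_norm_sq: "x > 0 \<Longrightarrow> w x * (cmod (x powr (-\<gamma>) *\<^sub>R z))\<^sup>2 = x powr (-\<gamma>) * E x * (cmod z)\<^sup>2"
  by (simp add: w_eq power_mult_distrib powr_minus power2_eq_square)

text \<open>The square of e^{y/4} times \<open>E\<close> is \<open>e2\<close>, which is integrable
  against x^{-\<gamma>}.\<close>

lemma L2_subexponential:
  assumes u: "continuous_on {0<..} u" and le: "\<And>x. x > 0 \<Longrightarrow> cmod (u x) \<le> C * exp (y x / 4)"
  shows "dens u \<in> L2"
proof (rule L2_bound(1))
  show "dens u \<in> borel_measurable (lebesgue_on {0<..})"
    by (intro continuous_imp_measurable_on_sets_lebesgue continuous_intros u) auto
  show "(\<lambda>x. C\<^sup>2 * (x powr (-\<gamma>) * e2 x)) integrable_on {0<..}"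
    by (intro integrable_on_mult_right weight_e2_integrable)
  fix x :: real assume x: "x > 0"
  have "(cmod (u x))\<^sup>2 \<le> (C * exp (y x / 4))\<^sup>2" using le[OF x] by (intro power_mono) auto
  also have "\<dots> = C\<^sup>2 * exp (y x / 2)" by (simp add: power_mult_distrib power2_eq_square flip: exp_add)
  finally have "x powr (-\<gamma>) * E x * (cmod (u x))\<^sup>2 \<le> x powr (-\<gamma>) * E x * (C\<^sup>2 * exp (y x / 2))"
    using E_pos[of x] by (intro mult_left_mono) (auto simp: less_imp_le)
  also have "\<dots> = C\<^sup>2 * (x powr (-\<gamma>) * (E x * exp (y x / 2)))" by (simp add: mult_ac)
  finally show "w x * (cmod (x powr (-\<gamma>) *\<^sub>R u x))\<^sup>2 \<le> C\<^sup>2 * (x powr (-\<gamma>) * e2 x)"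
    using x by (simp only: w_norm_sq E_exp_half)
qed

text \<open>The affine function \<alpha> + x \<beta> has the prescribed value and slope at 0;
  \<open>J\<close> and \<open>h\<close> are then forced by the system and are elementary. All
  boundary data occur, which is what makes 0 limit circle.\<close>

lemma sol_exists_data: "\<exists>u J h. sol \<alpha> \<beta> u J h"
proof -
  have lin: "(\<lambda>x. x powr (-\<gamma>) *\<^sub>R (A + x *\<^sub>R B)) \<in> L2" for A B :: complex
  proof (rule L2_subexponential)
    show "continuous_on {0<..} (\<lambda>x. A + x *\<^sub>R B)" by (intro continuous_intros)
    fix x :: real assume x: "x > 0"
    have "y x / 4 + 1 \<le> exp (y x / 4)" using exp_ge_add_one_self[of "y x / 4"] by linarith
    then have "1 + y x / \<kappa> \<le> (1 + 4 / \<kappa>) * exp (y x / 4)"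
    proof -
      assume e: "y x / 4 + 1 \<le> exp (y x / 4)"
      have "1 \<le> exp (y x / 4)" using y_nonneg[of x] by simp
      moreover have "y x / \<kappa> \<le> 4 / \<kappa> * exp (y x / 4)" using e kappa by (simp add: field_simps)
      ultimately have "1 + y x / \<kappa> \<le> exp (y x / 4) + 4 / \<kappa> * exp (y x / 4)" by (rule add_mono)
      then show ?thesis by (simp add: distrib_right)
    qed
    then have xe: "x \<le> (1 + 4 / \<kappa>) * exp (y x / 4)" using x_le_y[OF x] by simp
    have "cmod (A + x *\<^sub>R B) \<le> cmod A + x * cmod B"
      using x norm_triangle_ineq[of A "x *\<^sub>R B"] by simp
    also have "\<dots> \<le> cmod A * exp (y x / 4) + ((1 + 4 / \<kappa>) * exp (y x / 4)) * cmod B"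
      using y_nonneg[of x] by (intro add_mono mult_right_mono xe) (auto simp: mult_le_cancel_left1)
    finally show "cmod (A + x *\<^sub>R B) \<le> (cmod A + (1 + 4 / \<kappa>) * cmod B) * exp (y x / 4)"
      by (simp add: algebra_simps)
  qed
  define u where "u = (\<lambda>x::real. \<alpha> + x *\<^sub>R \<beta>)"
  define J where "J = (\<lambda>x::real. \<beta> - (c * x powr (1 - \<gamma>)) *\<^sub>R u x)"
  define h where "h = (\<lambda>x. x powr (-\<gamma>) *\<^sub>R ((- (c / q) * (1 - \<gamma>)) *\<^sub>R \<alpha> + x *\<^sub>R ((- (c / q) * (2 - \<gamma>)) *\<^sub>R \<beta>)))"
  have du: "(u has_vector_derivative \<beta>) (at x)" for x
    unfolding u_def by (auto intro!: derivative_eq_intros)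
  have dJ: "(J has_vector_derivative q *\<^sub>R h x) (at x)" if x: "x > 0" for x
  proof -
    have "((\<lambda>x. c * x powr (1 - \<gamma>)) has_real_derivative c * ((1 - \<gamma>) * x powr (-\<gamma>))) (at x)"
      using x by (auto intro!: derivative_eq_intros)
    from has_vector_derivative_diff[OF has_vector_derivative_const has_vector_derivative_scaleR[OF this du], of \<beta>]
    have "(J has_vector_derivative - ((c * x powr (1 - \<gamma>)) *\<^sub>R \<beta> + (c * ((1 - \<gamma>) * x powr (-\<gamma>))) *\<^sub>R u x)) (at x)"
      by (simp add: J_def)
    moreover have "q *\<^sub>R h x = - ((c * x powr (1 - \<gamma>)) *\<^sub>R \<beta> + (c * ((1 - \<gamma>) * x powr (-\<gamma>))) *\<^sub>R u x)"
    proof -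
      have e: "x powr (1 - \<gamma>) = x powr (-\<gamma>) * x" using x by (simp add: powr_diff powr_minus field_simps)
      have "q *\<^sub>R (X *\<^sub>R ((- k * (1 - \<gamma>)) *\<^sub>R \<alpha> + x *\<^sub>R ((- k * (2 - \<gamma>)) *\<^sub>R \<beta>))) =
          - ((q * k * (X * x)) *\<^sub>R \<beta> + (q * k * ((1 - \<gamma>) * X)) *\<^sub>R (\<alpha> + x *\<^sub>R \<beta>))" for X k
        by (simp add: scaleR_conv_of_real algebra_simps)
      from this[of "x powr (-\<gamma>)" "c / q"] show ?thesis
        using q_pos unfolding h_def u_def e by simp
    qed
    ultimately show ?thesis by simp
  qed
  have hL: "h \<in> L2" unfolding h_def by (rule lin)
  have "sol \<alpha> \<beta> u J h"
    unfolding sol_def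
  proof (intro conjI allI impI)
    show "h \<in> L2" by (rule hL)
    show "dens u \<in> L2" unfolding u_def by (rule lin)
    have "(u \<longlongrightarrow> u 0) (at_right 0)"
      by (rule continuous_on_Icc_tendsto_right[of 0 1]) (auto simp: u_def intro!: continuous_intros)
    then show "(u \<longlongrightarrow> \<alpha>) (at_right 0)" by (simp add: u_def)
    fix x :: real assume x: "x > 0"
    show "(u has_vector_derivative J x + (c * x powr (1 - \<gamma>)) *\<^sub>R u x) (at x)" using du by (simp add: J_def)
    have "((\<lambda>x. q *\<^sub>R h x) has_integral (J x - J 0)) {0..x}"
    proof (rule fundamental_theorem_of_calculus_interior)
      show "continuous_on {0..x} J" unfolding J_def u_def using gamma1 by (auto intro!: continuous_intros continuous_on_powr')
    qed (use x dJ in auto)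
    moreover have "J 0 = \<beta>" using gamma1 by (simp add: J_def)
    ultimately show "J x = \<beta> + q *\<^sub>R integral {0..x} h"
      using integral_unique[of "\<lambda>x. q *\<^sub>R h x"] by fastforce
  qed
  then show ?thesis by blast
qed

text \<open>Beyond 1, 1/w is at most x^{1-\<gamma>} e^y, which has the primitive e^y/c; up to 1 the
  integral is bounded. By Cauchy-Schwarz the integral of a square integrable function is then of
  order e^{y/2}.\<close>

lemma inv_w_bound: "\<exists>C>0. \<forall>t\<ge>0. integral {0..t} (\<lambda>x. 1 / w x) \<le> C * exp (y t)"
proof -
  define K where "K = integral {0..1} (\<lambda>x. 1 / w x)"
  have K: "K \<ge> 0" unfolding K_def by (rule integral_nonneg[OF inv_w_integrable]) (auto simp: w_nonneg)
  have e1: "1 \<le> exp (y t)" for t using y_nonneg[of t] by simp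
  have le1: "integral {0..t} (\<lambda>x. 1 / w x) \<le> K" if "0 \<le> t" "t \<le> 1" for t
    unfolding K_def by (rule integral_subset_le) (use that inv_w_integrable w_nonneg in auto)
  have "integral {0..t} (\<lambda>x. 1 / w x) \<le> (K + 1 / c) * exp (y t)" if t: "t \<ge> 0" for t
  proof (cases "t \<le> 1")
    case True
    have "K * 1 \<le> (K + 1 / c) * exp (y t)" using K c_pos e1[of t] by (intro mult_mono) auto
    then show ?thesis using le1[OF t True] by simp
  next
    case False
    have I: "((\<lambda>x. x powr (1 - \<gamma>) * exp (1 * y x)) has_integral (exp (1 * y t) / (c * 1) - exp (1 * y 1) / (c * 1))) {1..t}"
      by (rule powr_exp_half_has_integral) (use False in auto)
    have "integral {1..t} (\<lambda>x. 1 / w x) \<le> exp (1 * y t) / (c * 1) - exp (1 * y 1) / (c * 1)"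
    proof (rule has_integral_le[OF integrable_integral I])
      show "(\<lambda>x. 1 / w x) integrable_on {1..t}"
        by (rule integrable_subinterval_real[OF inv_w_integrable[OF t]]) auto
      fix x assume x: "x \<in> {1..t}"
      then have "x powr (-\<gamma>) \<le> x powr (1 - \<gamma>)" by (intro powr_mono) auto
      then show "1 / w x \<le> x powr (1 - \<gamma>) * exp (1 * y x)"
        using x by (simp add: w_eq E_def powr_minus exp_minus field_simps)
    qed
    also have "\<dots> \<le> 1 / c * exp (y t)" using c_pos by simp
    finally have "integral {1..t} (\<lambda>x. 1 / w x) \<le> 1 / c * exp (y t)" .
    moreover have "integral {0..t} (\<lambda>x. 1 / w x) = K + integral {1..t} (\<lambda>x. 1 / w x)"
      unfolding K_def by (rule Henstock_Kurzweil_Integration.integral_combine[symmetric]) (use False inv_w_integrable[OF t] in auto)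
    moreover have "K * 1 \<le> K * exp (y t)" using K e1 by (intro mult_left_mono) auto
    ultimately show ?thesis by (simp add: distrib_right)
  qed
  then show ?thesis using K c_pos by (intro exI[of _ "K + 1 / c"]) (auto intro: add_nonneg_pos)
qed

definition "Cw = (SOME C. C > 0 \<and> (\<forall>t\<ge>0. integral {0..t} (\<lambda>x. 1 / w x) \<le> C * exp (y t)))"

lemma Cw: "Cw > 0" "t \<ge> 0 \<Longrightarrow> integral {0..t} (\<lambda>x. 1 / w x) \<le> Cw * exp (y t)"
  using someI_ex[OF inv_w_bound] unfolding Cw_def by blast+

lemma L2_integral_bound:
  assumes h: "h \<in> L2" and st: "0 \<le> s" "s \<le> t"
  shows "integral {s..t} (\<lambda>x. cmod (h x)) \<le> L2_norm M h * sqrt Cw * exp (y t / 2)"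
    "cmod (integral {s..t} h) \<le> L2_norm M h * sqrt Cw * exp (y t / 2)"
proof -
  have hi: "h absolutely_integrable_on {0..t}" using st by (intro L2_integrable_0[OF h]) auto
  have "integral {s..t} (\<lambda>x. cmod (h x)) \<le> integral {0..t} (\<lambda>x. cmod (h x))"
    by (rule integral_subset_le)
       (use st hi in \<open>auto simp: absolutely_integrable_on_def intro: integrable_subinterval_real\<close>)
  also have "\<dots> \<le> L2_norm M h * sqrt (integral {0..t} (\<lambda>x. 1 / w x))"
    using st by (intro L2_imp_integrable_Icc(2)[OF h] inv_w_integrable) auto
  also have "\<dots> \<le> L2_norm M h * sqrt (Cw * exp (y t))"
    using st Cw by (intro mult_left_mono real_sqrt_le_mono) (auto simp: L2_norm_nonneg)
  also have "sqrt (Cw * exp (y t)) = sqrt Cw * exp (y t / 2)"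
    by (simp add: real_sqrt_mult exp_half_le2 real_sqrt_unique power2_eq_square flip: exp_add)
  finally show *: "integral {s..t} (\<lambda>x. cmod (h x)) \<le> L2_norm M h * sqrt Cw * exp (y t / 2)" by (simp add: mult.assoc)
  have "h absolutely_integrable_on {s..t}" by (rule set_integrable_subset[OF hi]) (use st in auto)
  then have "cmod (integral {s..t} h) \<le> integral {s..t} (\<lambda>x. cmod (h x))"
    by (intro integral_norm_bound_integral) (auto simp: absolutely_integrable_on_def)
  with * show "cmod (integral {s..t} h) \<le> L2_norm M h * sqrt Cw * exp (y t / 2)" by simp
qed

lemma sol_flux_bound:
  assumes s: "sol u0 j0 u J h" and x: "x > 0"
  shows "cmod (J x) \<le> (cmod j0 + q * (L2_norm M h * sqrt Cw)) * exp (y x / 2)"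
proof -
  have "cmod (J x) \<le> cmod j0 + q * cmod (integral {0..x} h)"
    using sol_J[OF s x] norm_triangle_ineq[of j0 "q *\<^sub>R integral {0..x} h"] q_pos by simp
  also have "\<dots> \<le> cmod j0 * exp (y x / 2) + q * (L2_norm M h * sqrt Cw * exp (y x / 2))"
    using x q_pos y_nonneg[of x] by (intro add_mono mult_left_mono L2_integral_bound(2)[OF sol_L2(1)[OF s]])
      (auto simp: mult_le_cancel_left1)
  finally show ?thesis by (simp add: algebra_simps)
qed

lemma flux_tail:
  fixes J :: "real \<Rightarrow> complex"
  assumes J: "continuous_on {s..} J" and b: "\<And>x. x \<ge> s \<Longrightarrow> cmod (J x) \<le> K * exp (y x / 2)" and s: "s > 0"
  shows "(\<lambda>x. E x *\<^sub>R J x) absolutely_integrable_on {s..}"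
    "cmod (integral {s..} (\<lambda>x. E x *\<^sub>R J x)) \<le> K * (2 / c * s powr (\<gamma> - 1) * e2 s)"
    "K \<ge> 0"
proof -
  have le: "norm (E x *\<^sub>R J x) \<le> K * e2 x" if "x \<in> {s..}" for x
  proof -
    have "E x * cmod (J x) \<le> E x * (K * exp (y x / 2))"
      using b[of x] that E_pos[of x] by (intro mult_left_mono) auto
    also have "\<dots> = K * (E x * exp (y x / 2))" by simp
    finally show ?thesis using E_pos[of x] by (simp add: E_exp_half)
  qed
  have K: "K \<ge> 0" using le[of s] e2_pos[of s] by (smt (verit) atLeast_iff norm_ge_zero zero_le_mult_iff order_refl)
  then show "K \<ge> 0" .
  have m: "(\<lambda>x. E x *\<^sub>R J x) \<in> borel_measurable (lebesgue_on {s..})"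
    using s by (intro continuous_imp_measurable_on_sets_lebesgue continuous_intros J continuous_on_subset[OF E_cont]) auto
  have i: "(\<lambda>x. K * e2 x) integrable_on {s..}" using e2_integrable(1)[OF s] by (rule integrable_on_mult_right)
  show ai: "(\<lambda>x. E x *\<^sub>R J x) absolutely_integrable_on {s..}"
    by (rule measurable_bounded_by_integrable_imp_absolutely_integrable[OF m _ i le]) simp_all
  have "cmod (integral {s..} (\<lambda>x. E x *\<^sub>R J x)) \<le> integral {s..} (\<lambda>x. K * e2 x)"
    using ai i le by (intro integral_norm_bound_integral) (auto simp: absolutely_integrable_on_def)
  also have "\<dots> = K * integral {s..} e2" by simp
  also have "\<dots> \<le> K * (2 / c * s powr (\<gamma> - 1) * e2 s)" using e2_integrable(2)[OF s] K by (rule mult_left_mono)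
  finally show "cmod (integral {s..} (\<lambda>x. E x *\<^sub>R J x)) \<le> K * (2 / c * s powr (\<gamma> - 1) * e2 s)" .
qed

lemma sol_Eu_deriv:
  assumes s: "sol u0 j0 u J h" and x: "x > 0"
  shows "((\<lambda>x. E x *\<^sub>R u x) has_vector_derivative E x *\<^sub>R J x) (at x)"
  using has_vector_derivative_scaleR[OF E_deriv[OF x] sol_deriv[OF s x]] by (simp add: algebra_simps)

text \<open>w |p|^2 equals x^{-\<gamma>} e^y |E u|^2, so this bound makes w |p|^2 nonintegrable as
  soon as |E u| stays away from 0. It uses y \<le> e^y and that x^{2-2\<gamma>} \<ge> 1.\<close>

lemma weight_lower_bound: "x \<ge> 1 \<Longrightarrow> \<kappa> \<le> x powr (-\<gamma>) * exp (y x)"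
proof -
  assume x: "x \<ge> 1"
  have "\<kappa> * 1 \<le> \<kappa> * x powr (2 - 2 * \<gamma>)" using x kappa gamma1 by (intro mult_left_mono ge_one_powr_ge_zero) auto
  also have "x powr (2 - 2 * \<gamma>) = x powr (-\<gamma>) * x powr (2 - \<gamma>)" using x by (simp flip: powr_add)
  also have "\<kappa> * (x powr (-\<gamma>) * x powr (2 - \<gamma>)) = x powr (-\<gamma>) * y x" by (simp add: y_def)
  also have "\<dots> \<le> x powr (-\<gamma>) * exp (y x)"
  proof (rule mult_left_mono)
    show "y x \<le> exp (y x)" using exp_ge_add_one_self[of "y x"] by linarith
  qed simp
  finally show ?thesis by simp
qed

text \<open>Square integrability at infinity forces \<open>E u \<rightarrow> 0\<close>: otherwise \<open>w |p|\<^sup>2\<close> stays bounded below.\<close>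

lemma sol_tail:
  assumes s: "sol u0 j0 u J h" and x: "x > 0"
  shows "E x *\<^sub>R u x = - integral {x..} (\<lambda>x. E x *\<^sub>R J x)"
proof -
  define K where "K = cmod j0 + q * (L2_norm M h * sqrt Cw)"
  have Jc: "continuous_on {t..} J" if "t > 0" for t
    using that by (intro continuous_on_subset[OF sol_J_cont(1)[OF s]]) auto
  have ai: "(\<lambda>x. E x *\<^sub>R J x) absolutely_integrable_on {x..}"
    by (rule flux_tail(1)[OF Jc _ x, of K]) (use x sol_flux_bound[OF s] in \<open>auto simp: K_def\<close>)
  define l where "l = E x *\<^sub>R u x + integral {x..} (\<lambda>x. E x *\<^sub>R J x)"
  have "((\<lambda>t. E x *\<^sub>R u x + integral {x..t} (\<lambda>x. E x *\<^sub>R J x)) \<longlongrightarrow> l) at_top"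
    unfolding l_def by (intro tendsto_intros integral_Ici_tendsto ai)
  moreover have "\<forall>\<^sub>F t in at_top. E x *\<^sub>R u x + integral {x..t} (\<lambda>x. E x *\<^sub>R J x) = E t *\<^sub>R u t"
  proof (rule eventually_mono[OF eventually_ge_at_top[of x]])
    fix t assume t: "x \<le> t"
    have "((\<lambda>x. E x *\<^sub>R J x) has_integral (E t *\<^sub>R u t - E x *\<^sub>R u x)) {x..t}"
      by (rule fundamental_theorem_of_calculus[OF t]) (use x in \<open>auto intro: has_vector_derivative_at_within[OF sol_Eu_deriv[OF s]]\<close>)
    then show "E x *\<^sub>R u x + integral {x..t} (\<lambda>x. E x *\<^sub>R J x) = E t *\<^sub>R u t" by (simp add: integral_unique)
  qed
  ultimately have lim: "((\<lambda>t. E t *\<^sub>R u t) \<longlongrightarrow> l) at_top" by (rule Lim_transform_eventually)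
  have "l = 0"
  proof (rule ccontr)
    assume l: "l \<noteq> 0"
    have "\<forall>\<^sub>F t in at_top. cmod (E t *\<^sub>R u t) > cmod l / 2"
      using tendsto_norm[OF lim] l by (intro order_tendstoD(1)) auto
    then obtain X where X: "\<And>t. t \<ge> X \<Longrightarrow> cmod (E t *\<^sub>R u t) > cmod l / 2"
      by (auto simp: eventually_at_top_linorder)
    define b where "b = \<kappa> * (cmod l / 2)\<^sup>2"
    have b: "b > 0" using kappa l by (simp add: b_def)
    define Y where "Y = max 1 X"
    have le: "b \<le> w t * (cmod (t powr (-\<gamma>) *\<^sub>R u t))\<^sup>2" if t: "t \<ge> Y" for t
    proof -
      have t0: "t > 0" "t \<ge> 1" "t \<ge> X" using t by (auto simp: Y_def)
      have "b \<le> (t powr (-\<gamma>) * exp (y t)) * (cmod (E t *\<^sub>R u t))\<^sup>2"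
        unfolding b_def using X[OF t0(3)] weight_lower_bound[OF t0(2)] kappa by (intro mult_mono power_mono) auto
      also have "\<dots> = t powr (-\<gamma>) * (exp (y t) * E t) * E t * (cmod (u t))\<^sup>2"
        using E_pos[of t] by (simp add: power_mult_distrib power2_eq_square)
      also have "exp (y t) * E t = 1" by (simp add: E_def flip: exp_add)
      finally show ?thesis by (simp only: w_norm_sq[OF t0(1)] mult_1_right)
    qed
    let ?F = "\<lambda>t. w t * (cmod (t powr (-\<gamma>) *\<^sub>R u t))\<^sup>2"
    have Fi: "?F integrable_on {0<..}" using sol_L2(2)[OF s] by (simp add: L2_iff)
    have "b * real n \<le> integral {0<..} ?F" for n :: nat
    proof -
      have sub: "{Y..Y + real n} \<subseteq> {0<..}" by (auto simp: Y_def)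
      have Fa: "?F absolutely_integrable_on {0<..}" using Fi w_nonneg by (intro nonnegative_absolutely_integrable_1) auto
      have Fn: "?F integrable_on {Y..Y + real n}"
        using set_integrable_subset[OF Fa _ sub] by (simp add: absolutely_integrable_on_def)
      have "integral {Y..Y + real n} (\<lambda>_. b) \<le> integral {Y..Y + real n} ?F"
        by (rule integral_le[OF _ Fn]) (use le in auto)
      also have "\<dots> \<le> integral {0<..} ?F" by (rule integral_subset_le[OF sub Fn Fi]) (simp add: w_nonneg)
      finally show ?thesis by (simp add: mult.commute)
    qed
    moreover obtain n :: nat where "integral {0<..} ?F / b < real n" using reals_Archimedean2 by blast
    ultimately show False using b by (smt (verit) mult.commute pos_divide_less_eq)
  qed
  then show ?thesis unfolding l_def by (simp add: eq_neg_iff_add_eq_0)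
qed

text \<open>Since E u is a tail integral of E J, the function u grows more slowly than
  \<open>J\<close> by the factor x^{\<gamma>-1}.\<close>

lemma sol_u_bound:
  assumes s: "sol u0 j0 u J h" and x: "x > 0"
  shows "cmod (u x) \<le> (cmod j0 + q * (L2_norm M h * sqrt Cw)) * (2 / c) * x powr (\<gamma> - 1) * exp (y x / 2)"
proof -
  define K where "K = cmod j0 + q * (L2_norm M h * sqrt Cw)"
  have Jc: "continuous_on {x..} J" using x by (intro continuous_on_subset[OF sol_J_cont(1)[OF s]]) auto
  have "E x * cmod (u x) = cmod (E x *\<^sub>R u x)" using E_pos[of x] by simp
  also have "\<dots> = cmod (integral {x..} (\<lambda>x. E x *\<^sub>R J x))" by (simp only: sol_tail[OF s x] norm_minus_cancel)
  also have "\<dots> \<le> K * (2 / c * x powr (\<gamma> - 1) * e2 x)"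
    using sol_flux_bound[OF s] x by (intro flux_tail(2)[OF Jc _ x]) (auto simp: K_def)
  finally have "E x * cmod (u x) \<le> K * (2 / c * x powr (\<gamma> - 1) * e2 x)" .
  then have "exp (y x) * (E x * cmod (u x)) \<le> exp (y x) * (K * (2 / c * x powr (\<gamma> - 1) * e2 x))"
    by (intro mult_left_mono) auto
  moreover have "exp (y x) * (E x * cmod (u x)) = cmod (u x)" by (simp add: E_def flip: mult.assoc exp_add)
  moreover have "exp (y x) * (K * (2 / c * x powr (\<gamma> - 1) * e2 x)) = K * (2 / c) * x powr (\<gamma> - 1) * (exp (y x) * e2 x)" by simp
  ultimately show ?thesis by (simp only: exp_e2 K_def)
qed

text \<open>The exponential growth of a product u J' is cancelled exactly by \<open>E\<close>; the
  factor x^{\<gamma>-1} from \<open>sol_u_bound\<close> remains and tends to 0.\<close>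

lemma sol_Wronskian_at_top:
  assumes s: "sol u0 j0 u J h" and s': "sol u0' j0' u' J' h'"
  shows "((\<lambda>x. E x *\<^sub>R (u x * J' x - J x * u' x)) \<longlongrightarrow> 0) at_top"
proof -
  have one: "((\<lambda>x. E x *\<^sub>R (u x * J' x)) \<longlongrightarrow> 0) at_top"
    if s: "sol u0 j0 u J h" and s': "sol u0' j0' u' J' h'" for u0 j0 u J h u0' j0' u' J' h'
  proof (rule Lim_null_comparison)
    let ?K = "(cmod j0 + q * (L2_norm M h * sqrt Cw)) * (2 / c)"
    let ?K' = "cmod j0' + q * (L2_norm M h' * sqrt Cw)"
    show "\<forall>\<^sub>F x in at_top. norm (E x *\<^sub>R (u x * J' x)) \<le> (?K * ?K') * x powr (\<gamma> - 1)"
    proof (rule eventually_mono[OF eventually_gt_at_top[of 0]])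
      fix x :: real assume x: "x > 0"
      have "E x * (cmod (u x) * cmod (J' x)) \<le> E x * ((?K * x powr (\<gamma> - 1) * exp (y x / 2)) * (?K' * exp (y x / 2)))"
        using sol_u_bound[OF s x] sol_flux_bound[OF s' x] E_pos[of x]
        by (intro mult_left_mono mult_mono) (auto intro: order_trans[OF norm_ge_zero])
      also have "\<dots> = (?K * ?K') * x powr (\<gamma> - 1) * (E x * (exp (y x / 2) * exp (y x / 2)))" by (simp only: mult_ac)
      also have "E x * (exp (y x / 2) * exp (y x / 2)) = 1" by (simp add: E_def flip: exp_add)
      finally show "norm (E x *\<^sub>R (u x * J' x)) \<le> (?K * ?K') * x powr (\<gamma> - 1)"
        using E_pos[of x] by (simp add: norm_mult)
    qed
    have "((\<lambda>x. x powr (\<gamma> - 1)) \<longlongrightarrow> 0) at_top"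
      using gamma1 by (intro tendsto_neg_powr filterlim_ident) auto
    then show "((\<lambda>x. (?K * ?K') * x powr (\<gamma> - 1)) \<longlongrightarrow> 0) at_top" by (rule tendsto_mult_right_zero)
  qed
  show ?thesis
    using tendsto_diff[OF one[OF s s'] one[OF s' s]] by (simp add: scaleR_diff_right mult.commute)
qed

section \<open>Wronskians, classification of the endpoints and Green's formula\<close>

text \<open>The multiples of f and g by which the fluxes differ from x^\<gamma> f' and x^\<gamma> g'
  drop out of the antisymmetric expression.\<close>

lemma Wronskian_eq:
  assumes f: "f \<in> cev_Dmax \<mu> \<sigma> \<gamma>" "sol u0 j0 (\<lambda>x. x powr \<gamma> *\<^sub>R f x) J h"
    and g: "g \<in> cev_Dmax \<mu> \<sigma> \<gamma>" "sol u0' j0' (\<lambda>x. x powr \<gamma> *\<^sub>R g x) J' h'" and x: "x > 0"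
  shows "cev_W \<mu> \<sigma> \<gamma> f g x = (1 / q) *\<^sub>R (E x *\<^sub>R ((x powr \<gamma> *\<^sub>R f x) * J' x - J x * (x powr \<gamma> *\<^sub>R g x)))"
proof -
  let ?v = "\<lambda>p x. (\<gamma> * x powr (\<gamma> - 1)) *\<^sub>R p x + x powr \<gamma> *\<^sub>R D1 p x"
  have J: "J x = ?v f x - (c * x powr (1 - \<gamma>)) *\<^sub>R (x powr \<gamma> *\<^sub>R f x)"
    and J': "J' x = ?v g x - (c * x powr (1 - \<gamma>)) *\<^sub>R (x powr \<gamma> *\<^sub>R g x)"
    using Dmax_flux[OF f x] Dmax_flux[OF g x] by (simp_all add: eq_diff_eq)
  have "(x powr \<gamma> *\<^sub>R f x) * J' x - J x * (x powr \<gamma> *\<^sub>R g x) = (x powr \<gamma> * x powr \<gamma>) *\<^sub>R (f x * D1 g x - D1 f x * g x)"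
    unfolding J J' by (simp add: scaleR_conv_of_real algebra_simps)
  moreover have "cev_Q2 \<mu> \<sigma> \<gamma> x = 1 / q * (E x * (x powr \<gamma> * x powr \<gamma>))"
    by (simp add: cev_Q2_def sigma_q(2) w_eq)
  ultimately show ?thesis by (simp add: cev_W_def)
qed

theorem limit_point_at_top: "cev_limit_point \<mu> \<sigma> \<gamma> at_top"
  unfolding cev_limit_point_def
proof (intro ballI)
  fix f g assume f: "f \<in> cev_Dmax \<mu> \<sigma> \<gamma>" and g: "g \<in> cev_Dmax \<mu> \<sigma> \<gamma>"
  obtain u0 j0 J where s: "sol u0 j0 (\<lambda>x. x powr \<gamma> *\<^sub>R f x) J (cev_L \<mu> \<sigma> \<gamma> f)" using Dmax_sol[OF f] .
  obtain u0' j0' J' where s': "sol u0' j0' (\<lambda>x. x powr \<gamma> *\<^sub>R g x) J' (cev_L \<mu> \<sigma> \<gamma> g)" using Dmax_sol[OF g] .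
  have "((\<lambda>x. (1 / q) *\<^sub>R (E x *\<^sub>R ((x powr \<gamma> *\<^sub>R f x) * J' x - J x * (x powr \<gamma> *\<^sub>R g x)))) \<longlongrightarrow> (1 / q) *\<^sub>R 0) at_top"
    by (intro tendsto_scaleR tendsto_const sol_Wronskian_at_top[OF s s'])
  then have "(cev_W \<mu> \<sigma> \<gamma> f g \<longlongrightarrow> (1 / q) *\<^sub>R 0) at_top"
    by (rule Lim_transform_eventually[OF _ eventually_mono[OF eventually_gt_at_top[of 0]]])
       (simp add: Wronskian_eq[OF f s g s'])
  then show "(cev_W \<mu> \<sigma> \<gamma> f g \<longlongrightarrow> 0) at_top" by simp
qed

lemma E_tendsto_0: "(E \<longlongrightarrow> 1) (at_right 0)"
proof -
  have "(E \<longlongrightarrow> E 0) (at_right 0)"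
    by (rule continuous_on_Icc_tendsto_right[of 0 1, OF continuous_on_subset[OF E_cont]]) auto
  then show ?thesis using gamma1 by (simp add: E_def y_def)
qed

lemma sol_Wronskian_at_0:
  assumes s: "sol u0 j0 u J h" and s': "sol u0' j0' u' J' h'"
  shows "((\<lambda>x. E x *\<^sub>R (u x * J' x - J x * u' x)) \<longlongrightarrow> u0 * j0' - j0 * u0') (at_right 0)"
proof -
  have "((\<lambda>x. E x *\<^sub>R (u x * J' x - J x * u' x)) \<longlongrightarrow> 1 *\<^sub>R (u0 * j0' - j0 * u0')) (at_right 0)"
    by (intro tendsto_intros E_tendsto_0 sol_u0[OF s] sol_u0[OF s'] sol_J_cont(2)[OF s] sol_J_cont(2)[OF s'])
  then show ?thesis by simp
qed

text \<open>Elements of the maximal domain with data (1, 0) and (0, 1) have a Wronskian tending to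
  1/q.\<close>

theorem limit_circle_at_0: "cev_limit_circle \<mu> \<sigma> \<gamma> (at_right 0)"
  unfolding cev_limit_circle_def
proof
  assume lp: "cev_limit_point \<mu> \<sigma> \<gamma> (at_right 0)"
  have ex: "\<exists>p\<in>cev_Dmax \<mu> \<sigma> \<gamma>. \<exists>J h. sol \<alpha> \<beta> (\<lambda>x. x powr \<gamma> *\<^sub>R p x) J h" for \<alpha> \<beta>
  proof -
    obtain u J h where s: "sol \<alpha> \<beta> u J h" using sol_exists_data by blast
    have "sol \<alpha> \<beta> (\<lambda>x. x powr \<gamma> *\<^sub>R (x powr (-\<gamma>) *\<^sub>R u x)) J h"
      by (rule sol_cong[OF s _ ae_eq_refl]) (simp add: powr_minus)
    then show ?thesis by (intro bexI[OF _ sol_Dmax(1)[OF s]] exI)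
  qed
  obtain f J h where f: "f \<in> cev_Dmax \<mu> \<sigma> \<gamma>" and s: "sol 1 0 (\<lambda>x. x powr \<gamma> *\<^sub>R f x) J h" using ex by blast
  obtain g J' h' where g: "g \<in> cev_Dmax \<mu> \<sigma> \<gamma>" and s': "sol 0 1 (\<lambda>x. x powr \<gamma> *\<^sub>R g x) J' h'" using ex by blast
  have "((\<lambda>x. (1 / q) *\<^sub>R (E x *\<^sub>R ((x powr \<gamma> *\<^sub>R f x) * J' x - J x * (x powr \<gamma> *\<^sub>R g x)))) \<longlongrightarrow> (1 / q) *\<^sub>R (1 * 1 - 0 * 0)) (at_right 0)"
    by (intro tendsto_scaleR tendsto_const sol_Wronskian_at_0[OF s s'])
  then have "(cev_W \<mu> \<sigma> \<gamma> f g \<longlongrightarrow> (1 / q) *\<^sub>R (1 * 1 - 0 * 0)) (at_right 0)"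
    by (rule Lim_transform_eventually[OF _ eventually_mono[OF eventually_at_right_less]])
       (simp add: Wronskian_eq[OF f s g s'])
  then have "(1 / q) *\<^sub>R (1 * 1 - 0 * 0) = (0::complex)"
    using lp f g unfolding cev_limit_point_def by (intro tendsto_unique[OF trivial_limit_at_right_real]) auto
  then show False using q_pos by simp
qed

text \<open>The Wronskian is absolutely continuous with derivative q times the integrand. Its
  boundary value at infinity is 0 and the one at 0 is given by the data. The pairing carries no
  conjugation, so that two eigensolutions for the same complex \<lambda> can be compared.\<close>

theorem Green_formula:
  assumes s: "sol u0 j0 u J h" and s': "sol u0' j0' u' J' h'"
  shows "q *\<^sub>R integral {0<..} (\<lambda>x. w x *\<^sub>R ((x powr (-\<gamma>) *\<^sub>R u x) * h' x - h x * (x powr (-\<gamma>) *\<^sub>R u' x))) =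
      - (u0 * j0' - j0 * u0')"
proof -
  define B where "B = (\<lambda>x. E x *\<^sub>R (u x * J' x - J x * u' x))"
  define F where "F = (\<lambda>x. w x *\<^sub>R ((x powr (-\<gamma>) *\<^sub>R u x) * h' x - h x * (x powr (-\<gamma>) *\<^sub>R u' x)))"
  have Fa: "F absolutely_integrable_on {0<..}"
    unfolding F_def scaleR_diff_right
    by (intro set_integral_diff L2_mult_absolutely_integrable sol_L2[OF s] sol_L2[OF s'])
  have Fsub: "F absolutely_integrable_on S" if "S \<subseteq> {0<..}" "S \<in> sets lebesgue" for S
    by (rule set_integrable_subset[OF Fa]) (use that in auto)
  have int: "q *\<^sub>R integral {r..t} F = B t - B r" if rt: "0 < r" "r \<le> t" for r t
  proof -
    have ac: "abs_continuous_on_interval r t (\<lambda>x. E x *\<^sub>R u x)" if s: "sol u0 j0 u J h" for u0 j0 u J h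
      by (rule abs_continuous_on_interval_C1[of _ _ _ "\<lambda>x. E x *\<^sub>R J x"])
         (use rt in \<open>auto intro!: has_vector_derivative_at_within[OF sol_Eu_deriv[OF s]] continuous_intros
            continuous_on_subset[OF E_cont] continuous_on_subset[OF sol_J_cont(1)[OF s]]\<close>)
    \<comment> \<open>\<open>E\<close> is attached to the factors u and u' because (E u)' = E J; the
      two products of \<open>E\<close>, \<open>J\<close> and \<open>J'\<close> then cancel in the
      derivative.\<close>
    have Beq: "B x = (E x *\<^sub>R u x) * J' x + (- 1) * (J x * (E x *\<^sub>R u' x))" for x
      by (simp add: B_def scaleR_diff_right)
    have "abs_continuous_on_interval r t (\<lambda>x. - 1 :: complex)"
      by (rule abs_continuous_on_interval_Lipschitz[of _ _ _ 0]) auto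
    then have "abs_continuous_on_interval r t B"
      unfolding Beq[abs_def]
      by (intro abs_continuous_on_interval_add abs_continuous_on_interval_mult ac[OF s] ac[OF s']
          sol_J_abs_continuous[OF s rt] sol_J_abs_continuous[OF s' rt])
    then obtain g where g: "\<And>x. x \<in> {r..t} \<Longrightarrow> (g has_integral (B x - B r)) {r..x}"
      "negligible {x\<in>{r<..<t}. \<not> (B has_vector_derivative g x) (at x)}"
      using rt by (elim abs_continuous_FTC) auto
    let ?N = "{x\<in>{r<..<t}. \<not> (B has_vector_derivative g x) (at x)} \<union>
        {x. x > 0 \<and> \<not> (J has_vector_derivative q *\<^sub>R h x) (at x)} \<union>
        {x. x > 0 \<and> \<not> (J' has_vector_derivative q *\<^sub>R h' x) (at x)} \<union> {r, t}"
    have neg: "negligible ?N"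
      using g(2) sol_J_derivative_AE[OF s] sol_J_derivative_AE[OF s'] by (intro negligible_Un) auto
    have "q *\<^sub>R F x = g x" if x: "x \<in> {r..t} - ?N" for x
    proof -
      have x0: "x > 0" using x rt by auto
      have dJ: "(J has_vector_derivative q *\<^sub>R h x) (at x)" "(J' has_vector_derivative q *\<^sub>R h' x) (at x)"
        and dB: "(B has_vector_derivative g x) (at x)" using x x0 by auto
      have "(B has_vector_derivative ((E x *\<^sub>R u x) * (q *\<^sub>R h' x) + (E x *\<^sub>R J x) * J' x)
          + (- 1) * (J x * (E x *\<^sub>R J' x) + (q *\<^sub>R h x) * (E x *\<^sub>R u' x))) (at x)"
        unfolding Beq[abs_def]
        by (intro has_vector_derivative_add has_vector_derivative_mult_right has_vector_derivative_mult dJ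
            sol_Eu_deriv[OF s x0] sol_Eu_deriv[OF s' x0])
      with dB have "g x = ((E x *\<^sub>R u x) * (q *\<^sub>R h' x) + (E x *\<^sub>R J x) * J' x)
          + (- 1) * (J x * (E x *\<^sub>R J' x) + (q *\<^sub>R h x) * (E x *\<^sub>R u' x))"
        using vector_derivative_unique_at by blast
      also have "\<dots> = q *\<^sub>R (E x *\<^sub>R (u x * h' x - h x * u' x))"
        by (simp add: algebra_simps)
      also have "E x *\<^sub>R (u x * h' x - h x * u' x) = F x"
      proof -
        have k: "w x * x powr (-\<gamma>) = E x" using x0 by (simp add: w_eq powr_minus)
        have "F x = (w x * x powr (-\<gamma>)) *\<^sub>R (u x * h' x - h x * u' x)"
          by (simp add: F_def scaleR_diff_right)
        then show ?thesis by (simp only: k)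
      qed
      finally show ?thesis by simp
    qed
    then have "integral {r..t} g = integral {r..t} (\<lambda>x. q *\<^sub>R F x)"
      by (intro integral_spike[OF neg]) auto
    then show ?thesis using g(1)[of t] rt by (simp add: integral_unique)
  qed
  have top: "q *\<^sub>R integral {r..} F = - B r" if r: "r > 0" for r
  proof -
    have sub: "{r..} \<subseteq> {0<..}" using r by auto
    have "((\<lambda>t. q *\<^sub>R integral {r..t} F) \<longlongrightarrow> q *\<^sub>R integral {r..} F) at_top"
      by (intro tendsto_intros integral_Ici_tendsto Fsub[OF sub]) simp
    moreover have "((\<lambda>t. B t - B r) \<longlongrightarrow> 0 - B r) at_top"
      unfolding B_def by (intro tendsto_diff tendsto_const sol_Wronskian_at_top[OF s s'])
    then have "((\<lambda>t. q *\<^sub>R integral {r..t} F) \<longlongrightarrow> 0 - B r) at_top"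
      by (rule Lim_transform_eventually[OF _ eventually_mono[OF eventually_ge_at_top[of r]]]) (simp add: int[OF r])
    ultimately show ?thesis using tendsto_unique[OF trivial_limit_at_top_linorder] by fastforce
  qed
  have "((\<lambda>r. q *\<^sub>R integral {r..} F) \<longlongrightarrow> q *\<^sub>R integral {0<..} F) (at_right 0)"
    by (intro tendsto_intros integral_Ioi_tendsto Fa)
  moreover have "((\<lambda>r. - B r) \<longlongrightarrow> - (u0 * j0' - j0 * u0')) (at_right 0)"
    unfolding B_def by (intro tendsto_minus sol_Wronskian_at_0[OF s s'])
  then have "((\<lambda>r. q *\<^sub>R integral {r..} F) \<longlongrightarrow> - (u0 * j0' - j0 * u0')) (at_right 0)"
    by (rule Lim_transform_eventually[OF _ eventually_mono[OF eventually_at_right_less]]) (simp add: top)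
  ultimately show ?thesis unfolding F_def using tendsto_unique[OF trivial_limit_at_right_real] by blast
qed

end

section \<open>Surjectivity of the shifted maximal operator\<close>

lemma continuous_on_Ici:
  fixes f :: "real \<Rightarrow> 'a::topological_space"
  assumes "\<And>t. t > s \<Longrightarrow> continuous_on {s..t} f"
  shows "continuous_on {s..} f"
  unfolding continuous_on_def
proof
  fix x assume x: "x \<in> {s..}"
  have "at x within {s..} = at x within {s..x + 1}"
    by (rule at_within_nhd[of x "{..<x + 1}"]) (use x in auto)
  moreover have "(f \<longlongrightarrow> f x) (at x within {s..x + 1})"
    using assms[of "x + 1"] x by (simp add: continuous_on_def)
  ultimately show "(f \<longlongrightarrow> f x) (at x within {s..})" by simp
qed

locale cev_resolvent = cev_parameters +
  fixes lam :: complex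
begin

text \<open>\<open>X\<close> and \<open>K\<close> make the two losses of the iteration at most 1/4
  each. Beyond \<open>X\<close> the flux integral costs 2k/(cX) and the tail integral 2/c, in total
  4k/(c^2 X); below \<open>X\<close> the two integrations cost 1/K each, in total k/K^2.\<close>

definition "k = q * cmod lam"
definition "X = max 1 (16 * k / c\<^sup>2)"
definition "K = 1 + 4 * k"
text \<open>A primitive of x^{-\<gamma>} + 1: the first summand serves the integral that defines the
  flux, the second the integral of the flux itself.\<close>

definition "\<Phi> x = x powr (1 - \<gamma>) / (1 - \<gamma>) + x"
definition "\<omega> x = (if x \<le> X then exp (K * (\<Phi> X - \<Phi> x)) else exp ((y x - y X) / 2))"

text \<open>The flux of the source g normalized to vanish at \<open>X\<close>, so that it is
  integrated away from \<open>X\<close>, the direction in which \<omega> grows.\<close>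

definition JJ :: "(real \<Rightarrow> complex) \<Rightarrow> real \<Rightarrow> complex" where
  "JJ g t = q *\<^sub>R (integral {0..t} g - integral {0..X} g)"

text \<open>The solution of u' = J + c x^{1-\<gamma>} u singled out by decay of E u at infinity, in
  accordance with \<open>sol_tail\<close>.\<close>

definition UU :: "(real \<Rightarrow> complex) \<Rightarrow> real \<Rightarrow> complex" where
  "UU g x = - (exp (y x) *\<^sub>R integral {x..} (\<lambda>t. E t *\<^sub>R JJ g t))"

lemma k0: "k \<ge> 0" and X1: "X \<ge> 1" and K1: "K \<ge> 1" and Xk: "4 * k / (c\<^sup>2 * X) \<le> 1/4" and Kk: "k / K\<^sup>2 \<le> 1/4"
proof -
  show k0: "k \<ge> 0" using q_pos by (simp add: k_def)
  show X1: "X \<ge> 1" by (simp add: X_def)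
  show K1: "K \<ge> 1" using k0 by (simp add: K_def)
  have "16 * k / c\<^sup>2 \<le> X" by (simp add: X_def)
  then show "4 * k / (c\<^sup>2 * X) \<le> 1/4" using X1 c_pos by (simp add: field_simps)
  have "K\<^sup>2 = 1 + 8 * k + 16 * k\<^sup>2" by (simp add: K_def power2_eq_square algebra_simps)
  moreover have "0 \<le> k\<^sup>2" by simp
  ultimately have "4 * k \<le> K\<^sup>2" using k0 by linarith
  then show "k / K\<^sup>2 \<le> 1/4" using K1 by (simp add: field_simps)
qed

lemma Phi_mono: "0 \<le> s \<Longrightarrow> s \<le> t \<Longrightarrow> \<Phi> s \<le> \<Phi> t"
  unfolding \<Phi>_def using gamma1 by (intro add_mono divide_right_mono powr_mono2) auto

lemma Phi_cont: "continuous_on {0..} \<Phi>"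
  unfolding \<Phi>_def[abs_def] using gamma1 by (auto intro!: continuous_intros continuous_on_powr')

lemma Phi_deriv: "x > 0 \<Longrightarrow> (\<Phi> has_real_derivative x powr (-\<gamma>) + 1) (at x)"
  unfolding \<Phi>_def[abs_def] using gamma1 by (auto intro!: derivative_eq_intros)

lemma powr_gamma_le1: "x \<ge> 1 \<Longrightarrow> x powr (\<gamma> - 1) \<le> 1"
  using powr_mono[of "\<gamma> - 1" 0 x] gamma1 by simp

lemma omega_pos: "\<omega> x > 0" and omega_ge1: "x \<ge> 0 \<Longrightarrow> 1 \<le> \<omega> x"
proof -
  show "\<omega> x > 0" by (simp add: \<omega>_def)
  show "1 \<le> \<omega> x" if "x \<ge> 0"
    using that Phi_mono[of x X] y_mono[of X x] X1 K1 by (auto simp: \<omega>_def)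
qed

lemma omega_cont: "continuous_on {0..} \<omega>"
proof -
  have "continuous_on ({0..X} \<union> {X..}) (\<lambda>x. if x \<le> X then exp (K * (\<Phi> X - \<Phi> x)) else exp ((y x - y X) / 2))"
  proof (rule continuous_on_If)
    show "continuous_on {0..X} (\<lambda>x. exp (K * (\<Phi> X - \<Phi> x)))"
      by (intro continuous_intros continuous_on_subset[OF Phi_cont]) auto
    show "continuous_on {X..} (\<lambda>x. exp ((y x - y X) / 2))"
      using X1 by (intro continuous_intros continuous_on_subset[OF y_cont]) auto
  qed auto
  moreover have "{0..X} \<union> {X..} = {0..}" using X1 by auto
  ultimately show ?thesis by (simp add: \<omega>_def[abs_def])
qed

lemma omega_le_0: "0 \<le> x \<Longrightarrow> x \<le> X \<Longrightarrow> \<omega> x \<le> exp (K * \<Phi> X)"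
  using Phi_mono[of 0 x] K1 gamma1 by (auto simp: \<omega>_def \<Phi>_def[of 0])

lemma powr_gamma_integrable:
  assumes u: "continuous_on {0..} u"
  shows "(\<lambda>x. x powr (-\<gamma>) *\<^sub>R (u x :: 'a::euclidean_space)) absolutely_integrable_on {0..t}"
proof (cases "t \<ge> 0")
  case True
  have "(\<lambda>x. x powr (-\<gamma>)) absolutely_integrable_on {0..t}"
    using integrable_on_powr_from_0[of "-\<gamma>" t] True gamma1 by (intro nonnegative_absolutely_integrable_1) auto
  moreover have ut: "continuous_on {0..t} u" by (rule continuous_on_subset[OF u]) auto
  ultimately show ?thesis
  proof -
    assume p: "(\<lambda>x. x powr (-\<gamma>)) absolutely_integrable_on {0..t}"
    have "bilinear (\<lambda>(v::'a) (r::real). r *\<^sub>R v)"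
      by (auto simp: bilinear_def intro!: linearI simp: scaleR_add_left scaleR_add_right)
    moreover have "u \<in> borel_measurable (lebesgue_on {0..t})"
      by (rule continuous_imp_measurable_on_sets_lebesgue[OF ut]) simp
    moreover have "bounded (u ` {0..t})"
      by (rule compact_imp_bounded[OF compact_continuous_image[OF ut compact_Icc]])
    ultimately show ?thesis
      using absolutely_integrable_bounded_measurable_product[OF _ _ _ _ p, of "\<lambda>v r. r *\<^sub>R v" u] by simp
  qed
qed auto

text \<open>The weight \<open>\<omega>\<close> is chosen so that integrating \<open>x\<^bsup>-\<gamma>\<^esup> \<omega>\<close> away from \<open>X\<close> in either direction gains a
  small factor.\<close>

lemma omega_integral_left:
  assumes "0 \<le> t" "t \<le> X"
  shows "integral {t..X} (\<lambda>x. x powr (-\<gamma>) * \<omega> x) \<le> \<omega> t / K" "integral {t..X} \<omega> \<le> \<omega> t / K"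
proof -
  let ?f = "\<lambda>x. (x powr (-\<gamma>) + 1) * \<omega> x"
  have I: "(?f has_integral (- \<omega> X / K - (- \<omega> t / K))) {t..X}"
  proof (rule fundamental_theorem_of_calculus_interior)
    show "continuous_on {t..X} (\<lambda>x. - \<omega> x / K)"
      using K1 assms by (intro continuous_intros continuous_on_subset[OF omega_cont]) auto
    fix x assume x: "x \<in> {t<..<X}"
    then have x0: "x > 0" using assms by simp
    have "((\<lambda>x. - exp (K * (\<Phi> X - \<Phi> x)) / K) has_real_derivative (x powr (-\<gamma>) + 1) * exp (K * (\<Phi> X - \<Phi> x))) (at x)"
      using K1 by (auto intro!: derivative_eq_intros Phi_deriv[OF x0] simp: field_simps)
    then have "((\<lambda>x. - exp (K * (\<Phi> X - \<Phi> x)) / K) has_vector_derivative ?f x) (at x)"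
      using x by (simp add: \<omega>_def has_real_derivative_iff_has_vector_derivative)
    then show "((\<lambda>x. - \<omega> x / K) has_vector_derivative ?f x) (at x)"
      by (rule has_vector_derivative_transform_within_open[where S = "{t<..<X}"]) (use x in \<open>auto simp: \<omega>_def\<close>)
  qed (use assms in auto)
  have le: "- \<omega> X / K - (- \<omega> t / K) \<le> \<omega> t / K" using omega_pos[of X] K1 by simp
  have a: "(\<lambda>x. x powr (-\<gamma>) *\<^sub>R \<omega> x) absolutely_integrable_on {0..X}" by (rule powr_gamma_integrable[OF omega_cont])
  then have "(\<lambda>x. x powr (-\<gamma>) * \<omega> x) integrable_on {t..X}"
    using assms by (auto simp: absolutely_integrable_on_def intro: integrable_subinterval_real)
  then have "integral {t..X} (\<lambda>x. x powr (-\<gamma>) * \<omega> x) \<le> - \<omega> X / K - (- \<omega> t / K)"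
    by (rule has_integral_le[OF integrable_integral I]) (use omega_pos in \<open>auto simp: distrib_right less_imp_le\<close>)
  then show "integral {t..X} (\<lambda>x. x powr (-\<gamma>) * \<omega> x) \<le> \<omega> t / K" using le by simp
  have "\<omega> integrable_on {t..X}"
    using assms by (intro integrable_continuous_real continuous_on_subset[OF omega_cont]) auto
  then have "integral {t..X} \<omega> \<le> - \<omega> X / K - (- \<omega> t / K)"
    by (rule has_integral_le[OF integrable_integral I]) (use omega_pos in \<open>auto simp: distrib_right less_imp_le\<close>)
  then show "integral {t..X} \<omega> \<le> \<omega> t / K" using le by simp
qed

text \<open>For x \<ge> \<open>X\<close> the factor x^{-\<gamma>} is at most x^{1-\<gamma>}/X, and
  x^{1-\<gamma>} e^{y/2} is an exact derivative. The factor 1/X is the reason for choosing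
  \<open>X\<close> large.\<close>

lemma omega_integral_right:
  assumes t: "X \<le> t"
  shows "integral {X..t} (\<lambda>x. x powr (-\<gamma>) * \<omega> x) \<le> 2 / (c * X) * exp (- y X / 2) * exp (y t / 2)"
proof -
  let ?e = "exp (- y X / 2) / X"
  have X0: "X > 0" using X1 by simp
  have "((\<lambda>x. x powr (1 - \<gamma>) * exp (1/2 * y x)) has_integral (exp (1/2 * y t) / (c * (1/2)) - exp (1/2 * y X) / (c * (1/2)))) {X..t}"
    by (rule powr_exp_half_has_integral[OF X0 t]) simp
  from has_integral_mult_right[OF this, of ?e]
  have I: "((\<lambda>x. ?e * (x powr (1 - \<gamma>) * exp (1/2 * y x))) has_integral ?e * (exp (1/2 * y t) / (c * (1/2)) - exp (1/2 * y X) / (c * (1/2)))) {X..t}" .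
  have "(\<lambda>x. x powr (-\<gamma>) *\<^sub>R \<omega> x) absolutely_integrable_on {0..t}" by (rule powr_gamma_integrable[OF omega_cont])
  then have "(\<lambda>x. x powr (-\<gamma>) * \<omega> x) integrable_on {X..t}"
    using X0 by (auto simp: absolutely_integrable_on_def intro: integrable_subinterval_real)
  then have "integral {X..t} (\<lambda>x. x powr (-\<gamma>) * \<omega> x) \<le> ?e * (exp (1/2 * y t) / (c * (1/2)) - exp (1/2 * y X) / (c * (1/2)))"
  proof (rule has_integral_le[OF integrable_integral I])
    fix x assume x: "x \<in> {X..t}"
    then have x0: "x > 0" using X0 by simp
    have w: "\<omega> x = exp (- y X / 2) * exp (1/2 * y x)"
      using x by (cases "x = X") (auto simp: \<omega>_def diff_divide_distrib simp flip: exp_add)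
    have "x powr (-\<gamma>) = x powr (1 - \<gamma>) / x" using x0 by (simp add: powr_diff powr_minus field_simps)
    also have "\<dots> \<le> x powr (1 - \<gamma>) / X" using x X0 by (intro divide_left_mono) auto
    finally have "x powr (-\<gamma>) * \<omega> x \<le> x powr (1 - \<gamma>) / X * \<omega> x" using omega_pos[of x] by (intro mult_right_mono) auto
    then show "x powr (-\<gamma>) * \<omega> x \<le> ?e * (x powr (1 - \<gamma>) * exp (1/2 * y x))" by (simp add: w mult_ac)
  qed
  also have "\<dots> \<le> ?e * (exp (1/2 * y t) / (c * (1/2)))" using X0 c_pos by (intro mult_left_mono) auto
  also have "\<dots> = 2 / (c * X) * exp (- y X / 2) * exp (y t / 2)" by (simp add: mult_ac)
  finally show ?thesis .
qed

section \<open>The integral operators for flux and solution\<close>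

lemma JJ_cont:
  assumes g: "\<And>t. g absolutely_integrable_on {0..t}"
  shows "continuous_on {0..} (JJ g)"
proof (rule continuous_on_Ici)
  fix t :: real assume "t > 0"
  show "continuous_on {0..t} (JJ g)"
    unfolding JJ_def[abs_def] using g[of t]
    by (intro continuous_intros indefinite_integral_continuous_1) (simp add: absolutely_integrable_on_def)
qed

lemma JJ_diff:
  assumes g: "\<And>t. g absolutely_integrable_on {0..t}"
  shows "X \<le> t \<Longrightarrow> JJ g t = q *\<^sub>R integral {X..t} g" "0 \<le> t \<Longrightarrow> t \<le> X \<Longrightarrow> JJ g t = - (q *\<^sub>R integral {t..X} g)"
proof -
  have gi: "g integrable_on {0..t}" for t using g by (simp add: absolutely_integrable_on_def)
  show "X \<le> t \<Longrightarrow> JJ g t = q *\<^sub>R integral {X..t} g"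
    using Henstock_Kurzweil_Integration.integral_combine[of 0 X t g, symmetric] gi X1 by (simp add: JJ_def)
  show "0 \<le> t \<Longrightarrow> t \<le> X \<Longrightarrow> JJ g t = - (q *\<^sub>R integral {t..X} g)"
    using Henstock_Kurzweil_Integration.integral_combine[of 0 t X g, symmetric] gi by (simp add: JJ_def)
qed

context
  fixes g :: "real \<Rightarrow> complex" and A :: real
  assumes g: "\<And>t. g absolutely_integrable_on {0..t}"
    and A: "\<And>t. t \<ge> X \<Longrightarrow> cmod (JJ g t) \<le> A * exp (y t / 2)"
begin

lemma EJ_cont: "continuous_on {0..} (\<lambda>t. E t *\<^sub>R JJ g t)"
  by (intro continuous_intros E_cont JJ_cont g)

lemma EJ_tail: "(\<lambda>t. E t *\<^sub>R JJ g t) absolutely_integrable_on {x..}"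
  "cmod (integral {x..} (\<lambda>t. E t *\<^sub>R JJ g t)) \<le> A * (2 / c * x powr (\<gamma> - 1) * e2 x)" if "x \<ge> X"
proof -
  have "continuous_on {x..} (JJ g)" using that X1 by (intro continuous_on_subset[OF JJ_cont[OF g]]) auto
  from flux_tail(1,2)[OF this, of A] that X1 A
  show "(\<lambda>t. E t *\<^sub>R JJ g t) absolutely_integrable_on {x..}"
    "cmod (integral {x..} (\<lambda>t. E t *\<^sub>R JJ g t)) \<le> A * (2 / c * x powr (\<gamma> - 1) * e2 x)" by simp_all
qed

lemma EJ_integrable: "x \<ge> 0 \<Longrightarrow> (\<lambda>t. E t *\<^sub>R JJ g t) absolutely_integrable_on {x..}"
proof -
  assume x: "x \<ge> 0"
  have "(\<lambda>t. E t *\<^sub>R JJ g t) absolutely_integrable_on {0..X}"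
    by (intro absolutely_integrable_continuous_real continuous_on_subset[OF EJ_cont]) auto
  then have "(\<lambda>t. E t *\<^sub>R JJ g t) absolutely_integrable_on {0..X} \<union> {X..}"
    using EJ_tail(1)[of X] by (rule absolutely_integrable_Un) auto
  then show ?thesis by (rule set_integrable_subset) (use x in auto)
qed

lemma EJ_split: "0 \<le> x \<Longrightarrow> x \<le> t \<Longrightarrow> integral {x..} (\<lambda>t. E t *\<^sub>R JJ g t) =
    integral {x..t} (\<lambda>t. E t *\<^sub>R JJ g t) + integral {t..} (\<lambda>t. E t *\<^sub>R JJ g t)"
proof -
  assume xt: "0 \<le> x" "x \<le> t"
  have "{x..t} \<inter> {t..} = {t}" "{x..t} \<union> {t..} = {x..}" using xt by auto
  moreover have "(\<lambda>t. E t *\<^sub>R JJ g t) integrable_on {x..t}"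
    using xt by (intro integrable_continuous_real continuous_on_subset[OF EJ_cont]) auto
  moreover have "(\<lambda>t. E t *\<^sub>R JJ g t) integrable_on {t..}"
    using EJ_integrable[of t] xt by (simp add: absolutely_integrable_on_def)
  ultimately show ?thesis using integral_Un[of "\<lambda>t. E t *\<^sub>R JJ g t" "{x..t}" "{t..}"] by simp
qed

lemma UU_right: "x \<ge> X \<Longrightarrow> cmod (UU g x) \<le> A * (2 / c) * x powr (\<gamma> - 1) * exp (y x / 2)"
proof -
  assume x: "x \<ge> X"
  have "cmod (UU g x) = exp (y x) * cmod (integral {x..} (\<lambda>t. E t *\<^sub>R JJ g t))" by (simp add: UU_def)
  also have "\<dots> \<le> exp (y x) * (A * (2 / c * x powr (\<gamma> - 1) * e2 x))"
    using EJ_tail(2)[OF x] by (intro mult_left_mono) auto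
  also have "\<dots> = A * (2 / c) * x powr (\<gamma> - 1) * (exp (y x) * e2 x)" by simp
  finally show ?thesis by (simp only: exp_e2)
qed

lemma A_nonneg: "A \<ge> 0"
  using A[of X] by (smt (verit) norm_ge_zero exp_gt_zero zero_le_mult_iff)

text \<open>The integral from x to infinity is split at \<open>X\<close>. On [x, X] the kernel e^{y
  x} E t is at most 1 because y is increasing; the part beyond \<open>X\<close> is the tail estimate
  at \<open>X\<close>.\<close>

lemma UU_left:
  assumes x: "0 \<le> x" "x \<le> X"
  shows "cmod (UU g x) \<le> integral {x..X} (\<lambda>t. cmod (JJ g t)) + A * (2 / c) * exp (y X / 2)"
proof -
  have Jc: "continuous_on {x..X} (JJ g)" using x by (intro continuous_on_subset[OF JJ_cont[OF g]]) auto
  have "cmod (exp (y x) *\<^sub>R integral {x..X} (\<lambda>t. E t *\<^sub>R JJ g t)) = cmod (integral {x..X} (\<lambda>t. exp (y x) *\<^sub>R (E t *\<^sub>R JJ g t)))"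
    by (simp only: integral_cmul)
  also have "\<dots> \<le> integral {x..X} (\<lambda>t. cmod (JJ g t))"
  proof (rule integral_norm_bound_integral)
    show "(\<lambda>t. exp (y x) *\<^sub>R (E t *\<^sub>R JJ g t)) integrable_on {x..X}"
      using x by (intro integrable_continuous_real continuous_intros Jc continuous_on_subset[OF E_cont]) auto
    show "(\<lambda>t. cmod (JJ g t)) integrable_on {x..X}"
      by (intro integrable_continuous_real continuous_intros Jc)
    fix t assume t: "t \<in> {x..X}"
    have "exp (y x) * E t \<le> 1" using y_mono[of x t] t x by (simp add: E_def flip: exp_add)
    then have "exp (y x) * E t * cmod (JJ g t) \<le> 1 * cmod (JJ g t)" by (intro mult_right_mono) auto
    then show "norm (exp (y x) *\<^sub>R (E t *\<^sub>R JJ g t)) \<le> cmod (JJ g t)" using E_pos[of t] by (simp add: mult.assoc)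
  qed
  finally have 1: "cmod (exp (y x) *\<^sub>R integral {x..X} (\<lambda>t. E t *\<^sub>R JJ g t)) \<le> integral {x..X} (\<lambda>t. cmod (JJ g t))" .
  have "cmod (exp (y x) *\<^sub>R integral {X..} (\<lambda>t. E t *\<^sub>R JJ g t)) \<le> exp (y X) * (A * (2 / c * X powr (\<gamma> - 1) * e2 X))"
    unfolding norm_scaleR using EJ_tail(2)[of X] y_mono[OF x] by (intro mult_mono) auto
  also have "\<dots> = A * (2 / c) * X powr (\<gamma> - 1) * (exp (y X) * e2 X)" by simp
  also have "\<dots> \<le> A * (2 / c) * 1 * (exp (y X) * e2 X)"
    using X1 A_nonneg c_pos e2_pos[of X]
    by (intro mult_right_mono mult_left_mono powr_gamma_le1) (auto simp: less_imp_le)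
  also have "\<dots> = A * (2 / c) * exp (y X / 2)" by (simp add: exp_e2)
  finally have 2: "cmod (exp (y x) *\<^sub>R integral {X..} (\<lambda>t. E t *\<^sub>R JJ g t)) \<le> A * (2 / c) * exp (y X / 2)" .
  have "UU g x = - (exp (y x) *\<^sub>R integral {x..X} (\<lambda>t. E t *\<^sub>R JJ g t)) - exp (y x) *\<^sub>R integral {X..} (\<lambda>t. E t *\<^sub>R JJ g t)"
    unfolding UU_def EJ_split[OF x] by (simp add: scaleR_add_right)
  then show ?thesis using 1 2 norm_triangle_ineq4[of "- (exp (y x) *\<^sub>R integral {x..X} (\<lambda>t. E t *\<^sub>R JJ g t))"
      "exp (y x) *\<^sub>R integral {X..} (\<lambda>t. E t *\<^sub>R JJ g t)"] by (simp only: norm_minus_cancel)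
qed

lemma UU_cont: "continuous_on {0..} (UU g)"
proof (rule continuous_on_Ici)
  fix t :: real assume t: "t > 0"
  let ?F = "\<lambda>t. E t *\<^sub>R JJ g t"
  have i: "?F integrable_on {0..t}"
    using t by (intro integrable_continuous_real continuous_on_subset[OF EJ_cont]) auto
  have "continuous_on {0..t} (\<lambda>x. - (exp (y x) *\<^sub>R (integral {0..} ?F - integral {0..x} ?F)))"
    by (intro continuous_intros continuous_on_subset[OF y_cont] indefinite_integral_continuous_1 i) auto
  moreover have "- (exp (y x) *\<^sub>R (integral {0..} ?F - integral {0..x} ?F)) = UU g x" if "x \<in> {0..t}" for x
    using EJ_split[of 0 x] that by (simp add: UU_def)
  ultimately show "continuous_on {0..t} (UU g)" by (rule continuous_on_eq)
qed

lemma UU_deriv: "x > 0 \<Longrightarrow> (UU g has_vector_derivative JJ g x + (c * x powr (1 - \<gamma>)) *\<^sub>R UU g x) (at x)"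
proof -
  assume x: "x > 0"
  let ?F = "\<lambda>t. E t *\<^sub>R JJ g t"
  have "((\<lambda>x. integral {0..x} ?F) has_vector_derivative ?F x) (at x within {0..x + 1})"
    using x by (intro integral_has_vector_derivative continuous_on_subset[OF EJ_cont]) auto
  then have d: "((\<lambda>x. integral {0..x} ?F) has_vector_derivative ?F x) (at x)"
    using x by (simp add: at_within_Icc_at)
  have "((\<lambda>x. integral {0..x} ?F - integral {0..} ?F) has_vector_derivative ?F x) (at x)"
    using has_vector_derivative_diff[OF d has_vector_derivative_const] by simp
  moreover have "((\<lambda>x. exp (y x)) has_real_derivative exp (y x) * (c * x powr (1 - \<gamma>))) (at x)"
    using x by (auto intro!: derivative_eq_intros y_deriv)
  ultimately have "((\<lambda>x. exp (y x) *\<^sub>R (integral {0..x} ?F - integral {0..} ?F)) has_vector_derivative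
      exp (y x) *\<^sub>R ?F x + (exp (y x) * (c * x powr (1 - \<gamma>))) *\<^sub>R (integral {0..x} ?F - integral {0..} ?F)) (at x)"
    by (intro has_vector_derivative_scaleR)
  moreover have U: "exp (y x) *\<^sub>R (integral {0..x} ?F - integral {0..} ?F) = UU g x" if "x > 0" for x
    using EJ_split[of 0 x] that by (simp add: UU_def flip: scaleR_minus_right)
  moreover have "exp (y x) *\<^sub>R ?F x = JJ g x"
    by (simp add: E_def flip: exp_add)
  moreover have "(exp (y x) * (c * x powr (1 - \<gamma>))) *\<^sub>R (integral {0..x} ?F - integral {0..} ?F) = (c * x powr (1 - \<gamma>)) *\<^sub>R UU g x"
    unfolding U[OF x, symmetric] by (simp add: mult.commute)
  ultimately have "((\<lambda>x. exp (y x) *\<^sub>R (integral {0..x} ?F - integral {0..} ?F)) has_vector_derivative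
      JJ g x + (c * x powr (1 - \<gamma>)) *\<^sub>R UU g x) (at x)" by simp
  then show ?thesis
    by (rule has_vector_derivative_transform_within_open[where S = "{0<..}"]) (use x U in auto)
qed

end

lemma h_JJ_bound:
  assumes h: "h \<in> L2"
  shows "t \<ge> X \<Longrightarrow> cmod (JJ h t) \<le> q * (L2_norm M h * sqrt Cw) * exp (y t / 2)"
    "0 \<le> t \<Longrightarrow> t \<le> X \<Longrightarrow> cmod (JJ h t) \<le> q * (L2_norm M h * sqrt Cw) * exp (y X / 2)"
proof -
  have hi: "h absolutely_integrable_on {0..t}" for t
    by (cases "t \<ge> 0") (auto intro: L2_integrable_0[OF h])
  show "cmod (JJ h t) \<le> q * (L2_norm M h * sqrt Cw) * exp (y t / 2)" if "t \<ge> X"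
    using L2_integral_bound(2)[OF h, of X t] that q_pos X1 unfolding JJ_diff(1)[OF hi that] by (simp add: mult.assoc)
  show "cmod (JJ h t) \<le> q * (L2_norm M h * sqrt Cw) * exp (y X / 2)" if "0 \<le> t" "t \<le> X"
    using L2_integral_bound(2)[OF h, of t X] that q_pos unfolding JJ_diff(2)[OF hi that] by (simp add: mult.assoc)
qed

lemma u_JJ_bound:
  assumes u: "continuous_on {0..} u" and b: "\<And>x. x \<ge> 0 \<Longrightarrow> cmod (u x) \<le> B * \<omega> x"
  defines "g \<equiv> \<lambda>x. lam * (x powr (-\<gamma>) *\<^sub>R u x)"
  shows "g absolutely_integrable_on {0..t}"
    "t \<ge> X \<Longrightarrow> cmod (JJ g t) \<le> (k * B * (2 / (c * X)) * exp (- y X / 2)) * exp (y t / 2)"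
    "0 \<le> t \<Longrightarrow> t \<le> X \<Longrightarrow> cmod (JJ g t) \<le> k * B / K * \<omega> t"
proof -
  have ga: "g absolutely_integrable_on {0..t}" for t
    unfolding g_def by (intro set_integrable_mult_right powr_gamma_integrable[OF u])
  then show "g absolutely_integrable_on {0..t}" .
  have B: "B \<ge> 0" using b[of 0] omega_pos[of 0] by (smt (verit) norm_ge_zero zero_le_mult_iff)
  have est: "q * cmod (integral {s..t} g) \<le> k * B * integral {s..t} (\<lambda>x. x powr (-\<gamma>) * \<omega> x)" if st: "0 \<le> s" "s \<le> t" for s t
  proof -
    have "(\<lambda>x. x powr (-\<gamma>) *\<^sub>R \<omega> x) absolutely_integrable_on {0..t}" by (rule powr_gamma_integrable[OF omega_cont])
    then have wi: "(\<lambda>x. x powr (-\<gamma>) * \<omega> x) integrable_on {s..t}"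
      using st by (auto simp: absolutely_integrable_on_def intro: integrable_subinterval_real)
    have "cmod (integral {s..t} g) \<le> integral {s..t} (\<lambda>x. (cmod lam * B) * (x powr (-\<gamma>) * \<omega> x))"
    proof (rule integral_norm_bound_integral)
      show "g integrable_on {s..t}"
        using ga[of t] st by (auto simp: absolutely_integrable_on_def intro: integrable_subinterval_real)
      show "(\<lambda>x. (cmod lam * B) * (x powr (-\<gamma>) * \<omega> x)) integrable_on {s..t}" by (rule integrable_on_mult_right[OF wi])
      fix x assume x: "x \<in> {s..t}"
      have "cmod lam * (x powr (-\<gamma>) * cmod (u x)) \<le> cmod lam * (x powr (-\<gamma>) * (B * \<omega> x))"
        using b[of x] x st by (intro mult_left_mono) auto
      then show "norm (g x) \<le> (cmod lam * B) * (x powr (-\<gamma>) * \<omega> x)" by (simp add: g_def norm_mult mult_ac)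
    qed
    also have "\<dots> = (cmod lam * B) * integral {s..t} (\<lambda>x. x powr (-\<gamma>) * \<omega> x)" by simp
    finally show ?thesis using q_pos by (simp add: k_def mult.assoc)
  qed
  show "cmod (JJ g t) \<le> (k * B * (2 / (c * X)) * exp (- y X / 2)) * exp (y t / 2)" if t: "t \<ge> X"
  proof -
    have "cmod (JJ g t) \<le> k * B * integral {X..t} (\<lambda>x. x powr (-\<gamma>) * \<omega> x)"
      using est[of X t] t X1 q_pos unfolding JJ_diff(1)[OF ga t] by simp
    also have "\<dots> \<le> k * B * (2 / (c * X) * exp (- y X / 2) * exp (y t / 2))"
      using omega_integral_right[OF t] k0 B by (intro mult_left_mono) auto
    finally show ?thesis by (simp add: mult.assoc)
  qed
  show "cmod (JJ g t) \<le> k * B / K * \<omega> t" if t: "0 \<le> t" "t \<le> X"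
  proof -
    have "cmod (JJ g t) \<le> k * B * integral {t..X} (\<lambda>x. x powr (-\<gamma>) * \<omega> x)"
      using est[of t X] t q_pos unfolding JJ_diff(2)[OF ga t] by simp
    also have "\<dots> \<le> k * B * (\<omega> t / K)"
      using omega_integral_left(1)[OF t] k0 B by (intro mult_left_mono) auto
    finally show ?thesis by simp
  qed
qed

text \<open>Beyond \<open>X\<close> the factor 4k/(c^2 X) alone suffices. Below \<open>X\<close> the
  integrals on [x, X] contribute k/K^2 times B \<omega>, and the tail beyond \<open>X\<close>
  another quarter of B, absorbed by \<omega> \<ge> 1.\<close>

lemma UU_contraction:
  assumes u: "continuous_on {0..} u" and b: "\<And>x. x \<ge> 0 \<Longrightarrow> cmod (u x) \<le> B * \<omega> x" and x: "x \<ge> 0"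
  shows "cmod (UU (\<lambda>x. lam * (x powr (-\<gamma>) *\<^sub>R u x)) x) \<le> 1/2 * B * \<omega> x"
proof -
  let ?g = "\<lambda>x. lam * (x powr (-\<gamma>) *\<^sub>R u x)"
  let ?A = "k * B * (2 / (c * X)) * exp (- y X / 2)"
  have B: "B \<ge> 0" using b[of 0] omega_pos[of 0] by (smt (verit) norm_ge_zero zero_le_mult_iff)
  note est = u_JJ_bound[OF u b]
  have ee: "exp (- y X / 2) * exp (y t / 2) = exp ((y t - y X) / 2)" for t
    by (simp add: diff_divide_distrib flip: exp_add)
  have kk: "k * B * (2 / (c * X)) * (2 / c) = 4 * k / (c\<^sup>2 * X) * B" by (simp add: power2_eq_square mult_ac)
  have k4: "4 * k / (c\<^sup>2 * X) * B \<le> 1/4 * B" using Xk B by (intro mult_right_mono) auto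
  show ?thesis
  proof (cases "x \<le> X")
    case False
    then have xX: "x \<ge> X" by simp
    have "cmod (UU ?g x) \<le> ?A * (2 / c) * x powr (\<gamma> - 1) * exp (y x / 2)"
      by (rule UU_right[OF est(1) _ xX]) (use est(2) in auto)
    also have "\<dots> = (k * B * (2 / (c * X)) * (2 / c)) * x powr (\<gamma> - 1) * (exp (- y X / 2) * exp (y x / 2))"
      by (simp only: mult_ac)
    also have "\<dots> = 4 * k / (c\<^sup>2 * X) * B * x powr (\<gamma> - 1) * \<omega> x" unfolding kk ee using False by (simp add: \<omega>_def)
    also have "\<dots> \<le> 1/4 * B * 1 * \<omega> x"
    proof (rule mult_right_mono)
      show "4 * k / (c\<^sup>2 * X) * B * x powr (\<gamma> - 1) \<le> 1/4 * B * 1"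
        by (rule mult_mono[OF k4 powr_gamma_le1]) (use B X1 xX in auto)
    qed (use omega_pos[of x] in simp)
    also have "\<dots> \<le> 1/2 * B * \<omega> x" using B omega_pos[of x] by (simp add: mult_right_mono)
    finally show ?thesis .
  next
    case True
    have "cmod (UU ?g x) \<le> integral {x..X} (\<lambda>t. cmod (JJ ?g t)) + ?A * (2 / c) * exp (y X / 2)"
      by (rule UU_left[OF est(1) _ x True]) (use est(2) in auto)
    also have "?A * (2 / c) * exp (y X / 2) = (k * B * (2 / (c * X)) * (2 / c)) * (exp (- y X / 2) * exp (y X / 2))" by (simp only: mult_ac)
    also have "\<dots> = 4 * k / (c\<^sup>2 * X) * B" unfolding kk ee by simp
    also have "integral {x..X} (\<lambda>t. cmod (JJ ?g t)) \<le> integral {x..X} (\<lambda>t. k * B / K * \<omega> t)"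
    proof (rule integral_le)
      show "(\<lambda>t. cmod (JJ ?g t)) integrable_on {x..X}"
        using x by (intro integrable_continuous_real continuous_intros continuous_on_subset[OF JJ_cont[OF est(1)]]) auto
      show "(\<lambda>t. k * B / K * \<omega> t) integrable_on {x..X}"
        using x by (intro integrable_continuous_real continuous_intros continuous_on_subset[OF omega_cont]) auto
      show "cmod (JJ ?g t) \<le> k * B / K * \<omega> t" if "t \<in> {x..X}" for t
        using est(3)[of t] that x by auto
    qed
    also have "\<dots> = k * B / K * integral {x..X} \<omega>" by simp
    also have "\<dots> \<le> k * B / K * (\<omega> x / K)"
      using omega_integral_left(2)[OF x True] k0 B K1 by (intro mult_left_mono) auto
    also have "\<dots> = k / K\<^sup>2 * (B * \<omega> x)" by (simp add: power2_eq_square)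
    also have "\<dots> \<le> 1/4 * (B * \<omega> x)" using Kk B omega_pos[of x] by (intro mult_right_mono) auto
    finally have "cmod (UU ?g x) \<le> 1/4 * (B * \<omega> x) + 4 * k / (c\<^sup>2 * X) * B" by simp
    also have "4 * k / (c\<^sup>2 * X) * B \<le> 1/4 * (B * \<omega> x)"
      using k4 mult_left_mono[OF omega_ge1[OF x] B] by linarith
    finally show ?thesis by simp
  qed
qed

definition "C1 = q * sqrt Cw * exp (y X / 2) * (X + 2 / c)"

lemma C1_nonneg: "C1 \<ge> 0"
  using q_pos Cw(1) X1 c_pos by (simp add: C1_def)

lemma UU_source:
  assumes h: "h \<in> L2" and x: "x \<ge> 0"
  shows "cmod (UU h x) \<le> C1 * L2_norm M h * \<omega> x"
proof -
  let ?A = "q * (L2_norm M h * sqrt Cw)"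
  have A0: "?A \<ge> 0" using q_pos L2_norm_nonneg[of h] Cw(1) by simp
  have hi: "h absolutely_integrable_on {0..t}" for t
    by (cases "t \<ge> 0") (auto intro: L2_integrable_0[OF h])
  have C: "C1 * L2_norm M h = ?A * exp (y X / 2) * X + ?A * exp (y X / 2) * (2 / c)"
    by (simp add: C1_def algebra_simps)
  show ?thesis
  proof (cases "x \<le> X")
    case False
    then have xX: "x \<ge> X" by simp
    have "cmod (UU h x) \<le> ?A * (2 / c) * x powr (\<gamma> - 1) * exp (y x / 2)"
      by (rule UU_right[OF hi _ xX]) (use h_JJ_bound[OF h] in auto)
    also have "exp (y x / 2) = exp (y X / 2) * \<omega> x" using False by (simp add: \<omega>_def diff_divide_distrib flip: exp_add)
    also have "?A * (2 / c) * x powr (\<gamma> - 1) * (exp (y X / 2) * \<omega> x) \<le> ?A * (2 / c) * 1 * (exp (y X / 2) * \<omega> x)"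
      using A0 c_pos X1 xX gamma1 omega_pos[of x] by (intro mult_right_mono mult_left_mono powr_gamma_le1) (auto simp: less_imp_le)
    also have "\<dots> = ?A * exp (y X / 2) * (2 / c) * \<omega> x" by (simp only: mult_ac mult_1)
    also have "\<dots> \<le> C1 * L2_norm M h * \<omega> x"
      unfolding C using A0 X1 omega_pos[of x] by (intro mult_right_mono) (auto simp: less_imp_le)
    finally show ?thesis .
  next
    case True
    have "cmod (UU h x) \<le> integral {x..X} (\<lambda>t. cmod (JJ h t)) + ?A * (2 / c) * exp (y X / 2)"
      by (rule UU_left[OF hi _ x True]) (use h_JJ_bound[OF h] in auto)
    also have "integral {x..X} (\<lambda>t. cmod (JJ h t)) \<le> integral {x..X} (\<lambda>t. ?A * exp (y X / 2))"
    proof (rule integral_le)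
      show "(\<lambda>t. cmod (JJ h t)) integrable_on {x..X}"
        using x by (intro integrable_continuous_real continuous_intros continuous_on_subset[OF JJ_cont[OF hi]]) auto
      show "cmod (JJ h t) \<le> ?A * exp (y X / 2)" if "t \<in> {x..X}" for t
        using h_JJ_bound(2)[OF h, of t] that x by auto
    qed auto
    also have "\<dots> = (X - x) * (?A * exp (y X / 2))" using True by simp
    also have "\<dots> \<le> X * (?A * exp (y X / 2))" using A0 x by (intro mult_right_mono) auto
    finally have "cmod (UU h x) \<le> C1 * L2_norm M h" unfolding C by (simp add: mult_ac)
    also have "\<dots> \<le> C1 * L2_norm M h * \<omega> x"
      using mult_left_mono[OF omega_ge1[OF x], of "C1 * L2_norm M h"] C1_nonneg L2_norm_nonneg[of h] by simp
    finally show ?thesis .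
  qed
qed

section \<open>The fixed point and its bounds\<close>

definition source :: "(real \<Rightarrow> complex) \<Rightarrow> (real \<Rightarrow>\<^sub>C complex) \<Rightarrow> real \<Rightarrow> complex" where
  "source h b x = h x + lam * (x powr (-\<gamma>) *\<^sub>R (\<omega> x *\<^sub>R apply_bcontfun b x))"

text \<open>The unknown is b = u/\<omega>, so that the weighted supremum norm becomes the norm of
  bounded continuous functions. These live on the whole line; \<open>max 0\<close> continues the
  image by its value at 0.\<close>

definition step :: "(real \<Rightarrow> complex) \<Rightarrow> (real \<Rightarrow>\<^sub>C complex) \<Rightarrow> (real \<Rightarrow>\<^sub>C complex)" where
  "step h b = Bcontfun (\<lambda>x. (1 / \<omega> (max 0 x)) *\<^sub>R UU (source h b) (max 0 x))"

context
  fixes h :: "real \<Rightarrow> complex"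
  assumes h: "h \<in> L2"
begin

lemma bc_cont: fixes b :: "real \<Rightarrow>\<^sub>C complex" shows "continuous_on {0..} (\<lambda>x. \<omega> x *\<^sub>R apply_bcontfun b x)"
  by (intro continuous_on_scaleR omega_cont continuous_on_apply_bcontfun)

lemma bc_le: fixes b :: "real \<Rightarrow>\<^sub>C complex" shows "cmod (\<omega> x *\<^sub>R apply_bcontfun b x) \<le> norm b * \<omega> x"
  using norm_bounded[of b x] omega_pos[of x] by (simp add: mult.commute)

lemma h_int: "h absolutely_integrable_on {0..t}"
  by (cases "t \<ge> 0") (auto intro: L2_integrable_0[OF h])

lemma source_int: "source h b absolutely_integrable_on {0..t}"
  unfolding source_def[abs_def] by (intro set_integral_add h_int u_JJ_bound(1)[OF bc_cont bc_le])

lemma JJ_add: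
  assumes "\<And>t. g absolutely_integrable_on {0..t}" "\<And>t. g' absolutely_integrable_on {0..t}"
  shows "JJ (\<lambda>x. g x + g' x) t = JJ g t + JJ g' t"
proof -
  have "g integrable_on {0..t}" "g' integrable_on {0..t}" for t using assms by (simp_all add: absolutely_integrable_on_def)
  then show ?thesis by (simp add: JJ_def integral_add scaleR_add_right scaleR_diff_right)
qed

lemma source_JJ: "JJ (source h b) t = JJ h t + JJ (\<lambda>x. lam * (x powr (-\<gamma>) *\<^sub>R (\<omega> x *\<^sub>R apply_bcontfun b x))) t"
  unfolding source_def[abs_def] by (rule JJ_add[OF h_int u_JJ_bound(1)[OF bc_cont bc_le]])

definition "AA b = q * (L2_norm M h * sqrt Cw) + k * norm b * (2 / (c * X)) * exp (- y X / 2)"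

lemma source_JJ_bound: "t \<ge> X \<Longrightarrow> cmod (JJ (source h b) t) \<le> AA b * exp (y t / 2)"
proof -
  assume t: "t \<ge> X"
  have "cmod (JJ (source h b) t) \<le> q * (L2_norm M h * sqrt Cw) * exp (y t / 2) +
      (k * norm b * (2 / (c * X)) * exp (- y X / 2)) * exp (y t / 2)"
    unfolding source_JJ using h_JJ_bound(1)[OF h t] u_JJ_bound(2)[OF bc_cont bc_le t, of b]
    by (intro norm_triangle_le add_mono)
  then show ?thesis by (simp add: AA_def distrib_right)
qed

lemma UU_add:
  assumes g: "\<And>t. g absolutely_integrable_on {0..t}" "\<And>t. t \<ge> X \<Longrightarrow> cmod (JJ g t) \<le> A * exp (y t / 2)"
    and g': "\<And>t. g' absolutely_integrable_on {0..t}" "\<And>t. t \<ge> X \<Longrightarrow> cmod (JJ g' t) \<le> A' * exp (y t / 2)"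
    and x: "x \<ge> 0"
  shows "UU (\<lambda>x. g x + g' x) x = UU g x + UU g' x"
proof -
  have "(\<lambda>t. E t *\<^sub>R JJ g t) integrable_on {x..}" "(\<lambda>t. E t *\<^sub>R JJ g' t) integrable_on {x..}"
    using EJ_integrable[OF g x] EJ_integrable[OF g' x] by (simp_all add: absolutely_integrable_on_def)
  then show ?thesis
    unfolding UU_def JJ_add[OF g(1) g'(1)] by (simp add: scaleR_add_right integral_add)
qed

lemma source_UU: "x \<ge> 0 \<Longrightarrow> UU (source h b) x = UU h x + UU (\<lambda>x. lam * (x powr (-\<gamma>) *\<^sub>R (\<omega> x *\<^sub>R apply_bcontfun b x))) x"
  unfolding source_def[abs_def]
  by (rule UU_add[OF h_int h_JJ_bound(1)[OF h] u_JJ_bound(1,2)[OF bc_cont bc_le]])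

lemma source_UU_le: "x \<ge> 0 \<Longrightarrow> cmod (UU (source h b) x) \<le> (C1 * L2_norm M h + 1/2 * norm b) * \<omega> x"
proof -
  assume x: "x \<ge> 0"
  show ?thesis
    unfolding source_UU[OF x] distrib_right
    by (rule norm_triangle_le[OF add_mono[OF UU_source[OF h x] UU_contraction[OF bc_cont bc_le x]]])
qed

lemma step_apply: "apply_bcontfun (step h b) x = (1 / \<omega> (max 0 x)) *\<^sub>R UU (source h b) (max 0 x)"
proof -
  have "(\<lambda>x. (1 / \<omega> (max 0 x)) *\<^sub>R UU (source h b) (max 0 x)) \<in> bcontfun"
  proof (rule bcontfun_normI)
    have c1: "continuous_on UNIV (\<lambda>x. \<omega> (max 0 x))" "continuous_on UNIV (\<lambda>x. UU (source h b) (max 0 x))"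
      by (rule continuous_on_compose2[OF omega_cont] continuous_on_compose2[OF UU_cont[OF source_int source_JJ_bound]];
          auto intro!: continuous_intros)+
    show "continuous_on UNIV (\<lambda>x. (1 / \<omega> (max 0 x)) *\<^sub>R UU (source h b) (max 0 x))"
      using omega_pos by (intro continuous_intros c1) (auto simp: less_imp_neq[symmetric])
    show "norm ((1 / \<omega> (max 0 x)) *\<^sub>R UU (source h b) (max 0 x)) \<le> C1 * L2_norm M h + 1/2 * norm b" for x
      using source_UU_le[of "max 0 x" b] omega_pos[of "max 0 x"] by (simp add: field_simps)
  qed
  then show ?thesis by (simp add: step_def Bcontfun_inverse)
qed

lemma step_contraction: "dist (step h b) (step h b') \<le> 1/2 * dist b b'"
proof (rule dist_bound)
  fix x :: real
  let ?x = "max 0 x"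
  let ?u = "\<lambda>b x. lam * (x powr (-\<gamma>) *\<^sub>R (\<omega> x *\<^sub>R apply_bcontfun b x))"
  have "UU (?u b) ?x = UU (?u (b - b')) ?x + UU (?u b') ?x"
  proof -
    have "?u b = (\<lambda>x. ?u (b - b') x + ?u b' x)"
      by (rule ext) (simp add: algebra_simps)
    then show ?thesis
      by (simp only: UU_add[OF u_JJ_bound(1,2)[OF bc_cont bc_le] u_JJ_bound(1,2)[OF bc_cont bc_le], of ?x] max.cobounded1)
  qed
  then have "UU (source h b) ?x - UU (source h b') ?x = UU (?u (b - b')) ?x"
    by (simp add: source_UU)
  then have "cmod (UU (source h b) ?x - UU (source h b') ?x) \<le> 1/2 * norm (b - b') * \<omega> ?x"
    using UU_contraction[OF bc_cont bc_le, of ?x "b - b'"] by simp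
  then show "dist (apply_bcontfun (step h b) x) (apply_bcontfun (step h b') x) \<le> 1/2 * dist b b'"
    unfolding step_apply dist_norm scaleR_diff_right[symmetric] norm_scaleR
    using omega_pos[of ?x] by (simp add: divide_simps)
qed

text \<open>The norm bound comes from the fixed-point equation itself: half of the norm of b is
  absorbed on the left.\<close>

lemma fixed_point: "\<exists>b. step h b = b \<and> norm b \<le> 2 * C1 * L2_norm M h"
proof -
  have "\<exists>!b. step h b = b"
    by (rule banach_fix_type[of "1/2"]) (auto simp: step_contraction[simplified])
  then obtain b where b: "step h b = b" by blast
  have "norm b \<le> C1 * L2_norm M h + 1/2 * norm b"
  proof (rule norm_bound)
    fix x
    have "apply_bcontfun b x = (1 / \<omega> (max 0 x)) *\<^sub>R UU (source h b) (max 0 x)"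
      using step_apply[of b x] by (simp add: b)
    then show "norm (apply_bcontfun b x) \<le> C1 * L2_norm M h + 1/2 * norm b"
      using source_UU_le[of "max 0 x" b] omega_pos[of "max 0 x"] by (simp add: field_simps)
  qed
  with b show ?thesis by (intro exI[of _ b]) simp
qed

end

definition "C2 = q * sqrt Cw + k * (2 * C1) * (2 / (c * X)) * exp (- y X / 2)"
definition "C3 = 2 * C1 * exp (K * \<Phi> X)"
text \<open>Bounds w |p|^2 for a right-hand side of norm 1. Below \<open>X\<close> the function u is
  bounded; beyond it u is of order x^{\<gamma>-1} e^{y/2}, the exponential cancels against
  \<open>E\<close>, and x^{2\<gamma>-2} x^{-\<gamma>} = x^{\<gamma>-2} is integrable since \<gamma>
  < 1.\<close>

definition "majorant x = (if x \<le> X then C3\<^sup>2 * x powr (-\<gamma>) else (C2 * (2 / c))\<^sup>2 * x powr (\<gamma> - 2))"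

lemma majorant_integrable: "majorant integrable_on {0<..}"
proof -
  have "(\<lambda>x. C3\<^sup>2 * x powr (-\<gamma>)) absolutely_integrable_on {0..X}"
    using integrable_on_powr_from_0[of "-\<gamma>" X] X1 gamma1
    by (intro nonnegative_absolutely_integrable_1 integrable_on_mult_right) auto
  then have "(\<lambda>x. C3\<^sup>2 * x powr (-\<gamma>)) absolutely_integrable_on {0<..X}" by (rule set_integrable_subset) auto
  then have "(\<lambda>x. C3\<^sup>2 * x powr (-\<gamma>)) integrable_on {0<..X}" by (simp add: absolutely_integrable_on_def)
  then have 1: "majorant integrable_on {0<..X}" by (rule integrable_eq) (simp add: majorant_def)
  have "(\<lambda>x. x powr (\<gamma> - 2)) integrable_on {X..}"
    using has_integral_powr_to_inf[of "\<gamma> - 2" X] X1 gamma1 by auto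
  then have "(\<lambda>x. (C2 * (2 / c))\<^sup>2 * x powr (\<gamma> - 2)) integrable_on {X..}" by (rule integrable_on_mult_right)
  then have 2: "majorant integrable_on {X..}"
    by (rule integrable_spike_finite[of "{X}", rotated 2]) (auto simp: majorant_def)
  have "{0<..X} \<inter> {X..} = {X}" "{0<..X} \<union> {X..} = {0<..}" using X1 by auto
  then show ?thesis using integrable_Un[OF _ 1 2] by simp
qed

text \<open>The constant does not depend on h. Bounds for the data are included because imposing a
  boundary condition later requires a multiple of the Kummer solution that is controlled by
  them.\<close>

theorem shifted_equation_solvable:
  "\<exists>C\<ge>0. \<forall>h\<in>L2. \<exists>u0 j0 u J. sol u0 j0 u J (\<lambda>x. h x + lam * (x powr (-\<gamma>) *\<^sub>R u x)) \<and>
     cmod u0 \<le> C * L2_norm M h \<and> cmod j0 \<le> C * L2_norm M h \<and>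
     (L2_norm M (dens u))\<^sup>2 \<le> (C * L2_norm M h)\<^sup>2"
proof -
  define D where "D = q * sqrt Cw * exp (y X / 2) + k * (2 * C1) / K * \<omega> 0"
  define I where "I = integral {0<..} majorant"
  have I0: "I \<ge> 0" unfolding I_def by (rule integral_nonneg[OF majorant_integrable]) (simp add: majorant_def)
  define C where "C = C3 + D + sqrt I"
  have C3: "C3 \<ge> 0" using C1_nonneg by (simp add: C3_def)
  have D0: "D \<ge> 0" using q_pos Cw(1) k0 C1_nonneg K1 omega_pos[of 0] by (simp add: D_def)
  have "\<exists>u0 j0 u J. sol u0 j0 u J (\<lambda>x. h x + lam * (x powr (-\<gamma>) *\<^sub>R u x)) \<and>
     cmod u0 \<le> C * L2_norm M h \<and> cmod j0 \<le> C * L2_norm M h \<and>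
     (L2_norm M (dens u))\<^sup>2 \<le> (C * L2_norm M h)\<^sup>2" if h: "h \<in> L2" for h
  proof -
    define N where "N = L2_norm M h"
    have N0: "N \<ge> 0" unfolding N_def by (rule L2_norm_nonneg)
    obtain b where b: "step h b = b" and nb: "norm b \<le> 2 * C1 * N" using fixed_point[OF h] by (auto simp: N_def)
    define u where "u = (\<lambda>x. \<omega> x *\<^sub>R apply_bcontfun b x)"
    define g where "g = source h b"
    note gi = source_int[OF h, where b = b, folded g_def] and gA = source_JJ_bound[OF h, where b = b, folded g_def]
    have g_eq: "g = (\<lambda>x. h x + lam * (x powr (-\<gamma>) *\<^sub>R u x))" by (auto simp: g_def source_def u_def)
    \<comment> \<open>The fixed-point equation multiplied by \<omega>: u is generated by its own
      source g, so its flux is \<open>JJ g\<close> and \<open>UU_deriv\<close> supplies the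
      differential equation.\<close>
    have uU: "u x = UU g x" if "x \<ge> 0" for x
      using step_apply[OF h, of b x] that omega_pos[of x] by (simp add: b u_def g_def)
    have A: "AA h b \<le> C2 * N"
    proof -
      have "k * norm b * (2 / (c * X)) * exp (- y X / 2) \<le> k * (2 * C1 * N) * (2 / (c * X)) * exp (- y X / 2)"
        using nb k0 c_pos X1 by (intro mult_right_mono mult_left_mono) auto
      then show ?thesis by (simp add: AA_def[OF h] C2_def N_def algebra_simps)
    qed
    have uw: "cmod (u x) \<le> 2 * C1 * N * \<omega> x" for x
      using bc_le[OF h, of x b] mult_right_mono[OF nb, of "\<omega> x"] omega_pos[of x] by (simp add: u_def)
    have uc: "continuous_on {0..} u" unfolding u_def by (rule bc_cont[OF h])
    have maj: "w x * (cmod (x powr (-\<gamma>) *\<^sub>R u x))\<^sup>2 \<le> N\<^sup>2 * majorant x" if x: "x > 0" for x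
    proof (cases "x \<le> X")
      case True
      have "cmod (u x) \<le> 2 * C1 * N * exp (K * \<Phi> X)"
        using uw[of x] mult_left_mono[OF omega_le_0[OF _ True], of "2 * C1 * N"] x C1_nonneg N0 by simp
      then have "(cmod (u x))\<^sup>2 \<le> (C3 * N)\<^sup>2" by (intro power_mono) (auto simp: C3_def mult_ac)
      then have "x powr (-\<gamma>) * E x * (cmod (u x))\<^sup>2 \<le> x powr (-\<gamma>) * 1 * (C3 * N)\<^sup>2"
        using E_le1[of x] E_pos[of x] by (intro mult_mono) (auto simp: less_imp_le)
      then show ?thesis unfolding w_norm_sq[OF x] using True by (simp add: majorant_def power_mult_distrib mult_ac)
    next
      case False
      then have "cmod (u x) \<le> AA h b * (2 / c) * x powr (\<gamma> - 1) * exp (y x / 2)"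
        using UU_right[OF gi gA, of x] uU[of x] x by simp
      also have "\<dots> \<le> C2 * N * (2 / c) * x powr (\<gamma> - 1) * exp (y x / 2)"
        using A c_pos by (intro mult_right_mono) auto
      finally have "(cmod (u x))\<^sup>2 \<le> (C2 * N * (2 / c) * x powr (\<gamma> - 1) * exp (y x / 2))\<^sup>2" by (intro power_mono) auto
      then have "x powr (-\<gamma>) * E x * (cmod (u x))\<^sup>2 \<le> x powr (-\<gamma>) * E x * (C2 * N * (2 / c) * x powr (\<gamma> - 1) * exp (y x / 2))\<^sup>2"
        using E_pos[of x] by (intro mult_left_mono) (auto simp: less_imp_le)
      also have "\<dots> = N\<^sup>2 * ((C2 * (2 / c))\<^sup>2 * ((x powr (\<gamma> - 1))\<^sup>2 * x powr (-\<gamma>)) * (E x * (exp (y x / 2))\<^sup>2))"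
        by (simp only: power_mult_distrib mult_ac)
      also have "E x * (exp (y x / 2))\<^sup>2 = 1" by (simp add: E_def power2_eq_square flip: exp_add)
      also have "(x powr (\<gamma> - 1))\<^sup>2 * x powr (-\<gamma>) = x powr (\<gamma> - 2)"
        by (simp add: power2_eq_square flip: powr_add)
      finally show ?thesis using False x by (simp only: w_norm_sq majorant_def if_False mult_1_right)
    qed
    have um: "dens u \<in> borel_measurable (lebesgue_on {0<..})"
      by (intro continuous_imp_measurable_on_sets_lebesgue continuous_intros continuous_on_subset[OF uc]) auto
    note uL = L2_bound[OF um integrable_on_mult_right[OF majorant_integrable] maj]
    have gL: "g \<in> L2" unfolding g_eq by (intro L2_add h L2_scale uL)
    define j0 where "j0 = - (q *\<^sub>R integral {0..X} g)"
    have s: "sol (u 0) j0 u (JJ g) g"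
      unfolding sol_def
    proof (intro conjI allI impI)
      show "(u \<longlongrightarrow> u 0) (at_right 0)"
        by (rule continuous_on_Icc_tendsto_right[of 0 1, OF continuous_on_subset[OF uc]]) auto
      fix x :: real assume x: "x > 0"
      show "JJ g x = j0 + q *\<^sub>R integral {0..x} g" by (simp add: JJ_def j0_def scaleR_diff_right)
      have "(UU g has_vector_derivative JJ g x + (c * x powr (1 - \<gamma>)) *\<^sub>R UU g x) (at x)" by (rule UU_deriv[OF gi gA x])
      then have "(u has_vector_derivative JJ g x + (c * x powr (1 - \<gamma>)) *\<^sub>R UU g x) (at x)"
        by (rule has_vector_derivative_transform_within_open[where S = "{0<..}"]) (use x uU in auto)
      then show "(u has_vector_derivative JJ g x + (c * x powr (1 - \<gamma>)) *\<^sub>R u x) (at x)" using uU[of x] x by simp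
    qed (use gL uL in auto)
    have "cmod (u 0) \<le> 2 * C1 * N * exp (K * \<Phi> X)"
      using uw[of 0] mult_left_mono[OF omega_le_0[of 0], of "2 * C1 * N"] X1 C1_nonneg N0 by simp
    then have u0: "cmod (u 0) \<le> C * N"
      using mult_right_mono[of C3 C N] C3 D0 I0 N0 by (simp add: C3_def C_def mult_ac)
    have "j0 = JJ g 0" by (simp add: JJ_def j0_def)
    also have "\<dots> = JJ h 0 + JJ (\<lambda>x. lam * (x powr (-\<gamma>) *\<^sub>R (\<omega> x *\<^sub>R apply_bcontfun b x))) 0"
      unfolding g_def by (rule source_JJ[OF h])
    also have "cmod \<dots> \<le> q * (N * sqrt Cw) * exp (y X / 2) + k * norm b / K * \<omega> 0"
      using h_JJ_bound(2)[OF h, of 0] u_JJ_bound(3)[OF bc_cont[OF h] bc_le[OF h], of 0 b] X1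
      by (intro norm_triangle_le add_mono) (auto simp: N_def)
    also have "k * norm b / K * \<omega> 0 \<le> k * (2 * C1 * N) / K * \<omega> 0"
      using nb k0 K1 omega_pos[of 0] by (intro mult_right_mono divide_right_mono mult_left_mono) auto
    also have "q * (N * sqrt Cw) * exp (y X / 2) + k * (2 * C1 * N) / K * \<omega> 0 = D * N"
      by (simp add: D_def algebra_simps)
    also have "D * N \<le> C * N" using C3 I0 N0 by (intro mult_right_mono) (auto simp: C_def)
    finally have j0: "cmod j0 \<le> C * N" by simp
    have "(L2_norm M (dens u))\<^sup>2 \<le> N\<^sup>2 * I" using uL(2) by (simp add: I_def)
    also have "\<dots> = (sqrt I * N)\<^sup>2" using I0 by (simp add: power_mult_distrib)
    also have "\<dots> \<le> (C * N)\<^sup>2" using C3 D0 I0 N0 by (intro power_mono mult_right_mono) (auto simp: C_def)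
    finally have "(L2_norm M (dens u))\<^sup>2 \<le> (C * N)\<^sup>2" .
    with s u0 j0 show ?thesis unfolding g_eq N_def by blast
  qed
  moreover have "C \<ge> 0" using C3 D0 I0 by (simp add: C_def)
  ultimately show ?thesis by blast
qed

end

section \<open>Recessive solutions of Kummer's equation\<close>

text \<open>The power t^z for t > 0 through the real logarithm: additivity in z and measurability on
  the whole line then come from the exponential alone.\<close>

definition cp :: "real \<Rightarrow> complex \<Rightarrow> complex" where "cp t z = exp (z * of_real (ln t))"

lemma cp_add: "cp t (z + w) = cp t z * cp t w" and cp_0: "cp t 0 = 1"
  and cp_minus: "cp t (- z) = inverse (cp t z)"
  by (auto simp: cp_def distrib_right exp_add exp_minus)

lemma cp_diff: "cp t (z - w) = cp t z / cp t w"
  using cp_add[of t z "- w"] by (simp add: cp_minus divide_inverse)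

lemma cp_mult: "s > 0 \<Longrightarrow> t > 0 \<Longrightarrow> cp (s * t) z = cp s z * cp t z"
  by (simp add: cp_def ln_mult distrib_left exp_add)

lemma cp_of_real: "t > 0 \<Longrightarrow> cp t (of_real r) = of_real (t powr r)"
  by (simp add: cp_def powr_def exp_of_real flip: of_real_mult)

lemma cp_1: "t > 0 \<Longrightarrow> cp t 1 = of_real t"
  using cp_of_real[of t 1] by simp

lemma norm_cp: "t > 0 \<Longrightarrow> cmod (cp t z) = t powr Re z"
  by (simp add: cp_def powr_def)

lemma cp_powr: "t > 0 \<Longrightarrow> of_real t powr z = cp t z"
  by (simp add: cp_def powr_def Ln_of_real)

lemma cp_measurable [measurable]: "(\<lambda>t. cp t z) \<in> borel_measurable borel"
  unfolding cp_def by measurable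

lemma cp_deriv: "t > 0 \<Longrightarrow> ((\<lambda>t. cp t z) has_vector_derivative z * cp t (z - 1)) (at t)"
proof -
  assume t: "t > 0"
  have "(ln has_real_derivative 1 / t) (at t)" using t by (auto intro!: derivative_eq_intros)
  then have "((\<lambda>t. complex_of_real (ln t)) has_vector_derivative of_real (1 / t)) (at t)"
    by (intro has_vector_derivative_of_real) (simp add: has_real_derivative_iff_has_vector_derivative)
  then have "((\<lambda>t. z * complex_of_real (ln t)) has_vector_derivative z * of_real (1 / t)) (at t)"
    by (rule has_vector_derivative_mult_right)
  from field_vector_diff_chain_at[OF this DERIV_exp]
  have "((\<lambda>t. cp t z) has_vector_derivative z * of_real (1 / t) * cp t z) (at t)"
    by (simp add: o_def cp_def)
  moreover have "cp t (z - 1) = cp t z * of_real (1 / t)" using t by (simp add: cp_diff cp_1 divide_inverse)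
  ultimately show ?thesis by (simp add: mult_ac)
qed

text \<open>Euler's integral after t = b s, in Bochner form over \<open>lborel\<close>, as Fubini's
  theorem will need it.\<close>

lemma Gamma_integral_scaled:
  assumes z: "Re z > 0" and b: "b > 0"
  shows "has_bochner_integral lborel (\<lambda>t. indicator {0<..} t *\<^sub>R (exp (- b * t) *\<^sub>R cp t (z - 1))) (Gamma z * cp b (- z))"
proof -
  define f where "f = (\<lambda>t. indicator {0<..} t *\<^sub>R (exp (- t) *\<^sub>R cp t (z - 1)))"
  have fm: "f \<in> borel_measurable borel" unfolding f_def by measurable
  have eq: "(\<lambda>t. complex_of_real t powr (z - 1) / of_real (exp t)) t = exp (- t) *\<^sub>R cp t (z - 1)" if "t \<in> {0<..}" for t
    using that by (simp add: cp_powr exp_minus scaleR_conv_of_real divide_inverse mult.commute)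
  have "(\<lambda>t. exp (- t) *\<^sub>R cp t (z - 1)) absolutely_integrable_on {0<..}"
    using absolutely_integrable_Gamma_integral'[OF z] eq by (subst (asm) set_integrable_cong[OF refl refl eq]) auto
  then have "integrable lebesgue f" unfolding f_def set_integrable_def .
  then have il: "integrable lborel f" using fm by (subst (asm) integrable_completion) auto
  then have "integral\<^sup>L lborel f = integral {0<..} (\<lambda>t. exp (- t) *\<^sub>R cp t (z - 1))"
    using set_borel_integral_eq_integral(2)[of "{0<..}" "\<lambda>t. exp (- t) *\<^sub>R cp t (z - 1)"]
    by (simp add: f_def set_integrable_def set_lebesgue_integral_def)
  also have "\<dots> = Gamma z"
    using has_integral_eq[OF eq Gamma_integral_complex'[OF z]] by (rule integral_unique)
  finally have "has_bochner_integral lborel f (Gamma z)" using il by (simp add: has_bochner_integral_iff)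
  then have "has_bochner_integral lborel (\<lambda>x. f (0 + b * x)) (Gamma z /\<^sub>R \<bar>b\<bar>)"
    using b by (subst (asm) lborel_has_bochner_integral_real_affine_iff[where c = b and t = 0]) auto
  then have "has_bochner_integral lborel (\<lambda>x. cp b (1 - z) * f (0 + b * x)) (cp b (1 - z) * (Gamma z /\<^sub>R \<bar>b\<bar>))"
    by (intro has_bochner_integral_mult_right) auto
  moreover have "cp b (1 - z) * (Gamma z /\<^sub>R \<bar>b\<bar>) = Gamma z * cp b (- z)"
    using b by (simp add: cp_diff cp_minus cp_1 scaleR_conv_of_real divide_inverse)
  moreover have "cp b (1 - z) * f (0 + b * x) = indicator {0<..} x *\<^sub>R (exp (- b * x) *\<^sub>R cp x (z - 1))" for x
  proof (cases "x > 0")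
    case True
    have "cp b (1 - z) * cp b (z - 1) = 1" by (simp flip: cp_add add: cp_0)
    then show ?thesis using True b by (simp add: f_def cp_mult[OF b True])
  qed (use b in \<open>auto simp: f_def indicator_def zero_less_mult_iff\<close>)
  ultimately show ?thesis by simp
qed

lemma powr_over_integrable:
  assumes "0 < s" "s < 1"
  shows "(\<lambda>t. t powr (-s) / (1 + t)) integrable_on {0::real<..}"
proof -
  let ?f = "\<lambda>t::real. t powr (-s) / (1 + t)"
  have m: "?f \<in> borel_measurable (lebesgue_on S)" if "S \<subseteq> {0<..}" "S \<in> sets lebesgue" for S
    using that by (intro continuous_imp_measurable_on_sets_lebesgue continuous_intros) (auto simp: add_nonneg_eq_0_iff subset_iff)
  have "(\<lambda>x. x powr (-s)) absolutely_integrable_on {0..1}"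
    using integrable_on_powr_from_0[of "-s" 1] assms by (intro nonnegative_absolutely_integrable_1) auto
  then have "(\<lambda>x. x powr (-s)) absolutely_integrable_on {0<..1}" by (rule set_integrable_subset) auto
  then have pi: "(\<lambda>x. x powr (-s)) integrable_on {0<..1}" by (simp add: absolutely_integrable_on_def)
  have 1: "?f integrable_on {0<..1}"
    by (rule measurable_bounded_by_integrable_imp_integrable[OF m[OF _ _] pi]) (auto simp: field_simps)
  have qi: "(\<lambda>x. x powr (-s - 1)) integrable_on {1..}"
    using has_integral_powr_to_inf[of "-s - 1" 1] assms by auto
  have 2: "?f integrable_on {1..}"
    by (rule measurable_bounded_by_integrable_imp_integrable[OF m[OF _ _] qi]) (auto simp: powr_diff field_simps)
  have "{0<..1} \<inter> {1..} = {1::real}" "{0<..1} \<union> {1..} = {0::real<..}" by auto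
  then show ?thesis using integrable_Un[OF _ 1 2] by simp
qed

lemma exp_diff_quadratic: "\<bar>exp s - 1 - s\<bar> \<le> s\<^sup>2 * exp \<bar>s\<bar>" for s :: real
proof -
  obtain \<xi> where \<xi>: "\<bar>\<xi>\<bar> \<le> \<bar>s\<bar>" "exp s = (\<Sum>m<2. s ^ m / fact m) + exp \<xi> / fact 2 * s ^ 2"
    using Maclaurin_exp_le[of s 2] by blast
  then have e: "exp s - 1 - s = exp \<xi> / 2 * s\<^sup>2" by (simp add: numeral_2_eq_2)
  have "\<bar>exp s - 1 - s\<bar> = exp \<xi> / 2 * s\<^sup>2" unfolding e by (simp add: abs_mult)
  also have "\<dots> \<le> exp \<bar>s\<bar> * s\<^sup>2"
  proof (rule mult_right_mono)
    have "exp \<xi> \<le> exp \<bar>s\<bar>" using \<xi>(1) by simp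
    then show "exp \<xi> / 2 \<le> exp \<bar>s\<bar>" using exp_gt_zero[of \<xi>] by linarith
  qed simp
  finally show ?thesis by (simp add: mult.commute)
qed

lemma norm_exp_minus_one_le:
  assumes "Re z \<le> 0" shows "cmod (exp z - 1) \<le> cmod z"
proof -
  have "cmod (exp z - exp 0) \<le> 1 * cmod (z - 0)"
  proof (rule field_differentiable_bound[of "{z. Re z \<le> 0}" exp exp])
    show "convex {z. Re z \<le> 0}" by (rule convex_halfspace_Re_le)
    show "(exp has_field_derivative exp w) (at w within {z. Re z \<le> 0})" for w :: complex
      by (auto intro!: derivative_eq_intros)
    show "cmod (exp w) \<le> 1" if "w \<in> {z. Re z \<le> 0}" for w using that by simp
  qed (use assms in auto)
  then show ?thesis by simp
qed

section \<open>The Laplace integral and its limits at 0\<close>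

locale kummer_laplace =
  fixes a :: real and \<Lambda> :: complex
  assumes a01: "0 < a" "a < 1" and Lam: "Re \<Lambda> \<ge> 1"
begin

text \<open>\<open>G 0\<close> is \<Gamma>(\<Lambda>-a) times Tricomi's function U(\<Lambda>-a, 1-a,
  r), and \<open>G n\<close> is (-1)^n times its n-th derivative in r.\<close>

definition "m t = cp t (\<Lambda> - of_real a - 1) * cp (1 + t) (- \<Lambda>)"
definition "G n r = integral {0<..} (\<lambda>t. (exp (- r * t) * t ^ n) *\<^sub>R m t)"

text \<open>For Re \<Lambda> \<ge> 1 the ratio t/(1+t) enters with a nonnegative exponent and may be
  dropped; a majorant without \<Lambda> remains.\<close>

lemma m_bound: "t > 0 \<Longrightarrow> cmod (m t) \<le> t powr (-a) / (1 + t)"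
proof -
  assume t: "t > 0"
  have "cmod (m t) = t powr (Re \<Lambda> - a - 1) * (1 + t) powr (- Re \<Lambda>)" using t by (simp add: m_def norm_mult norm_cp)
  also have "\<dots> = t powr (-a) / (1 + t) * (t powr (Re \<Lambda> - 1) / (1 + t) powr (Re \<Lambda> - 1))"
  proof -
    have "t powr (Re \<Lambda> - a - 1) = t powr (-a) * t powr (Re \<Lambda> - 1)" by (simp add: algebra_simps flip: powr_add)
    moreover have "(1 + t) powr (- Re \<Lambda>) = 1 / ((1 + t) * (1 + t) powr (Re \<Lambda> - 1))"
      using t by (simp add: powr_diff powr_minus divide_inverse)
    ultimately show ?thesis by simp
  qed
  also have "\<dots> \<le> t powr (-a) / (1 + t) * 1"
    using t Lam by (intro mult_left_mono) (auto intro!: powr_mono2)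
  finally show ?thesis by simp
qed

lemma m_measurable [measurable]: "m \<in> borel_measurable borel"
  unfolding m_def[abs_def] by measurable

lemma m_cont: "continuous_on {0<..} m"
  unfolding m_def[abs_def] cp_def by (intro continuous_intros) auto

lemma kernel_cont: "continuous_on {0<..} (\<lambda>t. (exp (- r * t) * t ^ n) *\<^sub>R m t)"
  by (intro continuous_intros m_cont)

lemma kernel_measurable: "(\<lambda>t. (exp (- r * t) * t ^ n) *\<^sub>R m t) \<in> borel_measurable (lebesgue_on {0<..})"
  by (rule continuous_imp_measurable_on_sets_lebesgue[OF kernel_cont]) simp

lemma m_integrable: "m absolutely_integrable_on {0<..}"
  by (rule measurable_bounded_by_integrable_imp_absolutely_integrable[OF _ _ powr_over_integrable[OF a01]])
     (auto intro: m_bound continuous_imp_measurable_on_sets_lebesgue[OF m_cont])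

lemma exp_powr_integrable:
  fixes r s :: real
  assumes "s > -1" "r > 0"
  shows "(\<lambda>t. exp (- r * t) * t powr s) integrable_on {0<..}"
proof -
  have "(\<lambda>t. complex_of_real t powr (of_real (s + 1) - 1) / of_real (exp (r * t))) absolutely_integrable_on {0<..}"
    by (rule absolutely_integrable_Gamma_integral) (use assms in auto)
  then have "(\<lambda>t. cmod (complex_of_real t powr (of_real (s + 1) - 1) / of_real (exp (r * t)))) integrable_on {0<..}"
    by (simp add: absolutely_integrable_on_def)
  then show ?thesis
    by (rule integrable_eq) (auto simp: norm_divide powr_of_real exp_minus divide_inverse mult.commute norm_mult norm_inverse)
qed

lemma kernel_integrable:
  assumes "r > 0 \<or> n = 0 \<and> r \<ge> 0"
  shows "(\<lambda>t. (exp (- r * t) * t ^ n) *\<^sub>R m t) absolutely_integrable_on {0<..}"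
proof (cases "n = 0")
  case True
  show ?thesis
  proof (rule measurable_bounded_by_integrable_imp_absolutely_integrable[OF kernel_measurable _ powr_over_integrable[OF a01]])
    fix t :: real assume t: "t \<in> {0<..}"
    have "exp (- r * t) * cmod (m t) \<le> 1 * (t powr (-a) / (1 + t))"
      using t assms by (intro mult_mono m_bound) auto
    then show "norm ((exp (- r * t) * t ^ n) *\<^sub>R m t) \<le> t powr (-a) / (1 + t)" by (simp add: True)
  qed simp
next
  case False
  then have r: "r > 0" using assms by auto
  show ?thesis
  proof (rule measurable_bounded_by_integrable_imp_absolutely_integrable[OF kernel_measurable _ exp_powr_integrable[OF _ r, of "real n - a"]])
    show "-1 < real n - a" using a01 by simp
    fix t :: real assume t: "t \<in> {0<..}"
    then have "cmod (m t) \<le> t powr (-a) / (1 + t)" by (intro m_bound) auto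
    also have "\<dots> \<le> t powr (-a) / 1" using t by (intro divide_left_mono) auto
    finally have "exp (- r * t) * t ^ n * cmod (m t) \<le> exp (- r * t) * t ^ n * t powr (-a)"
      using t by (intro mult_left_mono) auto
    also have "\<dots> = exp (- r * t) * t powr (real n - a)" using t by (simp add: powr_diff powr_minus powr_realpow divide_inverse)
    finally show "norm ((exp (- r * t) * t ^ n) *\<^sub>R m t) \<le> exp (- r * t) * t powr (real n - a)" using t by (simp add: abs_mult)
  qed simp
qed

lemma kernel_integrable': "r > 0 \<or> n = 0 \<and> r \<ge> 0 \<Longrightarrow> (\<lambda>t. (exp (- r * t) * t ^ n) *\<^sub>R m t) integrable_on {0<..}"
  "r > 0 \<or> n = 0 \<and> r \<ge> 0 \<Longrightarrow> (\<lambda>t. exp (- r * t) * t ^ n * cmod (m t)) integrable_on {0<..}"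
proof -
  assume "r > 0 \<or> n = 0 \<and> r \<ge> 0"
  from kernel_integrable[OF this]
  have 1: "(\<lambda>t. (exp (- r * t) * t ^ n) *\<^sub>R m t) integrable_on {0<..}"
    and 2: "(\<lambda>t. norm ((exp (- r * t) * t ^ n) *\<^sub>R m t)) integrable_on {0<..}" by (auto simp: absolutely_integrable_on_def)
  show "(\<lambda>t. (exp (- r * t) * t ^ n) *\<^sub>R m t) integrable_on {0<..}" by (rule 1)
  show "(\<lambda>t. exp (- r * t) * t ^ n * cmod (m t)) integrable_on {0<..}"
    by (rule integrable_eq[OF 2]) (simp add: abs_mult)
qed

text \<open>Differentiation under the integral with an explicit quadratic remainder: for |h| \<le>
  r/2 the error of the exponential costs at most e^{rt/2}, and e^{-rt/2} is left for
  convergence.\<close>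

lemma G_deriv:
  assumes r: "r > 0"
  shows "(G n has_vector_derivative - G (Suc n) r) (at r)"
proof -
  define C where "C = integral {0<..} (\<lambda>t. exp (- (r / 2) * t) * t ^ (n + 2) * cmod (m t))"
  have C0: "C \<ge> 0" unfolding C_def by (rule integral_nonneg[OF kernel_integrable'(2)]) (use r in auto)
  have est: "cmod (G n (r + h) - G n r - h *\<^sub>R (- G (Suc n) r)) \<le> h\<^sup>2 * C" if h: "\<bar>h\<bar> \<le> r / 2" for h
  proof -
    have i: "(\<lambda>t. (exp (- (r + h) * t) * t ^ n) *\<^sub>R m t) integrable_on {0<..}"
      "(\<lambda>t. (exp (- r * t) * t ^ n) *\<^sub>R m t) integrable_on {0<..}"
      "(\<lambda>t. (exp (- r * t) * t ^ Suc n) *\<^sub>R m t) integrable_on {0<..}"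
      by (rule kernel_integrable'(1); use r h in linarith)+
    have eq: "G n (r + h) - G n r - h *\<^sub>R (- G (Suc n) r) =
        integral {0<..} (\<lambda>t. (exp (- (r + h) * t) * t ^ n) *\<^sub>R m t - (exp (- r * t) * t ^ n) *\<^sub>R m t + h *\<^sub>R ((exp (- r * t) * t ^ Suc n) *\<^sub>R m t))"
      unfolding G_def integral_add[OF integrable_diff[OF i(1,2)] integrable_cmul[OF i(3)]] integral_diff[OF i(1,2)] integral_cmul by simp
    have "cmod (G n (r + h) - G n r - h *\<^sub>R (- G (Suc n) r)) \<le> integral {0<..} (\<lambda>t. h\<^sup>2 * (exp (- (r / 2) * t) * t ^ (n + 2) * cmod (m t)))"
      unfolding eq
    proof (rule integral_norm_bound_integral)
      show "(\<lambda>t. (exp (- (r + h) * t) * t ^ n) *\<^sub>R m t - (exp (- r * t) * t ^ n) *\<^sub>R m t + h *\<^sub>R ((exp (- r * t) * t ^ Suc n) *\<^sub>R m t)) integrable_on {0<..}"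
        using i by (intro integrable_add integrable_diff integrable_cmul)
      show "(\<lambda>t. h\<^sup>2 * (exp (- (r / 2) * t) * t ^ (n + 2) * cmod (m t))) integrable_on {0<..}"
        using r by (intro integrable_on_mult_right kernel_integrable'(2)) auto
      fix t :: real assume t: "t \<in> {0<..}"
      have "exp (- (r + h) * t) = exp (- r * t) * exp (- h * t)" by (simp add: algebra_simps flip: exp_add)
      then have "(exp (- (r + h) * t) * t ^ n) *\<^sub>R m t - (exp (- r * t) * t ^ n) *\<^sub>R m t + h *\<^sub>R ((exp (- r * t) * t ^ Suc n) *\<^sub>R m t)
          = (exp (- r * t) * t ^ n * (exp (- h * t) - 1 - (- h * t))) *\<^sub>R m t"
        by (simp add: algebra_simps scaleR_conv_of_real)
      also have "cmod \<dots> = exp (- r * t) * t ^ n * \<bar>exp (- h * t) - 1 - (- h * t)\<bar> * cmod (m t)"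
        using t by (simp add: abs_mult)
      also have "\<dots> \<le> exp (- r * t) * t ^ n * ((- h * t)\<^sup>2 * exp \<bar>- h * t\<bar>) * cmod (m t)"
        using t exp_diff_quadratic[of "- h * t"] by (intro mult_right_mono mult_left_mono) auto
      also have "\<dots> \<le> exp (- r * t) * t ^ n * ((- h * t)\<^sup>2 * exp (r / 2 * t)) * cmod (m t)"
        using t h by (intro mult_right_mono mult_left_mono) (auto simp: abs_mult)
      also have "\<dots> = h\<^sup>2 * (exp (- (r / 2) * t) * t ^ (n + 2) * cmod (m t))"
      proof -
        have "exp (- (r / 2) * t) = exp (- r * t) * exp (r / 2 * t)" by (simp flip: exp_add)
        then show ?thesis by (simp only: power_mult_distrib power_add power2_eq_square mult_ac minus_mult_minus)
      qed
      finally show "cmod ((exp (- (r + h) * t) * t ^ n) *\<^sub>R m t - (exp (- r * t) * t ^ n) *\<^sub>R m t + h *\<^sub>R ((exp (- r * t) * t ^ Suc n) *\<^sub>R m t))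
          \<le> h\<^sup>2 * (exp (- (r / 2) * t) * t ^ (n + 2) * cmod (m t))" .
    qed
    then show ?thesis unfolding C_def integral_mult_right .
  qed
  show ?thesis
    unfolding has_vector_derivative_def has_derivative_at_alt
  proof (intro conjI allI impI)
    show "bounded_linear (\<lambda>h. h *\<^sub>R - G (Suc n) r)" by (rule bounded_linear_scaleR_left)
    fix e :: real assume e: "e > 0"
    show "\<exists>d>0. \<forall>s. norm (s - r) < d \<longrightarrow> norm (G n s - G n r - (s - r) *\<^sub>R - G (Suc n) r) \<le> e * norm (s - r)"
    proof (intro exI[of _ "min (r / 2) (e / (C + 1))"] conjI allI impI)
      show "0 < min (r / 2) (e / (C + 1))" using r e C0 by simp
      fix s assume s: "norm (s - r) < min (r / 2) (e / (C + 1))"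
      have "\<bar>s - r\<bar> * (C + 1) \<le> e" using s C0 by (simp add: field_simps)
      then have "\<bar>s - r\<bar> * C \<le> e" using C0 by (smt (verit) abs_ge_zero mult_left_mono)
      then have "\<bar>s - r\<bar> * (\<bar>s - r\<bar> * C) \<le> \<bar>s - r\<bar> * e" by (intro mult_left_mono) auto
      then have "(s - r)\<^sup>2 * C \<le> e * norm (s - r)"
        by (simp only: power2_abs[symmetric, of "s - r"] power2_eq_square mult_ac real_norm_def)
      then show "norm (G n s - G n r - (s - r) *\<^sub>R - G (Suc n) r) \<le> e * norm (s - r)"
        using est[of "s - r"] s by simp
    qed
  qed
qed

text \<open>Integrating the total derivative of \<open>e\<^bsup>-rt\<^esup> t\<^bsup>\<Lambda>-a\<^esup> (1+t)\<^bsup>1-\<Lambda>\<^esup>\<close> gives Kummer's equation.\<close>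

lemma G_ode:
  assumes r: "r > 0"
  shows "of_real r * G 2 r = (\<Lambda> - of_real a) * G 0 r + of_real (1 - a - r) * G 1 r"
proof -
  let ?e = "\<lambda>n t. (exp (- r * t) * t ^ n) *\<^sub>R m t"
  define B where "B = (\<lambda>t. exp (- r * t) *\<^sub>R (cp t (\<Lambda> - of_real a) * cp (1 + t) (1 - \<Lambda>)))"
  define D where "D = (\<lambda>t. (\<Lambda> - of_real a) * ?e 0 t + of_real (1 - a - r) * ?e 1 t - of_real r * ?e 2 t)"
  have dB: "(B has_vector_derivative D t) (at t)" if t: "t > 0" for t
  proof -
    have "((\<lambda>t. exp (- r * t)) has_real_derivative - r * exp (- r * t)) (at t)" by (auto intro!: derivative_eq_intros)
    moreover have "((\<lambda>t. cp (1 + t) (1 - \<Lambda>)) has_vector_derivative 1 *\<^sub>R ((1 - \<Lambda>) * cp (1 + t) (1 - \<Lambda> - 1))) (at t)"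
      using t by (intro vector_diff_chain_at[of "\<lambda>t. 1 + t", unfolded o_def] cp_deriv) (auto intro!: derivative_eq_intros)
    ultimately have "(B has_vector_derivative exp (- r * t) *\<^sub>R (cp t (\<Lambda> - of_real a) * (1 *\<^sub>R ((1 - \<Lambda>) * cp (1 + t) (1 - \<Lambda> - 1)))
        + (\<Lambda> - of_real a) * cp t (\<Lambda> - of_real a - 1) * cp (1 + t) (1 - \<Lambda>)) +
        (- r * exp (- r * t)) *\<^sub>R (cp t (\<Lambda> - of_real a) * cp (1 + t) (1 - \<Lambda>))) (at t)"
      unfolding B_def using t by (intro has_vector_derivative_scaleR has_vector_derivative_mult cp_deriv)
    moreover have c1: "cp t (\<Lambda> - of_real a) = of_real t * cp t (\<Lambda> - of_real a - 1)"
      using t by (simp add: cp_diff cp_1)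
    moreover have c2: "cp (1 + t) (1 - \<Lambda>) = of_real (1 + t) * cp (1 + t) (- \<Lambda>)"
      using t cp_add[of "1 + t" 1 "- \<Lambda>"] by (simp add: cp_1)
    moreover have "exp (- r * t) *\<^sub>R (cp t (\<Lambda> - of_real a) * (1 *\<^sub>R ((1 - \<Lambda>) * cp (1 + t) (1 - \<Lambda> - 1)))
        + (\<Lambda> - of_real a) * cp t (\<Lambda> - of_real a - 1) * cp (1 + t) (1 - \<Lambda>)) +
        (- r * exp (- r * t)) *\<^sub>R (cp t (\<Lambda> - of_real a) * cp (1 + t) (1 - \<Lambda>)) = D t"
      unfolding c1 c2 D_def m_def by (simp add: scaleR_conv_of_real algebra_simps power2_eq_square)
    ultimately show ?thesis by simp
  qed
  have Di: "D absolutely_integrable_on {0<..}"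
    unfolding D_def using r by (intro set_integral_diff set_integral_add set_integrable_mult_right kernel_integrable) auto
  have Dsub: "D absolutely_integrable_on S" if "S \<subseteq> {0<..}" "S \<in> sets lebesgue" for S
    by (rule set_integrable_subset[OF Di]) (use that in auto)
  \<comment> \<open>The bound vanishes at 0 because a < 1 and at infinity because r > 0, so no
    boundary terms survive.\<close>
  have B_bound: "cmod (B t) \<le> exp (- r * t) * t powr (1 - a)" if t: "t > 0" for t
  proof -
    have "cmod (B t) = exp (- r * t) * (t powr (Re \<Lambda> - a) * (1 + t) powr (1 - Re \<Lambda>))"
      using t by (simp add: B_def norm_mult norm_cp)
    also have "t powr (Re \<Lambda> - a) * (1 + t) powr (1 - Re \<Lambda>) = t powr (1 - a) * (t powr (Re \<Lambda> - 1) / (1 + t) powr (Re \<Lambda> - 1))"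
      using t by (simp add: powr_diff field_simps)
    also have "exp (- r * t) * (t powr (1 - a) * (t powr (Re \<Lambda> - 1) / (1 + t) powr (Re \<Lambda> - 1))) \<le> exp (- r * t) * (t powr (1 - a) * 1)"
      using t Lam by (intro mult_left_mono) (auto intro!: powr_mono2)
    finally show ?thesis by simp
  qed
  have int: "integral {s..t} D = B t - B s" if "0 < s" "s \<le> t" for s t
    by (intro integral_unique fundamental_theorem_of_calculus that)
       (use that in \<open>auto intro: has_vector_derivative_at_within[OF dB]\<close>)
  have B_top: "(B \<longlongrightarrow> 0) at_top"
  proof (rule Lim_null_comparison)
    show "\<forall>\<^sub>F t in at_top. norm (B t) \<le> 1 / r * t powr (-a)"
    proof (rule eventually_mono[OF eventually_gt_at_top[of 0]])
      fix t :: real assume t: "0 < t"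
      have "r * t \<le> exp (r * t)" using exp_ge_add_one_self[of "r * t"] by linarith
      then have "exp (- r * t) \<le> 1 / (r * t)" using t r by (simp add: exp_minus field_simps)
      then have "exp (- r * t) * t powr (1 - a) \<le> 1 / (r * t) * t powr (1 - a)" by (intro mult_right_mono) auto
      also have "\<dots> = 1 / r * t powr (-a)" using t by (simp add: powr_diff powr_minus divide_inverse)
      finally show "norm (B t) \<le> 1 / r * t powr (-a)" using B_bound[OF t] by linarith
    qed
    have "((\<lambda>t. t powr (-a)) \<longlongrightarrow> 0) at_top" using a01 by (intro tendsto_neg_powr filterlim_ident) auto
    then show "((\<lambda>t. 1 / r * t powr (-a)) \<longlongrightarrow> 0) at_top" by (rule tendsto_mult_right_zero)
  qed
  have B_0: "(B \<longlongrightarrow> 0) (at_right 0)"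
  proof (rule Lim_null_comparison)
    show "\<forall>\<^sub>F t in at_right 0. norm (B t) \<le> t powr (1 - a)"
    proof (rule eventually_mono[OF eventually_at_right_less])
      fix t :: real assume t: "0 < t"
      have "exp (- r * t) * t powr (1 - a) \<le> 1 * t powr (1 - a)" using t r by (intro mult_right_mono) auto
      then show "norm (B t) \<le> t powr (1 - a)" using B_bound[OF t] by simp
    qed
    show "((\<lambda>t. t powr (1 - a)) \<longlongrightarrow> 0) (at_right 0)" using a01 by (intro powr_tendsto_0) simp
  qed
  have top: "integral {s..} D = - B s" if s: "s > 0" for s
  proof -
    have sub: "{s..} \<subseteq> {0<..}" using s by auto
    have "((\<lambda>t. B t - B s) \<longlongrightarrow> 0 - B s) at_top" by (intro tendsto_diff tendsto_const B_top)
    then have "((\<lambda>t. integral {s..t} D) \<longlongrightarrow> 0 - B s) at_top"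
      by (rule Lim_transform_eventually[OF _ eventually_mono[OF eventually_ge_at_top[of s]]]) (simp add: int[OF s])
    moreover have "((\<lambda>t. integral {s..t} D) \<longlongrightarrow> integral {s..} D) at_top"
      by (rule integral_Ici_tendsto[OF Dsub[OF sub]]) simp
    ultimately show ?thesis using tendsto_unique[OF trivial_limit_at_top_linorder] by fastforce
  qed
  have "((\<lambda>s. integral {s..} D) \<longlongrightarrow> integral {0<..} D) (at_right 0)" by (rule integral_Ioi_tendsto[OF Di])
  moreover have "((\<lambda>s. - B s) \<longlongrightarrow> - 0) (at_right 0)" by (intro tendsto_minus B_0)
  then have "((\<lambda>s. integral {s..} D) \<longlongrightarrow> - 0) (at_right 0)"
    by (rule Lim_transform_eventually[OF _ eventually_mono[OF eventually_at_right_less]]) (simp add: top)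
  ultimately have "integral {0<..} D = 0" using tendsto_unique[OF trivial_limit_at_right_real] by fastforce
  moreover have "integral {0<..} D = (\<Lambda> - of_real a) * G 0 r + of_real (1 - a - r) * G 1 r - of_real r * G 2 r"
  proof -
    have i: "?e n integrable_on {0<..}" for n using r by (intro kernel_integrable'(1)) auto
    show ?thesis
      unfolding D_def G_def
      by (subst integral_diff, (intro integrable_add integrable_on_mult_right i)+,
          subst integral_add, (intro integrable_on_mult_right i)+) (simp only: integral_mult_right)
  qed
  ultimately show ?thesis by simp
qed

lemma G_bound: "r \<ge> 1 \<Longrightarrow> cmod (G n r) \<le> integral {0<..} (\<lambda>t. exp (- 1 * t) * t ^ n * cmod (m t))"
proof -
  assume r: "r \<ge> 1"
  show ?thesis
    unfolding G_def
  proof (rule integral_norm_bound_integral)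
    show "(\<lambda>t. (exp (- r * t) * t ^ n) *\<^sub>R m t) integrable_on {0<..}" by (rule kernel_integrable'(1)) (use r in auto)
    show "(\<lambda>t. exp (- 1 * t) * t ^ n * cmod (m t)) integrable_on {0<..}" by (rule kernel_integrable'(2)) auto
    fix t :: real assume t: "t \<in> {0<..}"
    have "exp (- r * t) * t ^ n * cmod (m t) \<le> exp (- 1 * t) * t ^ n * cmod (m t)"
      using t r by (intro mult_right_mono) auto
    then show "norm ((exp (- r * t) * t ^ n) *\<^sub>R m t) \<le> exp (- 1 * t) * t ^ n * cmod (m t)" using t by (simp add: abs_mult)
  qed
qed

text \<open>1 - e^{-rt} is at most (rt)^{a/2}. The exponent a/2 is a compromise: it yields a power
  of r, and t^{a/2} times the majorant of \<open>m\<close> is still integrable.\<close>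

lemma G0_limit: "(G 0 \<longlongrightarrow> G 0 0) (at_right 0)"
proof (rule Lim_null[THEN iffD2], rule Lim_null_comparison)
  define C where "C = integral {0<..} (\<lambda>t. t powr (-(a / 2)) / (1 + t))"
  have i2: "(\<lambda>t. t powr (-(a / 2)) / (1 + t)) integrable_on {0::real<..}"
    using a01 by (intro powr_over_integrable) auto
  show "\<forall>\<^sub>F r in at_right 0. norm (G 0 r - G 0 0) \<le> C * r powr (a / 2)"
  proof (rule eventually_mono[OF eventually_at_right_less])
    fix r :: real assume r: "0 < r"
    have i: "(\<lambda>t. (exp (- r * t) * t ^ 0) *\<^sub>R m t) integrable_on {0<..}" "(\<lambda>t. (exp (- 0 * t) * t ^ 0) *\<^sub>R m t) integrable_on {0<..}"
      by (rule kernel_integrable'(1); use r in simp)+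
    have G: "G 0 r - G 0 0 = integral {0<..} (\<lambda>t. (exp (- r * t) * t ^ 0) *\<^sub>R m t - (exp (- 0 * t) * t ^ 0) *\<^sub>R m t)"
      unfolding G_def by (rule integral_diff[OF i, symmetric])
    have b: "norm (G 0 r - G 0 0) \<le> integral {0<..} (\<lambda>t. r powr (a / 2) * (t powr (-(a / 2)) / (1 + t)))"
      unfolding G
    proof (rule integral_norm_bound_integral[OF integrable_diff[OF i] integrable_on_mult_right[OF i2]])
      fix t :: real assume "t \<in> {0<..}"
      then have t: "t > 0" by simp
      have "1 - exp (- (r * t)) \<le> (r * t) powr (a / 2)"
      proof (cases "r * t \<le> 1")
        case True
        have "1 - exp (- (r * t)) \<le> r * t" using exp_ge_add_one_self[of "- (r * t)"] by linarith
        also have "\<dots> = (r * t) powr 1" using r t by simp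
        also have "\<dots> \<le> (r * t) powr (a / 2)" using True r t a01 by (intro powr_mono') auto
        finally show ?thesis .
      next
        case False
        have "1 \<le> (r * t) powr (a / 2)" using False a01 by (intro ge_one_powr_ge_zero) auto
        then show ?thesis using exp_ge_zero[of "- (r * t)"] by linarith
      qed
      moreover have "exp (- (r * t)) \<le> 1" using r t by simp
      ultimately have "\<bar>exp (- (r * t)) - 1\<bar> * cmod (m t) \<le> (r * t) powr (a / 2) * (t powr (-a) / (1 + t))"
        using m_bound[OF t] by (intro mult_mono) auto
      also have "(r * t) powr (a / 2) * (t powr (-a) / (1 + t)) = r powr (a / 2) * ((t powr (a / 2) * t powr (-a)) / (1 + t))"
        using r t by (simp add: powr_mult)
      also have "t powr (a / 2) * t powr (-a) = t powr (-(a / 2))" by (simp flip: powr_add)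
      finally have "\<bar>exp (- (r * t)) - 1\<bar> * cmod (m t) \<le> r powr (a / 2) * (t powr (-(a / 2)) / (1 + t))" .
      then show "norm ((exp (- r * t) * t ^ 0) *\<^sub>R m t - (exp (- 0 * t) * t ^ 0) *\<^sub>R m t) \<le> r powr (a / 2) * (t powr (-(a / 2)) / (1 + t))"
        by (simp flip: scaleR_diff_left add: scaleR_left_diff_distrib[of "exp (- (r * t))" 1 "m t", symmetric, simplified])
    qed
    show "norm (G 0 r - G 0 0) \<le> C * r powr (a / 2)" using b unfolding integral_mult_right C_def by (simp only: mult.commute)
  qed
  show "((\<lambda>r. C * r powr (a / 2)) \<longlongrightarrow> 0) (at_right 0)"
    using a01 by (intro tendsto_mult_right_zero powr_tendsto_0) simp
qed

text \<open>t m(t) is t^{-a} times (1 + 1/t)^{-\<Lambda>} = e^z with Re z \<le> 0. For t \<le> 1 the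
  crude bound 2 for |e^z - 1| is used, for t > 1 the bound |z| \<le> |\<Lambda>|/t; the constant
  makes both fit under 1/(1+t).\<close>

lemma m_asymptotic: "t > 0 \<Longrightarrow> cmod (t *\<^sub>R m t - of_real (t powr (-a))) \<le> (2 * cmod \<Lambda> + 4) * (t powr (-a) / (1 + t))"
proof -
  assume t: "t > 0"
  define z where "z = - \<Lambda> * of_real (ln (1 + 1 / t))"
  have l: "0 \<le> ln (1 + 1 / t)" "ln (1 + 1 / t) \<le> 1 / t" using t by (auto intro: ln_add_one_self_le_self)
  have rz: "Re z \<le> 0" using Lam l by (simp add: z_def)
  have "cp t (\<Lambda> - of_real a - 1) = of_real (t powr (-a)) * cp t \<Lambda> / of_real t"
    using t cp_of_real[of t "-a"] by (simp add: cp_diff cp_1 cp_minus divide_inverse mult.commute)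
  moreover have "cp t \<Lambda> * cp (1 + t) (- \<Lambda>) = exp z"
  proof -
    have "1 + 1 / t = (1 + t) / t" using t by (simp add: field_simps)
    then have "ln (1 + 1 / t) = ln (1 + t) - ln t" using t by (simp add: ln_div)
    then show ?thesis by (simp add: cp_def z_def right_diff_distrib flip: exp_add)
  qed
  ultimately have "t *\<^sub>R m t = of_real (t powr (-a)) * exp z"
    using t by (simp add: m_def scaleR_conv_of_real)
  then have "t *\<^sub>R m t - of_real (t powr (-a)) = of_real (t powr (-a)) * (exp z - 1)" by (simp add: algebra_simps)
  then have n: "cmod (t *\<^sub>R m t - of_real (t powr (-a))) = t powr (-a) * cmod (exp z - 1)" by (simp add: norm_mult)
  have "cmod (exp z - 1) \<le> (2 * cmod \<Lambda> + 4) / (1 + t)"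
  proof (cases "t \<le> 1")
    case True
    have "cmod (exp z - 1) \<le> cmod (exp z) + 1" using norm_triangle_ineq4[of "exp z" 1] by simp
    also have "\<dots> \<le> 2" using rz by simp
    also have "\<dots> \<le> (2 * cmod \<Lambda> + 4) / (1 + t)"
      using True t norm_ge_zero[of \<Lambda>] by (simp add: field_simps del: norm_ge_zero)
    finally show ?thesis .
  next
    case False
    have "cmod (exp z - 1) \<le> cmod z" by (rule norm_exp_minus_one_le[OF rz])
    also have "\<dots> = cmod \<Lambda> * ln (1 + 1 / t)" using l by (simp add: z_def norm_mult)
    also have "\<dots> \<le> cmod \<Lambda> * (1 / t)" using l by (intro mult_left_mono) auto
    also have "\<dots> \<le> (2 * cmod \<Lambda> + 4) / (1 + t)"
    proof -
      have "cmod \<Lambda> * 1 \<le> cmod \<Lambda> * t" using False by (intro mult_left_mono) auto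
      then show ?thesis using t by (simp add: field_simps)
    qed
    finally show ?thesis .
  qed
  then have "t powr (-a) * cmod (exp z - 1) \<le> t powr (-a) * ((2 * cmod \<Lambda> + 4) / (1 + t))" by (intro mult_left_mono) auto
  then show ?thesis unfolding n by (simp add: mult_ac)
qed

text \<open>Replacing t m(t) by t^{-a} turns \<open>G 1\<close> into \<Gamma>(1-a) r^{a-1}. By
  \<open>m_asymptotic\<close> the error is bounded uniformly in r, so the factor r^{1-a} removes
  it.\<close>

lemma G1_limit: "((\<lambda>r. r powr (1 - a) *\<^sub>R G 1 r) \<longlongrightarrow> Gamma (of_real (1 - a))) (at_right 0)"
proof (rule Lim_null[THEN iffD2], rule Lim_null_comparison)
  define C where "C = (2 * cmod \<Lambda> + 4) * integral {0<..} (\<lambda>t. t powr (-a) / (1 + t))"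
  show "\<forall>\<^sub>F r in at_right 0. norm (r powr (1 - a) *\<^sub>R G 1 r - Gamma (of_real (1 - a))) \<le> C * r powr (1 - a)"
  proof (rule eventually_mono[OF eventually_at_right_less])
    fix r :: real assume r: "0 < r"
    have "has_bochner_integral lborel (\<lambda>t. indicator {0<..} t *\<^sub>R (exp (- r * t) *\<^sub>R cp t (of_real (1 - a) - 1))) (Gamma (of_real (1 - a)) * cp r (- of_real (1 - a)))"
      by (rule Gamma_integral_scaled) (use a01 r in auto)
    then have g: "set_integrable lborel {0<..} (\<lambda>t. exp (- r * t) *\<^sub>R cp t (of_real (1 - a) - 1))"
      "set_lebesgue_integral lborel {0<..} (\<lambda>t. exp (- r * t) *\<^sub>R cp t (of_real (1 - a) - 1)) = Gamma (of_real (1 - a)) * cp r (- of_real (1 - a))"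
      by (auto simp: has_bochner_integral_iff set_integrable_def set_lebesgue_integral_def)
    have hi: "((\<lambda>t. exp (- r * t) *\<^sub>R cp t (of_real (1 - a) - 1)) has_integral (Gamma (of_real (1 - a)) * cp r (- of_real (1 - a)))) {0<..}"
      using set_borel_integral_eq_integral[OF g(1)] g(2) by (simp add: has_integral_iff)
    have c: "cp t (of_real (1 - a) - 1) = of_real (t powr (-a))" if "t > 0" for t
      using cp_of_real[OF that, of "-a"] by simp
    have h2: "((\<lambda>t. exp (- r * t) *\<^sub>R of_real (t powr (-a))) has_integral (Gamma (of_real (1 - a)) * cp r (- of_real (1 - a)))) {0<..}"
      by (rule has_integral_eq[OF _ hi]) (simp add: c[simplified])
    have i1: "(\<lambda>t. (exp (- r * t) * t ^ 1) *\<^sub>R m t) integrable_on {0<..}" by (rule kernel_integrable'(1)) (use r in simp)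
    have G: "G 1 r - Gamma (of_real (1 - a)) * cp r (- of_real (1 - a)) =
        integral {0<..} (\<lambda>t. (exp (- r * t) * t ^ 1) *\<^sub>R m t - exp (- r * t) *\<^sub>R of_real (t powr (-a)))"
      unfolding G_def using integral_diff[OF i1 has_integral_integrable[OF h2]] integral_unique[OF h2] by simp
    have "cmod (G 1 r - Gamma (of_real (1 - a)) * cp r (- of_real (1 - a))) \<le> integral {0<..} (\<lambda>t. (2 * cmod \<Lambda> + 4) * (t powr (-a) / (1 + t)))"
      unfolding G
    proof (rule integral_norm_bound_integral)
      show "(\<lambda>t. (exp (- r * t) * t ^ 1) *\<^sub>R m t - exp (- r * t) *\<^sub>R of_real (t powr (-a))) integrable_on {0<..}"
        using i1 h2 by (intro integrable_diff) auto
      show "(\<lambda>t. (2 * cmod \<Lambda> + 4) * (t powr (-a) / (1 + t))) integrable_on {0<..}"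
        by (intro integrable_on_mult_right powr_over_integrable a01)
      fix t :: real assume "t \<in> {0<..}"
      then have t: "t > 0" by simp
      have "(exp (- r * t) * t ^ 1) *\<^sub>R m t - exp (- r * t) *\<^sub>R of_real (t powr (-a)) = exp (- r * t) *\<^sub>R (t *\<^sub>R m t - of_real (t powr (-a)))"
        by (simp add: scaleR_diff_right)
      then have "norm ((exp (- r * t) * t ^ 1) *\<^sub>R m t - exp (- r * t) *\<^sub>R of_real (t powr (-a))) =
          exp (- r * t) * cmod (t *\<^sub>R m t - of_real (t powr (-a)))" by simp
      also have "\<dots> \<le> 1 * ((2 * cmod \<Lambda> + 4) * (t powr (-a) / (1 + t)))"
        using t r by (intro mult_mono m_asymptotic) auto
      finally show "norm ((exp (- r * t) * t ^ 1) *\<^sub>R m t - exp (- r * t) *\<^sub>R of_real (t powr (-a))) \<le> (2 * cmod \<Lambda> + 4) * (t powr (-a) / (1 + t))" by simp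
    qed
    then have "cmod (G 1 r - Gamma (of_real (1 - a)) * cp r (- of_real (1 - a))) \<le> C" unfolding integral_mult_right C_def .
    then have "r powr (1 - a) * cmod (G 1 r - Gamma (of_real (1 - a)) * cp r (- of_real (1 - a))) \<le> r powr (1 - a) * C"
      by (intro mult_left_mono) auto
    moreover have "r powr (1 - a) *\<^sub>R G 1 r - Gamma (of_real (1 - a)) =
        r powr (1 - a) *\<^sub>R (G 1 r - Gamma (of_real (1 - a)) * cp r (- of_real (1 - a)))"
      using cp_of_real[OF r, of "1 - a"] r by (simp only: cp_minus scaleR_diff_right) (simp add: scaleR_conv_of_real)
    ultimately show "norm (r powr (1 - a) *\<^sub>R G 1 r - Gamma (of_real (1 - a))) \<le> C * r powr (1 - a)"
      by (simp add: mult.commute)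
  qed
  show "((\<lambda>r. C * r powr (1 - a)) \<longlongrightarrow> 0) (at_right 0)"
    using a01 by (intro tendsto_mult_right_zero powr_tendsto_0) simp
qed

text \<open>Beta integral: integrate \<open>t\<^bsup>A-1\<^esup> s\<^bsup>\<Lambda>-1\<^esup> e\<^bsup>-s(1+t)\<^esup>\<close> in both orders, where \<open>A = \<Lambda> - a\<close>.\<close>

lemma G0_0: "G 0 0 * Gamma \<Lambda> = Gamma (\<Lambda> - of_real a) * Gamma (of_real a)"
proof -
  define A where "A = \<Lambda> - of_real a"
  have A: "Re A > 0" using Lam a01 by (simp add: A_def)
  have L: "Re \<Lambda> > 0" using Lam by simp
  define F where "F = (\<lambda>t s. (indicator {0<..} t * indicator {0<..} s * exp (- s * (1 + t))) *\<^sub>R (cp t (A - 1) * cp s (\<Lambda> - 1)))"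
  have ind: "indicator {0<..} t = (if t > 0 then 1 else 0 :: real)" for t :: real by (simp add: indicator_def)
  have Fs: "has_bochner_integral lborel (\<lambda>s. F t s) (indicator {0<..} t *\<^sub>R (Gamma \<Lambda> * m t))" for t
  proof (cases "t > 0")
    case True
    then have "has_bochner_integral lborel (\<lambda>s. cp t (A - 1) * (indicator {0<..} s *\<^sub>R (exp (- (1 + t) * s) *\<^sub>R cp s (\<Lambda> - 1)))) (cp t (A - 1) * (Gamma \<Lambda> * cp (1 + t) (- \<Lambda>)))"
      using L by (intro has_bochner_integral_mult_right Gamma_integral_scaled) auto
    moreover have "exp (- (1 + t) * s) = exp (- s * (1 + t))" for s by (simp add: algebra_simps)
    ultimately have "has_bochner_integral lborel (\<lambda>s. cp t (A - 1) * (indicator {0<..} s *\<^sub>R (exp (- s * (1 + t)) *\<^sub>R cp s (\<Lambda> - 1)))) (cp t (A - 1) * (Gamma \<Lambda> * cp (1 + t) (- \<Lambda>)))"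
      by (simp only:)
    then show ?thesis using True by (simp add: F_def ind A_def m_def mult_ac)
  qed (simp add: F_def ind has_bochner_integral_zero)
  have Ft: "(\<integral>t. F t s \<partial>lborel) = indicator {0<..} s *\<^sub>R (Gamma A * (exp (- 1 * s) *\<^sub>R cp s (of_real a - 1)))" for s
  proof (cases "s > 0")
    case True
    then have "has_bochner_integral lborel (\<lambda>t. (exp (- s) *\<^sub>R cp s (\<Lambda> - 1)) * (indicator {0<..} t *\<^sub>R (exp (- s * t) *\<^sub>R cp t (A - 1)))) ((exp (- s) *\<^sub>R cp s (\<Lambda> - 1)) * (Gamma A * cp s (- A)))"
      using A by (intro has_bochner_integral_mult_right Gamma_integral_scaled) auto
    then have "(\<integral>t. (exp (- s) *\<^sub>R cp s (\<Lambda> - 1)) * (indicator {0<..} t *\<^sub>R (exp (- s * t) *\<^sub>R cp t (A - 1))) \<partial>lborel) = (exp (- s) *\<^sub>R cp s (\<Lambda> - 1)) * (Gamma A * cp s (- A))"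
      by (rule has_bochner_integral_integral_eq)
    moreover have "(exp (- s) *\<^sub>R cp s (\<Lambda> - 1)) * (indicator {0<..} t *\<^sub>R (exp (- s * t) *\<^sub>R cp t (A - 1))) = F t s" for t
    proof -
      have "exp (- s) * exp (- s * t) = exp (- s * (1 + t))" by (simp add: algebra_simps flip: exp_add)
      then show ?thesis using True by (simp add: F_def ind mult_ac)
    qed
    moreover have "cp s (\<Lambda> - 1) * cp s (- A) = cp s (of_real a - 1)" by (simp add: A_def flip: cp_add)
    ultimately show ?thesis using True by (simp add: ind mult_ac)
  qed (simp add: F_def ind)
  have Fm: "(\<lambda>(t, s). F t s) \<in> borel_measurable (lborel \<Otimes>\<^sub>M lborel)"
    unfolding F_def by measurable
  have int: "integrable (lborel \<Otimes>\<^sub>M lborel) (\<lambda>(t, s). F t s)"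
  proof (rule lborel_pair.Fubini_integrable[OF Fm])
    show "AE t in lborel. integrable lborel (\<lambda>s. case (t, s) of (t, s) \<Rightarrow> F t s)"
      using Fs by (auto simp: has_bochner_integral_iff)
    \<comment> \<open>The inner integral of the norm is again a Gamma integral, with \<Lambda>
      replaced by its real part; it leaves a constant multiple of |m|, which is integrable.\<close>
    have n: "(\<integral>s. norm (F t s) \<partial>lborel) = indicator {0<..} t * (cmod (Gamma (of_real (Re \<Lambda>))) * (t powr (Re A - 1) * (1 + t) powr (- Re \<Lambda>)))" for t
    proof (cases "t > 0")
      case True
      have "has_bochner_integral lborel (\<lambda>s. indicator {0<..} s *\<^sub>R (exp (- (1 + t) * s) *\<^sub>R cp s (of_real (Re \<Lambda>) - 1))) (Gamma (of_real (Re \<Lambda>)) * cp (1 + t) (- of_real (Re \<Lambda>)))"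
        using L True by (intro Gamma_integral_scaled) auto
      from has_bochner_integral_bounded_linear[OF bounded_linear_Re this]
      have 1: "(\<integral>s. Re (indicator {0<..} s *\<^sub>R (exp (- (1 + t) * s) *\<^sub>R cp s (of_real (Re \<Lambda>) - 1))) \<partial>lborel) = Re (Gamma (of_real (Re \<Lambda>)) * cp (1 + t) (- of_real (Re \<Lambda>)))"
        by (rule has_bochner_integral_integral_eq)
      have "norm (F t s) = t powr (Re A - 1) * Re (indicator {0<..} s *\<^sub>R (exp (- (1 + t) * s) *\<^sub>R cp s (of_real (Re \<Lambda>) - 1)))" for s
      proof (cases "s > 0")
        case True2: True
        have "cp s (of_real (Re \<Lambda>) - 1) = of_real (s powr (Re \<Lambda> - 1))" using cp_of_real[OF True2, of "Re \<Lambda> - 1"] by simp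
        moreover have e: "- s * (1 + t) = - (1 + t) * s" by (simp add: algebra_simps)
        ultimately show ?thesis using True True2 unfolding F_def e by (simp add: ind norm_mult norm_cp mult_ac)
      qed (simp add: F_def ind)
      then have "(\<integral>s. norm (F t s) \<partial>lborel) = t powr (Re A - 1) * Re (Gamma (of_real (Re \<Lambda>)) * cp (1 + t) (- of_real (Re \<Lambda>)))"
        using 1 by simp
      also have "Gamma (of_real (Re \<Lambda>)) * cp (1 + t) (- of_real (Re \<Lambda>)) = of_real (Gamma (Re \<Lambda>) * (1 + t) powr (- Re \<Lambda>))"
        using cp_of_real[of "1 + t" "- Re \<Lambda>"] True by (simp add: Gamma_complex_of_real)
      finally show ?thesis using True L Gamma_real_pos[of "Re \<Lambda>"] by (simp add: ind Gamma_complex_of_real mult_ac)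
    qed (simp add: F_def ind)
    have "(\<lambda>t. cmod (m t)) absolutely_integrable_on {0<..}" using m_integrable by (rule set_integrable_norm)
    then have "integrable lebesgue (\<lambda>t. indicator {0<..} t *\<^sub>R cmod (m t))" unfolding set_integrable_def .
    then have "integrable lborel (\<lambda>t. indicator {0<..} t *\<^sub>R cmod (m t))"
      by (subst (asm) integrable_completion) auto
    then have "integrable lborel (\<lambda>t. cmod (Gamma (of_real (Re \<Lambda>))) * (indicator {0<..} t *\<^sub>R cmod (m t)))" by (rule integrable_mult_right)
    moreover have "cmod (Gamma (of_real (Re \<Lambda>))) * (indicator {0<..} t *\<^sub>R cmod (m t)) = (\<integral>s. norm (F t s) \<partial>lborel)" for t
      unfolding n by (cases "t > 0") (auto simp: ind m_def A_def norm_mult norm_cp)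
    ultimately have "integrable lborel (\<lambda>t. \<integral>s. norm (F t s) \<partial>lborel)" by (simp only:)
    then show "integrable lborel (\<lambda>t. \<integral>s. norm (case (t, s) of (t, s) \<Rightarrow> F t s) \<partial>lborel)" by simp
  qed
  have "(\<integral>s. (\<integral>t. F t s \<partial>lborel) \<partial>lborel) = (\<integral>t. (\<integral>s. F t s \<partial>lborel) \<partial>lborel)"
    by (rule lborel_pair.Fubini_integral[OF int])
  moreover have "(\<integral>t. (\<integral>s. F t s \<partial>lborel) \<partial>lborel) = Gamma \<Lambda> * G 0 0"
  proof -
    have "(\<integral>t. (\<integral>s. F t s \<partial>lborel) \<partial>lborel) = (\<integral>t. indicator {0<..} t *\<^sub>R (Gamma \<Lambda> * m t) \<partial>lborel)"
      using has_bochner_integral_integral_eq[OF Fs] by simp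
    also have "\<dots> = Gamma \<Lambda> * (\<integral>t. indicator {0<..} t *\<^sub>R m t \<partial>lborel)"
      by (simp only: mult_scaleR_right[symmetric] integral_mult_right_zero)
    also have "(\<integral>t. indicator {0<..} t *\<^sub>R m t \<partial>lborel) = integral {0<..} m"
    proof -
      have "integrable lebesgue (\<lambda>t. indicator {0<..} t *\<^sub>R m t)" using m_integrable unfolding set_integrable_def .
      then have "set_integrable lborel {0<..} m" unfolding set_integrable_def by (subst (asm) integrable_completion) auto
      from set_borel_integral_eq_integral(2)[OF this] show ?thesis by (simp add: set_lebesgue_integral_def)
    qed
    also have "integral {0<..} m = G 0 0" by (simp add: G_def)
    finally show ?thesis .
  qed
  moreover have "(\<integral>s. (\<integral>t. F t s \<partial>lborel) \<partial>lborel) = Gamma A * Gamma (of_real a)"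
  proof -
    have "has_bochner_integral lborel (\<lambda>t. indicator {0<..} t *\<^sub>R (exp (- 1 * t) *\<^sub>R cp t (of_real a - 1))) (Gamma (of_real a) * cp 1 (- of_real a))"
      by (rule Gamma_integral_scaled) (use a01 in auto)
    from has_bochner_integral_integral_eq[OF has_bochner_integral_mult_right[OF this, of "Gamma A"]]
    show ?thesis unfolding Ft by (simp add: cp_def)
  qed
  ultimately show ?thesis by (simp add: A_def mult.commute)
qed

end

text \<open>Kummer's equation \<open>r f'' + (1 - a - r) f' = (\<Lambda> - a) f\<close> as a system for \<open>f\<close> and \<open>g = f'\<close>, with polynomial
  growth at infinity; \<open>f0\<close> and \<open>g0\<close> correspond to the boundary data \<open>u0\<close> and \<open>j0\<close>.\<close>

definition recessive :: "real \<Rightarrow> complex \<Rightarrow> (real \<Rightarrow> complex) \<Rightarrow> (real \<Rightarrow> complex) \<Rightarrow> complex \<Rightarrow> complex \<Rightarrow> bool" where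
  "recessive a \<Lambda> f g f0 g0 \<longleftrightarrow>
     (\<forall>r>0. (f has_vector_derivative g r) (at r)) \<and>
     (\<forall>r>0. (g has_vector_derivative (1 / r) *\<^sub>R ((\<Lambda> - of_real a) * f r - of_real (1 - a - r) * g r)) (at r)) \<and>
     (\<exists>C n. \<forall>r\<ge>1. cmod (f r) \<le> C * (1 + r) ^ n \<and> cmod (g r) \<le> C * (1 + r) ^ n) \<and>
     (f \<longlongrightarrow> f0) (at_right 0) \<and> ((\<lambda>r. r powr (1 - a) *\<^sub>R g r) \<longlongrightarrow> g0) (at_right 0)"

section \<open>Continuation of the recessive solution to all \<Lambda>\<close>

lemma nonpos_Ints_Re_le_0: "z \<in> \<int>\<^sub>\<le>\<^sub>0 \<Longrightarrow> Re z \<le> 0"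
  by (auto elim!: nonpos_Ints_cases)

text \<open>The factor 1/\<Gamma>(\<Lambda>-a) cancels the numerator of \<open>G 0 0\<close> and
  leaves data without poles. Growth degree 0 suffices here; \<open>recessive\<close> admits
  polynomial growth because each lowering step raises the degree by one.\<close>

lemma recessive_Laplace:
  assumes "0 < a" "a < 1" "Re \<Lambda> \<ge> 1"
  shows "\<exists>f g. recessive a \<Lambda> f g (Gamma (of_real a) * rGamma \<Lambda>) (- Gamma (of_real (1 - a)) * rGamma (\<Lambda> - of_real a))"
proof -
  interpret kummer_laplace a \<Lambda> using assms by unfold_locales
  let ?k = "rGamma (\<Lambda> - of_real a)"
  have "Re (\<Lambda> - of_real a) > 0" using assms by simp
  then have G: "Gamma (\<Lambda> - of_real a) * ?k = 1"
    using nonpos_Ints_Re_le_0[of "\<Lambda> - of_real a"] rGamma_eq_zero_iff[of "\<Lambda> - of_real a"]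
    by (fastforce simp: Gamma_def)
  have "Gamma \<Lambda> * rGamma \<Lambda> = 1"
    using assms nonpos_Ints_Re_le_0[of \<Lambda>] rGamma_eq_zero_iff[of \<Lambda>] by (fastforce simp: Gamma_def)
  then have f0: "?k * G 0 0 = Gamma (of_real a) * rGamma \<Lambda>"
  proof -
    assume L: "Gamma \<Lambda> * rGamma \<Lambda> = 1"
    have "?k * G 0 0 = ?k * G 0 0 * (Gamma \<Lambda> * rGamma \<Lambda>)" unfolding L by simp
    also have "\<dots> = ?k * (G 0 0 * Gamma \<Lambda>) * rGamma \<Lambda>" by (simp only: mult_ac)
    also have "\<dots> = (Gamma (\<Lambda> - of_real a) * ?k) * (Gamma (of_real a) * rGamma \<Lambda>)" unfolding G0_0 by (simp only: mult_ac)
    finally show ?thesis unfolding G by simp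
  qed
  have "recessive a \<Lambda> (\<lambda>r. ?k * G 0 r) (\<lambda>r. - (?k * G 1 r)) (?k * G 0 0) (- (?k * Gamma (of_real (1 - a))))"
    unfolding recessive_def
  proof (intro conjI allI impI)
    fix r :: real assume r: "r > 0"
    show "((\<lambda>r. ?k * G 0 r) has_vector_derivative - (?k * G 1 r)) (at r)"
      using has_vector_derivative_mult_right[OF G_deriv[OF r, of 0], of ?k] by simp
    have "((\<lambda>r. - (?k * G 1 r)) has_vector_derivative ?k * G 2 r) (at r)"
      using has_vector_derivative_minus[OF has_vector_derivative_mult_right[OF G_deriv[OF r, of 1], of ?k]] by (simp add: numeral_2_eq_2)
    moreover have "?k * G 2 r = (1 / r) *\<^sub>R ((\<Lambda> - of_real a) * (?k * G 0 r) - of_real (1 - a - r) * (- (?k * G 1 r)))"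
      using arg_cong[OF G_ode[OF r], of "\<lambda>z. (1 / r) *\<^sub>R (?k * z)"] r by (simp add: scaleR_conv_of_real algebra_simps)
    ultimately show "((\<lambda>r. - (?k * G 1 r)) has_vector_derivative (1 / r) *\<^sub>R ((\<Lambda> - of_real a) * (?k * G 0 r) - of_real (1 - a - r) * (- (?k * G 1 r)))) (at r)"
      by simp
  next
    let ?C = "\<lambda>n. integral {0<..} (\<lambda>t. exp (- 1 * t) * t ^ n * cmod (m t))"
    let ?D = "cmod ?k * max (?C 0) (?C 1)"
    have "cmod ?k * cmod (G n r) \<le> cmod ?k * ?C n" if "r \<ge> 1" for n r using G_bound[OF that] by (intro mult_left_mono) auto
    moreover have "cmod ?k * ?C 0 \<le> ?D" "cmod ?k * ?C 1 \<le> ?D" by (auto intro!: mult_left_mono)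
    ultimately have "cmod ?k * cmod (G 0 r) \<le> ?D" "cmod ?k * cmod (G 1 r) \<le> ?D" if "r \<ge> 1" for r
      using that order_trans by blast+
    then show "\<exists>C n. \<forall>r\<ge>1. cmod (?k * G 0 r) \<le> C * (1 + r) ^ n \<and> cmod (- (?k * G 1 r)) \<le> C * (1 + r) ^ n"
      by (intro exI[of _ ?D] exI[of _ 0]) (simp add: norm_mult)
    show "((\<lambda>r. ?k * G 0 r) \<longlongrightarrow> ?k * G 0 0) (at_right 0)" by (intro tendsto_mult_left G0_limit)
    show "((\<lambda>r. r powr (1 - a) *\<^sub>R - (?k * G 1 r)) \<longlongrightarrow> - (?k * Gamma (of_real (1 - a)))) (at_right 0)"
      using tendsto_minus[OF tendsto_mult_left[OF G1_limit, of ?k]] by simp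
  qed
  then show ?thesis unfolding f0 by (auto simp: mult.commute)
qed

text \<open>The contiguous relation \<open>f \<mapsto> r f' + (1 - \<Lambda> - r) f\<close> lowers \<open>\<Lambda>\<close> by one.\<close>

lemma recessive_lower:
  assumes rec: "recessive a \<Lambda> f g f0 g0" and a01: "0 < a" "a < 1"
  shows "recessive a (\<Lambda> - 1) (\<lambda>r. of_real r * g r + (1 - \<Lambda> - of_real r) * f r)
    (\<lambda>r. (\<Lambda> - of_real a - 1) * (f r - g r)) ((1 - \<Lambda>) * f0) (- (\<Lambda> - of_real a - 1) * g0)"
proof -
  have df: "\<And>r. r > 0 \<Longrightarrow> (f has_vector_derivative g r) (at r)"
    and dg: "\<And>r. r > 0 \<Longrightarrow> (g has_vector_derivative (1 / r) *\<^sub>R ((\<Lambda> - of_real a) * f r - of_real (1 - a - r) * g r)) (at r)"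
    and f0: "(f \<longlongrightarrow> f0) (at_right 0)" and g0: "((\<lambda>r. r powr (1 - a) *\<^sub>R g r) \<longlongrightarrow> g0) (at_right 0)"
    using rec by (auto simp: recessive_def)
  obtain C n where C: "\<And>r. r \<ge> 1 \<Longrightarrow> cmod (f r) \<le> C * (1 + r) ^ n" "\<And>r. r \<ge> 1 \<Longrightarrow> cmod (g r) \<le> C * (1 + r) ^ n"
    using rec unfolding recessive_def by blast
  have C0: "C \<ge> 0" using C(1)[of 1] by (smt (verit) norm_ge_zero zero_le_mult_iff zero_less_power)
  have dr: "((\<lambda>r. complex_of_real r) has_vector_derivative 1) (at r)" for r
    using has_vector_derivative_of_real[OF DERIV_ident[of "at r"]] by simp
  have idl: "((\<lambda>r::real. complex_of_real r) \<longlongrightarrow> 0) (at_right 0)"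
    using tendsto_of_real[OF tendsto_ident_at[of "0::real" "{0<..}"], where 'a = complex] by simp
  show ?thesis
    unfolding recessive_def
  proof (intro conjI allI impI)
    fix r :: real assume r: "r > 0"
    have "((\<lambda>r. of_real r * g r + (1 - \<Lambda> - of_real r) * f r) has_vector_derivative
        (of_real r * ((1 / r) *\<^sub>R ((\<Lambda> - of_real a) * f r - of_real (1 - a - r) * g r)) + 1 * g r) +
        ((1 - \<Lambda> - of_real r) * g r + (0 - 1) * f r)) (at r)"
      by (intro has_vector_derivative_add has_vector_derivative_mult has_vector_derivative_diff has_vector_derivative_const dr df dg r)
    moreover have "(of_real r * ((1 / r) *\<^sub>R ((\<Lambda> - of_real a) * f r - of_real (1 - a - r) * g r)) + 1 * g r) +
        ((1 - \<Lambda> - of_real r) * g r + (0 - 1) * f r) = (\<Lambda> - of_real a - 1) * (f r - g r)"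
      using r by (simp add: scaleR_conv_of_real algebra_simps)
    ultimately show "((\<lambda>r. of_real r * g r + (1 - \<Lambda> - of_real r) * f r) has_vector_derivative (\<Lambda> - of_real a - 1) * (f r - g r)) (at r)"
      by simp
    have "((\<lambda>r. (\<Lambda> - of_real a - 1) * (f r - g r)) has_vector_derivative (\<Lambda> - of_real a - 1) *
        (g r - (1 / r) *\<^sub>R ((\<Lambda> - of_real a) * f r - of_real (1 - a - r) * g r))) (at r)"
      by (intro has_vector_derivative_mult_right has_vector_derivative_diff df dg r)
    moreover have "(\<Lambda> - of_real a - 1) * (g r - (1 / r) *\<^sub>R ((\<Lambda> - of_real a) * f r - of_real (1 - a - r) * g r)) =
        (1 / r) *\<^sub>R ((\<Lambda> - 1 - of_real a) * (of_real r * g r + (1 - \<Lambda> - of_real r) * f r) -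
          of_real (1 - a - r) * ((\<Lambda> - of_real a - 1) * (f r - g r)))"
      using r by (simp add: scaleR_conv_of_real field_simps)
    ultimately show "((\<lambda>r. (\<Lambda> - of_real a - 1) * (f r - g r)) has_vector_derivative
        (1 / r) *\<^sub>R ((\<Lambda> - 1 - of_real a) * (of_real r * g r + (1 - \<Lambda> - of_real r) * f r) -
          of_real (1 - a - r) * ((\<Lambda> - of_real a - 1) * (f r - g r)))) (at r)" by simp
  next
    let ?D = "max (C * (2 + cmod (1 - \<Lambda>))) (2 * cmod (\<Lambda> - of_real a - 1) * C)"
    have "cmod (of_real r * g r + (1 - \<Lambda> - of_real r) * f r) \<le> ?D * (1 + r) ^ Suc n \<and>
        cmod ((\<Lambda> - of_real a - 1) * (f r - g r)) \<le> ?D * (1 + r) ^ Suc n" if r: "r \<ge> 1" for r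
    proof
      let ?P = "C * (1 + r) ^ n"
      have P0: "?P \<ge> 0" using C0 r by simp
      have l: "cmod (1 - \<Lambda> - of_real r) \<le> cmod (1 - \<Lambda>) + r" using norm_triangle_ineq4[of "1 - \<Lambda>" "of_real r"] r by simp
      have "cmod (of_real r * g r + (1 - \<Lambda> - of_real r) * f r) \<le> r * cmod (g r) + cmod (1 - \<Lambda> - of_real r) * cmod (f r)"
        using norm_triangle_ineq[of "of_real r * g r" "(1 - \<Lambda> - of_real r) * f r"] r by (simp add: norm_mult)
      also have "\<dots> \<le> r * ?P + (cmod (1 - \<Lambda>) + r) * ?P"
        using C[OF r] l r by (intro add_mono mult_mono) auto
      also have "\<dots> = (2 * r + cmod (1 - \<Lambda>) * 1) * ?P" by (simp add: algebra_simps)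
      also have "\<dots> \<le> (2 * (1 + r) + cmod (1 - \<Lambda>) * (1 + r)) * ?P"
        using r P0 by (intro mult_right_mono add_mono mult_left_mono) auto
      also have "\<dots> = C * (2 + cmod (1 - \<Lambda>)) * (1 + r) ^ Suc n" by (simp add: algebra_simps)
      also have "\<dots> \<le> ?D * (1 + r) ^ Suc n" using r by (intro mult_right_mono) auto
      finally show "cmod (of_real r * g r + (1 - \<Lambda> - of_real r) * f r) \<le> ?D * (1 + r) ^ Suc n" .
      have "cmod ((\<Lambda> - of_real a - 1) * (f r - g r)) \<le> cmod (\<Lambda> - of_real a - 1) * (cmod (f r) + cmod (g r))"
        by (simp add: norm_mult mult_left_mono norm_triangle_ineq4)
      also have "\<dots> \<le> cmod (\<Lambda> - of_real a - 1) * (?P + ?P)" using C[OF r] by (intro mult_left_mono add_mono) auto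
      also have "\<dots> = 2 * cmod (\<Lambda> - of_real a - 1) * C * (1 + r) ^ n" by simp
      also have "\<dots> \<le> ?D * (1 + r) ^ Suc n" using r C0 by (intro mult_mono power_increasing) (auto simp: le_max_iff_disj)
      finally show "cmod ((\<Lambda> - of_real a - 1) * (f r - g r)) \<le> ?D * (1 + r) ^ Suc n" .
    qed
    then show "\<exists>C n. \<forall>r\<ge>1. cmod (of_real r * g r + (1 - \<Lambda> - of_real r) * f r) \<le> C * (1 + r) ^ n \<and>
        cmod ((\<Lambda> - of_real a - 1) * (f r - g r)) \<le> C * (1 + r) ^ n" by blast
    have "((\<lambda>r. r powr a *\<^sub>R (r powr (1 - a) *\<^sub>R g r)) \<longlongrightarrow> 0 *\<^sub>R g0) (at_right 0)"
      by (intro tendsto_scaleR powr_tendsto_0 g0 a01)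
    then have "((\<lambda>r. r powr a *\<^sub>R (r powr (1 - a) *\<^sub>R g r)) \<longlongrightarrow> 0) (at_right 0)" by simp
    then have rg: "((\<lambda>r. of_real r * g r) \<longlongrightarrow> 0) (at_right 0)"
      by (rule Lim_transform_eventually) (auto intro!: eventually_mono[OF eventually_at_right_less] simp: scaleR_conv_of_real simp flip: powr_add of_real_mult mult.assoc)
    have "((\<lambda>r. of_real r * g r + (1 - \<Lambda> - of_real r) * f r) \<longlongrightarrow> 0 + (1 - \<Lambda> - 0) * f0) (at_right 0)"
      by (intro tendsto_intros rg f0 idl)
    then show "((\<lambda>r. of_real r * g r + (1 - \<Lambda> - of_real r) * f r) \<longlongrightarrow> (1 - \<Lambda>) * f0) (at_right 0)" by simp
    have "((\<lambda>r. (\<Lambda> - of_real a - 1) * (r powr (1 - a) *\<^sub>R f r - r powr (1 - a) *\<^sub>R g r)) \<longlongrightarrow> (\<Lambda> - of_real a - 1) * (0 *\<^sub>R f0 - g0)) (at_right 0)"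
      using a01 by (intro tendsto_intros f0 g0 powr_tendsto_0) auto
    then show "((\<lambda>r. r powr (1 - a) *\<^sub>R ((\<Lambda> - of_real a - 1) * (f r - g r))) \<longlongrightarrow> - (\<Lambda> - of_real a - 1) * g0) (at_right 0)"
    proof -
      have "r powr (1 - a) *\<^sub>R ((\<Lambda> - of_real a - 1) * (f r - g r)) = (\<Lambda> - of_real a - 1) * (r powr (1 - a) *\<^sub>R f r - r powr (1 - a) *\<^sub>R g r)" for r
        by (simp only: scaleR_diff_right[symmetric] mult_scaleR_right)
      moreover have "- (\<Lambda> - of_real a - 1) * g0 = (\<Lambda> - of_real a - 1) * (0 *\<^sub>R f0 - g0)" by (simp add: algebra_simps)
      moreover assume "((\<lambda>r. (\<Lambda> - of_real a - 1) * (r powr (1 - a) *\<^sub>R f r - r powr (1 - a) *\<^sub>R g r)) \<longlongrightarrow> (\<Lambda> - of_real a - 1) * (0 *\<^sub>R f0 - g0)) (at_right 0)"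
      ultimately show ?thesis by (simp only:)
    qed
  qed
qed

text \<open>Finitely many unit shifts lead from any \<Lambda> into the half plane of the Laplace
  integral; n counts them. The data are carried along by 1/\<Gamma>(z) = z/\<Gamma>(z+1), which
  holds at the zeros of 1/\<Gamma> as well.\<close>

theorem recessive_exists:
  assumes a01: "0 < a" "a < 1"
  shows "\<exists>f g. recessive a \<Lambda> f g (Gamma (of_real a) * rGamma \<Lambda>) (- Gamma (of_real (1 - a)) * rGamma (\<Lambda> - of_real a))"
proof -
  have "\<exists>f g. recessive a \<Lambda> f g (Gamma (of_real a) * rGamma \<Lambda>) (- Gamma (of_real (1 - a)) * rGamma (\<Lambda> - of_real a))"
    if "Re \<Lambda> + real n \<ge> 1" for n \<Lambda>
    using that
  proof (induction n arbitrary: \<Lambda>)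
    case 0
    then show ?case using recessive_Laplace[OF a01] by simp
  next
    case (Suc n)
    then have "1 \<le> Re (\<Lambda> + 1) + real n" by simp
    from Suc.IH[OF this] obtain f g where fg: "recessive a (\<Lambda> + 1) f g (Gamma (of_real a) * rGamma (\<Lambda> + 1)) (- Gamma (of_real (1 - a)) * rGamma (\<Lambda> + 1 - of_real a))"
      by blast
    \<comment> \<open>Lowering from \<Lambda> + 1 multiplies the data by -\<Lambda> and
      -(\<Lambda>-a), whereas the recursion of 1/\<Gamma> asks for \<Lambda> and \<Lambda>-a; a
      change of sign repairs both.\<close>
    have neg: "recessive a \<Lambda>' (\<lambda>r. - f r) (\<lambda>r. - g r) (- f0) (- g0)" if rec: "recessive a \<Lambda>' f g f0 g0" for \<Lambda>' f g f0 g0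
      unfolding recessive_def
    proof (intro conjI allI impI)
      fix r :: real assume r: "r > 0"
      show "((\<lambda>r. - f r) has_vector_derivative - g r) (at r)"
        using rec r by (intro has_vector_derivative_minus) (auto simp: recessive_def)
      have "((\<lambda>r. - g r) has_vector_derivative - ((1 / r) *\<^sub>R ((\<Lambda>' - of_real a) * f r - of_real (1 - a - r) * g r))) (at r)"
        using rec r by (intro has_vector_derivative_minus) (auto simp: recessive_def)
      then show "((\<lambda>r. - g r) has_vector_derivative (1 / r) *\<^sub>R ((\<Lambda>' - of_real a) * - f r - of_real (1 - a - r) * - g r)) (at r)"
        by (simp flip: scaleR_minus_right)
    next
      show "\<exists>C n. \<forall>r\<ge>1. cmod (- f r) \<le> C * (1 + r) ^ n \<and> cmod (- g r) \<le> C * (1 + r) ^ n"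
        using rec by (simp add: recessive_def)
      show "((\<lambda>r. - f r) \<longlongrightarrow> - f0) (at_right 0)"
        using rec by (intro tendsto_minus) (simp add: recessive_def)
      have "((\<lambda>r. - (r powr (1 - a) *\<^sub>R g r)) \<longlongrightarrow> - g0) (at_right 0)"
        using rec by (intro tendsto_minus) (simp add: recessive_def)
      then show "((\<lambda>r. r powr (1 - a) *\<^sub>R - g r) \<longlongrightarrow> - g0) (at_right 0)" by simp
    qed
    have "rGamma \<Lambda> = \<Lambda> * rGamma (\<Lambda> + 1)" by (simp add: rGamma_plus1)
    moreover have "rGamma (\<Lambda> - of_real a) = (\<Lambda> - of_real a) * rGamma (\<Lambda> - of_real a + 1)" by (simp only: rGamma_plus1)
    moreover have "\<Lambda> + 1 - of_real a = \<Lambda> - of_real a + 1" by simp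
    ultimately have "- ((1 - (\<Lambda> + 1)) * (Gamma (of_real a) * rGamma (\<Lambda> + 1))) = Gamma (of_real a) * rGamma \<Lambda>"
      "- (- (\<Lambda> + 1 - of_real a - 1) * (- Gamma (of_real (1 - a)) * rGamma (\<Lambda> + 1 - of_real a))) = - Gamma (of_real (1 - a)) * rGamma (\<Lambda> - of_real a)"
      by (simp_all only:) (simp_all add: algebra_simps del: of_real_diff)
    moreover have "\<Lambda> + 1 - 1 = \<Lambda>" by simp
    ultimately show ?case
      using neg[OF recessive_lower[OF fg a01]] by metis
  qed
  moreover obtain n :: nat where "1 - Re \<Lambda> \<le> real n" using real_arch_simple by blast
  then have "Re \<Lambda> + real n \<ge> 1" by linarith
  ultimately show ?thesis by blast
qed

section \<open>Boundary conditions, spectrum and self-adjointness\<close>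

context cev_parameters
begin

section \<open>From Kummer's equation to eigensolutions\<close>

lemma y_tendsto_0: "filterlim y (at_right 0) (at_right 0)"
  unfolding filterlim_at
proof
  have "((\<lambda>x. \<kappa> * x powr (2 - \<gamma>)) \<longlongrightarrow> \<kappa> * 0) (at_right 0)"
    using gamma1 by (intro tendsto_intros powr_tendsto_0) auto
  then show "(y \<longlongrightarrow> 0) (at_right 0)" by (simp add: y_def[abs_def])
  show "\<forall>\<^sub>F x in at_right 0. y x \<in> {0<..} \<and> y x \<noteq> 0"
    using kappa by (auto simp: y_def intro!: eventually_mono[OF eventually_at_right_less])
qed

text \<open>1 + r \<le> N e^{r/N} with N = 4(n+1), raised to the power n+1.\<close>

lemma polynomial_le_exp: "\<exists>C\<ge>0. \<forall>r\<ge>1. (1 + r) ^ n \<le> C * exp (r / 4 :: real)" for n :: nat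
proof (intro exI[of _ "(4 * real (Suc n)) ^ Suc n"] conjI allI impI)
  fix r :: real assume r: "r \<ge> 1"
  define N where "N = 4 * real (Suc n)"
  have N: "N \<ge> 4" by (simp add: N_def)
  have "1 + r \<le> N * (1 + r / N)" using N r by (simp add: field_simps)
  also have "\<dots> \<le> N * exp (r / N)" using N by (intro mult_left_mono exp_ge_add_one_self) auto
  finally have "(1 + r) ^ Suc n \<le> (N * exp (r / N)) ^ Suc n" using r by (intro power_mono) auto
  also have "\<dots> = N ^ Suc n * exp (real (Suc n) * (r / N))"
    by (simp only: power_mult_distrib exp_of_nat_mult)
  also have "real (Suc n) * (r / N) = r / 4" by (simp add: N_def field_simps)
  finally have "(1 + r) ^ Suc n \<le> N ^ Suc n * exp (r / 4)" .
  moreover have "(1 + r) ^ n \<le> (1 + r) ^ Suc n" using r by (intro power_increasing) auto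
  ultimately show "(1 + r) ^ n \<le> (4 * real (Suc n)) ^ Suc n * exp (r / 4)" by (simp only: N_def)
qed simp

text \<open>The rate 1/4 is the one required by \<open>L2_subexponential\<close>. Near 0 the
  function is bounded because it extends continuously by \<open>f0\<close>.\<close>

lemma recessive_exp_bound:
  assumes rec: "recessive b \<Lambda> f g f0 g0"
  shows "\<exists>C. \<forall>r>0. cmod (f r) \<le> C * exp (r / 4)"
proof -
  have "\<exists>C n. \<forall>r\<ge>1. cmod (f r) \<le> C * (1 + r) ^ n \<and> cmod (g r) \<le> C * (1 + r) ^ n"
    using rec by (simp add: recessive_def)
  then obtain C n where "\<forall>r\<ge>1. cmod (f r) \<le> C * (1 + r) ^ n \<and> cmod (g r) \<le> C * (1 + r) ^ n"
    by (elim exE)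
  then have C: "\<And>r. r \<ge> 1 \<Longrightarrow> cmod (f r) \<le> C * (1 + r) ^ n" by simp
  obtain D where "D \<ge> 0 \<and> (\<forall>r\<ge>1. (1 + r) ^ n \<le> D * exp (r / 4 :: real))"
    using polynomial_le_exp[of n] by (elim exE)
  then have D: "D \<ge> 0" "\<And>r. r \<ge> 1 \<Longrightarrow> (1 + r) ^ n \<le> D * exp (r / 4)" by simp_all
  define F where "F = (\<lambda>r. if r \<le> 0 then f0 else f r)"
  have "continuous_on {0..1} F"
    unfolding F_def
  proof (rule continuous_on_extend_0)
    show "isCont f r" if "r > 0" for r
      using rec that by (intro has_vector_derivative_continuous[of f "g r"]) (simp add: recessive_def)
    show "(f \<longlongrightarrow> f0) (at_right 0)" using rec by (simp add: recessive_def)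
  qed simp
  from continuous_on_Icc_norm_bound[OF this] obtain B where B: "B \<ge> 0" "\<And>r. r \<in> {0..1} \<Longrightarrow> cmod (F r) \<le> B" by blast
  have C0: "C \<ge> 0" using C[of 1] by (smt (verit) norm_ge_zero zero_le_mult_iff zero_less_power)
  show ?thesis
  proof (intro exI[of _ "B + C * D"] allI impI)
    fix r :: real assume r: "r > 0"
    have e: "1 \<le> exp (r / 4)" using r by simp
    show "cmod (f r) \<le> (B + C * D) * exp (r / 4)"
    proof (cases "r \<le> 1")
      case True
      then have "cmod (f r) \<le> B" using B(2)[of r] r by (simp add: F_def)
      also have "\<dots> \<le> (B + C * D) * 1" using C0 D(1) by simp
      also have "\<dots> \<le> (B + C * D) * exp (r / 4)" using e B(1) C0 D(1) by (intro mult_left_mono) auto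
      finally show ?thesis .
    next
      case False
      then have "cmod (f r) \<le> C * (1 + r) ^ n" by (intro C) simp
      also have "\<dots> \<le> C * (D * exp (r / 4))" using False C0 D(2)[of r] by (intro mult_left_mono) auto
      also have "\<dots> \<le> (B + C * D) * exp (r / 4)" using B(1) by (simp add: distrib_right)
      finally show ?thesis .
    qed
  qed
qed

lemma sol_from_derivatives:
  assumes h: "h \<in> L2" and uL: "dens u \<in> L2"
    and du: "\<And>x. x > 0 \<Longrightarrow> (u has_vector_derivative J x + (c * x powr (1 - \<gamma>)) *\<^sub>R u x) (at x)"
    and dJ: "\<And>x. x > 0 \<Longrightarrow> (J has_vector_derivative q *\<^sub>R h x) (at x)"
    and u0: "(u \<longlongrightarrow> u0) (at_right 0)" and j0: "(J \<longlongrightarrow> j0) (at_right 0)"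
  shows "sol u0 j0 u J h"
  unfolding sol_def
proof (intro conjI allI impI h uL u0 du)
  fix x :: real assume x: "x > 0"
  define Jt where "Jt = (\<lambda>t. if t \<le> 0 then j0 else J t)"
  have dJt: "(Jt has_vector_derivative q *\<^sub>R h t) (at t)" if t: "t > 0" for t
    by (rule has_vector_derivative_transform_within_open[OF dJ[OF t], where S = "{0<..}"]) (use t in \<open>auto simp: Jt_def\<close>)
  have cJt: "continuous_on {0..x} Jt"
    unfolding Jt_def by (rule continuous_on_extend_0[OF has_vector_derivative_continuous[OF dJ] j0 x])
  have "((\<lambda>t. q *\<^sub>R h t) has_integral Jt x - Jt 0) {0..x}"
    by (rule fundamental_theorem_of_calculus_interior[OF _ cJt]) (use x dJt in auto)
  from integral_unique[OF this] show "J x = j0 + q *\<^sub>R integral {0..x} h"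
    using x unfolding integral_cmul by (simp add: Jt_def)
qed

text \<open>Substitution r = y x. From u' = c x^{1-\<gamma>} g(y x) the flux is c x^{1-\<gamma>} (g
  - f). Since (2-\<gamma>)(1-a) = 1-\<gamma>, the prefactor equals (2-\<gamma>) \<kappa>^a y^{1-a},
  and the limit of r^{1-a} g gives the initial flux.\<close>

lemma recessive_sol:
  assumes rec: "recessive a \<Lambda> f g f0 g0"
  shows "sol f0 (of_real ((2 - \<gamma>) * \<kappa> powr a) * g0) (\<lambda>x. f (y x))
    (\<lambda>x. (c * x powr (1 - \<gamma>)) *\<^sub>R (g (y x) - f (y x)))
    (\<lambda>x. of_real (\<mu> * (2 - \<gamma>)) * (\<Lambda> - 1) * (x powr (-\<gamma>) *\<^sub>R f (y x)))"
proof -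
  let ?Y = "\<lambda>x. c * x powr (1 - \<gamma>)"
  let ?lam = "of_real (\<mu> * (2 - \<gamma>)) * (\<Lambda> - 1)"
  let ?u = "\<lambda>x. f (y x)"
  let ?J = "\<lambda>x. ?Y x *\<^sub>R (g (y x) - f (y x))"
  let ?j0 = "of_real ((2 - \<gamma>) * \<kappa> powr a) * g0"
  have df: "\<And>r. r > 0 \<Longrightarrow> (f has_vector_derivative g r) (at r)"
    and dg: "\<And>r. r > 0 \<Longrightarrow> (g has_vector_derivative (1 / r) *\<^sub>R ((\<Lambda> - of_real a) * f r - of_real (1 - a - r) * g r)) (at r)"
    and f0: "(f \<longlongrightarrow> f0) (at_right 0)" and g0: "((\<lambda>r. r powr (1 - a) *\<^sub>R g r) \<longlongrightarrow> g0) (at_right 0)"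
    using rec by (auto simp: recessive_def)
  have ypos: "y x > 0" if "x > 0" for x using kappa that by (simp add: y_def)
  have dy: "(y has_vector_derivative ?Y x) (at x)" if "x > 0" for x
    using y_deriv[OF that] by (simp add: has_real_derivative_iff_has_vector_derivative)
  have du: "(?u has_vector_derivative ?Y x *\<^sub>R g (y x)) (at x)" if x: "x > 0" for x
    using vector_diff_chain_at[OF dy[OF x] df[OF ypos[OF x]]] by (simp add: o_def)
  have dgy: "((\<lambda>x. g (y x)) has_vector_derivative ?Y x *\<^sub>R ((1 / y x) *\<^sub>R ((\<Lambda> - of_real a) * f (y x) - of_real (1 - a - y x) * g (y x)))) (at x)" if x: "x > 0" for x
    using vector_diff_chain_at[OF dy[OF x] dg[OF ypos[OF x]]] by (simp add: o_def)
  have dJ: "(?J has_vector_derivative q *\<^sub>R (?lam * (x powr (-\<gamma>) *\<^sub>R ?u x))) (at x)" if x: "x > 0" for x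
  proof -
    have dY: "(?Y has_real_derivative c * ((1 - \<gamma>) * x powr (-\<gamma>))) (at x)"
      using x by (auto intro!: derivative_eq_intros)
    define X where "X = x powr (-\<gamma>)"
    \<comment> \<open>The chain rule produces y' squared; divided by y it is again a multiple of
      x^{-\<gamma>}, the factor that turns u into p. This clears the 1/r in Kummer's
      equation.\<close>
    have YY: "?Y x * (?Y x * (1 / y x)) = c * (2 - \<gamma>) * X"
    proof -
      have "x powr (1 - \<gamma>) * x powr (1 - \<gamma>) = x powr (2 - \<gamma>) * X"
        unfolding X_def by (simp flip: powr_add)
      then have "?Y x * ?Y x = c * (2 - \<gamma>) * X * y x" by (simp add: y_def c_kappa mult_ac)
      then show ?thesis using ypos[OF x] by (simp add: field_simps)
    qed
    have Yx: "?Y x * ?Y x = c * (2 - \<gamma>) * X * y x" using YY ypos[OF x] by (simp add: field_simps)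
    have "(?J has_vector_derivative ?Y x *\<^sub>R (?Y x *\<^sub>R ((1 / y x) *\<^sub>R ((\<Lambda> - of_real a) * f (y x) - of_real (1 - a - y x) * g (y x))) - ?Y x *\<^sub>R g (y x))
        + (c * ((1 - \<gamma>) * X)) *\<^sub>R (g (y x) - f (y x))) (at x)" (is "(_ has_vector_derivative ?R) _")
      unfolding X_def by (rule has_vector_derivative_scaleR[OF dY has_vector_derivative_diff[OF dgy[OF x] du[OF x]]])
    moreover have "?R = q *\<^sub>R (?lam * (X *\<^sub>R ?u x))"
    proof -
      have "?R = (?Y x * (?Y x * (1 / y x))) *\<^sub>R ((\<Lambda> - of_real a) * f (y x) - of_real (1 - a - y x) * g (y x)) - (?Y x * ?Y x) *\<^sub>R g (y x)
        + (c * ((1 - \<gamma>) * X)) *\<^sub>R (g (y x) - f (y x))" by (simp only: scaleR_diff_right scaleR_scaleR)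
      also have "\<dots> = of_real (c * X) * (of_real (2 - \<gamma>) * ((\<Lambda> - of_real a) * f (y x) - of_real (1 - a - y x) * g (y x)) - of_real ((2 - \<gamma>) * y x) * g (y x)
        + of_real (1 - \<gamma>) * (g (y x) - f (y x)))"
        unfolding YY Yx scaleR_conv_of_real by (simp add: algebra_simps)
      also have "\<dots> = of_real (c * X) * (of_real (2 - \<gamma>) * (\<Lambda> * f (y x)) - of_real ((2 - \<gamma>) * a) * f (y x)  + of_real ((2 - \<gamma>) * a) * g (y x) - g (y x) - of_real (1 - \<gamma>) * f (y x))"
        by (simp add: algebra_simps)
      \<comment> \<open>With (2-\<gamma>) a = 1 the terms in g cancel and those in f combine to
        (2-\<gamma>)(\<Lambda>-1): the origin of the shift by 1 in the eigenvalues.\<close>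
      also have "\<dots> = of_real (c * X) * (of_real (2 - \<gamma>) * ((\<Lambda> - 1) * f (y x)))"
        unfolding a_bounds(3) by (simp add: algebra_simps)
      also have "\<dots> = q *\<^sub>R (?lam * (X *\<^sub>R ?u x))"
        unfolding c_mu[symmetric] scaleR_conv_of_real by simp
      finally show ?thesis .
    qed
    ultimately show ?thesis unfolding X_def by simp
  qed
  have Jlim: "(?J \<longlongrightarrow> ?j0) (at_right 0)"
  proof -
    have "((\<lambda>r. r powr (1 - a) *\<^sub>R g r - r powr (1 - a) *\<^sub>R f r) \<longlongrightarrow> g0 - 0 *\<^sub>R f0) (at_right 0)"
      using a_bounds by (intro tendsto_intros g0 f0 powr_tendsto_0) auto
    from filterlim_compose[OF this y_tendsto_0]
    have "((\<lambda>x. of_real ((2 - \<gamma>) * \<kappa> powr a) * (y x powr (1 - a) *\<^sub>R g (y x) - y x powr (1 - a) *\<^sub>R f (y x))) \<longlongrightarrow> of_real ((2 - \<gamma>) * \<kappa> powr a) * (g0 - 0 *\<^sub>R f0)) (at_right 0)"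
      by (rule tendsto_mult_left)
    then have "((\<lambda>x. of_real ((2 - \<gamma>) * \<kappa> powr a) * (y x powr (1 - a) *\<^sub>R g (y x) - y x powr (1 - a) *\<^sub>R f (y x))) \<longlongrightarrow> ?j0) (at_right 0)" by simp
    then show ?thesis
    proof (rule Lim_transform_eventually)
      have "of_real ((2 - \<gamma>) * \<kappa> powr a) * (y x powr (1 - a) *\<^sub>R g (y x) - y x powr (1 - a) *\<^sub>R f (y x)) = ?J x" if x: "x > 0" for x
      proof -
        have "(2 - \<gamma>) * (1 - a) = 1 - \<gamma>" using a_bounds(3) by (simp add: algebra_simps)
        then have "y x powr (1 - a) = \<kappa> powr (1 - a) * x powr (1 - \<gamma>)"
          using x kappa by (simp add: y_def powr_mult powr_powr)
        moreover have "\<kappa> powr a * \<kappa> powr (1 - a) = \<kappa>" using kappa by (simp flip: powr_add)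
        ultimately have "(2 - \<gamma>) * \<kappa> powr a * y x powr (1 - a) = ?Y x"
          by (simp add: c_kappa mult_ac)
        then show ?thesis by (simp add: scaleR_conv_of_real flip: right_diff_distrib mult.assoc of_real_mult)
      qed
      then show "\<forall>\<^sub>F x in at_right 0. of_real ((2 - \<gamma>) * \<kappa> powr a) * (y x powr (1 - a) *\<^sub>R g (y x) - y x powr (1 - a) *\<^sub>R f (y x)) = ?J x"
        by (auto intro!: eventually_mono[OF eventually_at_right_less])
    qed
  qed
  obtain C where C: "\<And>r. r > 0 \<Longrightarrow> cmod (f r) \<le> C * exp (r / 4)" using recessive_exp_bound[OF rec] by blast
  have uL: "dens ?u \<in> L2"
  proof (rule L2_subexponential)
    show "continuous_on {0<..} ?u"
      using du by (intro continuous_at_imp_continuous_on ballI has_vector_derivative_continuous) auto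
    show "cmod (?u x) \<le> C * exp (y x / 4)" if "x > 0" for x using C[OF ypos[OF that]] .
  qed
  show ?thesis
  proof (rule sol_from_derivatives)
    show "(\<lambda>x. ?lam * (x powr (-\<gamma>) *\<^sub>R ?u x)) \<in> L2" by (rule L2_scale[OF uL])
    show "(?u \<longlongrightarrow> f0) (at_right 0)" by (rule filterlim_compose[OF f0 y_tendsto_0])
    show "(?u has_vector_derivative ?J x + ?Y x *\<^sub>R ?u x) (at x)" if "x > 0" for x
      using du[OF that] by (simp add: scaleR_diff_right)
  qed (use uL dJ Jlim in auto)
qed

section \<open>Realizations given by a boundary condition\<close>

text \<open>Homogeneous real coordinates for the boundary condition treat all cases at once: (1,
  \<theta> \<kappa>^a a) for finite \<theta> and (0, 1) for \<theta> = \<infinity>.\<close>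

definition bc_op :: "real \<Rightarrow> real \<Rightarrow> real op_graph" where
  "bc_op s t = {(f, g). \<exists>u0 j0 u J. sol u0 j0 u J g \<and> f \<in> L2 \<and> ae_eq M f (dens u) \<and>
     of_real s * j0 + of_real t * u0 = 0}"

lemma bc_opI: "sol u0 j0 u J g \<Longrightarrow> of_real s * j0 + of_real t * u0 = 0 \<Longrightarrow> (dens u, g) \<in> bc_op s t"
  unfolding bc_op_def using sol_L2(2) ae_eq_refl by blast

lemma bc_opE:
  assumes "(f, g) \<in> bc_op s t"
  obtains u0 j0 u J where "sol u0 j0 u J g" "f \<in> L2" "ae_eq M f (dens u)" "of_real s * j0 + of_real t * u0 = 0"
  using assms unfolding bc_op_def by blast

lemma bc_op_L2: "(f, g) \<in> bc_op s t \<Longrightarrow> f \<in> L2 \<and> g \<in> L2"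
  by (auto simp: bc_op_def dest: sol_L2)

lemma cev_op_eq: "cev_op \<mu> \<sigma> \<gamma> \<theta> = bc_op 1 (\<theta> * \<kappa> powr a * a)"
  by (auto simp: cev_op_iff bc_op_def set_eq_iff)

lemma cev_op_inf_eq: "cev_op_inf \<mu> \<sigma> \<gamma> = bc_op 0 1"
  by (auto simp: cev_op_inf_iff bc_op_def set_eq_iff)

lemma ae_eq_add: "ae_eq M f f' \<Longrightarrow> ae_eq M g g' \<Longrightarrow> ae_eq M (\<lambda>x. f x + g x) (\<lambda>x. f' x + g' x)"
  unfolding ae_eq_def by (erule (1) eventually_elim2) simp

lemma ae_eq_scale: "ae_eq M f f' \<Longrightarrow> ae_eq M (\<lambda>x. k * f x) (\<lambda>x. k * f' x)"
  unfolding ae_eq_def by (erule eventually_mono) simp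

lemma L2_inner_ae:
  assumes "f \<in> L2" "f' \<in> L2" "g \<in> L2" "g' \<in> L2" "ae_eq M f f'" "ae_eq M g g'"
  shows "L2_inner M f g = L2_inner M f' g'"
  unfolding L2_inner_def
proof (rule integral_cong_AE)
  show "(\<lambda>x. f x * cnj (g x)) \<in> borel_measurable M" "(\<lambda>x. f' x * cnj (g' x)) \<in> borel_measurable M"
    using assms by (auto intro!: borel_measurable_integrable L2_mult_integrable L2_cnj)
  show "AE x in M. f x * cnj (g x) = f' x * cnj (g' x)"
    using assms(5,6) unfolding ae_eq_def by eventually_elim simp
qed

lemma L2_inner_linear:
  assumes "f \<in> L2" "g \<in> L2" "h \<in> L2"
  shows "L2_inner M (\<lambda>x. f x - k * g x) h = L2_inner M f h - k * L2_inner M g h"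
    and "L2_inner M h (\<lambda>x. f x - k * g x) = L2_inner M h f - cnj k * L2_inner M h g"
proof -
  have i: "integrable M (\<lambda>x. f x * cnj (h x))" "integrable M (\<lambda>x. g x * cnj (h x))"
    "integrable M (\<lambda>x. h x * cnj (f x))" "integrable M (\<lambda>x. h x * cnj (g x))"
    by (intro L2_mult_integrable L2_cnj assms)+
  show "L2_inner M (\<lambda>x. f x - k * g x) h = L2_inner M f h - k * L2_inner M g h"
    using i unfolding L2_inner_def by (simp add: left_diff_distrib mult.assoc)
  have "(\<lambda>x. h x * cnj (f x - k * g x)) = (\<lambda>x. h x * cnj (f x) - cnj k * (h x * cnj (g x)))"
    by (simp add: fun_eq_iff algebra_simps)
  then show "L2_inner M h (\<lambda>x. f x - k * g x) = L2_inner M h f - cnj k * L2_inner M h g"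
    using i unfolding L2_inner_def by simp
qed

lemma L2_inner_self_zero:
  assumes "f \<in> L2" "L2_inner M f f = 0"
  shows "ae_eq M f (\<lambda>x. 0)"
proof (rule L2_zero_ae[OF assms(1)])
  have "L2_inner M f f = (\<integral>x. of_real ((cmod (f x))\<^sup>2) \<partial>M)"
    unfolding L2_inner_def by (simp only: complex_norm_square)
  also have "\<dots> = of_real (\<integral>x. (cmod (f x))\<^sup>2 \<partial>M)" by (rule integral_complex_of_real)
  finally show "L2_norm M f = 0" using assms(2) by (simp add: L2_norm_def)
qed

text \<open>Green's formula applied to the conjugated second solution; the right-hand side is the
  sesquilinear form whose vanishing expresses symmetry.\<close>

lemma Green_inner:
  assumes s: "sol u0 j0 u J h" "f \<in> L2" "ae_eq M f (dens u)"
    and s': "sol v0 k0 v K l" "e \<in> L2" "ae_eq M e (dens v)"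
  shows "q *\<^sub>R (L2_inner M h e - L2_inner M f l) = u0 * cnj k0 - j0 * cnj v0"
proof -
  have L: "h \<in> L2" "dens u \<in> L2" "l \<in> L2" "dens v \<in> L2" using sol_L2[OF s(1)] sol_L2[OF s'(1)] by auto
  have "L2_inner M h e = L2_inner M h (dens v)"
    by (rule L2_inner_ae[OF L(1) L(1) s'(2) L(4) ae_eq_refl s'(3)])
  also have "\<dots> = integral {0<..} (\<lambda>x. w x *\<^sub>R (h x * cnj (dens v x)))" by (rule L2_inner_eq[OF L(1,4)])
  finally have 1: "L2_inner M h e = integral {0<..} (\<lambda>x. w x *\<^sub>R (h x * cnj (dens v x)))" .
  have "L2_inner M f l = L2_inner M (dens u) l"
    by (rule L2_inner_ae[OF s(2) L(2) L(3) L(3) s(3) ae_eq_refl])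
  also have "\<dots> = integral {0<..} (\<lambda>x. w x *\<^sub>R (dens u x * cnj (l x)))" by (rule L2_inner_eq[OF L(2,3)])
  finally have 2: "L2_inner M f l = integral {0<..} (\<lambda>x. w x *\<^sub>R (dens u x * cnj (l x)))" .
  have i1: "(\<lambda>x. w x *\<^sub>R (dens u x * cnj (l x))) integrable_on {0<..}"
    and i2: "(\<lambda>x. w x *\<^sub>R (h x * cnj (dens v x))) integrable_on {0<..}"
    by (rule set_lebesgue_integral_eq_integral(1)[OF L2_mult_absolutely_integrable[OF _ L2_cnj]], rule L, rule L)+
  have "integral {0<..} (\<lambda>x. w x *\<^sub>R (dens u x * cnj (l x) - h x * (x powr (-\<gamma>) *\<^sub>R cnj (v x))))
      = integral {0<..} (\<lambda>x. w x *\<^sub>R (dens u x * cnj (l x)) - w x *\<^sub>R (h x * cnj (dens v x)))"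
    by (simp add: scaleR_diff_right)
  also have "\<dots> = L2_inner M f l - L2_inner M h e" unfolding 1 2 by (rule integral_diff[OF i1 i2])
  finally have "q *\<^sub>R (L2_inner M f l - L2_inner M h e) = - (u0 * cnj k0 - j0 * cnj v0)"
    using Green_formula[OF s(1) sol_cnj[OF s'(1)]] by simp
  then have "- (q *\<^sub>R (L2_inner M f l - L2_inner M h e)) = u0 * cnj k0 - j0 * cnj v0" by simp
  then show ?thesis by (simp flip: scaleR_minus_right)
qed

text \<open>Boundary data and image depend only on the equivalence class: u is continuous on an open
  set, so vanishing almost everywhere means vanishing, and the system then kills \<open>J\<close>
  and, a.e., h.\<close>

lemma sol_zero:
  assumes s: "sol u0 j0 u J h" and z: "ae_eq M (dens u) (\<lambda>x. 0)"
  shows "ae_eq M h (\<lambda>x. 0)" "u0 = 0" "j0 = 0"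
proof -
  have n: "negligible {x. x > 0 \<and> u x \<noteq> 0}"
    using z unfolding ae_eq_def AE_M_negligible by (rule negligible_subset) auto
  have "open {x \<in> {0<..}. u x \<in> - {0}}"
    using continuous_open_preimage[OF sol_u_cont[OF s] open_greaterThan open_Compl[OF closed_singleton], of 0]
    by (simp add: vimage_def Int_def)
  then have "open {x. x > 0 \<and> u x \<noteq> 0}" by simp
  then have "{x. x > 0 \<and> u x \<noteq> 0} = {}" using n open_not_negligible by blast
  then have u: "u x = 0" if "x > 0" for x using that by auto
  have J: "J x = 0" if x: "x > 0" for x
  proof -
    have "((\<lambda>x. 0) has_vector_derivative (J x + (c * x powr (1 - \<gamma>)) *\<^sub>R u x)) (at x)"
      by (rule has_vector_derivative_transform_within_open[OF sol_deriv[OF s x], where S = "{0<..}"]) (use x u in auto)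
    from vector_derivative_unique_at[OF this has_vector_derivative_const] show ?thesis using u[OF x] by simp
  qed
  have "(u \<longlongrightarrow> 0) (at_right 0)"
    by (rule Lim_transform_eventually[OF tendsto_const]) (auto simp: u intro!: eventually_mono[OF eventually_at_right_less])
  then show "u0 = 0" using tendsto_unique[OF _ sol_u0[OF s]] by simp
  have "(J \<longlongrightarrow> 0) (at_right 0)"
    by (rule Lim_transform_eventually[OF tendsto_const]) (auto simp: J intro!: eventually_mono[OF eventually_at_right_less])
  then show "j0 = 0" using tendsto_unique[OF _ sol_J_cont(2)[OF s]] by simp
  have "h x = 0" if x: "x > 0" and d: "(J has_vector_derivative q *\<^sub>R h x) (at x)" for x
  proof -
    have "((\<lambda>x. 0) has_vector_derivative q *\<^sub>R h x) (at x)"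
      by (rule has_vector_derivative_transform_within_open[OF d, where S = "{0<..}"]) (use x J in auto)
    from vector_derivative_unique_at[OF this has_vector_derivative_const] show ?thesis using q_pos by simp
  qed
  then show "ae_eq M h (\<lambda>x. 0)"
    unfolding ae_eq_def AE_M_negligible
    by (intro negligible_subset[OF sol_J_derivative_AE[OF s]]) auto
qed

lemma sol_diff:
  assumes "sol u0 j0 u J h" "sol v0 k0 v K l"
  shows "sol (u0 - k * v0) (j0 - k * k0) (\<lambda>x. u x - k * v x) (\<lambda>x. J x - k * K x) (\<lambda>x. h x - k * l x)"
  using sol_add[OF assms(1) sol_scale[OF assms(2), of "- k"]] by simp

lemma resolvent_equation:
  "\<exists>C\<ge>0. \<forall>h\<in>L2. \<exists>u0 j0 u J. sol u0 j0 u J (\<lambda>x. h x + z * dens u x) \<and>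
     cmod u0 \<le> C * L2_norm M h \<and> cmod j0 \<le> C * L2_norm M h \<and> (L2_norm M (dens u))\<^sup>2 \<le> (C * L2_norm M h)\<^sup>2"
proof -
  interpret cev_resolvent \<mu> \<sigma> \<gamma> z by unfold_locales
  show ?thesis by (rule shifted_equation_solvable)
qed

text \<open>Pairing with the solution \<open>v\<close> of \<open>(L - z) v = cnj (dens u)\<close> shows that vanishing boundary data force \<open>u = 0\<close>.\<close>

lemma eigen_zero_data:
  assumes s: "sol 0 0 u J (\<lambda>x. z * dens u x)"
  shows "ae_eq M (dens u) (\<lambda>x. 0)"
proof -
  have L: "dens u \<in> L2" by (rule sol_L2[OF s])
  obtain C where C: "\<forall>h\<in>L2. \<exists>u0 j0 u J. sol u0 j0 u J (\<lambda>x. h x + z * dens u x) \<and>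
     cmod u0 \<le> C * L2_norm M h \<and> cmod j0 \<le> C * L2_norm M h \<and> (L2_norm M (dens u))\<^sup>2 \<le> (C * L2_norm M h)\<^sup>2"
    using resolvent_equation[of z] by (elim exE conjE)
  from bspec[OF C L2_cnj[OF L]] obtain v0 k0 v K where v: "sol v0 k0 v K (\<lambda>x. cnj (dens u x) + z * dens v x)"
    by blast
  have "q *\<^sub>R integral {0<..} (\<lambda>x. w x *\<^sub>R (dens u x * (cnj (dens u x) + z * dens v x) - z * dens u x * dens v x)) = 0"
    using Green_formula[OF s v] by simp
  then have "integral {0<..} (\<lambda>x. w x *\<^sub>R (dens u x * cnj (dens u x))) = 0"
    using q_pos by (simp add: algebra_simps)
  then have "L2_inner M (dens u) (dens u) = 0" by (simp only: L2_inner_eq[OF L L])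
  then show ?thesis by (rule L2_inner_self_zero[OF L])
qed

text \<open>For two eigensolutions with the same z the integrand in Green's formula cancels, so
  their data are proportional. The corresponding combination has zero data and vanishes by
  \<open>eigen_zero_data\<close>.\<close>

lemma eigen_multiple:
  assumes p: "sol \<alpha> \<beta> \<psi> \<Psi> (\<lambda>x. z * dens \<psi> x)" and nz: "\<alpha> \<noteq> 0 \<or> \<beta> \<noteq> 0"
    and s: "sol u0 j0 u J (\<lambda>x. z * dens u x)"
  obtains k where "u0 = k * \<alpha>" "j0 = k * \<beta>" "ae_eq M (dens u) (\<lambda>x. k * dens \<psi> x)"
proof -
  have "- (u0 * \<beta> - j0 * \<alpha>) = q *\<^sub>R integral {0<..} (\<lambda>x. w x *\<^sub>R (dens u x * (z * dens \<psi> x) - z * dens u x * dens \<psi> x))"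
    using Green_formula[OF s p] by simp
  also have "\<dots> = 0" by (simp add: mult_ac)
  finally have W: "u0 * \<beta> = j0 * \<alpha>" by simp
  obtain k where k: "u0 = k * \<alpha>" "j0 = k * \<beta>"
  proof (cases "\<alpha> = 0")
    case True
    then have "\<beta> \<noteq> 0" using nz by simp
    then show ?thesis using that[of "j0 / \<beta>"] W True by simp
  next
    case False
    then show ?thesis using that[of "u0 / \<alpha>"] W by (simp add: field_simps)
  qed
  have d: "dens (\<lambda>x. u x - k * \<psi> x) = (\<lambda>x. dens u x - k * dens \<psi> x)"
    by (simp add: scaleR_diff_right)
  have "sol 0 0 (\<lambda>x. u x - k * \<psi> x) (\<lambda>x. J x - k * \<Psi> x) (\<lambda>x. z * dens (\<lambda>x. u x - k * \<psi> x) x)"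
    using sol_diff[OF s p, of k] k by (simp add: d algebra_simps)
  from eigen_zero_data[OF this] have "ae_eq M (\<lambda>x. dens u x - k * dens \<psi> x) (\<lambda>x. 0)" unfolding d .
  then have "ae_eq M (dens u) (\<lambda>x. k * dens \<psi> x)" by (simp add: ae_eq_def)
  then show ?thesis using that k by blast
qed

text \<open>The eigenvector is not a null function because its data are not both 0; it violates the
  norm bound in \<open>resolvent_set\<close>, since A - z maps it to 0.\<close>

lemma eigenvalue_spectrum:
  assumes p: "sol \<alpha> \<beta> \<psi> \<Psi> (\<lambda>x. z * dens \<psi> x)" and nz: "\<alpha> \<noteq> 0 \<or> \<beta> \<noteq> 0"
    and bc: "of_real s * \<beta> + of_real t * \<alpha> = 0"
  shows "eigenspace_spanned_by M (bc_op s t) z (dens \<psi>)" "z \<in> op_spectrum M (bc_op s t)"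
proof -
  have L: "dens \<psi> \<in> L2" by (rule sol_L2[OF p])
  have in_op: "(dens \<psi>, \<lambda>x. z * dens \<psi> x) \<in> bc_op s t" by (rule bc_opI[OF p bc])
  have nonzero: "\<not> ae_eq M (dens \<psi>) (\<lambda>x. 0)" using sol_zero[OF p] nz by blast
  show "eigenspace_spanned_by M (bc_op s t) z (dens \<psi>)"
    unfolding eigenspace_spanned_by_def
  proof (intro conjI ballI)
    show "dens \<psi> \<in> eigenspace M (bc_op s t) z"
      unfolding eigenspace_def using in_op ae_eq_refl by blast
    show "\<not> ae_eq M (dens \<psi>) (\<lambda>x. 0)" by (rule nonzero)
    fix f assume "f \<in> eigenspace M (bc_op s t) z"
    then obtain g where g: "(f, g) \<in> bc_op s t" "ae_eq M g (\<lambda>x. z * f x)" by (auto simp: eigenspace_def)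
    from g(1) obtain u0 j0 u J where u: "sol u0 j0 u J g" "ae_eq M f (dens u)" by (rule bc_opE)
    have "sol u0 j0 u J (\<lambda>x. z * dens u x)"
      by (rule sol_cong[OF u(1) _ ae_eq_trans[OF g(2) ae_eq_scale[OF u(2)]]]) simp
    then obtain k where "ae_eq M (dens u) (\<lambda>x. k * dens \<psi> x)" by (rule eigen_multiple[OF p nz])
    then show "\<exists>k. ae_eq M f (\<lambda>x. k * dens \<psi> x)" using ae_eq_trans[OF u(2)] by blast
  qed
  show "z \<in> op_spectrum M (bc_op s t)"
  proof (rule ccontr)
    assume "z \<notin> op_spectrum M (bc_op s t)"
    then obtain C where "\<forall>(f, g)\<in>bc_op s t. L2_norm M f \<le> C * L2_norm M (\<lambda>x. g x - z * f x)"
      by (auto simp: op_spectrum_def resolvent_set_def)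
    with in_op have "L2_norm M (dens \<psi>) \<le> C * L2_norm M (\<lambda>x. z * dens \<psi> x - z * dens \<psi> x)" by fast
    then have "L2_norm M (dens \<psi>) \<le> 0" by (simp add: L2_norm_def)
    then have "L2_norm M (dens \<psi>) = 0" using L2_norm_nonneg[of "dens \<psi>"] by simp
    then show False using L2_zero_ae[OF L] nonzero by blast
  qed
qed

lemma resolvent_bc:
  assumes p: "sol \<alpha> \<beta> \<psi> \<Psi> (\<lambda>x. z * dens \<psi> x)"
    and bc: "of_real s * \<beta> + of_real t * \<alpha> \<noteq> 0"
  shows "z \<in> resolvent_set M (bc_op s t)"
proof -
  define d where "d = of_real s * \<beta> + of_real t * \<alpha>"
  have d: "d \<noteq> 0" using bc by (simp add: d_def)
  then have nz: "\<alpha> \<noteq> 0 \<or> \<beta> \<noteq> 0" by (auto simp: d_def)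
  have L: "dens \<psi> \<in> L2" by (rule sol_L2[OF p])
  obtain C where C0: "C \<ge> 0" and C: "\<And>h. h \<in> L2 \<Longrightarrow> \<exists>u0 j0 u J. sol u0 j0 u J (\<lambda>x. h x + z * dens u x) \<and>
     cmod u0 \<le> C * L2_norm M h \<and> cmod j0 \<le> C * L2_norm M h \<and> (L2_norm M (dens u))\<^sup>2 \<le> (C * L2_norm M h)\<^sup>2"
    using resolvent_equation[of z] by blast
  show ?thesis
    unfolding resolvent_set_def mem_Collect_eq
  proof (intro conjI ballI)
    fix h assume h: "h \<in> L2"
    from C[OF h] obtain u0 j0 u J where u: "sol u0 j0 u J (\<lambda>x. h x + z * dens u x)" by blast
    \<comment> \<open>Subtracting this multiple of \<psi> enforces the boundary condition and leaves
      the right-hand side h unchanged, as \<psi> lies in the kernel.\<close>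
    define k where "k = (of_real s * j0 + of_real t * u0) / d"
    define v where "v = (\<lambda>x. u x - k * \<psi> x)"
    have v: "dens v x = dens u x - k * dens \<psi> x" for x by (simp add: v_def scaleR_diff_right)
    have "of_real s * (j0 - k * \<beta>) + of_real t * (u0 - k * \<alpha>) = (of_real s * j0 + of_real t * u0) - k * d"
      by (simp add: d_def algebra_simps)
    also have "\<dots> = 0" using d by (simp add: k_def)
    finally have b: "of_real s * (j0 - k * \<beta>) + of_real t * (u0 - k * \<alpha>) = 0" .
    have e: "(dens v, \<lambda>x. h x + z * dens u x - k * (z * dens \<psi> x)) \<in> bc_op s t"
      unfolding v_def by (rule bc_opI[OF sol_diff[OF u p] b])
    have "ae_eq M (\<lambda>x. (h x + z * dens u x - k * (z * dens \<psi> x)) - z * dens v x) h"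
      unfolding v ae_eq_def by (simp add: algebra_simps)
    with e show "\<exists>(f, g)\<in>bc_op s t. ae_eq M (\<lambda>x. g x - z * f x) h" by fast
  next
    define B where "B = (\<bar>s\<bar> + \<bar>t\<bar>) * C / cmod d"
    have B0: "B \<ge> 0" using C0 by (simp add: B_def)
    define R where "R = sqrt (2 * C\<^sup>2 + 2 * (B * L2_norm M (dens \<psi>))\<^sup>2)"
    have "L2_norm M f \<le> R * L2_norm M (\<lambda>x. g x - z * f x)" if fg: "(f, g) \<in> bc_op s t" for f g
    proof -
      define h where "h = (\<lambda>x. g x - z * f x)"
      have h: "h \<in> L2" using bc_op_L2[OF fg] by (auto simp: h_def intro: L2_diff L2_scale)
      from fg obtain v0 k0 v K where v: "sol v0 k0 v K g" "f \<in> L2" "ae_eq M f (dens v)" "of_real s * k0 + of_real t * v0 = 0"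
        by (rule bc_opE)
      from C[OF h] obtain u0 j0 u J where u: "sol u0 j0 u J (\<lambda>x. h x + z * dens u x)"
        and b: "cmod u0 \<le> C * L2_norm M h" "cmod j0 \<le> C * L2_norm M h" "(L2_norm M (dens u))\<^sup>2 \<le> (C * L2_norm M h)\<^sup>2" by blast
      have Lu: "dens u \<in> L2" by (rule sol_L2[OF u])
      have dd: "dens (\<lambda>x. u x - 1 * v x) = (\<lambda>x. dens u x - dens v x)" by (simp add: scaleR_diff_right)
      \<comment> \<open>u and v solve the same inhomogeneous equation, hence differ by a multiple k
        of \<psi>. As v satisfies the boundary condition, k d is the boundary form of u, which the
        norm of h controls.\<close>
      have "sol (u0 - 1 * v0) (j0 - 1 * k0) (\<lambda>x. u x - 1 * v x) (\<lambda>x. J x - 1 * K x) (\<lambda>x. z * dens (\<lambda>x. u x - 1 * v x) x)"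
      proof (rule sol_cong[OF sol_diff[OF u v(1)]])
        show "ae_eq M (\<lambda>x. h x + z * dens u x - 1 * g x) (\<lambda>x. z * dens (\<lambda>x. u x - 1 * v x) x)"
          unfolding dd using v(3) unfolding ae_eq_def by eventually_elim (simp add: h_def algebra_simps)
      qed simp
      then obtain k where k: "u0 - 1 * v0 = k * \<alpha>" "j0 - 1 * k0 = k * \<beta>" "ae_eq M (dens (\<lambda>x. u x - 1 * v x)) (\<lambda>x. k * dens \<psi> x)"
        by (rule eigen_multiple[OF p nz])
      have "k * d = of_real s * (j0 - k0) + of_real t * (u0 - v0)" using k(1,2) by (simp add: d_def algebra_simps)
      also have "\<dots> = of_real s * j0 + of_real t * u0" using v(4) by (simp add: algebra_simps)
      finally have "cmod k * cmod d = cmod (of_real s * j0 + of_real t * u0)" by (metis norm_mult)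
      also have "\<dots> \<le> \<bar>s\<bar> * cmod j0 + \<bar>t\<bar> * cmod u0" by (rule order_trans[OF norm_triangle_ineq]) (simp add: norm_mult)
      also have "\<dots> \<le> \<bar>s\<bar> * (C * L2_norm M h) + \<bar>t\<bar> * (C * L2_norm M h)" using b by (intro add_mono mult_left_mono) auto
      finally have kB: "cmod k \<le> B * L2_norm M h" using d by (simp add: B_def field_simps)
      have Lk: "(\<lambda>x. - k * dens \<psi> x) \<in> L2" by (rule L2_scale[OF L])
      have "ae_eq M f (\<lambda>x. dens u x + - k * dens \<psi> x)"
        using v(3) k(3) unfolding dd ae_eq_def by eventually_elim (simp add: algebra_simps)
      then have "(L2_norm M f)\<^sup>2 = (L2_norm M (\<lambda>x. dens u x + - k * dens \<psi> x))\<^sup>2"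
        using L2_norm_ae[OF v(2) L2_add[OF Lu Lk]] by simp
      also have "\<dots> \<le> 2 * (L2_norm M (dens u))\<^sup>2 + 2 * (L2_norm M (\<lambda>x. - k * dens \<psi> x))\<^sup>2"
        by (rule L2_norm_add[OF Lu Lk])
      also have "L2_norm M (\<lambda>x. - k * dens \<psi> x) = cmod k * L2_norm M (dens \<psi>)"
        using L2_norm_scale[OF L, of "- k"] by simp
      also have "2 * (L2_norm M (dens u))\<^sup>2 + 2 * (cmod k * L2_norm M (dens \<psi>))\<^sup>2 \<le>
          2 * (C * L2_norm M h)\<^sup>2 + 2 * (B * L2_norm M h * L2_norm M (dens \<psi>))\<^sup>2"
        by (rule add_mono[OF mult_left_mono[OF b(3)] mult_left_mono[OF power_mono[OF mult_right_mono[OF kB]]]])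
          (auto simp: L2_norm_nonneg)
      also have "\<dots> = (2 * C\<^sup>2 + 2 * (B * L2_norm M (dens \<psi>))\<^sup>2) * (L2_norm M h)\<^sup>2"
        by (simp add: power_mult_distrib algebra_simps)
      also have "\<dots> = (R * L2_norm M h)\<^sup>2" by (simp add: R_def power_mult_distrib)
      finally show "L2_norm M f \<le> R * L2_norm M (\<lambda>x. g x - z * f x)"
        unfolding h_def[symmetric] by (rule power2_le_imp_le) (simp add: R_def L2_norm_nonneg)
    qed
    then show "\<exists>C. \<forall>(f, g)\<in>bc_op s t. L2_norm M f \<le> C * L2_norm M (\<lambda>x. g x - z * f x)" by auto
  qed
qed

section \<open>The spectrum in terms of \<Lambda>\<close>

definition "ev_of \<Lambda> = of_real (\<mu> * (2 - \<gamma>)) * (\<Lambda> - 1 :: complex)"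

lemma ev_of_surj: "\<exists>\<Lambda>. z = ev_of \<Lambda>"
proof -
  have "complex_of_real (\<mu> * (2 - \<gamma>)) \<noteq> 0" unfolding of_real_eq_0_iff using mu gamma1 by simp
  then show ?thesis
    by (intro exI[of _ "z / of_real (\<mu> * (2 - \<gamma>)) + 1"]) (simp add: ev_of_def del: of_real_mult of_real_diff)
qed

abbreviation "data0 \<Lambda> \<equiv> Gamma (complex_of_real a) * rGamma \<Lambda>"
abbreviation "data1 \<Lambda> \<equiv> of_real ((2 - \<gamma>) * \<kappa> powr a) * (- Gamma (complex_of_real (1 - a)) * rGamma (\<Lambda> - of_real a))"

lemma exists_eigensolution: "\<exists>\<psi> \<Psi>. sol (data0 \<Lambda>) (data1 \<Lambda>) \<psi> \<Psi> (\<lambda>x. ev_of \<Lambda> * dens \<psi> x)"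
proof -
  have "0 < a" "a < 1" using a_bounds by auto
  from recessive_exists[OF this, of \<Lambda>] show ?thesis unfolding ev_of_def using recessive_sol by blast
qed

lemma Gamma_a_nonzero: "Gamma (complex_of_real a) \<noteq> 0" "Gamma (complex_of_real (1 - a)) \<noteq> 0"
proof -
  have "0 < a" "0 < 1 - a" using a_bounds by auto
  from this[THEN Gamma_real_pos] show "Gamma (complex_of_real a) \<noteq> 0" "Gamma (complex_of_real (1 - a)) \<noteq> 0"
    unfolding Gamma_complex_of_real of_real_eq_0_iff by simp_all
qed

text \<open>A common zero would make both \<Lambda> and \<Lambda>-a nonpositive integers, although 0
  < a < 1.\<close>

lemma data_nonzero: "data0 \<Lambda> \<noteq> 0 \<or> data1 \<Lambda> \<noteq> 0"
proof (rule ccontr)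
  assume "\<not> ?thesis"
  then have "rGamma \<Lambda> = 0" "rGamma (\<Lambda> - of_real a) = 0"
    using Gamma_a_nonzero kappa gamma1 of_real_eq_0_iff[of "2 - \<gamma>", where 'a = complex] by auto
  then have "\<Lambda> \<in> \<int>\<^sub>\<le>\<^sub>0" "\<Lambda> - of_real a \<in> \<int>\<^sub>\<le>\<^sub>0" by (simp_all add: rGamma_eq_zero_iff)
  then obtain m n where "\<Lambda> = of_int m" "\<Lambda> - of_real a = of_int n" by (auto elim!: nonpos_Ints_cases)
  then have "of_real a = complex_of_real (of_int (m - n))" by (simp add: algebra_simps)
  then have "a = of_int (m - n)" by (simp only: of_real_eq_iff)
  then have "0 < m - n" "m - n < 1" using a_bounds by linarith+
  then show False by simp
qed

text \<open>Eigensolution and resolvent exhaust the alternatives for the boundary form, and every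
  complex number is some \<open>ev_of\<close>; hence the spectrum consists of eigenvalues
  only.\<close>

theorem spectrum_bc_op:
  "ev_of \<Lambda> \<in> op_spectrum M (bc_op s t) \<longleftrightarrow> of_real s * data1 \<Lambda> + of_real t * data0 \<Lambda> = 0"
  "ev_of \<Lambda> \<in> op_spectrum M (bc_op s t) \<Longrightarrow> \<exists>f. eigenspace_spanned_by M (bc_op s t) (ev_of \<Lambda>) f"
proof -
  obtain \<psi> \<Psi> where p: "sol (data0 \<Lambda>) (data1 \<Lambda>) \<psi> \<Psi> (\<lambda>x. ev_of \<Lambda> * dens \<psi> x)"
    using exists_eigensolution by blast
  show *: "ev_of \<Lambda> \<in> op_spectrum M (bc_op s t) \<longleftrightarrow> of_real s * data1 \<Lambda> + of_real t * data0 \<Lambda> = 0"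
    using eigenvalue_spectrum(2)[OF p data_nonzero] resolvent_bc[OF p] unfolding op_spectrum_def by blast
  show "\<exists>f. eigenspace_spanned_by M (bc_op s t) (ev_of \<Lambda>) f" if "ev_of \<Lambda> \<in> op_spectrum M (bc_op s t)"
    using eigenvalue_spectrum(1)[OF p data_nonzero] that unfolding * by blast
qed

text \<open>\<open>\<Lambda> = 0\<close> works if \<open>s \<noteq> 0\<close>, since \<open>data0\<close> vanishes there, and \<open>\<Lambda> = 1\<close> if \<open>s = 0\<close>.\<close>

lemma real_resolvent_point:
  assumes "s \<noteq> 0 \<or> t \<noteq> 0" shows "\<exists>r::real. of_real r \<in> resolvent_set M (bc_op s t)"
proof -
  have 0: "rGamma (0::complex) = 0" by (simp add: rGamma_eq_zero_iff)
  then have "data0 0 = 0" by simp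
  then have d1: "data1 0 \<noteq> 0" using data_nonzero[of 0] by simp
  have ev: "ev_of 0 = of_real (- (\<mu> * (2 - \<gamma>)))" "ev_of 1 = of_real 0" by (simp_all add: ev_of_def)
  show ?thesis
  proof (cases "s = 0")
    case True
    have "rGamma (1::complex) \<noteq> 0" by simp
    then have "of_real t * data0 1 \<noteq> 0" using assms True Gamma_a_nonzero(1) by simp
    then have "ev_of 1 \<notin> op_spectrum M (bc_op s t)" unfolding spectrum_bc_op(1) using True by simp
    then show ?thesis unfolding ev op_spectrum_def by blast
  next
    case False
    then have "ev_of 0 \<notin> op_spectrum M (bc_op s t)" unfolding spectrum_bc_op(1) using d1 0 by simp
    then show ?thesis unfolding ev op_spectrum_def by blast
  qed
qed

subsection \<open>Density of the domains\<close>

text \<open>The measure is finite: 1 is \<open>dens\<close> of x^\<gamma>, which grows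
  subexponentially. Constants can therefore dominate in convergence arguments.\<close>

lemma const_integrable: "integrable M (\<lambda>x. r :: real)"
proof -
  have "(\<lambda>x. x powr (-\<gamma>) *\<^sub>R complex_of_real (x powr \<gamma>)) \<in> L2"
  proof (rule L2_subexponential)
    show "continuous_on {0<..} (\<lambda>x. complex_of_real (x powr \<gamma>))" by (auto intro!: continuous_intros)
    fix x :: real assume x: "x > 0"
    have 1: "1 \<le> exp (y x / 4)" using y_nonneg[of x] by simp
    have 4: "y x \<le> 4 * exp (y x / 4)" using exp_ge_add_one_self[of "y x / 4"] by linarith
    have "x powr \<gamma> \<le> 1 + x"
    proof (cases "x \<le> 1")
      case True
      then have "x powr \<gamma> \<le> 1" using x gamma0 by (intro powr_le1) auto
      then show ?thesis using x by simp
    next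
      case False
      then have "x powr \<gamma> \<le> x powr 1" using gamma1 by (intro powr_mono) auto
      then show ?thesis using x by simp
    qed
    also have "\<dots> \<le> 2 + 1 / \<kappa> * y x" using x_le_y[OF x] by simp
    also have "\<dots> \<le> 2 * exp (y x / 4) + 1 / \<kappa> * (4 * exp (y x / 4))"
      using 1 4 kappa by (intro add_mono mult_left_mono) auto
    finally show "cmod (complex_of_real (x powr \<gamma>)) \<le> (2 + 4 / \<kappa>) * exp (y x / 4)"
      by (simp add: algebra_simps)
  qed
  then have "(\<lambda>x. 1) \<in> L2"
    by (rule L2_ae) (auto simp: ae_eq_def powr_minus scaleR_conv_of_real intro!: AE_M_pos simp flip: of_real_mult of_real_inverse)
  then have "integrable M (\<lambda>x. (cmod 1)\<^sup>2)" by (simp add: L2_fun_def)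
  then have "integrable M (\<lambda>x. r * (cmod 1)\<^sup>2)" by (rule integrable_mult_right)
  then show ?thesis by simp
qed

lemma bounded_L2:
  assumes "f \<in> borel_measurable (lebesgue_on {0<..})" "\<And>x. cmod (f x) \<le> B"
  shows "f \<in> L2"
  unfolding L2_fun_def mem_Collect_eq
proof
  show m: "f \<in> borel_measurable M" unfolding measurable_M by (rule assms)
  show "integrable M (\<lambda>x. (cmod (f x))\<^sup>2)"
  proof (rule Bochner_Integration.integrable_bound[OF const_integrable[of "B\<^sup>2"]])
    show "(\<lambda>x. (cmod (f x))\<^sup>2) \<in> borel_measurable M" using m by measurable
    show "AE x in M. norm ((cmod (f x))\<^sup>2) \<le> norm (B\<^sup>2)"
      using assms(2) by (intro AE_I2) (auto intro: power_mono)
  qed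
qed

lemma L2_dominated_convergence:
  assumes f: "\<And>n. f n \<in> L2" and h: "h \<in> L2" and G: "integrable M G"
    and b: "\<And>n. AE x in M. (cmod (h x - f n x))\<^sup>2 \<le> G x" and l: "AE x in M. (\<lambda>n. f n x) \<longlonglongrightarrow> h x"
  shows "(\<lambda>n. L2_norm M (\<lambda>x. h x - f n x)) \<longlonglongrightarrow> 0"
proof -
  have m: "h \<in> borel_measurable M" "\<And>n. f n \<in> borel_measurable M" using f h by (auto simp: L2_fun_def)
  have "(\<lambda>n. \<integral>x. (cmod (h x - f n x))\<^sup>2 \<partial>M) \<longlonglongrightarrow> (\<integral>x. 0 \<partial>M)"
  proof (rule integral_dominated_convergence[OF _ _ G])
    show "(\<lambda>x. (cmod (h x - f n x))\<^sup>2) \<in> borel_measurable M" for n using m by measurable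
    show "AE x in M. (\<lambda>n. (cmod (h x - f n x))\<^sup>2) \<longlonglongrightarrow> 0"
      using l
    proof eventually_elim
      case (elim x)
      have "(\<lambda>n. (cmod (h x - f n x))\<^sup>2) \<longlonglongrightarrow> (cmod (h x - h x))\<^sup>2" by (intro tendsto_intros elim)
      then show ?case by simp
    qed
    show "AE x in M. norm ((cmod (h x - f n x))\<^sup>2) \<le> G x" for n using b[of n] by simp
  qed simp
  then have "(\<lambda>n. sqrt (\<integral>x. (cmod (h x - f n x))\<^sup>2 \<partial>M)) \<longlonglongrightarrow> sqrt 0" by (intro tendsto_intros) simp
  then show ?thesis by (simp add: L2_norm_def)
qed

text \<open>Support away from 0 and infinity removes all boundary terms. The bound \<open>B\<close>
  is recorded because averaging preserves it, so that one constant dominates all averages.\<close>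

definition bump :: "real \<Rightarrow> real \<Rightarrow> real \<Rightarrow> (real \<Rightarrow> complex) \<Rightarrow> bool" where
  "bump B s t k \<longleftrightarrow> 0 < s \<and> s < t \<and> (\<forall>x. cmod (k x) \<le> B) \<and> (\<forall>x. x < s \<or> t < x \<longrightarrow> k x = 0) \<and> k integrable_on UNIV"

lemma bump_integrable: "bump B s t k \<Longrightarrow> k integrable_on {u..v}"
  unfolding bump_def by (auto intro: integrable_on_subinterval)

lemma bump_L2: "bump B s t k \<Longrightarrow> k \<in> L2"
proof -
  assume k: "bump B s t k"
  then have "k \<in> borel_measurable (lebesgue_on UNIV)" by (intro integrable_imp_measurable) (simp add: bump_def)
  then have "k \<in> borel_measurable (lebesgue_on {0<..})" by (rule measurable_restrict_mono) auto
  then show ?thesis using k by (intro bounded_L2) (auto simp: bump_def)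
qed

lemma bump_approx:
  assumes h: "h \<in> L2" and e: "e > 0"
  shows "\<exists>B s t k. bump B s t k \<and> L2_norm M (\<lambda>x. h x - k x) < e"
proof -
  \<comment> \<open>With \<open>n + 2\<close> the left end of the support lies strictly below the
    right end for n = 0 too.\<close>
  define k where "k = (\<lambda>n x. if 1 / real (n + 2) \<le> x \<and> x \<le> real (n + 2) \<and> cmod (h x) \<le> real n then h x else 0)"
  have hm [measurable]: "h \<in> borel_measurable (lebesgue_on {0<..})" by (rule L2_measurable[OF h])
  have [measurable]: "(\<lambda>x::real. x) \<in> borel_measurable (lebesgue_on {0<..})"
    by (rule continuous_imp_measurable_on_sets_lebesgue) auto
  have km: "k n \<in> borel_measurable (lebesgue_on {0<..})" for n unfolding k_def by measurable
  have kb: "cmod (k n x) \<le> real n" for n x by (auto simp: k_def)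
  have bump: "bump (real n) (1 / real (n + 2)) (real (n + 2)) (k n)" for n
    unfolding bump_def
  proof (intro conjI allI impI)
    have "1 / real (n + 2) < 1" by simp
    then show "1 / real (n + 2) < real (n + 2)" by linarith
    have "k n \<in> borel_measurable (lebesgue_on {1 / real (n + 2)..real (n + 2)})"
      by (rule measurable_restrict_mono[OF km]) (auto intro: less_le_trans[of 0 "1 / real (n + 2)"])
    then have "k n integrable_on {1 / real (n + 2)..real (n + 2)}"
      by (rule measurable_bounded_by_integrable_imp_integrable[of _ _ "\<lambda>x. real n"]) (auto simp: kb)
    then show "k n integrable_on UNIV" by (rule integrable_on_superset) (auto simp: k_def)
  qed (use kb in \<open>auto simp: k_def\<close>)
  have "(\<lambda>n. L2_norm M (\<lambda>x. h x - k n x)) \<longlonglongrightarrow> 0"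
  proof (rule L2_dominated_convergence[OF bump_L2[OF bump] h])
    show "integrable M (\<lambda>x. (cmod (h x))\<^sup>2)" using h by (simp add: L2_fun_def)
    show "AE x in M. (cmod (h x - k n x))\<^sup>2 \<le> (cmod (h x))\<^sup>2" for n by (rule AE_I2) (simp add: k_def)
    show "AE x in M. (\<lambda>n. k n x) \<longlonglongrightarrow> h x"
    proof (rule AE_M_pos)
      fix x :: real assume x: "x > 0"
      obtain N where N: "1 / x + x + cmod (h x) \<le> real N" using real_arch_simple by blast
      have "\<forall>\<^sub>F n in sequentially. k n x = h x"
        unfolding eventually_sequentially
      proof (intro exI[of _ N] allI impI)
        fix n assume "N \<le> n"
        then have n: "1 / x + x + cmod (h x) \<le> real n" using N by linarith
        have p: "0 < 1 / x" "0 \<le> cmod (h x)" using x by auto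
        then have "1 / x \<le> real (n + 2)" "x \<le> real (n + 2)" "cmod (h x) \<le> real n" using n x by (simp_all, linarith+)
        moreover from this(1) have "1 / real (n + 2) \<le> x" using x by (simp add: field_simps)
        ultimately show "k n x = h x" by (simp add: k_def)
      qed
      then show "(\<lambda>n. k n x) \<longlonglongrightarrow> h x" by (rule tendsto_eventually)
    qed
  qed
  from order_tendstoD(2)[OF this e] obtain n where "L2_norm M (\<lambda>x. h x - k n x) < e"
    unfolding eventually_sequentially by blast
  then show ?thesis using bump by blast
qed

text \<open>Steklov mean, the average of k over [x, x + \<delta>] when x \<ge> 0. Each application
  gains one order of smoothness, so three of them lead from a bounded measurable function to a twice
  continuously differentiable one.\<close>

definition avg :: "real \<Rightarrow> (real \<Rightarrow> complex) \<Rightarrow> real \<Rightarrow> complex" where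
  "avg \<delta> k x = (1 / \<delta>) *\<^sub>R (integral {0..x + \<delta>} k - integral {0..x} k)"

lemma bump_integral_diff:
  assumes k: "bump B s t k" and uv: "0 \<le> u" "u \<le> v"
  shows "integral {0..v} k - integral {0..u} k = integral {u..v} k"
  using Henstock_Kurzweil_Integration.integral_combine[OF uv bump_integrable[OF k]] by (simp add: algebra_simps)

lemma bump_integral_0: "bump B s t k \<Longrightarrow> v < s \<Longrightarrow> integral {u..v} k = 0"
  and bump_integral_0': "bump B s t k \<Longrightarrow> t < u \<Longrightarrow> integral {u..v} k = 0"
  using integral_cong[of "{u..v}" k "\<lambda>x. 0"] by (auto simp: bump_def)

lemma bump_integral_Lipschitz:
  assumes k: "bump B s t k" and uv: "u \<le> v"
  shows "cmod (integral {0..v} k - integral {0..u} k) \<le> B * (v - u)"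
proof -
  have bd: "cmod (integral {r..v} k) \<le> B * (v - r)" if "r \<le> v" for r
  proof -
    have "cmod (integral {r..v} k) \<le> integral {r..v} (\<lambda>x. B)"
      by (rule integral_norm_bound_integral[OF bump_integrable[OF k]]) (use k in \<open>auto simp: bump_def\<close>)
    then show ?thesis using that by (simp add: mult.commute)
  qed
  have B: "B \<ge> 0" using k norm_ge_zero[of "k 0"] unfolding bump_def by (meson order_trans)
  show ?thesis
  proof (cases "0 \<le> u")
    case True
    then show ?thesis using bump_integral_diff[OF k True uv] bd[OF uv] by simp
  next
    case False
    have "u < s" using False k by (simp add: bump_def)
    then have u: "integral {0..u} k = 0" by (rule bump_integral_0[OF k])
    show ?thesis
    proof (cases "0 \<le> v")
      case True
      have "cmod (integral {0..v} k) \<le> B * (v - 0)" by (rule bd[OF True])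
      also have "\<dots> \<le> B * (v - u)" using B False by (intro mult_left_mono) auto
      finally show ?thesis using u by simp
    next
      case False
      then have "v < s" using k by (simp add: bump_def)
      then have "integral {0..v} k = 0" by (rule bump_integral_0[OF k])
      then show ?thesis using u B uv by simp
    qed
  qed
qed

lemma bump_integral_continuous:
  assumes k: "bump B s t k"
  shows "continuous_on UNIV (\<lambda>x. integral {0..x} k)"
proof -
  have B: "B \<ge> 0" using k norm_ge_zero[of "k 0"] unfolding bump_def by (meson order_trans)
  have "B-lipschitz_on UNIV (\<lambda>x. integral {0..x} k)"
  proof (rule lipschitz_onI)
    fix u v :: real
    show "dist (integral {0..u} k) (integral {0..v} k) \<le> B * dist u v"
      using bump_integral_Lipschitz[OF k, of u v] bump_integral_Lipschitz[OF k, of v u]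
      by (cases "u \<le> v") (auto simp: dist_norm dist_real_def norm_minus_commute)
  qed (rule B)
  then show ?thesis by (rule lipschitz_on_continuous_on)
qed

text \<open>Averaging to the right moves the left end of the support down by \<delta>; \<delta> < s
  keeps it positive.\<close>

lemma avg_bump:
  assumes k: "bump B s t k" and d: "0 < \<delta>" "\<delta> < s"
  shows "bump B (s - \<delta>) t (avg \<delta> k)" "continuous_on UNIV (avg \<delta> k)"
proof -
  have st: "0 < s" "s < t" using k by (auto simp: bump_def)
  have "continuous_on UNIV (\<lambda>x. integral {0..x + \<delta>} k)"
    by (rule continuous_on_compose2[OF bump_integral_continuous[OF k]]) (auto intro!: continuous_intros)
  then show c: "continuous_on UNIV (avg \<delta> k)"
    unfolding avg_def[abs_def] by (intro continuous_intros bump_integral_continuous[OF k])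
  have z: "avg \<delta> k x = 0" if "x < s - \<delta> \<or> t < x" for x
    using that
  proof
    assume x: "x < s - \<delta>"
    have "integral {0..x + \<delta>} k = 0" "integral {0..x} k = 0" by (rule bump_integral_0[OF k]; use x d in linarith)+
    then show ?thesis by (simp add: avg_def)
  next
    assume x: "t < x"
    have "integral {0..x + \<delta>} k - integral {0..x} k = integral {x..x + \<delta>} k"
      by (rule bump_integral_diff[OF k]) (use x st d in auto)
    also have "\<dots> = 0" by (rule bump_integral_0'[OF k x])
    finally show ?thesis by (simp add: avg_def)
  qed
  have "avg \<delta> k integrable_on {s - \<delta>..t}"
    by (rule integrable_continuous_real[OF continuous_on_subset[OF c]]) simp
  then have "avg \<delta> k integrable_on UNIV" by (rule integrable_on_superset) (use z in auto)
  moreover have "cmod (avg \<delta> k x) \<le> B" for x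
  proof -
    have "cmod (avg \<delta> k x) = (1 / \<delta>) * cmod (integral {0..x + \<delta>} k - integral {0..x} k)" using d by (simp add: avg_def)
    also have "\<dots> \<le> (1 / \<delta>) * (B * (x + \<delta> - x))" using d by (intro mult_left_mono bump_integral_Lipschitz[OF k]) auto
    finally show ?thesis using d by simp
  qed
  ultimately show "bump B (s - \<delta>) t (avg \<delta> k)" using z d st by (auto simp: bump_def)
qed

text \<open>The averages converge to k wherever its indefinite integral has derivative k, that is
  almost everywhere, and are dominated by a constant. Beyond t both sides vanish, so differentiation
  on a bounded interval is enough.\<close>

lemma avg_approx:
  assumes k: "bump B s t k" and e: "e > 0"
  shows "\<exists>\<delta>. 0 < \<delta> \<and> \<delta> < s \<and> L2_norm M (\<lambda>x. k x - avg \<delta> k x) < e"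
proof -
  have st: "0 < s" "s < t" and kb: "\<And>x. cmod (k x) \<le> B" and k0: "\<And>x. t < x \<Longrightarrow> k x = 0" using k by (auto simp: bump_def)
  define \<delta> where "\<delta> = (\<lambda>n. s / real (n + 2))"
  have d: "0 < \<delta> n" "\<delta> n < s" for n using st by (auto simp: \<delta>_def divide_less_eq)
  have dlim: "\<delta> \<longlonglongrightarrow> 0"
    unfolding \<delta>_def using LIMSEQ_ignore_initial_segment[OF lim_const_over_n[of s], of 2] by simp
  then have dlim': "filterlim \<delta> (at 0) sequentially"
    by (rule filterlim_atI) (use d(1) in \<open>auto intro!: always_eventually simp: less_imp_neq[symmetric]\<close>)
  have "(\<lambda>n. L2_norm M (\<lambda>x. k x - avg (\<delta> n) k x)) \<longlonglongrightarrow> 0"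
  proof (rule L2_dominated_convergence[OF bump_L2[OF avg_bump(1)[OF k d]] bump_L2[OF k] const_integrable[of "(2 * B)\<^sup>2"]])
    fix n
    have ab: "cmod (avg (\<delta> n) k x) \<le> B" for x using avg_bump(1)[OF k d] by (auto simp: bump_def)
    show "AE x in M. (cmod (k x - avg (\<delta> n) k x))\<^sup>2 \<le> (2 * B)\<^sup>2"
    proof (intro AE_I2 power_mono)
      fix x
      have "cmod (k x - avg (\<delta> n) k x) \<le> cmod (k x) + cmod (avg (\<delta> n) k x)" by (rule norm_triangle_ineq4)
      then show "cmod (k x - avg (\<delta> n) k x) \<le> 2 * B" using kb[of x] ab[of x] by linarith
    qed simp
  next
    have conv: "(\<lambda>n. avg (\<delta> n) k x) \<longlonglongrightarrow> k x" if "((\<lambda>u. integral {0..u} k) has_vector_derivative k x) (at x)" for x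
    proof -
      have "((\<lambda>h. norm (integral {0..x + h} k - integral {0..x} k - h *\<^sub>R k x) / norm h) \<longlongrightarrow> 0) (at 0)"
        using that unfolding has_vector_derivative_def has_derivative_at by blast
      from filterlim_compose[OF this dlim']
      have "(\<lambda>n. norm (integral {0..x + \<delta> n} k - integral {0..x} k - \<delta> n *\<^sub>R k x) / norm (\<delta> n)) \<longlonglongrightarrow> 0" .
      moreover have "norm (integral {0..x + \<delta> n} k - integral {0..x} k - \<delta> n *\<^sub>R k x) / norm (\<delta> n) = norm (avg (\<delta> n) k x - k x)" for n
      proof -
        have "avg (\<delta> n) k x - k x = (1 / \<delta> n) *\<^sub>R (integral {0..x + \<delta> n} k - integral {0..x} k - \<delta> n *\<^sub>R k x)"
          using d(1)[of n] by (simp add: avg_def scaleR_diff_right)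
        then show ?thesis using d(1)[of n] by simp
      qed
      ultimately have "(\<lambda>n. norm (avg (\<delta> n) k x - k x)) \<longlonglongrightarrow> 0" by simp
      then have "(\<lambda>n. avg (\<delta> n) k x - k x) \<longlonglongrightarrow> 0" by (rule tendsto_norm_zero_cancel)
      then show ?thesis by (rule LIM_zero_cancel)
    qed
    have n: "negligible {x\<in>{0<..<t + 1}. \<not> ((\<lambda>u. integral {0..u} k) has_vector_derivative k x) (at x)}"
      by (rule Lebesgue_differentiation[OF bump_integrable[OF k]])
    show "AE x in M. (\<lambda>n. avg (\<delta> n) k x) \<longlonglongrightarrow> k x"
      unfolding AE_M_negligible
    proof (rule negligible_subset[OF n], rule subsetI)
      fix x assume x: "x \<in> {x. 0 < x \<and> \<not> (\<lambda>n. avg (\<delta> n) k x) \<longlonglongrightarrow> k x}"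
      have "x \<le> t"
      proof (rule ccontr)
        assume "\<not> x \<le> t"
        then have "avg (\<delta> n) k x = 0" "k x = 0" for n using avg_bump(1)[OF k d, of n] k0 by (auto simp: bump_def)
        then show False using x by simp
      qed
      then show "x \<in> {x\<in>{0<..<t + 1}. \<not> ((\<lambda>u. integral {0..u} k) has_vector_derivative k x) (at x)}"
        using x conv by auto
    qed
  qed
  from order_tendstoD(2)[OF this e] obtain n where "L2_norm M (\<lambda>x. k x - avg (\<delta> n) k x) < e"
    unfolding eventually_sequentially by blast
  then show ?thesis using d by blast
qed

lemma has_vector_derivative_shift_arg:
  fixes f :: "real \<Rightarrow> complex"
  assumes "(f has_vector_derivative f') (at (x + r))"
  shows "((\<lambda>x. f (x + r)) has_vector_derivative f') (at x)"
proof -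
  have "((\<lambda>x. x + r) has_vector_derivative 1) (at x)"
    unfolding has_real_derivative_iff_has_vector_derivative[symmetric] by (auto intro!: derivative_eq_intros)
  from vector_diff_chain_at[OF this assms] show ?thesis by (simp add: o_def)
qed

lemma avg_deriv:
  assumes k: "continuous_on UNIV k" and x: "x > 0" and d: "\<delta> > 0"
  shows "(avg \<delta> k has_vector_derivative (1 / \<delta>) *\<^sub>R (k (x + \<delta>) - k x)) (at x)"
proof -
  have I: "((\<lambda>x. integral {0..x} k) has_vector_derivative k r) (at r)" if "r > 0" for r
  proof -
    have "((\<lambda>x. integral {0..x} k) has_vector_derivative k r) (at r within {0..r + 1})"
      by (rule integral_has_vector_derivative[OF continuous_on_subset[OF k]]) (use that in auto)
    then show ?thesis using that by (simp add: at_within_Icc_at)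
  qed
  have "((\<lambda>x. integral {0..x + \<delta>} k) has_vector_derivative k (x + \<delta>)) (at x)"
    by (rule has_vector_derivative_shift_arg[OF I]) (use x d in simp)
  from bounded_linear.has_vector_derivative[OF bounded_linear_scaleR_right has_vector_derivative_diff[OF this I[OF x]], of "1 / \<delta>"]
  show ?thesis by (simp add: avg_def[abs_def])
qed

text \<open>Near 0 the function and its derivatives vanish, so the data are (0, 0) and satisfy every
  boundary condition at once.\<close>

lemma C2_compact_support_sol:
  fixes p p1 p2 :: "real \<Rightarrow> complex"
  assumes p: "bump B s t p"
    and d1: "\<And>x. x > 0 \<Longrightarrow> (p has_vector_derivative p1 x) (at x)"
    and d2: "\<And>x. x > 0 \<Longrightarrow> (p1 has_vector_derivative p2 x) (at x)"
    and c2: "continuous_on {0<..} p2"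
  shows "\<exists>u J h. sol 0 0 u J h \<and> ae_eq M p (dens u)"
proof -
  have st: "0 < s" "s < t" and p0: "\<And>x. x < s \<or> t < x \<Longrightarrow> p x = 0" using p by (auto simp: bump_def)
  have zero: "(\<lambda>x. 0) = (\<lambda>x::real. 0 :: complex)" ..
  have op: "open ({0<..<s} \<union> {t<..})" by auto
  have p10: "p1 x = 0" if x: "x \<in> {0<..<s} \<union> {t<..}" for x
  proof -
    have x0: "x > 0" using x st by auto
    have "((\<lambda>x. 0) has_vector_derivative p1 x) (at x)"
      by (rule has_vector_derivative_transform_within_open[OF d1[OF x0] op x]) (use p0 in auto)
    from vector_derivative_unique_at[OF this has_vector_derivative_const] show ?thesis .
  qed
  have p20: "p2 x = 0" if x: "x \<in> {0<..<s} \<union> {t<..}" for x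
  proof -
    have x0: "x > 0" using x st by auto
    have "((\<lambda>x. 0) has_vector_derivative p2 x) (at x)"
      by (rule has_vector_derivative_transform_within_open[OF d2[OF x0] op x]) (use p10 in auto)
    from vector_derivative_unique_at[OF this has_vector_derivative_const] show ?thesis .
  qed
  define u where "u = (\<lambda>x. x powr \<gamma> *\<^sub>R p x)"
  define J where "J = (\<lambda>x. x powr \<gamma> *\<^sub>R p1 x + (\<gamma> * x powr (\<gamma> - 1)) *\<^sub>R p x - (c * x) *\<^sub>R p x)"
  define h' where "h' = (\<lambda>x. x powr \<gamma> *\<^sub>R p2 x + (\<gamma> * x powr (\<gamma> - 1)) *\<^sub>R p1 x
     + ((\<gamma> * x powr (\<gamma> - 1)) *\<^sub>R p1 x + (\<gamma> * ((\<gamma> - 1) * x powr (\<gamma> - 2))) *\<^sub>R p x) - ((c * x) *\<^sub>R p1 x + c *\<^sub>R p x))"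
  \<comment> \<open>The values at x \<le> 0 do not matter for \<open>M\<close>; 0 makes the bound
    required by \<open>bounded_L2\<close> hold on the whole line.\<close>
  define h where "h = (\<lambda>x. if x \<le> 0 then 0 else (1 / q) *\<^sub>R h' x)"
  have dpw: "((\<lambda>x. x powr \<gamma>) has_real_derivative \<gamma> * x powr (\<gamma> - 1)) (at x)" if "x > 0" for x
    using that by (auto intro!: derivative_eq_intros)
  have dpw1: "((\<lambda>x. \<gamma> * x powr (\<gamma> - 1)) has_real_derivative \<gamma> * ((\<gamma> - 1) * x powr (\<gamma> - 2))) (at x)" if "x > 0" for x
    using that by (auto intro!: derivative_eq_intros)
  have dcx: "((\<lambda>x. c * x) has_real_derivative c) (at x)" for x by (auto intro!: derivative_eq_intros)
  have pc: "continuous_on {0<..} p" and p1c: "continuous_on {0<..} p1"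
    using d1 d2 by (auto intro!: continuous_at_imp_continuous_on has_vector_derivative_continuous)
  have h'c: "continuous_on {0<..} h'"
    unfolding h'_def by (intro continuous_intros pc p1c c2) auto
  have "{s..t} \<subseteq> {0<..}" using st by auto
  from continuous_on_Icc_norm_bound[OF continuous_on_subset[OF h'c this]]
  obtain D where D: "\<And>x. x \<in> {s..t} \<Longrightarrow> cmod (h' x) \<le> D" "D \<ge> 0" by blast
  have hb: "cmod (h x) \<le> 1 / q * D" for x
  proof (cases "x \<in> {s..t}")
    case True
    then show ?thesis using D(1)[OF True] st q_pos by (auto simp: h_def divide_right_mono)
  next
    case False
    then have "h x = 0" using p0[of x] p10[of x] p20[of x] by (auto simp: h_def h'_def)
    then show ?thesis using q_pos D(2) by simp
  qed
  have "sol 0 0 u J h"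
  proof (rule sol_from_derivatives)
    have "continuous_on {0<..} h"
      by (subst continuous_on_cong[OF refl, of _ _ "\<lambda>x. (1 / q) *\<^sub>R h' x"]) (auto simp: h_def intro!: continuous_intros h'c)
    then have "h \<in> borel_measurable (lebesgue_on {0<..})" by (rule continuous_imp_measurable_on_sets_lebesgue) simp
    then show "h \<in> L2" by (rule bounded_L2[OF _ hb])
    show "dens u \<in> L2"
      by (rule L2_ae[OF bump_L2[OF p]]) (auto simp: ae_eq_def u_def powr_minus intro!: AE_M_pos)
    fix x :: real assume x: "x > 0"
    have "x powr (1 - \<gamma>) * x powr \<gamma> = x" using x by (simp flip: powr_add)
    then have e: "(c * x powr (1 - \<gamma>)) *\<^sub>R u x = (c * x) *\<^sub>R p x" by (simp add: u_def)
    have "(u has_vector_derivative x powr \<gamma> *\<^sub>R p1 x + (\<gamma> * x powr (\<gamma> - 1)) *\<^sub>R p x) (at x)"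
      unfolding u_def by (rule has_vector_derivative_scaleR[OF dpw[OF x] d1[OF x]])
    then show "(u has_vector_derivative J x + (c * x powr (1 - \<gamma>)) *\<^sub>R u x) (at x)"
      unfolding e by (simp add: J_def)
    have "(J has_vector_derivative h' x) (at x)"
      unfolding J_def h'_def
      by (intro has_vector_derivative_diff has_vector_derivative_add has_vector_derivative_scaleR dpw dpw1 dcx d1 d2 x)
    then show "(J has_vector_derivative q *\<^sub>R h x) (at x)" using q_pos x by (simp add: h_def)
  next
    have ev: "\<forall>\<^sub>F x in at_right 0. x \<in> {0<..<s}" using st by (intro eventually_at_rightI) auto
    show "(u \<longlongrightarrow> 0) (at_right 0)"
      by (rule Lim_transform_eventually[OF tendsto_const eventually_mono[OF ev]]) (auto simp: u_def p0)
    show "(J \<longlongrightarrow> 0) (at_right 0)"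
      by (rule Lim_transform_eventually[OF tendsto_const eventually_mono[OF ev]]) (auto simp: J_def p0 p10)
  qed
  moreover have "ae_eq M p (dens u)" by (auto simp: ae_eq_def u_def powr_minus intro!: AE_M_pos)
  ultimately show ?thesis by blast
qed

lemma L2_norm_split:
  assumes "f \<in> L2" "g \<in> L2" "h \<in> L2"
  shows "(L2_norm M (\<lambda>x. f x - h x))\<^sup>2 \<le> 2 * (L2_norm M (\<lambda>x. f x - g x))\<^sup>2 + 2 * (L2_norm M (\<lambda>x. g x - h x))\<^sup>2"
  using L2_norm_add[OF L2_diff[OF assms(1,2)] L2_diff[OF assms(2,3)]] by simp

lemma bc_op_dense: "densely_defined M (bc_op s t)"
  unfolding densely_defined_def
proof (intro ballI allI impI)
  fix h and \<epsilon> :: real assume h: "h \<in> L2" and e: "\<epsilon> > 0"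
  \<comment> \<open>Four errors enter the nested square inequality with the factors 2, 4, 8 and 8;
    their sum 22 is less than 64.\<close>
  then have e8: "\<epsilon> / 8 > 0" by simp
  obtain B s0 t0 k0 where k0: "bump B s0 t0 k0" and n0: "L2_norm M (\<lambda>x. h x - k0 x) < \<epsilon> / 8" using bump_approx[OF h e8] by blast
  obtain d1 where d1: "0 < d1" "d1 < s0" and n1: "L2_norm M (\<lambda>x. k0 x - avg d1 k0 x) < \<epsilon> / 8"
    using avg_approx[OF k0 e8] by blast
  define k1 where "k1 = avg d1 k0"
  have k1: "bump B (s0 - d1) t0 k1" and c1: "continuous_on UNIV k1" unfolding k1_def by (rule avg_bump[OF k0 d1])+
  obtain d2 where d2: "0 < d2" "d2 < s0 - d1" and n2: "L2_norm M (\<lambda>x. k1 x - avg d2 k1 x) < \<epsilon> / 8"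
    using avg_approx[OF k1 e8] by blast
  define k2 where "k2 = avg d2 k1"
  have k2: "bump B (s0 - d1 - d2) t0 k2" and c2: "continuous_on UNIV k2" unfolding k2_def by (rule avg_bump[OF k1 d2])+
  obtain d3 where d3: "0 < d3" "d3 < s0 - d1 - d2" and n3: "L2_norm M (\<lambda>x. k2 x - avg d3 k2 x) < \<epsilon> / 8"
    using avg_approx[OF k2 e8] by blast
  define k3 where "k3 = avg d3 k2"
  have k3: "bump B (s0 - d1 - d2 - d3) t0 k3" unfolding k3_def by (rule avg_bump[OF k2 d3])
  define m where "m = (\<lambda>x. (1 / d2) *\<^sub>R (k1 (x + d2) - k1 x))"
  have dm: "(k2 has_vector_derivative m x) (at x)" if "x > 0" for x
    unfolding k2_def m_def by (rule avg_deriv[OF c1 that d2(1)])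
  have shift: "continuous_on UNIV (\<lambda>x. f (x + r))" if "continuous_on UNIV f" for f :: "real \<Rightarrow> complex" and r
    by (rule continuous_on_compose2[OF that]) (auto intro!: continuous_intros)
  have mc: "continuous_on UNIV m" unfolding m_def by (intro continuous_intros shift c1)
  have "\<exists>u J g. sol 0 0 u J g \<and> ae_eq M k3 (dens u)"
  proof (rule C2_compact_support_sol[OF k3])
    fix x :: real assume x: "x > 0"
    show "(k3 has_vector_derivative (1 / d3) *\<^sub>R (k2 (x + d3) - k2 x)) (at x)"
      unfolding k3_def by (rule avg_deriv[OF c2 x d3(1)])
    have "((\<lambda>x. k2 (x + d3)) has_vector_derivative m (x + d3)) (at x)"
      by (rule has_vector_derivative_shift_arg[OF dm]) (use x d3 in simp)
    from bounded_linear.has_vector_derivative[OF bounded_linear_scaleR_right has_vector_derivative_diff[OF this dm[OF x]], of "1 / d3"]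
    show "((\<lambda>x. (1 / d3) *\<^sub>R (k2 (x + d3) - k2 x)) has_vector_derivative (1 / d3) *\<^sub>R (m (x + d3) - m x)) (at x)" by simp
  next
    show "continuous_on {0<..} (\<lambda>x. (1 / d3) *\<^sub>R (m (x + d3) - m x))"
      by (rule continuous_on_subset[of UNIV]) (auto intro!: continuous_intros shift mc)
  qed
  then obtain u J g where g: "sol 0 0 u J g" "ae_eq M k3 (dens u)" by blast
  have L: "k0 \<in> L2" "k1 \<in> L2" "k2 \<in> L2" "k3 \<in> L2" using k0 k1 k2 k3 by (auto intro: bump_L2)
  have op: "(k3, g) \<in> bc_op s t" unfolding bc_op_def using g L(4) by force
  have sq: "r\<^sup>2 \<le> \<epsilon>\<^sup>2 / 64" if "r < \<epsilon> / 8" "r \<ge> 0" for r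
    using power_mono[of r "\<epsilon> / 8" 2] that by (simp add: power_divide)
  have "(L2_norm M (\<lambda>x. h x - k0 x))\<^sup>2 \<le> \<epsilon>\<^sup>2 / 64" "(L2_norm M (\<lambda>x. k0 x - k1 x))\<^sup>2 \<le> \<epsilon>\<^sup>2 / 64"
    "(L2_norm M (\<lambda>x. k1 x - k2 x))\<^sup>2 \<le> \<epsilon>\<^sup>2 / 64" "(L2_norm M (\<lambda>x. k2 x - k3 x))\<^sup>2 \<le> \<epsilon>\<^sup>2 / 64"
    unfolding k1_def k2_def k3_def by (rule sq[OF _ L2_norm_nonneg], rule n0 n1[unfolded k1_def] n2[unfolded k1_def] n3[unfolded k2_def k1_def])+
  moreover note L2_norm_split[OF h L(1) L(4)] L2_norm_split[OF L(1,2,4)] L2_norm_split[OF L(2,3,4)]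
  moreover have "\<epsilon>\<^sup>2 > 0" using e by simp
  ultimately have "(L2_norm M (\<lambda>x. h x - k3 x))\<^sup>2 < \<epsilon>\<^sup>2" by linarith
  then have "L2_norm M (\<lambda>x. h x - k3 x) < \<epsilon>" by (rule power2_less_imp_less) (use e in simp)
  then show "\<exists>(f, g)\<in>bc_op s t. L2_norm M (\<lambda>x. h x - f x) < \<epsilon>" using op by (intro bexI[of _ "(k3, g)"]) simp_all
qed

subsection \<open>Self-adjoint realizations and their spectra\<close>

lemma bc_op_ae:
  assumes fg: "(f, g) \<in> bc_op s t" and L: "f' \<in> L2" "g' \<in> L2" and e: "ae_eq M f f'" "ae_eq M g g'"
  shows "(f', g') \<in> bc_op s t"
proof -
  from fg obtain u0 j0 u J where u: "sol u0 j0 u J g" "ae_eq M f (dens u)" "of_real s * j0 + of_real t * u0 = 0"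
    by (rule bc_opE)
  have "sol u0 j0 u J g'" by (rule sol_cong[OF u(1) _ e(2)]) simp
  moreover have "ae_eq M f' (dens u)" by (rule ae_eq_trans[OF ae_eq_sym[OF e(1)] u(2)])
  ultimately show ?thesis unfolding bc_op_def using L u(3) by blast
qed

lemma bc_op_linear: "linear_operator M (bc_op s t)"
  unfolding linear_operator_def
proof (intro conjI allI impI)
  show "bc_op s t \<subseteq> L2 \<times> L2" using bc_op_L2 by auto
  have "sol 0 0 (\<lambda>x. 0) (\<lambda>x. 0) (\<lambda>x. 0)" by (simp add: sol_def L2_zero)
  from bc_opI[OF this, of s t] show "((\<lambda>x. 0), (\<lambda>x. 0)) \<in> bc_op s t" by simp
next
  fix f g f' g' assume "(f, g) \<in> bc_op s t" "f' \<in> L2" "g' \<in> L2" "ae_eq M f f'" "ae_eq M g g'"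
  then show "(f', g') \<in> bc_op s t" by (rule bc_op_ae)
next
  fix f g f' g' assume "(f, g) \<in> bc_op s t" "(f', g') \<in> bc_op s t"
  then obtain u0 j0 u J u0' j0' u' J' where u: "sol u0 j0 u J g" "f \<in> L2" "ae_eq M f (dens u)" "of_real s * j0 + of_real t * u0 = 0"
    and u': "sol u0' j0' u' J' g'" "f' \<in> L2" "ae_eq M f' (dens u')" "of_real s * j0' + of_real t * u0' = 0"
    by (elim bc_opE) blast
  have "of_real s * (j0 + j0') + of_real t * (u0 + u0') = (of_real s * j0 + of_real t * u0) + (of_real s * j0' + of_real t * u0')"
    by (simp add: algebra_simps)
  then have "of_real s * (j0 + j0') + of_real t * (u0 + u0') = 0" unfolding u(4) u'(4) by simp
  moreover have "ae_eq M (\<lambda>x. f x + f' x) (dens (\<lambda>x. u x + u' x))"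
    using ae_eq_add[OF u(3) u'(3)] by (simp add: scaleR_add_right)
  ultimately show "((\<lambda>x. f x + f' x), (\<lambda>x. g x + g' x)) \<in> bc_op s t"
    unfolding bc_op_def using sol_add[OF u(1) u'(1)] L2_add[OF u(2) u'(2)] by blast
next
  fix k f g assume "(f, g) \<in> bc_op s t"
  then obtain u0 j0 u J where u: "sol u0 j0 u J g" "f \<in> L2" "ae_eq M f (dens u)" "of_real s * j0 + of_real t * u0 = 0"
    by (rule bc_opE)
  have "of_real s * (k * j0) + of_real t * (k * u0) = k * (of_real s * j0 + of_real t * u0)" by (simp add: algebra_simps)
  then have "of_real s * (k * j0) + of_real t * (k * u0) = 0" unfolding u(4) by simp
  moreover have "ae_eq M (\<lambda>x. k * f x) (dens (\<lambda>x. k * u x))" using ae_eq_scale[OF u(3), of k] by simp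
  ultimately show "((\<lambda>x. k * f x), (\<lambda>x. k * g x)) \<in> bc_op s t"
    unfolding bc_op_def using sol_scale[OF u(1)] L2_scale[OF u(2)] by blast
next
  fix f g g' assume "(f, g) \<in> bc_op s t" "(f, g') \<in> bc_op s t"
  then obtain u0 j0 u J u0' j0' u' J' where u: "sol u0 j0 u J g" "ae_eq M f (dens u)"
    and u': "sol u0' j0' u' J' g'" "ae_eq M f (dens u')"
    by (elim bc_opE) blast
  have "ae_eq M (dens u) (dens u')" by (rule ae_eq_trans[OF ae_eq_sym[OF u(2)] u'(2)])
  then have "ae_eq M (dens (\<lambda>x. u x - 1 * u' x)) (\<lambda>x. 0)" unfolding ae_eq_def by eventually_elim (simp add: scaleR_diff_right)
  from sol_zero(1)[OF sol_diff[OF u(1) u'(1)] this] show "ae_eq M g g'" by (simp add: ae_eq_def)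
qed

text \<open>Real coefficients give both pairs of data the same real ratio j0/u0, or u0 = v0 = 0, and
  the conjugations become harmless.\<close>

lemma real_line_form:
  fixes u0 j0 v0 k0 :: complex
  assumes "s \<noteq> 0 \<or> t \<noteq> 0" "of_real s * j0 + of_real t * u0 = 0" "of_real s * k0 + of_real t * v0 = 0"
  shows "u0 * cnj k0 - j0 * cnj v0 = 0"
proof (cases "s = 0")
  case True
  then show ?thesis using assms by simp
next
  case False
  define r where "r = - (t / s)"
  have "j0 = of_real r * u0" "k0 = of_real r * v0"
    using assms(2,3) False by (simp_all add: r_def field_simps add_eq_0_iff)
  then show ?thesis by simp
qed

lemma bc_op_symmetric:
  assumes "s \<noteq> 0 \<or> t \<noteq> 0" "(f, g) \<in> bc_op s t" "(f', g') \<in> bc_op s t"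
  shows "L2_inner M g f' = L2_inner M f g'"
proof -
  from assms(2) obtain u0 j0 u J where u: "sol u0 j0 u J g" "f \<in> L2" "ae_eq M f (dens u)" "of_real s * j0 + of_real t * u0 = 0"
    by (rule bc_opE)
  from assms(3) obtain v0 k0 v K where v: "sol v0 k0 v K g'" "f' \<in> L2" "ae_eq M f' (dens v)" "of_real s * k0 + of_real t * v0 = 0"
    by (rule bc_opE)
  have "q *\<^sub>R (L2_inner M g f' - L2_inner M f g') = 0"
    unfolding Green_inner[OF u(1-3) v(1-3)] by (rule real_line_form[OF assms(1) u(4) v(4)])
  then show ?thesis using q_pos by simp
qed

text \<open>A symmetric operator such that \<open>A - r\<close> is onto for a real \<open>r\<close> has no proper extension inside its adjoint.\<close>

theorem bc_op_selfadjoint: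
  assumes st: "s \<noteq> 0 \<or> t \<noteq> 0"
  shows "selfadjoint M (bc_op s t)"
  unfolding selfadjoint_def
proof (intro conjI bc_op_linear bc_op_dense equalityI subsetI)
  fix fg assume "fg \<in> bc_op s t"
  then show "fg \<in> adjoint_graph M (bc_op s t)"
    using bc_op_symmetric[OF st] bc_op_L2 by (cases fg) (fastforce simp: adjoint_graph_def)
next
  fix fg assume "fg \<in> adjoint_graph M (bc_op s t)"
  then obtain f g where fg: "fg = (f, g)" and L: "f \<in> L2" "g \<in> L2"
    and adj: "\<And>u v. (u, v) \<in> bc_op s t \<Longrightarrow> L2_inner M v f = L2_inner M u g"
    by (cases fg) (fastforce simp: adjoint_graph_def)
  obtain r :: real where r: "of_real r \<in> resolvent_set M (bc_op s t)" using real_resolvent_point[OF st] by blast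
  then have surj: "\<And>h. h \<in> L2 \<Longrightarrow> \<exists>(f, g)\<in>bc_op s t. ae_eq M (\<lambda>x. g x - of_real r * f x) h"
    by (simp add: resolvent_set_def)
  have "(\<lambda>x. g x - of_real r * f x) \<in> L2" by (intro L2_diff L2_scale L)
  from surj[OF this] obtain f' g' where f': "(f', g') \<in> bc_op s t"
    and e: "ae_eq M (\<lambda>x. g' x - of_real r * f' x) (\<lambda>x. g x - of_real r * f x)" by auto
  have L': "f' \<in> L2" "g' \<in> L2" using bc_op_L2[OF f'] by auto
  define d where "d = (\<lambda>x. f x - 1 * f' x)"
  have d: "d \<in> L2" using L2_diff[OF L(1) L'(1)] by (simp add: d_def)
  have gd: "ae_eq M (\<lambda>x. g x - 1 * g' x) (\<lambda>x. of_real r * d x)"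
    using e unfolding ae_eq_def by eventually_elim (simp add: d_def algebra_simps)
  \<comment> \<open>As r is real it moves across the inner product unchanged, so d is orthogonal to
    the range of A - r, which is the whole space.\<close>
  have orth: "L2_inner M (\<lambda>x. v x - of_real r * u x) d = 0" if uv: "(u, v) \<in> bc_op s t" for u v
  proof -
    have Luv: "u \<in> L2" "v \<in> L2" using bc_op_L2[OF uv] by auto
    have "L2_inner M v d = L2_inner M v f - L2_inner M v f'"
      unfolding d_def using L2_inner_linear(2)[OF L(1) L'(1) Luv(2), of 1] by simp
    also have "\<dots> = L2_inner M u g - L2_inner M u g'" unfolding adj[OF uv] bc_op_symmetric[OF st uv f'] ..
    also have "\<dots> = L2_inner M u (\<lambda>x. g x - 1 * g' x)"
      using L2_inner_linear(2)[OF L(2) L'(2) Luv(1), of 1] by simp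
    also have "\<dots> = L2_inner M u (\<lambda>x. of_real r * d x)"
      using L2_diff[OF L(2) L'(2)] by (intro L2_inner_ae[OF Luv(1) Luv(1) _ L2_scale[OF d] ae_eq_refl gd]) simp
    also have "\<dots> = of_real r * L2_inner M u d"
      using L2_inner_linear(2)[OF L2_zero d Luv(1), of "- of_real r"] by (simp add: L2_inner_def)
    finally show ?thesis using L2_inner_linear(1)[OF Luv(2,1) d, of "of_real r"] by simp
  qed
  from surj[OF d] obtain u v where uv: "(u, v) \<in> bc_op s t" and vd: "ae_eq M (\<lambda>x. v x - of_real r * u x) d" by auto
  have "(\<lambda>x. v x - of_real r * u x) \<in> L2" using bc_op_L2[OF uv] by (intro L2_diff L2_scale) auto
  from L2_inner_ae[OF this d d d vd ae_eq_refl] have "L2_inner M d d = 0" using orth[OF uv] by simp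
  then have d0: "ae_eq M d (\<lambda>x. 0)" by (rule L2_inner_self_zero[OF d])
  have "ae_eq M f' f" using d0 unfolding ae_eq_def by eventually_elim (simp add: d_def)
  moreover have "ae_eq M g' g"
    using d0 gd unfolding ae_eq_def by eventually_elim simp
  ultimately show "fg \<in> bc_op s t" unfolding fg by (rule bc_op_ae[OF f' L])
qed

text \<open>Adjoints reverse inclusions. Thus inclusion in one of the \<open>bc_op\<close> already
  identifies a self-adjoint realization.\<close>

lemma selfadjoint_maximal:
  assumes A: "selfadjoint M A" and B: "selfadjoint M B" and "A \<subseteq> B"
  shows "A = B"
proof -
  have "adjoint_graph M B \<subseteq> adjoint_graph M A" using assms(3) by (fastforce simp: adjoint_graph_def)
  then show ?thesis using assms by (simp add: selfadjoint_def)
qed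

lemma bc_op_subset_max: "bc_op s t \<subseteq> cev_max \<mu> \<sigma> \<gamma>"
proof (rule subrelI)
  fix f g assume "(f, g) \<in> bc_op s t"
  then show "(f, g) \<in> cev_max \<mu> \<sigma> \<gamma>" unfolding cev_max_iff by (rule bc_opE) blast
qed

theorem selfadjoint_realization_iff:
  "cev_selfadjoint_realization \<mu> \<sigma> \<gamma> A \<longleftrightarrow>
     (\<exists>\<theta>::real. A = cev_op \<mu> \<sigma> \<gamma> \<theta>) \<or> A = cev_op_inf \<mu> \<sigma> \<gamma>"
proof
  assume "(\<exists>\<theta>::real. A = cev_op \<mu> \<sigma> \<gamma> \<theta>) \<or> A = cev_op_inf \<mu> \<sigma> \<gamma>"
  then show "cev_selfadjoint_realization \<mu> \<sigma> \<gamma> A"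
    unfolding cev_selfadjoint_realization_def cev_op_eq cev_op_inf_eq
    by (elim disjE exE) (simp_all add: bc_op_selfadjoint bc_op_subset_max)
next
  assume "cev_selfadjoint_realization \<mu> \<sigma> \<gamma> A"
  then have A: "selfadjoint M A" and max: "A \<subseteq> cev_max \<mu> \<sigma> \<gamma>" by (auto simp: cev_selfadjoint_realization_def)
  have data: "\<exists>u0 j0 u J. sol u0 j0 u J g \<and> f \<in> L2 \<and> ae_eq M f (dens u)" if "(f, g) \<in> A" for f g
    using subsetD[OF max that] unfolding cev_max_iff .
  have form: "u0 * cnj k0 = j0 * cnj v0"
    if fg: "(f, g) \<in> A" and u: "sol u0 j0 u J g" "f \<in> L2" "ae_eq M f (dens u)"
      and fg': "(f', g') \<in> A" and v: "sol v0 k0 v K g'" "f' \<in> L2" "ae_eq M f' (dens v)"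
    for f g u0 j0 u J f' g' v0 k0 v K
  proof -
    have "(f', g') \<in> adjoint_graph M A" using A fg' by (simp add: selfadjoint_def)
    then have "L2_inner M g f' = L2_inner M f g'" using fg by (fastforce simp: adjoint_graph_def)
    then show ?thesis using Green_inner[OF u v] by simp
  qed
  have eq: "A = bc_op s t" if "s \<noteq> 0 \<or> t \<noteq> 0"
    and b: "\<And>f g u0 j0 u J. (f, g) \<in> A \<Longrightarrow> sol u0 j0 u J g \<Longrightarrow> f \<in> L2 \<Longrightarrow> ae_eq M f (dens u) \<Longrightarrow> of_real s * j0 + of_real t * u0 = 0" for s t
  proof (rule selfadjoint_maximal[OF A bc_op_selfadjoint[OF that(1)]], rule subrelI)
    fix f g assume fg: "(f, g) \<in> A"
    from data[OF fg] obtain u0 j0 u J where u: "sol u0 j0 u J g" "f \<in> L2" "ae_eq M f (dens u)" by blast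
    show "(f, g) \<in> bc_op s t" unfolding bc_op_def using u b[OF fg u] by blast
  qed
  show "(\<exists>\<theta>::real. A = cev_op \<mu> \<sigma> \<gamma> \<theta>) \<or> A = cev_op_inf \<mu> \<sigma> \<gamma>"
  proof (cases "\<exists>f g u0 j0 u J. (f, g) \<in> A \<and> sol u0 j0 u J g \<and> f \<in> L2 \<and> ae_eq M f (dens u) \<and> u0 \<noteq> 0")
    case False
    have "A = bc_op 0 1"
    proof (rule eq)
      fix f g u0 j0 u J assume "(f, g) \<in> A" "sol u0 j0 u J g" "f \<in> L2" "ae_eq M f (dens u)"
      with False have "u0 = 0" by blast
      then show "of_real 0 * j0 + of_real 1 * u0 = 0" by simp
    qed simp
    then show ?thesis by (simp add: cev_op_inf_eq)
  next
    case True
    then obtain f g u0 j0 u J where fg: "(f, g) \<in> A" and u: "sol u0 j0 u J g" "f \<in> L2" "ae_eq M f (dens u)" and u0: "u0 \<noteq> 0"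
      by blast
    \<comment> \<open>An element with u0 \<noteq> 0 paired with itself shows that its ratio j0/u0 is
      real; paired with the others, it forces the same ratio on all data.\<close>
    have "cnj (j0 / u0) = j0 / u0"
      using form[OF fg u fg u] u0 by (simp add: field_simps)
    then have "j0 / u0 \<in> \<real>" by (simp add: Reals_cnj_iff)
    then obtain r where r: "j0 / u0 = complex_of_real r" by (auto elim: Reals_cases)
    have "A = bc_op 1 (- r)"
    proof (rule eq)
      fix f' g' v0 k0 v K assume fg': "(f', g') \<in> A" and v: "sol v0 k0 v K g'" "f' \<in> L2" "ae_eq M f' (dens v)"
      have "u0 * cnj k0 = j0 * cnj v0" by (rule form[OF fg u fg' v])
      then have "cnj k0 = of_real r * cnj v0" using u0 r by (simp add: field_simps)
      then have "cnj (cnj k0) = cnj (of_real r * cnj v0)" by (rule arg_cong)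
      then show "of_real 1 * k0 + of_real (- r) * v0 = 0" by simp
    qed simp
    \<comment> \<open>\<theta> solves \<theta> \<kappa>^a a = -r; the factor \<kappa>^a a is not
      0.\<close>
    also have "- r = (- r / (\<kappa> powr a * a)) * \<kappa> powr a * a" using kappa a_bounds by simp
    finally show ?thesis unfolding cev_op_eq[symmetric] by blast
  qed
qed

text \<open>With 2-\<gamma> = 1/a, \<Gamma>(1-a) = -a \<Gamma>(-a) and \<Gamma>(1+a) = a
  \<Gamma>(a), the boundary form is \<kappa>^a times \<Gamma>(-a)/\<Gamma>(\<Lambda>-a) + \<theta>
  \<Gamma>(1+a)/\<Gamma>(\<Lambda>). At a nonpositive integer \<Lambda> the second term is 0 and the
  first is not, so the excluded values contribute nothing; elsewhere division gives the equation for
  \<open>cev_m\<close>.\<close>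

theorem spectrum_cev_op:
  "op_spectrum M (cev_op \<mu> \<sigma> \<gamma> \<theta>) = {of_real (\<mu> * (2 - \<gamma>)) * (\<Lambda> - 1) | \<Lambda>::complex. \<Lambda> \<notin> \<int>\<^sub>\<le>\<^sub>0 \<and> cev_m a \<Lambda> = of_real \<theta>}"
proof -
  have a01: "0 < a" "a < 1" using a_bounds by auto
  have a2: "2 - \<gamma> = 1 / a" using a_bounds(3) a01 by (simp add: field_simps)
  have na: "- complex_of_real a \<notin> \<int>\<^sub>\<le>\<^sub>0"
  proof
    assume "- complex_of_real a \<in> \<int>\<^sub>\<le>\<^sub>0"
    then obtain n where "- complex_of_real a = of_int n" by (auto elim!: nonpos_Ints_cases)
    then have "complex_of_real (- a) = of_real (of_int n)" by simp
    then have "- a = of_int n" by (simp only: of_real_eq_iff)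
    then have "-1 < n" "n < 0" using a01 by linarith+
    then show False by simp
  qed
  have na1: "complex_of_real a \<notin> \<int>\<^sub>\<le>\<^sub>0" using nonpos_Ints_Re_le_0[of "complex_of_real a"] a01 by auto
  have G1: "Gamma (1 - complex_of_real a) = - of_real a * Gamma (- of_real a)"
    using Gamma_plus1[OF na] by simp
  have G2: "Gamma (1 + complex_of_real a) = of_real a * Gamma (of_real a)"
    using Gamma_plus1[OF na1] by (simp add: add.commute)
  have nz: "Gamma (- complex_of_real a) \<noteq> 0" "Gamma (1 + complex_of_real a) \<noteq> 0"
    using na Gamma_a_nonzero(1) a01 by (auto simp: Gamma_eq_zero_iff G2)
  have key: "of_real 1 * data1 \<Lambda> + of_real (\<theta> * \<kappa> powr a * a) * data0 \<Lambda> = 0 \<longleftrightarrow>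
      of_real \<theta> * (Gamma (1 + of_real a) * rGamma \<Lambda>) = - (Gamma (- of_real a) * rGamma (\<Lambda> - of_real a))" for \<Lambda>
  proof -
    have "of_real 1 * data1 \<Lambda> + of_real (\<theta> * \<kappa> powr a * a) * data0 \<Lambda> =
      of_real (\<kappa> powr a) * (of_real (1 / a) * (- Gamma (1 - of_real a)) * rGamma (\<Lambda> - of_real a) + of_real \<theta> * (of_real a * Gamma (of_real a)) * rGamma \<Lambda>)"
      unfolding a2 by (simp add: algebra_simps)
    also have "of_real (1 / a) * (- Gamma (1 - of_real a)) = Gamma (- complex_of_real a)"
      unfolding G1 using a01 by simp
    also have "of_real a * Gamma (complex_of_real a) = Gamma (1 + complex_of_real a)" by (rule G2[symmetric])
    finally have e: "of_real 1 * data1 \<Lambda> + of_real (\<theta> * \<kappa> powr a * a) * data0 \<Lambda> =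
      of_real (\<kappa> powr a) * (Gamma (- of_real a) * rGamma (\<Lambda> - of_real a) + of_real \<theta> * Gamma (1 + of_real a) * rGamma \<Lambda>)" .
    have "complex_of_real (\<kappa> powr a) \<noteq> 0" using kappa by simp
    then show ?thesis unfolding e mult_eq_0_iff by (auto simp: add_eq_0_iff mult.assoc)
  qed
  have m: "of_real 1 * data1 \<Lambda> + of_real (\<theta> * \<kappa> powr a * a) * data0 \<Lambda> = 0 \<longleftrightarrow> \<Lambda> \<notin> \<int>\<^sub>\<le>\<^sub>0 \<and> cev_m a \<Lambda> = of_real \<theta>" for \<Lambda>
  proof (cases "\<Lambda> \<in> \<int>\<^sub>\<le>\<^sub>0")
    case True
    then have "rGamma \<Lambda> = 0" by (simp add: rGamma_eq_zero_iff)
    then have 0: "data0 \<Lambda> = 0" by simp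
    with data_nonzero[of \<Lambda>] have "data1 \<Lambda> \<noteq> 0" by blast
    then show ?thesis unfolding 0 using True by simp
  next
    case False
    then have r: "rGamma \<Lambda> \<noteq> 0" by (simp add: rGamma_eq_zero_iff)
    have e: "cev_m a \<Lambda> = - (Gamma (- of_real a) * rGamma (\<Lambda> - of_real a)) / (Gamma (1 + of_real a) * rGamma \<Lambda>)"
      unfolding cev_m_def by (simp add: Gamma_def divide_inverse mult_ac)
    have "Gamma (1 + of_real a) * rGamma \<Lambda> \<noteq> 0" using r nz(2) by simp
    then have "cev_m a \<Lambda> = of_real \<theta> \<longleftrightarrow> of_real \<theta> * (Gamma (1 + of_real a) * rGamma \<Lambda>) = - (Gamma (- of_real a) * rGamma (\<Lambda> - of_real a))"
      unfolding e by (subst nonzero_divide_eq_eq) (auto simp only: )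
    then show ?thesis unfolding key using False by simp
  qed
  show ?thesis
    unfolding cev_op_eq ev_of_def[symmetric]
  proof (intro equalityI subsetI)
    fix z assume z: "z \<in> op_spectrum M (bc_op 1 (\<theta> * \<kappa> powr a * a))"
    obtain \<Lambda> where L: "z = ev_of \<Lambda>" using ev_of_surj by blast
    show "z \<in> {ev_of \<Lambda> |\<Lambda>. \<Lambda> \<notin> \<int>\<^sub>\<le>\<^sub>0 \<and> cev_m a \<Lambda> = of_real \<theta>}"
      using z unfolding L spectrum_bc_op(1) m by blast
  next
    fix z assume "z \<in> {ev_of \<Lambda> |\<Lambda>. \<Lambda> \<notin> \<int>\<^sub>\<le>\<^sub>0 \<and> cev_m a \<Lambda> = of_real \<theta>}"
    then obtain \<Lambda> where L: "z = ev_of \<Lambda>" "\<Lambda> \<notin> \<int>\<^sub>\<le>\<^sub>0 \<and> cev_m a \<Lambda> = of_real \<theta>" by blast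
    from L(2) show "z \<in> op_spectrum M (bc_op 1 (\<theta> * \<kappa> powr a * a))" unfolding L(1) spectrum_bc_op(1) m .
  qed
qed

lemma ev_of_neg_nat: "ev_of (- of_nat n) = of_real (- \<mu> * (2 - \<gamma>) * (real n + 1))"
  by (simp add: ev_of_def algebra_simps)

theorem spectrum_cev_op_inf:
  "op_spectrum M (cev_op_inf \<mu> \<sigma> \<gamma>) = {of_real (- \<mu> * (2 - \<gamma>) * (real n + 1)) | n::nat. True}"
proof -
  have m: "of_real 0 * data1 \<Lambda> + of_real 1 * data0 \<Lambda> = 0 \<longleftrightarrow> (\<exists>n. \<Lambda> = - of_nat n)" for \<Lambda>
    using Gamma_a_nonzero(1) by (auto simp: rGamma_eq_zero_iff elim!: nonpos_Ints_cases')
  show ?thesis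
    unfolding cev_op_inf_eq ev_of_neg_nat[symmetric]
  proof (intro equalityI subsetI)
    fix z assume z: "z \<in> op_spectrum M (bc_op 0 1)"
    obtain \<Lambda> where L: "z = ev_of \<Lambda>" using ev_of_surj by blast
    show "z \<in> {ev_of (- of_nat n) |n. True}"
      using z unfolding L spectrum_bc_op(1) m by blast
  next
    fix z assume "z \<in> {ev_of (- of_nat n) |n. True}"
    then show "z \<in> op_spectrum M (bc_op 0 1)" using m spectrum_bc_op(1)[of _ 0 1] by blast
  qed
qed

end

subsection \<open>Laguerre eigenfunctions\<close>

text \<open>The polynomial P with D^k (e^{-t} t^b) = e^{-t} t^{b-k} P(t). For b = k + a it is k!
  times the Laguerre polynomial with parameter a.\<close>

fun lag_P :: "real \<Rightarrow> nat \<Rightarrow> real poly" where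
  "lag_P b 0 = 1"
| "lag_P b (Suc k) = smult (b - real k) (lag_P b k) - pCons 0 (lag_P b k) + pCons 0 (pderiv (lag_P b k))"

definition lag_D :: "real \<Rightarrow> nat \<Rightarrow> real \<Rightarrow> real" where
  "lag_D b k t = exp (- t) * t powr (b - real k) * poly (lag_P b k) t"

lemma lag_D_deriv: "t > 0 \<Longrightarrow> (lag_D b k has_real_derivative lag_D b (Suc k) t) (at t)"
proof -
  assume t: "t > 0"
  have "((\<lambda>t. exp (- t) * t powr (b - real k) * poly (lag_P b k) t) has_real_derivative
    ((- exp (- t)) * t powr (b - real k) + (b - real k) * t powr (b - real k - 1) * exp (- t)) * poly (lag_P b k) t
     + poly (pderiv (lag_P b k)) t * (exp (- t) * t powr (b - real k))) (at t)"
    using t by (intro DERIV_mult poly_DERIV) (auto intro!: derivative_eq_intros)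
  moreover have "t powr (b - real k) = t * t powr (b - real (Suc k))"
    "t powr (b - real k - 1) = t powr (b - real (Suc k))"
    using t powr_add[of t 1 "b - real (Suc k)"] by (simp_all add: algebra_simps)
  ultimately show ?thesis
    unfolding lag_D_def[abs_def] by (simp add: algebra_simps)
qed

lemma lag_D_iterate: "t > 0 \<Longrightarrow> (deriv ^^ k) (\<lambda>t. exp (- t) * t powr b) t = lag_D b k t"
proof (induction k arbitrary: t)
  case 0
  then show ?case by (simp add: lag_D_def)
next
  case (Suc k)
  have "((deriv ^^ k) (\<lambda>t. exp (- t) * t powr b) has_real_derivative lag_D b (Suc k) t) (at t)"
    by (rule has_field_derivative_transform_within_open[OF lag_D_deriv[OF Suc.prems], where S = "{0<..}"])
      (use Suc in auto)
  then show ?case by (simp add: DERIV_imp_deriv)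
qed

text \<open>Differentiate \<open>t v' = (b - t) v\<close>, where \<open>v = lag_D b 0\<close>, \<open>k + 1\<close> times.\<close>

lemma lag_D_ode:
  assumes t: "t > 0"
  shows "t * lag_D b (k + 2) t + (t + real k + 1 - b) * lag_D b (k + 1) t + (real k + 1) * lag_D b k t = 0"
  using t
proof (induction k arbitrary: t)
  have first: "t * lag_D b 1 t + (t - b) * lag_D b 0 t = 0" if t: "t > 0" for t
  proof -
    have "t powr b = t * t powr (b - 1)" using t powr_add[of t 1 "b - 1"] by simp
    then show ?thesis by (simp add: lag_D_def algebra_simps)
  qed
  case 0
  have "((\<lambda>t. t * lag_D b 1 t + (t - b) * lag_D b 0 t) has_real_derivative
      (1 * lag_D b 1 t + lag_D b (Suc 1) t * t) + (1 * lag_D b 0 t + lag_D b (Suc 0) t * (t - b))) (at t)"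
    by (intro DERIV_add DERIV_mult lag_D_deriv 0) (auto intro!: derivative_eq_intros)
  then have "((\<lambda>t. 0) has_real_derivative
      (1 * lag_D b 1 t + lag_D b (Suc 1) t * t) + (1 * lag_D b 0 t + lag_D b (Suc 0) t * (t - b))) (at t)"
    by (rule has_field_derivative_transform_within_open[where S = "{0<..}"]) (use 0 first in auto)
  from DERIV_unique[OF this DERIV_const] show ?case by (simp add: algebra_simps numeral_2_eq_2)
next
  case (Suc k)
  have "((\<lambda>t. t * lag_D b (k + 2) t + (t + real k + 1 - b) * lag_D b (k + 1) t + (real k + 1) * lag_D b k t) has_real_derivative
      (1 * lag_D b (k + 2) t + lag_D b (Suc (k + 2)) t * t) + (1 * lag_D b (k + 1) t + lag_D b (Suc (k + 1)) t * (t + real k + 1 - b))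
      + (0 * lag_D b k t + lag_D b (Suc k) t * (real k + 1))) (at t)"
    by (intro DERIV_add DERIV_mult lag_D_deriv Suc.prems) (auto intro!: derivative_eq_intros)
  then have "((\<lambda>t. 0) has_real_derivative
      (1 * lag_D b (k + 2) t + lag_D b (Suc (k + 2)) t * t) + (1 * lag_D b (k + 1) t + lag_D b (Suc (k + 1)) t * (t + real k + 1 - b))
      + (0 * lag_D b k t + lag_D b (Suc k) t * (real k + 1))) (at t)"
    by (rule has_field_derivative_transform_within_open[where S = "{0<..}"]) (use Suc in auto)
  from DERIV_unique[OF this DERIV_const] show ?case by (simp add: algebra_simps)
qed

lemma poly_bound: "\<exists>C\<ge>0. \<forall>r\<ge>1. \<bar>poly p r\<bar> \<le> C * (1 + r) ^ degree p" for p :: "real poly"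
proof (intro exI[of _ "\<Sum>i\<le>degree p. \<bar>coeff p i\<bar>"] conjI allI impI sum_nonneg abs_ge_zero)
  fix r :: real assume r: "r \<ge> 1"
  have "\<bar>poly p r\<bar> \<le> (\<Sum>i\<le>degree p. \<bar>coeff p i * r ^ i\<bar>)" unfolding poly_altdef by (rule sum_abs)
  also have "\<dots> \<le> (\<Sum>i\<le>degree p. \<bar>coeff p i\<bar> * (1 + r) ^ degree p)"
  proof (rule sum_mono)
    fix i assume "i \<in> {..degree p}"
    then have "r ^ i \<le> (1 + r) ^ i" "(1 + r) ^ i \<le> (1 + r) ^ degree p" using r by (auto intro: power_mono power_increasing)
    then have "r ^ i \<le> (1 + r) ^ degree p" by linarith
    then show "\<bar>coeff p i * r ^ i\<bar> \<le> \<bar>coeff p i\<bar> * (1 + r) ^ degree p" using r by (simp add: abs_mult mult_left_mono)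
  qed
  finally show "\<bar>poly p r\<bar> \<le> (\<Sum>i\<le>degree p. \<bar>coeff p i\<bar>) * (1 + r) ^ degree p" by (simp add: sum_distrib_right)
qed

text \<open>At 0 the recursion multiplies by b - k, so the value is the product of the b - j with j
  < k.\<close>

lemma lag_P_0: "(\<And>j. j < k \<Longrightarrow> b \<noteq> real j) \<Longrightarrow> poly (lag_P b k) 0 \<noteq> 0"
  by (induction k) auto

text \<open>With b = n + a, f is e^r/n! times the n-th derivative of e^{-t} t^b, and Kummer's
  equation for \<Lambda> = -n comes from \<open>lag_D_ode\<close>. The factor r^a makes f vanish at
  0, while r^{1-a} f' tends to a multiple of the value at 0 of the next polynomial, which is not
  0.\<close>

lemma Laguerre_recessive:
  fixes n :: nat and a :: real
  assumes a: "0 < a" "a < 1"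
  defines "f \<equiv> \<lambda>r. complex_of_real (r powr a * gen_laguerre n a r)"
  shows "\<exists>g g0. g0 \<noteq> 0 \<and> recessive a (- of_nat n) f g 0 g0"
proof -
  define b where "b = real n + a"
  define P where "P = lag_P b"
  define f1 where "f1 = (\<lambda>r. exp r * lag_D b n r / fact n)"
  define g1 where "g1 = (\<lambda>r. exp r * (lag_D b n r + lag_D b (n + 1) r) / fact n)"
  have f: "f r = of_real (f1 r)" if r: "r > 0" for r
  proof -
    have "r powr a * r powr (- a) = 1" using r by (simp flip: powr_add)
    then have "r powr a * gen_laguerre n a r = f1 r"
      using lag_D_iterate[OF r, of n b] by (simp add: f1_def gen_laguerre_def b_def)
    then show ?thesis by (simp only: f_def)
  qed
  have f1: "f1 r = r powr a * poly (P n) r / fact n" for r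
    by (simp add: f1_def lag_D_def P_def b_def exp_minus field_simps)
  have g1: "r powr (1 - a) * g1 r = (r * poly (P n) r + poly (P (n + 1)) r) / fact n" if r: "r > 0" for r
  proof -
    have "r powr (1 - a) * r powr (b - real n) = r" "r powr (1 - a) * r powr (b - real (n + 1)) = 1"
      using r by (simp_all add: b_def flip: powr_add)
    then show ?thesis
      by (simp add: g1_def lag_D_def P_def exp_minus field_simps)
  qed
  have df: "(f1 has_real_derivative g1 r) (at r)" if r: "r > 0" for r
    unfolding f1_def[abs_def] g1_def using lag_D_deriv[OF r, of b n]
    by (auto intro!: derivative_eq_intros simp: algebra_simps add_divide_distrib)
  have dg: "(g1 has_real_derivative (1 / r) * ((- real n - a) * f1 r - (1 - a - r) * g1 r)) (at r)" if r: "r > 0" for r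
  proof -
    have "(g1 has_real_derivative exp r * (lag_D b n r + 2 * lag_D b (n + 1) r + lag_D b (n + 2) r) / fact n) (at r)"
      unfolding g1_def[abs_def] using lag_D_deriv[OF r, of b n] lag_D_deriv[OF r, of b "n + 1"]
      by (auto intro!: derivative_eq_intros simp: algebra_simps add_divide_distrib)
    moreover have "exp r * (lag_D b n r + 2 * lag_D b (n + 1) r + lag_D b (n + 2) r) / fact n = (1 / r) * ((- real n - a) * f1 r - (1 - a - r) * g1 r)"
    proof -
      have "r * lag_D b (n + 2) r = - (r + 1 - a) * lag_D b (n + 1) r - (real n + 1) * lag_D b n r"
        using lag_D_ode[OF r, of b n] by (simp add: b_def algebra_simps)
      then have "r * (lag_D b n r + 2 * lag_D b (n + 1) r + lag_D b (n + 2) r) =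
          (- real n - a) * lag_D b n r - (1 - a - r) * (lag_D b n r + lag_D b (n + 1) r)"
        by (simp add: algebra_simps)
      then have "r * (exp r * (lag_D b n r + 2 * lag_D b (n + 1) r + lag_D b (n + 2) r) / fact n) =
          exp r / fact n * ((- real n - a) * lag_D b n r - (1 - a - r) * (lag_D b n r + lag_D b (n + 1) r))"
        by (simp add: mult_ac)
      also have "\<dots> = (- real n - a) * f1 r - (1 - a - r) * g1 r"
        by (simp add: f1_def g1_def algebra_simps add_divide_distrib diff_divide_distrib)
      finally show ?thesis using r by (simp add: field_simps)
    qed
    ultimately show ?thesis by simp
  qed
  define g where "g = (\<lambda>r. complex_of_real (g1 r))"
  define g0 where "g0 = complex_of_real (poly (P (n + 1)) 0 / fact n)"
  have "poly (P (n + 1)) 0 \<noteq> 0"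
    unfolding P_def by (rule lag_P_0) (use a in \<open>auto simp: b_def\<close>)
  then have "g0 \<noteq> 0" by (simp add: g0_def)
  moreover have "recessive a (- of_nat n) f g 0 g0"
    unfolding recessive_def
  proof (intro conjI allI impI)
    fix r :: real assume r: "r > 0"
    have "((\<lambda>r. complex_of_real (f1 r)) has_vector_derivative of_real (g1 r)) (at r)"
      by (intro has_vector_derivative_of_real df r)
    then show "(f has_vector_derivative g r) (at r)"
      unfolding g_def by (rule has_vector_derivative_transform_within_open[where S = "{0<..}"]) (use r f in auto)
    have "(g has_vector_derivative of_real ((1 / r) * ((- real n - a) * f1 r - (1 - a - r) * g1 r))) (at r)"
      unfolding g_def by (intro has_vector_derivative_of_real dg r)
    moreover have "of_real ((1 / r) * ((- real n - a) * f1 r - (1 - a - r) * g1 r)) = (1 / r) *\<^sub>R ((- of_nat n - of_real a) * f r - of_real (1 - a - r) * g r)"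
      unfolding f[OF r] g_def by (simp add: scaleR_conv_of_real)
    ultimately show "(g has_vector_derivative (1 / r) *\<^sub>R ((- of_nat n - of_real a) * f r - of_real (1 - a - r) * g r)) (at r)" by simp
  next
    obtain C where C: "C \<ge> 0" "\<And>r. r \<ge> 1 \<Longrightarrow> \<bar>poly (P n) r\<bar> \<le> C * (1 + r) ^ degree (P n)" using poly_bound[of "P n"] by blast
    obtain D where D: "D \<ge> 0" "\<And>r. r \<ge> 1 \<Longrightarrow> \<bar>poly (P (n + 1)) r\<bar> \<le> D * (1 + r) ^ degree (P (n + 1))" using poly_bound[of "P (n + 1)"] by blast
    define N where "N = Suc (degree (P n) + degree (P (n + 1)))"
    have "cmod (f r) \<le> (C + D) * (1 + r) ^ N \<and> cmod (g r) \<le> (C + D) * (1 + r) ^ N" if r: "r \<ge> 1" for r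
    proof -
      have p: "(1 + r) * (C * (1 + r) ^ degree (P n)) \<le> C * (1 + r) ^ N"
      proof -
        have "(1 + r) ^ Suc (degree (P n)) \<le> (1 + r) ^ N" using r by (intro power_increasing) (auto simp: N_def)
        from mult_left_mono[OF this C(1)] show ?thesis by (simp add: mult_ac)
      qed
      have p': "D * (1 + r) ^ degree (P (n + 1)) \<le> D * (1 + r) ^ N"
        using r D(1) by (intro mult_left_mono power_increasing) (auto simp: N_def)
      have DN: "0 \<le> D * (1 + r) ^ N" using r D(1) by simp
      have fact1: "x / fact n \<le> x" if "x \<ge> 0" for x :: real
        using that fact_ge_1[of n, where 'a = real] by (simp add: divide_le_eq mult_le_cancel_left1)
      have ra: "r powr a \<le> 1 + r" "1 \<le> r powr (1 - a)"
        using r a powr_mono[of a 1 r] ge_one_powr_ge_zero[of r "1 - a"] by auto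
      have "\<bar>f1 r\<bar> = r powr a * \<bar>poly (P n) r\<bar> / fact n" unfolding f1 by (simp add: abs_mult)
      also have "\<dots> \<le> r powr a * \<bar>poly (P n) r\<bar>" by (rule fact1) simp
      also have "\<dots> \<le> (1 + r) * (C * (1 + r) ^ degree (P n))" using r ra C(2)[OF r] by (intro mult_mono) auto
      also have "\<dots> \<le> (C + D) * (1 + r) ^ N" using p DN by (simp add: distrib_right)
      finally have 1: "\<bar>f1 r\<bar> \<le> (C + D) * (1 + r) ^ N" .
      have "\<bar>g1 r\<bar> \<le> r powr (1 - a) * \<bar>g1 r\<bar>" using ra(2) by (simp add: mult_le_cancel_right1)
      also have "\<dots> = \<bar>r powr (1 - a) * g1 r\<bar>" by (simp add: abs_mult)
      also have "\<dots> = \<bar>r * poly (P n) r + poly (P (n + 1)) r\<bar> / fact n" using r by (subst g1) auto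
      also have "\<dots> \<le> \<bar>r * poly (P n) r + poly (P (n + 1)) r\<bar>" by (rule fact1) simp
      also have "\<dots> \<le> (1 + r) * \<bar>poly (P n) r\<bar> + \<bar>poly (P (n + 1)) r\<bar>"
        using r by (intro order_trans[OF abs_triangle_ineq] add_mono) (auto simp: abs_mult mult_right_mono)
      also have "\<dots> \<le> (1 + r) * (C * (1 + r) ^ degree (P n)) + D * (1 + r) ^ degree (P (n + 1))"
        using r C(2)[OF r] D(2)[OF r] by (intro add_mono mult_left_mono) auto
      also have "\<dots> \<le> (C + D) * (1 + r) ^ N" using p p' by (simp add: distrib_right)
      finally have "\<bar>g1 r\<bar> \<le> (C + D) * (1 + r) ^ N" .
      then show ?thesis using 1 r f[of r] by (simp add: g_def)
    qed
    then show "\<exists>C n. \<forall>r\<ge>1. cmod (f r) \<le> C * (1 + r) ^ n \<and> cmod (g r) \<le> C * (1 + r) ^ n" by blast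
    have pl: "((\<lambda>r. poly p r) \<longlongrightarrow> poly p 0) (at_right 0)" for p :: "real poly"
      by (intro tendsto_intros)
    have "((\<lambda>r. complex_of_real (r powr a * poly (P n) r / fact n)) \<longlongrightarrow> of_real (0 * poly (P n) 0 / fact n)) (at_right 0)"
      by (intro tendsto_intros powr_tendsto_0 a pl) simp
    then have "((\<lambda>r. complex_of_real (r powr a * poly (P n) r / fact n)) \<longlongrightarrow> 0) (at_right 0)" by simp
    then show "(f \<longlongrightarrow> 0) (at_right 0)"
      by (rule Lim_transform_eventually) (use f f1 in \<open>auto intro!: eventually_mono[OF eventually_at_right_less]\<close>)
    have "((\<lambda>r. complex_of_real ((r * poly (P n) r + poly (P (n + 1)) r) / fact n)) \<longlongrightarrow> of_real ((0 * poly (P n) 0 + poly (P (n + 1)) 0) / fact n)) (at_right 0)"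
      by (intro tendsto_intros pl) simp
    then have "((\<lambda>r. complex_of_real ((r * poly (P n) r + poly (P (n + 1)) r) / fact n)) \<longlongrightarrow> g0) (at_right 0)" by (simp add: g0_def)
    then show "((\<lambda>r. r powr (1 - a) *\<^sub>R g r) \<longlongrightarrow> g0) (at_right 0)"
    proof (rule Lim_transform_eventually)
      have "complex_of_real ((r * poly (P n) r + poly (P (n + 1)) r) / fact n) = r powr (1 - a) *\<^sub>R g r" if "r > 0" for r
        by (simp only: g1[OF that, symmetric] g_def scaleR_conv_of_real of_real_mult)
      then show "\<forall>\<^sub>F r in at_right 0. complex_of_real ((r * poly (P n) r + poly (P (n + 1)) r) / fact n) = r powr (1 - a) *\<^sub>R g r"
        by (auto intro!: eventually_mono[OF eventually_at_right_less])
    qed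
  qed
  ultimately show ?thesis by blast
qed

context cev_parameters
begin

text \<open>The Laguerre function has data (0, j0) with j0 \<noteq> 0. This alone makes it span the
  eigenspace, so it need not be matched with the Laplace integral.\<close>

theorem eigenfun_spans:
  "eigenspace_spanned_by M (cev_op_inf \<mu> \<sigma> \<gamma>) (of_real (- \<mu> * (2 - \<gamma>) * (real n + 1))) (cev_eigenfun \<mu> \<sigma> \<gamma> n)"
proof -
  have a01: "0 < a" "a < 1" using a_bounds by auto
  let ?f = "\<lambda>r. complex_of_real (r powr a * gen_laguerre n a r)"
  obtain g g0 where g0: "g0 \<noteq> 0" and rec: "recessive a (- of_nat n) ?f g 0 g0"
    using Laguerre_recessive[OF a01] by blast
  have kn: "complex_of_real (\<kappa> powr a) \<noteq> 0" using kappa by simp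
  \<comment> \<open>y^a = \<kappa>^a x, so dividing by \<kappa>^a turns \<psi> into x times the
    Laguerre polynomial of y, and \<open>dens \<psi>\<close> into the eigenfunction itself.\<close>
  define \<psi> where "\<psi> = (\<lambda>x. of_real (1 / \<kappa> powr a) * ?f (y x))"
  obtain j0 \<Psi> where p: "sol 0 j0 \<psi> \<Psi> (\<lambda>x. ev_of (- of_nat n) * dens \<psi> x)" and j0: "j0 \<noteq> 0"
  proof -
    let ?j0 = "of_real (1 / \<kappa> powr a) * (of_real ((2 - \<gamma>) * \<kappa> powr a) * g0)"
    have "complex_of_real (1 / \<kappa> powr a) \<noteq> 0" "complex_of_real ((2 - \<gamma>) * \<kappa> powr a) \<noteq> 0"
      unfolding of_real_eq_0_iff using kappa gamma1 by simp_all
    then have "?j0 \<noteq> 0" using g0 by (simp del: of_real_mult of_real_divide)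
    moreover have "sol (of_real (1 / \<kappa> powr a) * 0) ?j0 \<psi> (\<lambda>x. of_real (1 / \<kappa> powr a) * ((c * x powr (1 - \<gamma>)) *\<^sub>R (g (y x) - ?f (y x))))
        (\<lambda>x. of_real (1 / \<kappa> powr a) * (of_real (\<mu> * (2 - \<gamma>)) * (- of_nat n - 1) * (x powr (-\<gamma>) *\<^sub>R ?f (y x))))"
      unfolding \<psi>_def by (rule sol_scale[OF recessive_sol[OF rec]])
    moreover have "(\<lambda>x. of_real (1 / \<kappa> powr a) * (of_real (\<mu> * (2 - \<gamma>)) * (- of_nat n - 1) * (x powr (-\<gamma>) *\<^sub>R ?f (y x)))) = (\<lambda>x. ev_of (- of_nat n) * dens \<psi> x)"
      unfolding \<psi>_def ev_of_def scaleR_conv_of_real by (simp add: fun_eq_iff mult_ac)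
    ultimately show ?thesis using that by simp
  qed
  have sp: "eigenspace_spanned_by M (bc_op 0 1) (ev_of (- of_nat n)) (dens \<psi>)"
    by (rule eigenvalue_spectrum(1)[OF p]) (use j0 in auto)
  have eq: "dens \<psi> x = cev_eigenfun \<mu> \<sigma> \<gamma> n x" if x: "x > 0" for x
  proof -
    have "y x powr a = \<kappa> powr a * x" using x kappa a_bounds(3) by (simp add: y_def powr_mult powr_powr)
    then have "\<psi> x = of_real (x * gen_laguerre n a (y x))" using kappa by (simp add: \<psi>_def)
    moreover have "x powr (-\<gamma>) * x = x powr (1 - \<gamma>)" using x powr_add[of x "-\<gamma>" 1] by simp
    ultimately show ?thesis
      by (simp add: cev_eigenfun_def nu_kappa y_def a_def[symmetric] scaleR_conv_of_real flip: of_real_mult mult.assoc)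
  qed
  have ae: "ae_eq M (dens \<psi>) (cev_eigenfun \<mu> \<sigma> \<gamma> n)" unfolding ae_eq_def by (rule AE_M_pos) (rule eq)
  have L: "dens \<psi> \<in> L2" by (rule sol_L2[OF p])
  have L': "cev_eigenfun \<mu> \<sigma> \<gamma> n \<in> L2" by (rule L2_ae[OF L ae])
  have op: "(dens \<psi>, \<lambda>x. ev_of (- of_nat n) * dens \<psi> x) \<in> bc_op 0 1" by (rule bc_opI[OF p]) simp
  have "(cev_eigenfun \<mu> \<sigma> \<gamma> n, \<lambda>x. ev_of (- of_nat n) * cev_eigenfun \<mu> \<sigma> \<gamma> n x) \<in> bc_op 0 1"
    by (rule bc_op_ae[OF op L' L2_scale[OF L'] ae ae_eq_scale[OF ae]])
  then have "cev_eigenfun \<mu> \<sigma> \<gamma> n \<in> eigenspace M (bc_op 0 1) (ev_of (- of_nat n))"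
    unfolding eigenspace_def using ae_eq_refl by blast
  moreover have "\<not> ae_eq M (cev_eigenfun \<mu> \<sigma> \<gamma> n) (\<lambda>x. 0)"
    using sp ae_eq_trans[OF ae] by (auto simp: eigenspace_spanned_by_def)
  moreover have "\<exists>k. ae_eq M f (\<lambda>x. k * cev_eigenfun \<mu> \<sigma> \<gamma> n x)" if f: "f \<in> eigenspace M (bc_op 0 1) (ev_of (- of_nat n))" for f
  proof -
    obtain k where "ae_eq M f (\<lambda>x. k * dens \<psi> x)" using sp f unfolding eigenspace_spanned_by_def by blast
    then show ?thesis using ae_eq_trans ae_eq_scale[OF ae] by blast
  qed
  ultimately show ?thesis
    unfolding eigenspace_spanned_by_def cev_op_inf_eq ev_of_neg_nat[symmetric] by blast
qed

end

theorem mainTheorem3: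
  fixes \<mu> \<sigma> \<gamma> \<nu> a :: real
  assumes "\<mu> > 0" and "\<sigma> > 0" and "0 \<le> \<gamma>" and "\<gamma> < 1"
    and "\<nu> = 2 * \<mu> / ((\<gamma> - 2) * \<sigma>\<^sup>2)" and "a = 1 / (2 - \<gamma>)"
  shows "\<nu> < 0 \<and> a \<in> {1/2..<1} \<and>
    cev_limit_point \<mu> \<sigma> \<gamma> at_top \<and> cev_limit_circle \<mu> \<sigma> \<gamma> (at_right 0) \<and>
    (\<forall>A. cev_selfadjoint_realization \<mu> \<sigma> \<gamma> A \<longleftrightarrow>
       (\<exists>\<theta>::real. A = cev_op \<mu> \<sigma> \<gamma> \<theta>) \<or> A = cev_op_inf \<mu> \<sigma> \<gamma>) \<and>
    (\<forall>\<theta>::real.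
       (\<forall>z \<in> op_spectrum (cev_measure \<mu> \<sigma> \<gamma>) (cev_op \<mu> \<sigma> \<gamma> \<theta>).
          simple_eigenvalue (cev_measure \<mu> \<sigma> \<gamma>) (cev_op \<mu> \<sigma> \<gamma> \<theta>) z) \<and>
       op_spectrum (cev_measure \<mu> \<sigma> \<gamma>) (cev_op \<mu> \<sigma> \<gamma> \<theta>) =
         {of_real (\<mu> * (2 - \<gamma>)) * (\<Lambda> - 1) | \<Lambda>::complex. \<Lambda> \<notin> \<int>\<^sub>\<le>\<^sub>0 \<and> cev_m a \<Lambda> = of_real \<theta>}) \<and>
    op_spectrum (cev_measure \<mu> \<sigma> \<gamma>) (cev_op_inf \<mu> \<sigma> \<gamma>) =
      {of_real (- \<mu> * (2 - \<gamma>) * (real n + 1)) | n::nat. True} \<and>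
    (\<forall>n::nat. eigenspace_spanned_by (cev_measure \<mu> \<sigma> \<gamma>) (cev_op_inf \<mu> \<sigma> \<gamma>)
       (of_real (- \<mu> * (2 - \<gamma>) * (real n + 1))) (cev_eigenfun \<mu> \<sigma> \<gamma> n))"
proof -
  interpret P: cev_parameters \<mu> \<sigma> \<gamma> using assms by unfold_locales
  have a: "a = P.a" unfolding P.a_def by (rule assms)
  have "\<nu> = - P.\<kappa>" using P.nu_kappa unfolding cev_nu_def assms(5) .
  then have "\<nu> < 0" using P.kappa by simp
  moreover have "a \<in> {1/2..<1}" using P.a_bounds unfolding a by simp
  moreover have "simple_eigenvalue (cev_measure \<mu> \<sigma> \<gamma>) (cev_op \<mu> \<sigma> \<gamma> \<theta>) z"
    if z: "z \<in> op_spectrum (cev_measure \<mu> \<sigma> \<gamma>) (cev_op \<mu> \<sigma> \<gamma> \<theta>)" for \<theta> z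
  proof -
    obtain \<Lambda> where "z = P.ev_of \<Lambda>" using P.ev_of_surj by blast
    then show ?thesis using z P.spectrum_bc_op(2) unfolding simple_eigenvalue_def P.cev_op_eq by blast
  qed
  ultimately show ?thesis
    using P.limit_point_at_top P.limit_circle_at_0 P.selfadjoint_realization_iff P.spectrum_cev_op
      P.spectrum_cev_op_inf P.eigenfun_spans unfolding a[symmetric] by simp
qed

end
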